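(* Let $n\ge2$ and $C_7\ge0$. Let $(\gamma_x)_{x\in\mathbb R^n}$ be a family of curves $\gamma_x:\mathbb R\to\mathbb R^n$ with $\gamma_x(0)=x$ such that $\|\gamma_x(t)\|$ depends only on $s=\|x\|$ and $t$; write $\|\gamma_s(t)\|$ for this quantity. Suppose that for every $s_0\in[0,\infty)$ there exists a neighborhood $V\subset[0,\infty)\times\mathbb R$ of $(s_0,0)$ such that $$\|\gamma_s(t)\|=s+C_7|t|^{1/2}\quad\text{for all }(s,t)\in V.$$ Then for all $f\in\dot H^{1/4}(\mathbb R^n)_o$, and hence for all $f\in H^\beta(\mathbb R^n)_o$ with $\beta\ge1/4$, $$\lim_{t\to0}\tilde S_tf(\gamma_s(t))=f(s)\quad\text{for almost every }s\in[0,\infty),$$ equivalently $\lim_{t\to0}\tilde S_tf(\gamma_x(t))=f(x)$ for almost every $x\in\mathbb R^n$.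
   Context: $\|\cdot\|$ is the Euclidean norm; a radial function on $\mathbb R^n$ is also written as a function of $s=\|x\|$, and the subscript $o$ on a function space denotes its radial elements. $\mathscr S(\mathbb R^n)_o$ is the space of radial Schwartz functions. For $\mu\ge0$, $\mathscr J_\mu(z)=2^\mu\pi^{1/2}\Gamma(\mu+\tfrac12)\dfrac{J_\mu(z)}{z^\mu}$ with $J_\mu$ the Bessel function. The Euclidean spherical Fourier transform of a radial $f$ is $\mathscr Ff(\lambda)=\int_0^\infty f(s)\mathscr J_{\frac{n-2}2}(\lambda s)s^{n-1}\,ds$, extended to radial $L^2$ functions by Plancherel; let $c_n>0$ be the constant in the inversion formula $f(s)=c_n\int_0^\infty\mathscr J_{\frac{n-2}2}(\lambda s)\mathscr Ff(\lambda)\lambda^{n-1}\,d\lambda$. For $\beta\ge0$, $\dot H^\beta(\mathbb R^n)_o$ (resp. $H^\beta(\mathbb R^n)_o$) is the space of radial $f\in L^2(\mathbb R^n)$ with $\int_0^\infty\lambda^{2\beta}|\mathscr Ff(\lambda)|^2\lambda^{n-1}d\lambda<\infty$ (resp. $\int_0^\infty(1+\lambda^2)^\beta|\mathscr Ff(\lambda)|^2\lambda^{n-1}d\lambda<\infty$), with norm the square root of this integral. For $f\in\mathscr S(\mathbb R^n)_o$ the Schrödinger propagation is $$\tilde S_tf(s)=c_n\int_0^\infty\mathscr J_{\frac{n-2}2}(\lambda s)\,e^{it\lambda^2}\,\mathscr Ff(\lambda)\,\lambda^{n-1}\,d\lambda,\qquad\tilde S_tf(\gamma_s(t)):=\tilde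 S_tf(\|\gamma_s(t)\|).$$ For general $f\in\dot H^{1/4}(\mathbb R^n)_o$, $\tilde S_tf(\gamma_s(t))$ is understood by continuous extension: if $f_j\in\mathscr S(\mathbb R^n)_o$ with $\|f_j-f\|_{L^2}+\|f_j-f\|_{\dot H^{1/4}}\le2^{-j}$, then $\tilde S_tf(\gamma_s(t))$ denotes, for a.e. $s$, the limit of $\tilde S_tf_j(\gamma_s(t))$, which exists uniformly for $t$ in some neighborhood of $0$ depending on $s$ and does not depend on the choice of $(f_j)$ up to a null set of $s$. *)

theory Defs
  imports "HOL-Analysis.Analysis"
begin

text \<open>
  Throughout, \<open>\<real>\<^sup>n\<close> is a type \<open>'a :: euclidean_space\<close> with \<open>n = DIM('a)\<close>; functions are complex valued,
  and elements of \<open>L\<^sup>2\<close> are represented by Lebesgue measurable functions.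
\<close>

section \<open>Radial functions\<close>

definition radial :: "('a::euclidean_space \<Rightarrow> 'b) \<Rightarrow> bool" where
  "radial f \<longleftrightarrow> (\<forall>x y. norm x = norm y \<longrightarrow> f x = f y)"

text \<open>A radial function regarded as a function of \<open>s = \<parallel>x\<parallel>\<close>; only meaningful for \<open>s \<ge> 0\<close>.\<close>

definition profile :: "('a::euclidean_space \<Rightarrow> 'b) \<Rightarrow> real \<Rightarrow> 'b" where
  "profile f s = f (SOME x. norm x = s)"

fun iterated_partial :: "'a::euclidean_space list \<Rightarrow> ('a \<Rightarrow> complex) \<Rightarrow> 'a \<Rightarrow> complex" where
  "iterated_partial [] f = f"
| "iterated_partial (b # bs) f = (\<lambda>x. frechet_derivative (iterated_partial bs f) (at x) b)"

text \<open>
  Differentiability of all iterated partial derivatives amounts to \<open>C\<^sup>\<infinity>\<close>; lists of basis vectors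
  play the role of multi-indices.
\<close>

definition schwartz :: "('a::euclidean_space \<Rightarrow> complex) set" where
  "schwartz = {f. \<forall>bs. set bs \<subseteq> Basis \<longrightarrow>
     (\<forall>x. iterated_partial bs f differentiable (at x)) \<and>
     (\<forall>k::nat. \<exists>C. \<forall>x. norm x ^ k * norm (iterated_partial bs f x) \<le> C)}"

definition schwartz_o :: "('a::euclidean_space \<Rightarrow> complex) set" where
  "schwartz_o = {f \<in> schwartz. radial f}"

definition L2_o :: "('a::euclidean_space \<Rightarrow> complex) set" where
  "L2_o = {f. radial f \<and> f \<in> borel_measurable lebesgue \<and>
     integrable lebesgue (\<lambda>x. (norm (f x))\<^sup>2)}"

definition L2_norm :: "('a::euclidean_space \<Rightarrow> complex) \<Rightarrow> real" where
  "L2_norm f = sqrt (LINT x|lebesgue. (norm (f x))\<^sup>2)"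


section \<open>The spherical Fourier transform\<close>

text \<open>Bessel function of the first kind, for arguments \<open>z > 0\<close>.\<close>

definition bessel_J :: "real \<Rightarrow> real \<Rightarrow> real" where
  "bessel_J \<mu> z =
     (\<Sum>k. (-1) ^ k / (fact k * Gamma (real k + \<mu> + 1)) * (z / 2) powr (2 * real k + \<mu>))"

text \<open>
  \<open>J\<^sub>\<mu>(z) / z\<^sup>\<mu>\<close> is read at \<open>z = 0\<close> as its limit \<open>1 / (2\<^sup>\<mu> \<Gamma>(\<mu> + 1))\<close>, the leading coefficient of
  the power series.
\<close>

definition spherical_J :: "real \<Rightarrow> real \<Rightarrow> real" where
  "spherical_J \<mu> z = 2 powr \<mu> * sqrt pi * Gamma (\<mu> + 1 / 2) *
     (if z = 0 then 1 / (2 powr \<mu> * Gamma (\<mu> + 1)) else bessel_J \<mu> z / z powr \<mu>)"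

definition sph_kernel :: "'a::euclidean_space itself \<Rightarrow> real \<Rightarrow> real" where
  "sph_kernel _ = spherical_J ((real DIM('a) - 2) / 2)"

text \<open>
  The transform given by the integral, used for Schwartz functions; the spectral variable is
  written \<open>\<xi>\<close>.
\<close>

definition sft :: "('a::euclidean_space \<Rightarrow> complex) \<Rightarrow> real \<Rightarrow> complex" where
  "sft f \<xi> = (LINT s:{0..}|lebesgue.
     profile f s * of_real (sph_kernel TYPE('a) (\<xi> * s) * s ^ (DIM('a) - 1)))"

text \<open>The constant \<open>c\<^sub>n > 0\<close> of the inversion formula.\<close>

definition inv_const :: "'a::euclidean_space itself \<Rightarrow> real" where
  "inv_const _ = (THE c. c > 0 \<and>
     (\<forall>f \<in> (schwartz_o :: ('a \<Rightarrow> complex) set). \<forall>s\<ge>0. profile f s =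
        of_real c * (LINT \<xi>:{0..}|lebesgue.
          of_real (sph_kernel TYPE('a) (\<xi> * s)) * sft f \<xi> * of_real (\<xi> ^ (DIM('a) - 1)))))"

text \<open>
  Extension by Plancherel: \<open>g\<close> is a limit in \<open>L\<^sup>2((0,\<infinity>), \<xi>\<^sup>n\<^sup>-\<^sup>1 d\<xi>)\<close> of the transforms of radial
  Schwartz functions converging to \<open>f\<close> in \<open>L\<^sup>2(\<real>\<^sup>n)\<close>. Such \<open>g\<close> is unique up to null sets. The
  integrals are taken in \<open>[0,\<infinity>]\<close>, so that convergence to \<open>0\<close> includes square integrability.
\<close>

definition is_sft_L2 :: "('a::euclidean_space \<Rightarrow> complex) \<Rightarrow> (real \<Rightarrow> complex) \<Rightarrow> bool" where
  "is_sft_L2 f g \<longleftrightarrow> g \<in> borel_measurable (lebesgue_on {0..}) \<and>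
     (\<exists>F. (\<forall>j::nat. F j \<in> schwartz_o) \<and>
        (\<lambda>j. \<integral>\<^sup>+x. ennreal ((norm (F j x - f x))\<^sup>2) \<partial>lebesgue) \<longlonglongrightarrow> 0 \<and>
        (\<lambda>j. \<integral>\<^sup>+\<xi>. ennreal ((norm (sft (F j) \<xi> - g \<xi>))\<^sup>2 * \<xi> ^ (DIM('a) - 1))
               \<partial>(lebesgue_on {0..})) \<longlonglongrightarrow> 0)"

definition sft_L2 :: "('a::euclidean_space \<Rightarrow> complex) \<Rightarrow> real \<Rightarrow> complex" where
  "sft_L2 f = (SOME g. is_sft_L2 f g)"


section \<open>Radial Sobolev spaces\<close>

definition Hdot_o :: "real \<Rightarrow> ('a::euclidean_space \<Rightarrow> complex) set" where
  "Hdot_o \<beta> = {f \<in> L2_o. set_integrable lebesgue {0..}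
     (\<lambda>\<xi>. \<xi> powr (2 * \<beta>) * (norm (sft_L2 f \<xi>))\<^sup>2 * \<xi> ^ (DIM('a) - 1))}"

definition Hdot_norm :: "real \<Rightarrow> ('a::euclidean_space \<Rightarrow> complex) \<Rightarrow> real" where
  "Hdot_norm \<beta> f = sqrt (LINT \<xi>:{0..}|lebesgue.
     \<xi> powr (2 * \<beta>) * (norm (sft_L2 f \<xi>))\<^sup>2 * \<xi> ^ (DIM('a) - 1))"

definition H_o :: "real \<Rightarrow> ('a::euclidean_space \<Rightarrow> complex) set" where
  "H_o \<beta> = {f \<in> L2_o. set_integrable lebesgue {0..}
     (\<lambda>\<xi>. (1 + \<xi>\<^sup>2) powr \<beta> * (norm (sft_L2 f \<xi>))\<^sup>2 * \<xi> ^ (DIM('a) - 1))}"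


section \<open>The Schroedinger propagation\<close>

definition schroedinger :: "('a::euclidean_space \<Rightarrow> complex) \<Rightarrow> real \<Rightarrow> real \<Rightarrow> complex" where
  "schroedinger f t s = of_real (inv_const TYPE('a)) * (LINT \<xi>:{0..}|lebesgue.
     of_real (sph_kernel TYPE('a) (\<xi> * s)) * exp (\<i> * of_real (t * \<xi>\<^sup>2)) * sft f \<xi>
       * of_real (\<xi> ^ (DIM('a) - 1)))"

text \<open>The quantity \<open>\<parallel>\<gamma>\<^sub>s(t)\<parallel>\<close>, for a family of curves such that \<open>\<parallel>\<gamma>\<^sub>x(t)\<parallel>\<close> is radial in \<open>x\<close>.\<close>

definition curve_norm :: "('a::euclidean_space \<Rightarrow> real \<Rightarrow> 'a) \<Rightarrow> real \<Rightarrow> real \<Rightarrow> real" where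
  "curve_norm \<gamma> s t = profile (\<lambda>x. norm (\<gamma> x t)) s"

definition approximates :: "(nat \<Rightarrow> 'a::euclidean_space \<Rightarrow> complex) \<Rightarrow> ('a \<Rightarrow> complex) \<Rightarrow> bool" where
  "approximates F f \<longleftrightarrow> (\<forall>j. F j \<in> schwartz_o \<and>
     L2_norm (\<lambda>x. F j x - f x) + Hdot_norm (1/4) (\<lambda>x. F j x - f x) \<le> 1 / 2 ^ j)"

text \<open>
  \<open>U s t\<close> is (a version of) the propagation of \<open>f\<close> at \<open>\<gamma>\<^sub>s(t)\<close>, defined by continuous extension.
  It is determined only for almost every \<open>s\<close> and for \<open>t\<close> near \<open>0\<close>. The limit is required to be the
  same for all approximating sequences, which are required to exist, so that the predicate does not
  hold vacuously.
\<close>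

definition is_propagation_along ::
  "('a::euclidean_space \<Rightarrow> real \<Rightarrow> 'a) \<Rightarrow> ('a \<Rightarrow> complex) \<Rightarrow> (real \<Rightarrow> real \<Rightarrow> complex) \<Rightarrow> bool" where
  "is_propagation_along \<gamma> f U \<longleftrightarrow> (\<exists>F. approximates F f) \<and>
     (\<forall>F. approximates F f \<longrightarrow>
        (AE s in lebesgue_on {0..}. \<exists>\<delta>>0.
           uniform_limit {-\<delta><..<\<delta>} (\<lambda>j t. schroedinger (F j) t (curve_norm \<gamma> s t)) (U s)
             sequentially))"

text \<open>
  The propagation of \<open>f\<close> along \<open>\<gamma>\<close> is well defined and converges to \<open>f\<close> as \<open>t \<rightarrow> 0\<close>, for almost
  every radius and for almost every point.
\<close>

definition converges_along ::
  "('a::euclidean_space \<Rightarrow> real \<Rightarrow> 'a) \<Rightarrow> ('a \<Rightarrow> complex) \<Rightarrow> bool" where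
  "converges_along \<gamma> f \<longleftrightarrow> (\<exists>U. is_propagation_along \<gamma> f U) \<and>
     (\<forall>U. is_propagation_along \<gamma> f U \<longrightarrow>
        (AE s in lebesgue_on {0..}. (U s \<longlongrightarrow> profile f s) (at 0)) \<and>
        (AE x in lebesgue. (U (norm x) \<longlongrightarrow> f x) (at 0)))"

end

theory Submission
  imports Defs
begin

text \<open>
  By the asymptotics \<open>Im (w e\<^sup>i\<^sup>z) + O(1/z)\<close> of the Bessel kernel and the substitution
  \<open>\<xi> = \<eta>\<^sup>2\<close>, the propagation at a measurably chosen time \<open>t(s)\<close> is an oscillatory integral.
  Its \<open>T T\<^sup>*\<close> kernel is \<open>\<integral> exp (i (x \<eta>\<^sup>2 + \<tau> \<eta>\<^sup>4)) d\<eta>\<close>, where \<open>\<tau> = t(s) - t(s')\<close> and \<open>x\<close> is the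
  difference of the two curve points; by van der Corput it is
  \<open>O(min (|x|\<^sup>-\<^sup>1\<^sup>/\<^sup>2, |\<tau>|\<^sup>-\<^sup>1\<^sup>/\<^sup>4))\<close>. As \<open>t \<mapsto> \<surd>|t|\<close> is Hoelder continuous of order 1/2, either
  \<open>|s - s'| \<le> 2 |x|\<close> or \<open>|s - s'| \<le> 2 C \<surd>|\<tau>|\<close>, so in both cases the kernel is
  \<open>O(|s - s'|\<^sup>-\<^sup>1\<^sup>/\<^sup>2)\<close>, which is integrable in \<open>s'\<close>. Hence on compact subsets of \<open>(0, \<infinity>)\<close> the
  maximal function along the curves is bounded in \<open>L\<^sup>2\<close> by the inhomogeneous \<open>H\<^sup>1\<^sup>/\<^sup>4\<close> norm.
  For approximants at distance \<open>2\<^sup>-\<^sup>j\<close> the maximal functions of the differences are summable at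
  almost every \<open>s\<close>, so the propagations converge uniformly in \<open>t\<close>; each is continuous in \<open>t\<close>.

  Inversion and Plancherel for the Hankel transform are obtained from Gaussians: their transforms
  are explicit, and a function orthogonal to all of them vanishes by the Weierstrass theorem.
\<close>

subsection \<open>Oscillatory integrals\<close>

text \<open>The weight of order 1/4 comes from the substitution: the amplitude turns into
  \<open>2 * \<eta> * h (\<eta>\<^sup>2)\<close>, whose square integral is twice that of
  \<open>sqrt \<xi> * (norm (h \<xi>))\<^sup>2\<close>. It also makes the spatial phase quadratic,
  so that its second derivative gives decay in x. The obstacle is the case where x and \<tau> have
  opposite signs: the second derivative vanishes at one frequency, and around it the first
  derivative has to take over. The remainder of the Bessel asymptotics is square integrable in
  \<xi>, uniformly in the radius, as long as the radius stays away from 0. Hence the intervals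
  \<open>{a..b}\<close> with \<open>a > 0\<close>, and hence the unweighted L2 norm next to the
  weighted one. A bound uniform in the selected time passes to the supremum over rational times and,
  by continuity, to all times. An error \<open>2^-j\<close> in norm is \<open>4^-j\<close> in
  squared norm. Half of this decay is spent on passing from integrals to almost every point; the
  other half still makes the square roots summable.\<close>

definition cexp :: "real \<Rightarrow> complex" where "cexp x = exp (\<i> * of_real x)"

lemma norm_cexp [simp]: "norm (cexp x) = 1"
  by (simp add: cexp_def)

lemma cexp_add: "cexp (x + y) = cexp x * cexp y"
  by (simp add: cexp_def distrib_left exp_add)

lemma cnj_cexp: "cnj (cexp x) = cexp (- x)"
  by (simp add: cexp_def exp_cnj)

lemma continuous_on_cexp [continuous_intros]:
  "continuous_on S f \<Longrightarrow> continuous_on S (\<lambda>x. cexp (f x))"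
  unfolding cexp_def by (intro continuous_intros)

lemma cexp_measurable [measurable]: "cexp \<in> borel_measurable borel"
  by (intro borel_measurable_continuous_onI continuous_on_cexp continuous_on_id)

lemma cexp_has_vector_derivative:
  assumes "(p has_real_derivative p') (at x)"
  shows "((\<lambda>x. cexp (p x)) has_vector_derivative (\<i> * of_real p' * cexp (p x))) (at x)"
proof -
  have "((\<lambda>x. \<i> * complex_of_real (p x)) has_vector_derivative \<i> * of_real p') (at x)"
    by (intro has_vector_derivative_mult_right has_vector_derivative_of_real)
       (use assms in \<open>simp add: has_real_derivative_iff_has_vector_derivative\<close>)
  then have "((exp \<circ> (\<lambda>x. \<i> * complex_of_real (p x))) has_vector_derivative
      (\<i> * of_real p') * exp (\<i> * of_real (p x))) (at x)"
    by (rule field_vector_diff_chain_at) (auto intro: DERIV_exp)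
  then show ?thesis by (simp add: cexp_def o_def)
qed

text \<open>Van der Corput with a first derivative. Integration by parts against
  \<open>1 / p'\<close> leaves two boundary terms of size \<open>1 / l\<close>. In the remainder
  \<open>p'' / (p')\<^sup>2\<close> is, up to sign, the derivative of \<open>1 / p'\<close>; as
  \<open>p''\<close> has one sign, its absolute value integrates to at most
  \<open>2 / l\<close>.\<close>

lemma osc_first:
  fixes p p' p'' :: "real \<Rightarrow> real"
  assumes ab: "a \<le> b" and p: "\<And>x. (p has_real_derivative p' x) (at x)"
    and p': "\<And>x. (p' has_real_derivative p'' x) (at x)" and c: "continuous_on UNIV p''"
    and l: "l > 0" "\<And>x. x \<in> {a..b} \<Longrightarrow> l \<le> \<bar>p' x\<bar>"
    and sgn: "(\<forall>x\<in>{a..b}. p'' x \<ge> 0) \<or> (\<forall>x\<in>{a..b}. p'' x \<le> 0)"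
  shows "norm (integral {a..b} (\<lambda>x. cexp (p x))) \<le> 4 / l"
proof -
  have nz: "p' x \<noteq> 0" if "x \<in> {a..b}" for x using l(2)[OF that] l(1) by auto
  have cp': "continuous_on S p'" and cp: "continuous_on S p" for S
    using p p' by (auto intro!: DERIV_continuous_on intro: has_field_derivative_at_within)
  have cp'': "continuous_on S p''" for S using c continuous_on_subset by blast
  define R where "R x = cexp (p x) * of_real (p'' x / (p' x)\<^sup>2)" for x
  define F where "F x = - \<i> * cexp (p x) * of_real (1 / p' x)" for x
  have dF: "(F has_vector_derivative (cexp (p x) + \<i> * R x)) (at x within {a..b})" if x: "x \<in> {a..b}" for x
  proof -
    have "((\<lambda>x. 1 / p' x) has_vector_derivative - (p'' x / (p' x)\<^sup>2)) (at x)"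
      unfolding has_real_derivative_iff_has_vector_derivative [symmetric]
      using nz[OF x] by (auto intro!: derivative_eq_intros p' simp: power2_eq_square)
    then have D: "((\<lambda>x. complex_of_real (1 / p' x)) has_vector_derivative of_real (- (p'' x / (p' x)\<^sup>2))) (at x)"
      by (intro has_vector_derivative_of_real) (simp only: has_real_derivative_iff_has_vector_derivative)
    have "((\<lambda>x. (- \<i> * cexp (p x)) * of_real (1 / p' x)) has_vector_derivative
       ((- \<i> * cexp (p x)) * of_real (- (p'' x / (p' x)\<^sup>2)) + (- \<i> * (\<i> * of_real (p' x) * cexp (p x))) * of_real (1 / p' x))) (at x)"
      by (intro has_vector_derivative_mult has_vector_derivative_mult_right cexp_has_vector_derivative p D)
    moreover have "((- \<i> * cexp (p x)) * of_real (- (p'' x / (p' x)\<^sup>2))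
        + (- \<i> * (\<i> * of_real (p' x) * cexp (p x))) * of_real (1 / p' x)) = cexp (p x) + \<i> * R x"
      using nz[OF x] by (simp add: R_def field_simps)
    ultimately show ?thesis unfolding F_def by (auto intro: has_vector_derivative_at_within)
  qed
  have I1: "((\<lambda>x. cexp (p x) + \<i> * R x) has_integral (F b - F a)) {a..b}"
    by (rule fundamental_theorem_of_calculus[OF ab dF])
  have cR: "continuous_on {a..b} R" unfolding R_def
    by (intro continuous_intros cp cp' cp'') (use nz in auto)
  have Ri: "R integrable_on {a..b}" by (rule integrable_continuous_real[OF cR])
  have Ci: "(\<lambda>x. cexp (p x)) integrable_on {a..b}"
    by (rule integrable_continuous_real) (intro continuous_intros cp)
  have eq: "integral {a..b} (\<lambda>x. cexp (p x)) = F b - F a - \<i> * integral {a..b} R"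
    using integral_unique[OF I1] Ri Ci by (simp add: integral_add integrable_on_mult_right algebra_simps)
  have nF: "norm (F x) \<le> 1 / l" if "x \<in> {a..b}" for x
    using l(2)[OF that] l(1) nz[OF that] by (auto simp: F_def norm_mult norm_divide intro!: divide_left_mono)
  have nR: "norm (integral {a..b} R) \<le> 2 / l"
  proof -
    have J: "((\<lambda>x. p'' x / (p' x)\<^sup>2) has_integral (- 1 / p' b - (- 1 / p' a))) {a..b}"
    proof (rule fundamental_theorem_of_calculus[OF ab])
      fix x assume x: "x \<in> {a..b}"
      have "((\<lambda>x. - 1 / p' x) has_vector_derivative (p'' x / (p' x)\<^sup>2)) (at x)"
        unfolding has_real_derivative_iff_has_vector_derivative [symmetric]
        using nz[OF x] by (auto intro!: derivative_eq_intros p' simp: power2_eq_square)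
      then show "((\<lambda>x. - 1 / p' x) has_vector_derivative (p'' x / (p' x)\<^sup>2)) (at x within {a..b})"
        by (rule has_vector_derivative_at_within)
    qed
    have bd: "\<bar>1 / p' x\<bar> \<le> 1 / l" if "x \<in> {a..b}" for x
      using l(2)[OF that] l(1) nz[OF that] by (auto intro!: divide_left_mono)
    have ends: "\<bar>1 / p' a\<bar> \<le> 1 / l" "\<bar>1 / p' b\<bar> \<le> 1 / l" using bd ab by auto
    \<comment> \<open>\<open>e\<close> is the constant sign of \<open>p''\<close>; it turns the
      absolute value of the integrand into a derivative.\<close>
    obtain e :: real where e: "\<bar>e\<bar> = 1" "\<And>x. x \<in> {a..b} \<Longrightarrow> \<bar>p'' x\<bar> = e * p'' x"
    proof (cases "\<forall>x\<in>{a..b}. p'' x \<ge> 0")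
      case True then show ?thesis by (intro that[of 1]) auto
    next
      case False then show ?thesis using sgn by (intro that[of "-1"]) auto
    qed
    have J': "((\<lambda>x. e * (p'' x / (p' x)\<^sup>2)) has_integral e * (- 1 / p' b - (- 1 / p' a))) {a..b}"
      by (rule has_integral_mult_right[OF J])
    have "norm (integral {a..b} R) \<le> integral {a..b} (\<lambda>x. e * (p'' x / (p' x)\<^sup>2))"
      using J' Ri e by (intro integral_norm_bound_integral) (auto simp: R_def norm_mult norm_divide norm_power)
    also have "\<dots> = e * (- 1 / p' b - (- 1 / p' a))" using J' by (rule integral_unique)
    also have "\<dots> \<le> \<bar>e\<bar> * (\<bar>1 / p' b\<bar> + \<bar>1 / p' a\<bar>)"
    proof -
      have "e * (- 1 / p' b - (- 1 / p' a)) \<le> \<bar>e\<bar> * \<bar>1 / p' a - 1 / p' b\<bar>"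
        unfolding abs_mult[symmetric] by (simp add: algebra_simps)
      also have "\<dots> \<le> \<bar>e\<bar> * (\<bar>1 / p' b\<bar> + \<bar>1 / p' a\<bar>)" by (intro mult_left_mono) linarith+
      finally show ?thesis .
    qed
    also have "\<dots> \<le> 2 / l" using ends e(1) by simp
    finally show ?thesis .
  qed
  have "norm (F b - F a - \<i> * integral {a..b} R) \<le> norm (F b) + norm (F a) + norm (integral {a..b} R)"
    by (metis (no_types, opaque_lifting) add_right_mono dual_order.trans norm_ii norm_mult norm_triangle_ineq4 mult_1)
  also have "\<dots> \<le> 4 / l" using nF[of a] nF[of b] nR ab by simp
  finally show ?thesis unfolding eq .
qed

text \<open>If the level \<open>y\<close> is not reached inside the interval, the cut degenerates to
  an endpoint, and the disjunct \<open>c = a\<close> or \<open>c = b\<close> releases the claim on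
  the empty side. Two cuts, at \<open>-m\<close> and at \<open>m\<close>, will isolate the zone in
  which \<open>q\<close> is small.\<close>

lemma increasing_cut:
  fixes q :: "real \<Rightarrow> real"
  assumes ab: "a \<le> b" and q: "continuous_on {a..b} q"
    and mono: "\<And>x y. a \<le> x \<Longrightarrow> x \<le> y \<Longrightarrow> y \<le> b \<Longrightarrow> q x \<le> q y"
  shows "\<exists>c\<in>{a..b}. (c = a \<or> (\<forall>x\<in>{a..c}. q x \<le> y)) \<and> (c = b \<or> (\<forall>x\<in>{c..b}. y \<le> q x))"
proof -
  consider "y \<le> q a" | "q b \<le> y" | "q a \<le> y" "y \<le> q b" by linarith
  then show ?thesis
  proof cases
    case 1
    have "y \<le> q x" if "x \<in> {a..b}" for x using mono[of a x] that 1 by auto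
    with ab show ?thesis by (intro bexI[of _ a]) auto
  next
    case 2
    have "q x \<le> y" if "x \<in> {a..b}" for x using mono[of x b] that 2 by auto
    with ab show ?thesis by (intro bexI[of _ b]) auto
  next
    case 3
    then obtain c where "c \<ge> a" "c \<le> b" "q c = y" using IVT'[of q a y b] ab q by auto
    with mono show ?thesis by (intro bexI[of _ c]) auto
  qed
qed

text \<open>Since \<open>q\<close> grows at rate at least \<open>l\<close>, its modulus is below
  \<open>m\<close> on an interval of length at most \<open>2 * m / l\<close>; there the integrand is
  bounded by 1. On the two remaining pieces the estimate \<open>B\<close> is available. With
  \<open>q\<close> a derivative of the phase, this is the induction step of van der Corput's
  lemma.\<close>

lemma osc_step_pos:
  fixes q q' :: "real \<Rightarrow> real" and f :: "real \<Rightarrow> complex"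
  assumes ab: "a \<le> b" and q: "\<And>x. (q has_real_derivative q' x) (at x)"
    and l: "l > 0" "\<And>x. x \<in> {a..b} \<Longrightarrow> l \<le> q' x"
    and f: "continuous_on {a..b} f" "\<And>x. norm (f x) \<le> 1" and m: "m > 0" and B: "B \<ge> 0"
    and sub: "\<And>c d. a \<le> c \<Longrightarrow> c \<le> d \<Longrightarrow> d
        \<le> b \<Longrightarrow> (\<And>x. x \<in> {c..d} \<Longrightarrow> m \<le> \<bar>q x\<bar>)
       \<Longrightarrow> norm (integral {c..d} f) \<le> B"
  shows "norm (integral {a..b} f) \<le> 2 * B + 2 * m / l"
proof -
  have cq: "continuous_on S q" for S
    using q by (auto intro!: DERIV_continuous_on intro: has_field_derivative_at_within)
  have inc: "l * (y - x) \<le> q y - q x" if "a \<le> x" "x \<le> y" "y \<le> b" for x y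
  proof (cases "x = y")
    case False
    then have "x < y" using that by simp
    from MVT2[OF this, of q q'] q obtain z where z: "x < z" "z < y" "q y - q x = (y - x) * q' z"
      by blast
    have "l * (y - x) \<le> q' z * (y - x)" using l(2)[of z] z that by (intro mult_right_mono) auto
    then show ?thesis unfolding z(3) by (simp only: mult.commute)
  qed simp
  have mono: "q x \<le> q y" if "a \<le> x" "x \<le> y" "y \<le> b" for x y
    using inc[OF that] l(1) that by (smt (verit) mult_nonneg_nonneg)
  obtain c where c: "c \<in> {a..b}" "c = a \<or> (\<forall>x\<in>{a..c}. q x \<le> -m)" "c = b \<or> (\<forall>x\<in>{c..b}. -m \<le> q x)"
    using increasing_cut[OF ab cq mono] by blast
  obtain d where d: "d \<in> {a..b}" "d = a \<or> (\<forall>x\<in>{a..d}. q x \<le> m)" "d = b \<or> (\<forall>x\<in>{d..b}. m \<le> q x)"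
    using increasing_cut[OF ab cq mono] by blast
  have cd: "c \<le> d"
  proof (rule ccontr)
    assume "\<not> c \<le> d"
    then have "c \<noteq> a" "d \<noteq> b" "d < c" using c d by auto
    then have "q c \<le> -m" "m \<le> q d" "q d \<le> q c" using c d mono[of d c] by auto
    then show False using m by simp
  qed
  have dc: "d - c \<le> 2 * m / l"
  proof (cases "c = d")
    case True then show ?thesis using m l by simp
  next
    case False
    then have "c \<noteq> b" "d \<noteq> a" using cd c d by auto
    then have "-m \<le> q c" "q d \<le> m" using c d cd by auto
    with inc[of c d] c d cd have "l * (d - c) \<le> 2 * m" by auto
    then show ?thesis using l(1) by (simp add: field_simps)
  qed
  have i: "f integrable_on {u..v}" if "a \<le> u" "v \<le> b" for u v
    by (rule integrable_continuous_real) (use f(1) that in \<open>auto intro: continuous_on_subset\<close>)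
  have 1: "norm (integral {a..c} f) \<le> B"
  proof (cases "c = a")
    case False then show ?thesis using c by (intro sub) force+
  qed (use B in simp)
  have 3: "norm (integral {d..b} f) \<le> B"
  proof (cases "d = b")
    case False then show ?thesis using d by (intro sub) force+
  qed (use B in simp)
  have 2: "norm (integral {c..d} f) \<le> 2 * m / l"
  proof -
    have "norm (integral {c..d} f) \<le> 1 * (d - c)"
      by (rule integral_bound) (use cd c d f in \<open>auto intro: continuous_on_subset\<close>)
    with dc show ?thesis by simp
  qed
  have "integral {a..b} f = integral {a..c} f + integral {c..d} f + integral {d..b} f"
    using c d cd i by (simp add: Henstock_Kurzweil_Integration.integral_combine)
  then show ?thesis using 1 2 3 by (smt (verit) norm_triangle_ineq)
qed

lemma osc_step:
  fixes q q' :: "real \<Rightarrow> real" and f :: "real \<Rightarrow> complex"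
  assumes ab: "a \<le> b" and q: "\<And>x. (q has_real_derivative q' x) (at x)"
    and l: "l > 0" "(\<forall>x\<in>{a..b}. l \<le> q' x) \<or> (\<forall>x\<in>{a..b}. q' x \<le> - l)"
    and f: "continuous_on {a..b} f" "\<And>x. norm (f x) \<le> 1" and m: "m > 0" and B: "B \<ge> 0"
    and sub: "\<And>c d. a \<le> c \<Longrightarrow> c \<le> d \<Longrightarrow> d
        \<le> b \<Longrightarrow> (\<And>x. x \<in> {c..d} \<Longrightarrow> m \<le> \<bar>q x\<bar>)
       \<Longrightarrow> norm (integral {c..d} f) \<le> B"
  shows "norm (integral {a..b} f) \<le> 2 * B + 2 * m / l"
  using l(2)
proof
  assume "\<forall>x\<in>{a..b}. l \<le> q' x"
  then have *: "l \<le> q' x" if "x \<in> {a..b}" for x using that by blast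
  show ?thesis by (rule osc_step_pos[OF ab q l(1) * f m B sub])
next
  assume *: "\<forall>x\<in>{a..b}. q' x \<le> - l"
  show ?thesis
  proof (rule osc_step_pos[where q = "\<lambda>x. - q x" and q' = "\<lambda>x. - q' x", OF ab _ l(1) _ f m B])
    show "((\<lambda>x. - q x) has_real_derivative - q' x) (at x)" for x
      by (auto intro!: derivative_eq_intros q)
    show "l \<le> - q' x" if "x \<in> {a..b}" for x using * that by force
    show "norm (integral {c..d} f) \<le> B"
      if "a \<le> c" "c \<le> d" "d \<le> b" "\<And>x. x \<in> {c..d} \<Longrightarrow> m \<le> \<bar>- q x\<bar>" for c d
      using that by (intro sub) auto
  qed
qed

text \<open>\<open>osc_step\<close> with \<open>q = p'\<close> and threshold \<open>l\<close>: two
  pieces with \<open>4 / l\<close> from \<open>osc_first\<close> and the middle piece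
  \<open>2 * l / l\<^sup>2\<close> add up to \<open>10 / l\<close>. The lower bound for
  \<open>p''\<close> is written as a square so that the threshold involves no root.\<close>

lemma osc_second:
  fixes p p' p'' :: "real \<Rightarrow> real"
  assumes ab: "a \<le> b" and p: "\<And>x. (p has_real_derivative p' x) (at x)"
    and p': "\<And>x. (p' has_real_derivative p'' x) (at x)" and c: "continuous_on UNIV p''"
    and l: "l > 0" "\<And>x. x \<in> {a..b} \<Longrightarrow> l\<^sup>2 \<le> \<bar>p'' x\<bar>"
  shows "norm (integral {a..b} (\<lambda>x. cexp (p x))) \<le> 10 / l"
proof -
  have cp: "continuous_on S p" for S
    using p by (auto intro!: DERIV_continuous_on intro: has_field_derivative_at_within)
  have nz: "p'' x \<noteq> 0" if "x \<in> {a..b}" for x using l(2)[OF that] l(1) by auto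
  \<comment> \<open>A continuous \<open>p''\<close> without zeros keeps its sign on the
    interval.\<close>
  have alt: "(\<forall>x\<in>{a..b}. l\<^sup>2 \<le> p'' x) \<or> (\<forall>x\<in>{a..b}. p'' x \<le> - l\<^sup>2)"
  proof (rule ccontr)
    assume "\<not> ?thesis"
    then obtain x y where xy: "x \<in> {a..b}" "y \<in> {a..b}" "p'' x < l\<^sup>2" "p'' y > - l\<^sup>2" by force
    then have "p'' x < 0" "p'' y > 0" using l(2)[of x] l(2)[of y] nz[of x] nz[of y] by (auto simp: abs_if split: if_splits)
    moreover have "connected (p'' ` {a..b})" using c
      by (intro connected_continuous_image) (auto intro: continuous_on_subset)
    ultimately have "0 \<in> p'' ` {a..b}"
      using xy connectedD_interval[of "p'' ` {a..b}" "p'' x" "p'' y" 0] by auto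
    then show False using nz by auto
  qed
  have "norm (integral {a..b} (\<lambda>x. cexp (p x))) \<le> 2 * (4 / l) + 2 * l / l\<^sup>2"
  proof (rule osc_step[where q = p' and q' = p'' and m = l, OF ab p' _ alt])
    fix u v assume uv: "a \<le> u" "u \<le> v" "v \<le> b" "\<And>x. x \<in> {u..v} \<Longrightarrow> l \<le> \<bar>p' x\<bar>"
    have "(\<forall>x\<in>{u..v}. p'' x \<ge> 0) \<or> (\<forall>x\<in>{u..v}. p'' x \<le> 0)"
      using alt uv by (smt (verit) atLeastAtMost_iff zero_le_power2)
    then show "norm (integral {u..v} (\<lambda>x. cexp (p x))) \<le> 4 / l"
      using uv by (intro osc_first[OF _ p p' c l(1)]) auto
  qed (use l in \<open>auto intro!: continuous_intros cp\<close>)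
  also have "\<dots> = 10 / l" using l by (simp add: power2_eq_square)
  finally show ?thesis .
qed

text \<open>The two bounds are assumed for all subintervals on their side, so \<open>y\<close> may
  lie anywhere, also outside the interval, and the lemma can be nested without discussing the
  relative position of the cuts.\<close>

lemma norm_integral_split:
  fixes f :: "real \<Rightarrow> complex"
  assumes ab: "a \<le> b" and f: "continuous_on {a..b} f"
    and 1: "\<And>c d. a \<le> c \<Longrightarrow> c \<le> d \<Longrightarrow> d \<le> b \<Longrightarrow> d \<le> y \<Longrightarrow> norm (integral {c..d} f) \<le> B1"
    and 2: "\<And>c d. a \<le> c \<Longrightarrow> c \<le> d \<Longrightarrow> d \<le> b \<Longrightarrow> y \<le> c \<Longrightarrow> norm (integral {c..d} f) \<le> B2"
    and B: "B1 \<ge> 0" "B2 \<ge> 0"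
  shows "norm (integral {a..b} f) \<le> B1 + B2"
proof -
  consider "b \<le> y" | "y \<le> a" | "a \<le> y" "y \<le> b" by linarith
  then show ?thesis
  proof cases
    case 1 then show ?thesis using assms(3)[of a b] ab B by auto
  next
    case 2 then show ?thesis using assms(4)[of a b] ab B by auto
  next
    case 3
    have "integral {a..b} f = integral {a..y} f + integral {y..b} f"
      using 3 f by (simp add: Henstock_Kurzweil_Integration.integral_combine integrable_continuous_real)
    then show ?thesis using assms(3)[of a y] assms(4)[of y b] 3 by (smt (verit) norm_triangle_ineq)
  qed
qed

section \<open>Decay for the phase with a quadratic and a quartic term\<close>

context
  fixes x t :: real
begin

abbreviation (input) "qp \<eta> \<equiv> x * \<eta>\<^sup>2 + t * \<eta>^4"
abbreviation (input) "qp1 \<eta> \<equiv> 2 * x * \<eta> + 4 * t * \<eta>^3"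
abbreviation (input) "qp2 \<eta> \<equiv> 2 * x + 12 * t * \<eta>\<^sup>2"

lemma quartic_derivs:
  "((\<lambda>\<eta>. qp \<eta>) has_real_derivative qp1 \<eta>) (at \<eta>)"
  "((\<lambda>\<eta>. qp1 \<eta>) has_real_derivative qp2 \<eta>) (at \<eta>)"
  "((\<lambda>\<eta>. qp2 \<eta>) has_real_derivative 24 * t * \<eta>) (at \<eta>)"
  "continuous_on S (\<lambda>\<eta>. qp2 \<eta>)"
  "continuous_on S (\<lambda>\<eta>. cexp (qp \<eta>))"
  by (auto intro!: derivative_eq_intros continuous_intros)

text \<open>Below the frequency \<open>1 / m\<close> the trivial estimate costs
  \<open>1 / m\<close>. Above it the third derivative \<open>24 * t * \<eta>\<close> of the phase
  has modulus at least \<open>24 * m^3\<close>, and \<open>osc_step\<close> on the second derivative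
  with threshold \<open>m\<^sup>2\<close> gives \<open>20 / m + 1 / (12 * m)\<close>, rounded to
  \<open>21 / m\<close>.\<close>

lemma quartic_osc_t:
  assumes "0 \<le> a" "a \<le> b" and m: "m > 0" "\<bar>t\<bar> = m ^ 4"
  shows "norm (integral {a..b} (\<lambda>\<eta>. cexp (qp \<eta>))) \<le> 22 / m"
proof -
  have "norm (integral {a..b} (\<lambda>\<eta>. cexp (qp \<eta>))) \<le> 1 / m + 21 / m"
  proof (rule norm_integral_split[where y = "1 / m"])
    fix c d assume cd: "a \<le> c" "c \<le> d" "d \<le> b" "d \<le> 1 / m"
    have "norm (integral {c..d} (\<lambda>\<eta>. cexp (qp \<eta>))) \<le> 1 * (d - c)"
      by (rule integral_bound) (use cd quartic_derivs in auto)
    then show "norm (integral {c..d} (\<lambda>\<eta>. cexp (qp \<eta>))) \<le> 1 / m" using cd assms by simp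
  next
    fix c d assume cd: "a \<le> c" "c \<le> d" "d \<le> b" "1 / m \<le> c"
    have ge: "24 * m^3 \<le> 24 * \<bar>t\<bar> * \<eta>" if "\<eta> \<in> {c..d}" for \<eta>
    proof -
      have "1 / m \<le> \<eta>" using that cd by auto
      then have "m^3 * 1 \<le> m^3 * (m * \<eta>)" using m by (intro mult_left_mono) (auto simp: field_simps)
      then show ?thesis using m by (simp add: eval_nat_numeral mult.assoc)
    qed
    have "norm (integral {c..d} (\<lambda>\<eta>. cexp (qp \<eta>))) \<le> 2 * (10 / m) + 2 * m\<^sup>2 / (24 * m^3)"
    proof (rule osc_step[where q = "\<lambda>\<eta>. qp2 \<eta>" and q' = "\<lambda>\<eta>. 24 * t * \<eta>"])
      show "(\<forall>x\<in>{c..d}. 24 * m ^ 3 \<le> 24 * t * x) \<or> (\<forall>x\<in>{c..d}. 24 * t * x \<le> - (24 * m ^ 3))"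
      proof (cases "t \<ge> 0")
        case True then show ?thesis using ge by auto
      next
        case False
        then have "24 * t * \<eta> \<le> - (24 * m^3)" if "\<eta> \<in> {c..d}" for \<eta> using ge[OF that] by (simp add: abs_if)
        then show ?thesis by auto
      qed
      fix u v assume uv: "c \<le> u" "u \<le> v" "v \<le> d" "\<And>\<eta>. \<eta> \<in> {u..v} \<Longrightarrow> m\<^sup>2 \<le> \<bar>qp2 \<eta>\<bar>"
      then show "norm (integral {u..v} (\<lambda>\<eta>. cexp (qp \<eta>))) \<le> 10 / m"
        by (intro osc_second[OF _ quartic_derivs(1,2) _ m(1)] quartic_derivs) auto
    qed (use cd m quartic_derivs in auto)
    also have "\<dots> \<le> 21 / m" using m by (simp add: field_simps eval_nat_numeral)
    finally show "norm (integral {c..d} (\<lambda>\<eta>. cexp (qp \<eta>))) \<le> 21 / m" .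
  qed (use assms quartic_derivs in auto)
  also have "\<dots> = 22 / m" by simp
  finally show ?thesis .
qed

text \<open>Equal signs of \<open>x\<close> and \<open>t\<close> keep the second derivative at least
  \<open>2 * \<bar>x\<bar>\<close> in modulus. For opposite signs let \<open>m\<close> be the fourth
  root of \<open>\<bar>t\<bar>\<close>. If \<open>m \<ge> y\<close>, the bound in \<open>t\<close>
  is already good enough. Otherwise the inflection point is \<open>y / (sqrt 6 * m\<^sup>2)\<close>
  and the positive stationary point is \<open>y / (sqrt 2 * m\<^sup>2)\<close>. The cuts at
  \<open>y / (4 * m\<^sup>2)\<close> and \<open>y / (2 * m\<^sup>2)\<close> enclose the former and
  stay below the latter: outside them the second derivative is large, between them the first. The
  total is 10 + 16 + 16 + 10.\<close>

lemma quartic_osc_x: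
  assumes ab: "0 \<le> a" "a \<le> b" and y: "y > 0" "\<bar>x\<bar> = y\<^sup>2"
  shows "norm (integral {a..b} (\<lambda>\<eta>. cexp (qp \<eta>))) \<le> 52 / y"
proof (cases "x * t \<ge> 0")
  case True
  have "norm (integral {a..b} (\<lambda>\<eta>. cexp (qp \<eta>))) \<le> 10 / y"
  proof (rule osc_second[OF ab(2) quartic_derivs(1,2) _ y(1)])
    fix \<eta> :: real
    have "\<bar>2 * x\<bar> \<le> \<bar>qp2 \<eta>\<bar>"
    proof (cases "x \<ge> 0")
      case T: True
      then have "t \<ge> 0" using True y by (auto simp: zero_le_mult_iff)
      then show ?thesis using T by simp
    next
      case F: False
      then have "t \<le> 0" using True y by (auto simp: zero_le_mult_iff)
      then have "12 * t * \<eta>\<^sup>2 \<le> 0" by (auto simp: mult_nonpos_nonneg)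
      then show ?thesis using F by simp
    qed
    then show "y\<^sup>2 \<le> \<bar>qp2 \<eta>\<bar>" using y by simp
  qed (rule quartic_derivs)
  also have "\<dots> \<le> 52 / y" using y by (simp add: divide_right_mono)
  finally show ?thesis .
next
  case neg: False
  define m where "m = root 4 \<bar>t\<bar>"
  have t0: "t \<noteq> 0" using neg by auto
  have m: "m > 0" "\<bar>t\<bar> = m ^ 4" using t0 by (auto simp: m_def)
  show ?thesis
  proof (cases "m \<ge> y")
    case True
    have "norm (integral {a..b} (\<lambda>\<eta>. cexp (qp \<eta>))) \<le> 22 / m" by (rule quartic_osc_t[OF ab m])
    also have "\<dots> \<le> 22 / y" using True y by (simp add: divide_left_mono)
    also have "\<dots> \<le> 52 / y" using y by (simp add: divide_right_mono)
    finally show ?thesis .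
  next
    case False
    then have my: "m < y" by simp
    \<comment> \<open>\<open>e\<close> is the sign of \<open>x\<close>; multiplying the derivatives
      of the phase by it normalises to a positive quadratic and a negative quartic
      coefficient.\<close>
    obtain e :: real where e: "\<bar>e\<bar> = 1" "e * x = y\<^sup>2" "e * t = - (m^4)"
    proof (cases "x \<ge> 0")
      case True
      then show ?thesis using neg m y by (intro that[of 1]) (auto simp: abs_if mult_less_0_iff not_le split: if_splits)
    next
      case False
      then show ?thesis using neg m y by (intro that[of "-1"]) (auto simp: abs_if mult_less_0_iff not_le split: if_splits)
    qed
    have e2: "e * (e * z) = z" for z using e(1) by (auto simp: abs_if split: if_splits)
    have ab1: "\<bar>z\<bar> = \<bar>e * z\<bar>" for z using e(1) by (simp add: abs_mult)
    have p2: "e * qp2 \<eta> = 2 * y\<^sup>2 - 12 * (m\<^sup>2 * \<eta>)\<^sup>2" for \<eta>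
    proof -
      have "e * qp2 \<eta> = 2 * (e * x) + 12 * (e * t) * \<eta>\<^sup>2" by (simp add: algebra_simps)
      then show ?thesis unfolding e by (simp add: algebra_simps power_mult_distrib flip: power_mult)
    qed
    have p1: "e * qp1 \<eta> = 2 * \<eta> * (y\<^sup>2 - 2 * (m\<^sup>2 * \<eta>)\<^sup>2)" for \<eta>
    proof -
      have "e * qp1 \<eta> = 2 * (e * x) * \<eta> + 4 * (e * t) * \<eta>^3" by (simp add: algebra_simps)
      then show ?thesis unfolding e by (simp add: algebra_simps eval_nat_numeral)
    qed
    let ?I = "\<lambda>c d. norm (integral {c..d} (\<lambda>\<eta>. cexp (qp \<eta>)))"
    have m2: "m\<^sup>2 > 0" using m by simp
    have hi: "?I c d \<le> 10 / y" if "c \<le> d" "y / (2 * m\<^sup>2) \<le> c" for c d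
    proof (rule osc_second[OF that(1) quartic_derivs(1,2) _ y(1)])
      fix \<eta> assume "\<eta> \<in> {c..d}"
      then have "y / (2 * m\<^sup>2) \<le> \<eta>" using that by auto
      then have "y / 2 \<le> m\<^sup>2 * \<eta>" using m2 by (simp add: field_simps)
      then have "(y / 2)\<^sup>2 \<le> (m\<^sup>2 * \<eta>)\<^sup>2" using y by (intro power_mono) auto
      then have "e * qp2 \<eta> \<le> - (y\<^sup>2)" unfolding p2 by (simp add: power_divide)
      then show "y\<^sup>2 \<le> \<bar>qp2 \<eta>\<bar>" unfolding ab1[of "qp2 \<eta>"] by linarith
    qed (rule quartic_derivs)
    have lo: "?I c d \<le> 10 / y" if "0 \<le> c" "c \<le> d" "d \<le> y / (4 * m\<^sup>2)" for c d
    proof (rule osc_second[OF that(2) quartic_derivs(1,2) _ y(1)])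
      fix \<eta> assume n: "\<eta> \<in> {c..d}"
      then have "\<eta> \<le> y / (4 * m\<^sup>2)" using that by auto
      then have "m\<^sup>2 * \<eta> \<le> y / 4" using m2 by (simp add: field_simps)
      then have "(m\<^sup>2 * \<eta>)\<^sup>2 \<le> (y / 4)\<^sup>2" using y n that m2 by (intro power_mono) auto
      then have "16 * (m\<^sup>2 * \<eta>)\<^sup>2 \<le> y\<^sup>2" by (simp add: power_divide)
      then have "e * qp2 \<eta> \<ge> y\<^sup>2" unfolding p2 using zero_le_power2[of "m\<^sup>2 * \<eta>"] by linarith
      then show "y\<^sup>2 \<le> \<bar>qp2 \<eta>\<bar>" unfolding ab1[of "qp2 \<eta>"] by linarith
    qed (rule quartic_derivs)
    have mid: "?I c d \<le> 4 / (y / 4)" if "0 \<le> c" "c \<le> d" "y / (4 * m\<^sup>2) \<le> c" "d \<le> y / (2 * m\<^sup>2)"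
      and s: "(\<forall>\<eta>\<in>{c..d}. e * qp2 \<eta> \<ge> 0) \<or> (\<forall>\<eta>\<in>{c..d}. e * qp2 \<eta> \<le> 0)" for c d
    proof (rule osc_first[OF that(2) quartic_derivs(1,2)])
      show "(\<forall>\<eta>\<in>{c..d}. 0 \<le> qp2 \<eta>) \<or> (\<forall>\<eta>\<in>{c..d}. qp2 \<eta> \<le> 0)"
        using s e(1) by (auto simp: abs_if split: if_splits)
      fix \<eta> assume n: "\<eta> \<in> {c..d}"
      then have "\<eta> \<le> y / (2 * m\<^sup>2)" and n2: "y / (4 * m\<^sup>2) \<le> \<eta>" using that by auto
      then have "m\<^sup>2 * \<eta> \<le> y / 2" using m2 by (simp add: field_simps)
      then have "(m\<^sup>2 * \<eta>)\<^sup>2 \<le> (y / 2)\<^sup>2" using y n that m2 by (intro power_mono) auto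
      then have A: "y\<^sup>2 / 2 \<le> y\<^sup>2 - 2 * (m\<^sup>2 * \<eta>)\<^sup>2" by (simp add: power_divide)
      \<comment> \<open>Here \<open>m < y\<close> is used: the lower bound for the first derivative
        is naturally of size \<open>y^3 / m\<^sup>2\<close>, which this turns into a multiple of
        \<open>y\<close>.\<close>
      have "1 \<le> y\<^sup>2 / m\<^sup>2" using my m y by (simp add: power_mono)
      then have "y / 4 * 1 \<le> y / 4 * (y\<^sup>2 / m\<^sup>2)" using y by (intro mult_left_mono) auto
      also have "\<dots> = 2 * (y / (4 * m\<^sup>2)) * (y\<^sup>2 / 2)" using m2 by (simp add: field_simps)
      also have "\<dots> \<le> 2 * \<eta> * (y\<^sup>2 - 2 * (m\<^sup>2 * \<eta>)\<^sup>2)"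
        using A n2 y n that by (intro mult_mono) auto
      finally have "y / 4 \<le> e * qp1 \<eta>" unfolding p1 by simp
      then show "y / 4 \<le> \<bar>qp1 \<eta>\<bar>" unfolding ab1[of "qp1 \<eta>"] by linarith
    qed (use y quartic_derivs in auto)
    define s6 :: real where "s6 = sqrt 6"
    have s6: "s6 > 0" "s6\<^sup>2 = 6" by (auto simp: s6_def)
    have "?I a b \<le> (10 / y + (16 / y + 16 / y)) + 10 / y"
    proof (rule norm_integral_split[where y = "y / (2 * m\<^sup>2)"])
      fix c d assume cd: "a \<le> c" "c \<le> d" "d \<le> b" "d \<le> y / (2 * m\<^sup>2)"
      show "?I c d \<le> 10 / y + (16 / y + 16 / y)"
      proof (rule norm_integral_split[where y = "y / (4 * m\<^sup>2)"])
        fix c' d' assume cd': "c \<le> c'" "c' \<le> d'" "d' \<le> d" "y / (4 * m\<^sup>2) \<le> c'"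
        show "?I c' d' \<le> 16 / y + 16 / y"
        proof (rule norm_integral_split[where y = "y / (s6 * m\<^sup>2)"])
          fix u v assume uv: "c' \<le> u" "u \<le> v" "v \<le> d'" "v \<le> y / (s6 * m\<^sup>2)"
          have "e * qp2 \<eta> \<ge> 0" if "\<eta> \<in> {u..v}" for \<eta>
          proof -
            have "\<eta> \<le> y / (s6 * m\<^sup>2)" "0 \<le> \<eta>" using that uv cd cd' ab by auto
            then have "s6 * (m\<^sup>2 * \<eta>) \<le> y" using m2 s6 by (simp add: field_simps)
            then have "(s6 * (m\<^sup>2 * \<eta>))\<^sup>2 \<le> y\<^sup>2" using \<open>0 \<le> \<eta>\<close> m2 s6 by (intro power_mono) auto
            then show ?thesis unfolding p2 by (simp only: power_mult_distrib[of s6] s6)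
          qed
          then show "?I u v \<le> 16 / y" using mid[of u v] uv cd cd' ab by simp
        next
          fix u v assume uv: "c' \<le> u" "u \<le> v" "v \<le> d'" "y / (s6 * m\<^sup>2) \<le> u"
          have "e * qp2 \<eta> \<le> 0" if "\<eta> \<in> {u..v}" for \<eta>
          proof -
            have "y / (s6 * m\<^sup>2) \<le> \<eta>" "0 \<le> \<eta>" using that uv cd cd' ab by auto
            then have "y \<le> s6 * (m\<^sup>2 * \<eta>)" using m2 s6 by (simp add: field_simps)
            then have "y\<^sup>2 \<le> (s6 * (m\<^sup>2 * \<eta>))\<^sup>2" using y by (intro power_mono) auto
            then show ?thesis unfolding p2 by (simp only: power_mult_distrib[of s6] s6)
          qed
          then show "?I u v \<le> 16 / y" using mid[of u v] uv cd cd' ab by simp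
        qed (use cd' y quartic_derivs in auto)
      next
        fix c' d' assume "c \<le> c'" "c' \<le> d'" "d' \<le> d" "d' \<le> y / (4 * m\<^sup>2)"
        then show "?I c' d' \<le> 10 / y" using lo cd ab by auto
      qed (use cd y quartic_derivs in auto)
    qed (use hi ab y quartic_derivs in auto)
    also have "\<dots> = 52 / y" by (simp add: field_simps)
    finally show ?thesis .
  qed
qed

end

subsection \<open>The Bessel kernel\<close>

text \<open>\<open>sj\<close> is \<open>spherical_J\<close> as a power series in
  \<open>z\<^sup>2\<close>: the factor \<open>z powr \<nu>\<close> of the Bessel function cancels
  against the denominator. The resulting function is even, smooth and defined on the whole line,
  without a separate value at 0.\<close>

definition sj_coeff :: "real \<Rightarrow> nat \<Rightarrow> real" where
  "sj_coeff \<nu> k = sqrt pi * Gamma (\<nu> + 1/2) * (-1/4) ^ k / (fact k * Gamma (real k + \<nu> + 1))"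

definition sj :: "real \<Rightarrow> real \<Rightarrow> real" where
  "sj \<nu> z = (\<Sum>k. sj_coeff \<nu> k * (z\<^sup>2) ^ k)"

text \<open>The functional equation of Gamma. This recurrence yields the majorant of the series, the
  differential equation and the transform of Gaussians.\<close>

lemma sj_coeff_Suc:
  assumes "\<nu> \<ge> 0"
  shows "4 * real (Suc k) * (real (Suc k) + \<nu>) * sj_coeff \<nu> (Suc k) = - sj_coeff \<nu> k"
proof -
  have "Gamma (real (Suc k) + \<nu> + 1) = (real (Suc k) + \<nu>) * Gamma (real k + \<nu> + 1)"
    using Gamma_plus1[of "real (Suc k) + \<nu>"] assms by (simp add: add_ac nonpos_Ints_def)
  moreover have G: "Gamma (real k + \<nu> + 1) > 0" using assms by (intro Gamma_real_pos) auto
  moreover have p: "real (Suc k) + \<nu> > 0" using assms by simp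
  have alg: "4 * a * b * (c * (-1/4 * e) / (a * f * (b * g))) = - (c * e / (f * g))"
    if "a > 0" "b > 0" "f > 0" "g > 0" for a b c e f g :: real
    using that by (simp add: divide_simps)
  show ?thesis unfolding sj_coeff_def calculation(1) power_Suc fact_Suc of_nat_mult of_nat_fact
    by (rule alg) (use G p in auto)
qed

lemma abs_sj_coeff_le:
  assumes "\<nu> \<ge> 0"
  shows "\<bar>sj_coeff \<nu> k\<bar> \<le> \<bar>sj_coeff \<nu> 0\<bar> / fact k"
proof (induction k)
  case (Suc k)
  have 1: "1 \<le> 4 * (real (Suc k) + \<nu>)" using assms by simp
  have 2: "\<bar>4 * a * b * c\<bar> = a * \<bar>c\<bar> * (4 * b)" if "a \<ge> 0" "b \<ge> 0" for a b c :: real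
    using that by (simp add: abs_mult mult_ac)
  have "real (Suc k) * \<bar>sj_coeff \<nu> (Suc k)\<bar> * 1 \<le> real (Suc k) * \<bar>sj_coeff \<nu> (Suc k)\<bar> * (4 * (real (Suc k) + \<nu>))"
    by (rule mult_left_mono[OF 1]) simp
  also have "\<dots> = \<bar>4 * real (Suc k) * (real (Suc k) + \<nu>) * sj_coeff \<nu> (Suc k)\<bar>"
    by (rule 2[symmetric]) (use assms in auto)
  also have "\<dots> = \<bar>sj_coeff \<nu> k\<bar>" unfolding sj_coeff_Suc[OF assms] by simp
  also have "\<dots> \<le> \<bar>sj_coeff \<nu> 0\<bar> / fact k" by (rule Suc.IH)
  finally have "real (Suc k) * \<bar>sj_coeff \<nu> (Suc k)\<bar> \<le> \<bar>sj_coeff \<nu> 0\<bar> / fact k" by simp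
  then have "\<bar>sj_coeff \<nu> (Suc k)\<bar> \<le> \<bar>sj_coeff \<nu> 0\<bar> / fact k / real (Suc k)"
    by (simp only: pos_le_divide_eq of_nat_0_less_iff zero_less_Suc mult.commute)
  then show ?case by (simp add: mult.commute)
qed simp

lemma summable_sj:
  assumes "\<nu> \<ge> 0"
  shows "summable (\<lambda>k. sj_coeff \<nu> k * y ^ k)"
proof (rule summable_comparison_test')
  show "summable (\<lambda>k. \<bar>sj_coeff \<nu> 0\<bar> * (inverse (fact k) * \<bar>y\<bar> ^ k))"
    by (intro summable_mult summable_exp)
  show "norm (sj_coeff \<nu> k * y ^ k) \<le> \<bar>sj_coeff \<nu> 0\<bar> * (inverse (fact k) * \<bar>y\<bar> ^ k)" for k
    using mult_right_mono[OF abs_sj_coeff_le[OF assms, of k], of "\<bar>y\<bar> ^ k"]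
    by (simp add: abs_mult power_abs field_simps)
qed

text \<open>The link to the kernel of the statement. Real powers restrict it to
  \<open>z \<ge> 0\<close>, which suffices because radii and frequencies are nonnegative.\<close>

lemma spherical_J_eq_sj:
  assumes "\<nu> \<ge> 0" "z \<ge> 0"
  shows "spherical_J \<nu> z = sj \<nu> z"
proof (cases "z = 0")
  case True
  have "sj \<nu> 0 = sj_coeff \<nu> 0" unfolding sj_def by (simp add: powser_zero)
  then show ?thesis using True by (simp add: spherical_J_def sj_coeff_def)
next
  case False
  then have z: "z > 0" using assms by simp
  let ?c = "2 powr \<nu> * sqrt pi * Gamma (\<nu> + 1/2) / z powr \<nu>"
  have trm: "(-1) ^ k / (fact k * Gamma (real k + \<nu> + 1)) * (z / 2) powr (2 * real k + \<nu>)
      = sj_coeff \<nu> k * (z\<^sup>2) ^ k * inverse ?c" for k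
  proof -
    have "(z / 2) powr (2 * real k + \<nu>) = (z / 2) ^ (2 * k) * (z / 2) powr \<nu>"
      using z by (simp add: powr_add flip: powr_realpow)
    also have "(z / 2) ^ (2 * k) = (z\<^sup>2) ^ k * (1/4) ^ k"
      by (simp add: power_mult power_divide)
    also have "(z / 2) powr \<nu> = z powr \<nu> / 2 powr \<nu>" using z by (simp add: powr_divide)
    finally have e: "(z / 2) powr (2 * real k + \<nu>) = (z\<^sup>2) ^ k * (1/4) ^ k * (z powr \<nu> / 2 powr \<nu>)" .
    have G: "Gamma (\<nu> + 1/2) \<noteq> 0" using Gamma_real_pos[of "\<nu> + 1/2"] assms by linarith
    have e4: "(-1/4 :: real) ^ k = (-1) ^ k * (1/4) ^ k" by (simp flip: power_mult_distrib)
    show ?thesis unfolding e sj_coeff_def e4 using z G by (simp add: field_simps)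
  qed
  have "spherical_J \<nu> z = ?c * bessel_J \<nu> z" using False by (simp add: spherical_J_def)
  also have "\<dots> = ?c * (\<Sum>k. sj_coeff \<nu> k * (z\<^sup>2) ^ k * inverse ?c)"
    unfolding bessel_J_def trm ..
  also have "\<dots> = sj \<nu> z"
  proof -
    have "Gamma (\<nu> + 1/2) > 0" using assms by (intro Gamma_real_pos) auto
    then have c: "?c \<noteq> 0" using z by simp
    have "(\<Sum>k. inverse ?c * (sj_coeff \<nu> k * (z\<^sup>2) ^ k)) = inverse ?c * sj \<nu> z"
      unfolding sj_def by (rule suminf_mult[OF summable_sj[OF assms(1)]])
    then show ?thesis using c
      by (simp add: mult.commute)
  qed
  finally show ?thesis .
qed

text \<open>First and second derivative of \<open>sj\<close>, obtained by the chain rule from the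
  series in \<open>z\<^sup>2\<close> differentiated termwise.\<close>

definition sj1 :: "real \<Rightarrow> real \<Rightarrow> real" where
  "sj1 \<nu> z = (\<Sum>k. diffs (sj_coeff \<nu>) k * (z\<^sup>2) ^ k) * (2 * z)"

definition sj2 :: "real \<Rightarrow> real \<Rightarrow> real" where
  "sj2 \<nu> z = (\<Sum>k. diffs (diffs (sj_coeff \<nu>)) k * (z\<^sup>2) ^ k) * (2 * z) * (2 * z)
     + (\<Sum>k. diffs (sj_coeff \<nu>) k * (z\<^sup>2) ^ k) * 2"

context
  fixes \<nu> :: real
  assumes nu: "\<nu> \<ge> 0"
begin

lemma summable_diffs_sj: "summable (\<lambda>k. diffs (sj_coeff \<nu>) k * y ^ k)" for y :: real
  by (rule termdiff_converges_all) (rule summable_sj[OF nu])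

lemma summable_diffs2_sj: "summable (\<lambda>k. diffs (diffs (sj_coeff \<nu>)) k * y ^ k)" for y :: real
  by (rule termdiff_converges_all) (rule summable_diffs_sj)

lemma sj_deriv: "(sj \<nu> has_real_derivative sj1 \<nu> z) (at z)"
proof -
  have "((\<lambda>z. (\<lambda>y. \<Sum>k. sj_coeff \<nu> k * y ^ k) (z\<^sup>2)) has_real_derivative
     (\<Sum>k. diffs (sj_coeff \<nu>) k * (z\<^sup>2) ^ k) * (2 * z)) (at z)"
    by (rule DERIV_chain2[OF termdiffs_strong_converges_everywhere[OF summable_sj[OF nu]]])
       (auto intro!: derivative_eq_intros)
  then show ?thesis by (simp add: sj_def[abs_def] sj1_def)
qed

lemma sj1_deriv: "(sj1 \<nu> has_real_derivative sj2 \<nu> z) (at z)"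
proof -
  have "((\<lambda>z. (\<lambda>y. \<Sum>k. diffs (sj_coeff \<nu>) k * y ^ k) (z\<^sup>2)) has_real_derivative
     (\<Sum>k. diffs (diffs (sj_coeff \<nu>)) k * (z\<^sup>2) ^ k) * (2 * z)) (at z)"
    by (rule DERIV_chain2[OF termdiffs_strong_converges_everywhere[OF summable_diffs_sj]])
       (auto intro!: derivative_eq_intros)
  then have "((\<lambda>z. (\<Sum>k. diffs (sj_coeff \<nu>) k * (z\<^sup>2) ^ k) * (2 * z)) has_real_derivative sj2 \<nu> z) (at z)"
    unfolding sj2_def by (auto intro!: derivative_eq_intros)
  then show ?thesis by (simp add: sj1_def[abs_def])
qed

text \<open>Bessel's equation for the Bessel function divided by \<open>z powr \<nu>\<close>;
  comparing coefficients in powers of \<open>z\<^sup>2\<close>, it is exactly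
  \<open>sj_coeff_Suc\<close>. For \<open>\<nu> = (n - 2) / 2\<close> the factor
  \<open>2 * \<nu> + 1\<close> is \<open>n - 1\<close>, so this is the eigenvalue equation of the
  radial Laplacian in dimension n.\<close>

lemma sj_ode: "z * sj2 \<nu> z + (2 * \<nu> + 1) * sj1 \<nu> z + z * sj \<nu> z = 0"
proof -
  let ?c = "sj_coeff \<nu>" and ?y = "z\<^sup>2"
  have s0: "(\<lambda>k. ?c k * ?y ^ k) sums (sj \<nu> z)"
    unfolding sj_def by (rule summable_sums[OF summable_sj[OF nu]])
  have s1: "(\<lambda>k. diffs ?c k * ?y ^ k) sums (\<Sum>k. diffs ?c k * ?y ^ k)"
    by (rule summable_sums[OF summable_diffs_sj])
  have s2: "(\<lambda>k. diffs (diffs ?c) k * ?y ^ k) sums (\<Sum>k. diffs (diffs ?c) k * ?y ^ k)"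
    by (rule summable_sums[OF summable_diffs2_sj])
  have "(\<lambda>k. ?y * (diffs (diffs ?c) k * ?y ^ k)) sums (?y * (\<Sum>k. diffs (diffs ?c) k * ?y ^ k))"
    by (rule sums_mult[OF s2])
  then have "(\<lambda>k. (\<lambda>j. real j * diffs ?c j * ?y ^ j) (Suc k)) sums (?y * (\<Sum>k. diffs (diffs ?c) k * ?y ^ k))"
    by (simp add: diffs_def mult_ac)
  then have s3: "(\<lambda>k. real k * diffs ?c k * ?y ^ k) sums (?y * (\<Sum>k. diffs (diffs ?c) k * ?y ^ k))"
    by (subst (asm) sums_Suc_iff) simp
  have "(\<lambda>k. 4 * (real k * diffs ?c k * ?y ^ k) + 4 * (\<nu> + 1) * (diffs ?c k * ?y ^ k) + ?c k * ?y ^ k) sums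
     (4 * (?y * (\<Sum>k. diffs (diffs ?c) k * ?y ^ k)) + 4 * (\<nu> + 1) * (\<Sum>k. diffs ?c k * ?y ^ k) + sj \<nu> z)"
    by (intro sums_add sums_mult s0 s1 s3)
  moreover have "4 * (real k * diffs ?c k * ?y ^ k) + 4 * (\<nu> + 1) * (diffs ?c k * ?y ^ k) + ?c k * ?y ^ k = 0" for k
  proof -
    have "4 * (real k * diffs ?c k * ?y ^ k) + 4 * (\<nu> + 1) * (diffs ?c k * ?y ^ k) + ?c k * ?y ^ k
      = (4 * real (Suc k) * (real (Suc k) + \<nu>) * ?c (Suc k) + ?c k) * ?y ^ k"
      by (simp add: diffs_def algebra_simps)
    then show ?thesis unfolding sj_coeff_Suc[OF nu] by simp
  qed
  ultimately have "4 * (?y * (\<Sum>k. diffs (diffs ?c) k * ?y ^ k)) + 4 * (\<nu> + 1) * (\<Sum>k. diffs ?c k * ?y ^ k) + sj \<nu> z = 0"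
    by (simp add: sums_iff)
  moreover have "z * sj2 \<nu> z + (2 * \<nu> + 1) * sj1 \<nu> z + z * sj \<nu> z =
     z * (4 * (?y * (\<Sum>k. diffs (diffs ?c) k * ?y ^ k)) + 4 * (\<nu> + 1) * (\<Sum>k. diffs ?c k * ?y ^ k) + sj \<nu> z)"
    by (simp add: sj1_def sj2_def algebra_simps power2_eq_square)
  ultimately show ?thesis by simp
qed

lemma continuous_on_sj [continuous_intros]: "continuous_on S f \<Longrightarrow> continuous_on S (\<lambda>x. sj \<nu> (f x))"
  by (rule continuous_on_compose2[of UNIV "sj \<nu>"])
     (auto intro!: continuous_at_imp_continuous_on DERIV_isCont[OF sj_deriv])

lemma continuous_on_sj1 [continuous_intros]: "continuous_on S f \<Longrightarrow> continuous_on S (\<lambda>x. sj1 \<nu> (f x))"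
  by (rule continuous_on_compose2[of UNIV "sj1 \<nu>"])
     (auto intro!: continuous_at_imp_continuous_on DERIV_isCont[OF sj1_deriv])

text \<open>Liouville normal form: the power removes the first-order term, so \<open>su\<close>
  solves \<open>u'' = - u + (\<nu>\<^sup>2 - 1/4) * u / z\<^sup>2\<close>, a harmonic oscillator
  with a perturbation that is integrable at infinity. \<open>su1\<close> is its derivative.\<close>

definition su :: "real \<Rightarrow> real" where "su z = z powr (\<nu> + 1/2) * sj \<nu> z"
definition su1 :: "real \<Rightarrow> real" where
  "su1 z = z powr (\<nu> + 1/2) * (sj1 \<nu> z + (\<nu> + 1/2) / z * sj \<nu> z)"

lemma su_deriv: "z > 0 \<Longrightarrow> (su has_real_derivative su1 z) (at z)"
proof -
  assume z: "z > 0"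
  have "((\<lambda>z. z powr (\<nu> + 1/2) * sj \<nu> z) has_real_derivative
      ((\<nu> + 1/2) * z powr (\<nu> + 1/2 - 1) * sj \<nu> z + sj1 \<nu> z * z powr (\<nu> + 1/2))) (at z)"
    using z by (intro DERIV_mult has_real_derivative_powr sj_deriv) auto
  moreover have "(\<nu> + 1/2) * z powr (\<nu> + 1/2 - 1) * sj \<nu> z + sj1 \<nu> z * z powr (\<nu> + 1/2) = su1 z"
  proof -
    have pw: "z powr (\<nu> + 1/2 - 1) = z powr (\<nu> + 1/2) / z"
      using z by (simp only: powr_diff powr_one)
    show ?thesis unfolding pw su1_def using z by (simp add: field_simps)
  qed
  ultimately show ?thesis by (simp add: su_def[abs_def])
qed

lemma su1_deriv: "z > 0 \<Longrightarrow> (su1 has_real_derivative (- su z + (\<nu>\<^sup>2 - 1/4) * su z / z\<^sup>2)) (at z)"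
proof -
  assume z: "z > 0"
  let ?m = "\<nu> + 1/2"
  have "((\<lambda>z. z powr ?m * (sj1 \<nu> z + ?m / z * sj \<nu> z)) has_real_derivative
      (?m * z powr (?m - 1) * (sj1 \<nu> z + ?m / z * sj \<nu> z)
       + (sj2 \<nu> z + (?m / z * sj1 \<nu> z + (- ?m / z\<^sup>2) * sj \<nu> z)) * z powr ?m)) (at z)"
    using z by (intro DERIV_mult has_real_derivative_powr)
      (auto intro!: derivative_eq_intros sj_deriv sj1_deriv simp: power2_eq_square field_simps)
  moreover have "?m * z powr (?m - 1) * (sj1 \<nu> z + ?m / z * sj \<nu> z)
       + (sj2 \<nu> z + (?m / z * sj1 \<nu> z + (- ?m / z\<^sup>2) * sj \<nu> z)) * z powr ?m = - su z + (\<nu>\<^sup>2 - 1/4) * su z / z\<^sup>2"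
  proof -
    have e: "sj2 \<nu> z = - sj \<nu> z - 2 * ?m * sj1 \<nu> z / z"
      using sj_ode[of z] z by (simp add: field_simps)
    have pw: "z powr (?m - 1) = z powr ?m / z"
      using z by (simp only: powr_diff powr_one)
    show ?thesis unfolding e su_def pw using z
      by (simp add: field_simps power2_eq_square)
  qed
  ultimately show ?thesis by (simp add: su1_def[abs_def])
qed

text \<open>The oscillator energy \<open>(su z)\<^sup>2 + (su1 z)\<^sup>2\<close> has derivative at
  most \<open>\<bar>\<nu>\<^sup>2 - 1/4\<bar> / z\<^sup>2\<close> times itself. The factor
  \<open>exp (\<bar>\<nu>\<^sup>2 - 1/4\<bar> / z)\<close> absorbs this growth and makes the product
  nonincreasing.\<close>

lemma su_energy_bound:
  "\<exists>D\<ge>0. \<forall>z\<ge>1. (su z)\<^sup>2 + (su1 z)\<^sup>2 \<le> D"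
proof -
  let ?c = "\<nu>\<^sup>2 - 1/4"
  define E where "E z = ((su z)\<^sup>2 + (su1 z)\<^sup>2) * exp (\<bar>?c\<bar> / z)" for z
  have dE: "\<exists>y. (E has_real_derivative y) (at z) \<and> y \<le> 0" if z: "z \<ge> 1" for z
  proof -
    let ?e = "exp (\<bar>?c\<bar> / z)"
    have "(E has_real_derivative ((2 * su z * su1 z + 2 * su1 z * (- su z + ?c * su z / z\<^sup>2)) * ?e
        + ((su z)\<^sup>2 + (su1 z)\<^sup>2) * (?e * (- \<bar>?c\<bar> / z\<^sup>2)))) (at z)"
      unfolding E_def[abs_def] using z
      by (auto intro!: derivative_eq_intros su_deriv su1_deriv simp: power2_eq_square field_simps)
    moreover have "(2 * su z * su1 z + 2 * su1 z * (- su z + ?c * su z / z\<^sup>2)) * ?e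
        + ((su z)\<^sup>2 + (su1 z)\<^sup>2) * (?e * (- \<bar>?c\<bar> / z\<^sup>2))
        = ?e / z\<^sup>2 * (?c * (2 * su z * su1 z) - \<bar>?c\<bar> * ((su z)\<^sup>2 + (su1 z)\<^sup>2))"
      using z by (simp add: field_simps)
    moreover have "?c * (2 * su z * su1 z) \<le> \<bar>?c\<bar> * ((su z)\<^sup>2 + (su1 z)\<^sup>2)"
    proof -
      have "?c * (2 * su z * su1 z) \<le> \<bar>?c\<bar> * \<bar>2 * su z * su1 z\<bar>" by (metis abs_ge_self abs_mult)
      also have "\<bar>2 * su z * su1 z\<bar> \<le> (su z)\<^sup>2 + (su1 z)\<^sup>2"
        using sum_squares_bound[of "\<bar>su z\<bar>" "\<bar>su1 z\<bar>"] by (simp add: abs_mult)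
      finally show ?thesis by (simp add: mult_left_mono)
    qed
    moreover have "?e / z\<^sup>2 \<ge> 0" by simp
    ultimately show ?thesis by (smt (verit) mult_nonneg_nonpos)
  qed
  show ?thesis
  proof (intro exI[of _ "E 1"] conjI allI impI)
    fix z :: real assume z: "1 \<le> z"
    have "(su z)\<^sup>2 + (su1 z)\<^sup>2 \<le> ((su z)\<^sup>2 + (su1 z)\<^sup>2) * exp (\<bar>?c\<bar> / z)"
      using z mult_left_mono[of 1 "exp (\<bar>?c\<bar> / z)" "(su z)\<^sup>2 + (su1 z)\<^sup>2"] by simp
    also have "\<dots> = E z" by (simp add: E_def)
    also have "\<dots> \<le> E 1"
      by (rule DERIV_nonpos_imp_nonincreasing[OF z]) (use dE in auto)
    finally show "(su z)\<^sup>2 + (su1 z)\<^sup>2 \<le> E 1" .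
  qed (simp add: E_def)
qed

text \<open>Variation of constants: the complex amplitude
  \<open>W z = cexp (- z) * (su1 z + \<i> * su z)\<close> would be constant without the
  perturbation, and its actual derivative is of order \<open>1 / z\<^sup>2\<close>. It therefore has
  a limit \<open>w\<close>, approached at rate \<open>1 / z\<close>, and \<open>su z\<close> is the
  imaginary part of \<open>W z * cexp z\<close>.\<close>

lemma su_asymp_aux:
  "\<exists>w::complex. \<exists>D\<ge>0. \<forall>z\<ge>1. \<bar>su z - Im (w * cexp z)\<bar> \<le> D / z"
proof -
  let ?c = "\<nu>\<^sup>2 - 1/4"
  obtain D where D: "D \<ge> 0" "\<And>z. z \<ge> 1 \<Longrightarrow> (su z)\<^sup>2 + (su1 z)\<^sup>2 \<le> D" using su_energy_bound by blast
  have su_le: "\<bar>su z\<bar> \<le> sqrt D" if "z \<ge> 1" for z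
  proof -
    have "(su z)\<^sup>2 \<le> D" using D(2)[OF that] zero_le_power2[of "su1 z"] by linarith
    from real_sqrt_le_mono[OF this] show ?thesis by simp
  qed
  define W where "W z = cexp (- z) * (of_real (su1 z) + \<i> * of_real (su z))" for z
  define W' where "W' z = cexp (- z) * of_real (?c * su z / z\<^sup>2)" for z
  have dW: "(W has_vector_derivative W' z) (at z)" if z: "z > 0" for z
  proof -
    have 1: "((\<lambda>z. cexp (- z)) has_vector_derivative (\<i> * of_real (-1) * cexp (- z))) (at z)"
      by (intro cexp_has_vector_derivative) (auto intro!: derivative_eq_intros)
    have 2: "((\<lambda>z. complex_of_real (su1 z) + \<i> * of_real (su z)) has_vector_derivative
       (of_real (- su z + ?c * su z / z\<^sup>2) + \<i> * of_real (su1 z))) (at z)"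
      using su_deriv[OF z] su1_deriv[OF z]
      by (intro has_vector_derivative_add has_vector_derivative_mult_right has_vector_derivative_of_real) auto
    have "(W has_vector_derivative (cexp (- z) * (of_real (- su z + ?c * su z / z\<^sup>2) + \<i> * of_real (su1 z))
       + (\<i> * of_real (-1) * cexp (- z)) * (of_real (su1 z) + \<i> * of_real (su z)))) (at z)"
      unfolding W_def[abs_def] by (rule has_vector_derivative_mult[OF 1 2])
    moreover have "cexp (- z) * (of_real (- su z + ?c * su z / z\<^sup>2) + \<i> * of_real (su1 z))
       + (\<i> * of_real (-1) * cexp (- z)) * (of_real (su1 z) + \<i> * of_real (su z)) = W' z"
      by (simp add: W'_def algebra_simps)
    ultimately show ?thesis by simp
  qed
  define K where "K = \<bar>?c\<bar> * sqrt D"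
  have K: "K \<ge> 0" using D by (simp add: K_def)
  have bd: "norm (W y - W x) \<le> K / x - K / y" if xy: "1 \<le> x" "x \<le> y" for x y
  proof (cases "x = y")
    case False
    then have "x < y" using xy by simp
    have "norm (W y - W x) \<le> (\<lambda>x. - K / x) y - (\<lambda>x. - K / x) x"
    proof (rule differentiable_bound_general[OF \<open>x < y\<close>, where f' = W' and \<phi>' = "\<lambda>z. K / z\<^sup>2"])
      show "continuous_on {x..y} W"
        by (intro continuous_at_imp_continuous_on ballI has_vector_derivative_continuous[OF dW])
           (use xy in auto)
      show "continuous_on {x..y} (\<lambda>x. - K / x)" using xy by (intro continuous_intros) auto
      fix z assume z: "x < z" "z < y"
      show "(W has_vector_derivative W' z) (at z)" using dW z xy by simp
      show "((\<lambda>x. - K / x) has_vector_derivative K / z\<^sup>2) (at z)"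
        unfolding has_real_derivative_iff_has_vector_derivative[symmetric]
        using z xy by (auto intro!: derivative_eq_intros simp: power2_eq_square)
      have "norm (W' z) = \<bar>?c\<bar> * \<bar>su z\<bar> / z\<^sup>2"
        by (simp only: W'_def norm_mult norm_cexp norm_of_real abs_divide abs_mult) simp
      also have "\<dots> \<le> K / z\<^sup>2" unfolding K_def
        using su_le[of z] z xy by (intro divide_right_mono mult_left_mono) auto
      finally show "norm (W' z) \<le> K / z\<^sup>2" .
    qed
    then show ?thesis by simp
  qed simp
  \<comment> \<open>The limit is formed along the positive integers; \<open>Ww\<close> below
    compares it with every \<open>z \<ge> 1\<close> by letting the upper point in \<open>bd\<close>
    grow.\<close>
  have cau: "Cauchy (\<lambda>n. W (real (Suc n)))"
  proof (rule CauchyI)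
    fix e :: real assume e: "e > 0"
    obtain N :: nat where N: "real N > K / e" using reals_Archimedean2 by blast
    have "norm (W (real (Suc n)) - W (real (Suc m))) < e" if "n \<ge> N" "m \<ge> N" for n m
    proof -
      have *: "norm (W (real (Suc n)) - W (real (Suc m))) < e" if "m \<ge> N" "m \<le> n" for n m
      proof -
        have "norm (W (real (Suc n)) - W (real (Suc m))) \<le> K / real (Suc m) - K / real (Suc n)"
          using bd[of "real (Suc m)" "real (Suc n)"] that by simp
        also have "\<dots> \<le> K / real (Suc m)" using K by simp
        also have "\<dots> < e"
        proof -
          have "K / e < real (Suc m)" using N that by simp
          then show ?thesis using e by (simp add: field_simps)
        qed
        finally show ?thesis .
      qed
      show ?thesis using *[of m n] *[of n m] that by (metis nle_le norm_minus_commute)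
    qed
    then show "\<exists>M. \<forall>m\<ge>M. \<forall>n\<ge>M. norm (W (real (Suc m)) - W (real (Suc n))) < e" by blast
  qed
  then obtain w where w: "(\<lambda>n. W (real (Suc n))) \<longlonglongrightarrow> w" using Cauchy_convergent convergent_def by blast
  have Ww: "norm (w - W z) \<le> K / z" if z: "z \<ge> 1" for z
  proof (rule tendsto_upperbound)
    show "(\<lambda>n. norm (W (real (Suc n)) - W z)) \<longlonglongrightarrow> norm (w - W z)" by (intro tendsto_intros w)
    obtain N :: nat where N: "real N > z" using reals_Archimedean2 by blast
    show "\<forall>\<^sub>F n in sequentially. norm (W (real (Suc n)) - W z) \<le> K / z"
    proof (rule eventually_sequentiallyI[of N])
      fix n assume "N \<le> n"
      then have "norm (W (real (Suc n)) - W z) \<le> K / z - K / real (Suc n)" using N z by (intro bd) auto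
      also have "\<dots> \<le> K / z" using K by simp
      finally show "norm (W (real (Suc n)) - W z) \<le> K / z" .
    qed
  qed simp
  have "\<bar>su z - Im (w * cexp z)\<bar> \<le> K / z" if z: "z \<ge> 1" for z
  proof -
    have "Im (W z * cexp z) = su z"
    proof -
      have "cexp (- z) * cexp z = cexp (- z + z)" by (simp only: cexp_add)
      then have "cexp (- z) * cexp z = 1" by (simp add: cexp_def)
      then have "W z * cexp z = of_real (su1 z) + \<i> * of_real (su z)"
        unfolding W_def by (metis (no_types, lifting) mult.assoc mult.commute mult_1)
      then show ?thesis by simp
    qed
    then have "\<bar>su z - Im (w * cexp z)\<bar> = \<bar>Im ((w - W z) * cexp z)\<bar>"
      by (simp add: left_diff_distrib abs_minus_commute)
    also have "\<dots> \<le> norm ((w - W z) * cexp z)" by (rule abs_Im_le_cmod)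
    also have "\<dots> \<le> K / z" using Ww[OF z] by (simp add: norm_mult)
    finally show ?thesis .
  qed
  with K show ?thesis by blast
qed

text \<open>For \<open>z \<ge> 1\<close> the energy bound is divided by a power that is at least 1;
  on \<open>{0..1}\<close> compactness suffices. The bound on \<open>sj1\<close> serves the boundary
  terms in the integration by parts of \<open>sj_laplacian_sq\<close>.\<close>

lemma sj_bounded: "\<exists>D>0. \<forall>z\<ge>0. \<bar>sj \<nu> z\<bar> \<le> D \<and> \<bar>sj1 \<nu> z\<bar> \<le> D"
proof -
  let ?m = "\<nu> + 1/2"
  obtain D where D: "D \<ge> 0" "\<And>z. z \<ge> 1 \<Longrightarrow> (su z)\<^sup>2 + (su1 z)\<^sup>2 \<le> D" using su_energy_bound by blast
  have c: "compact (sj \<nu> ` {0..1})" "compact (sj1 \<nu> ` {0..1})"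
    by (intro compact_continuous_image continuous_intros compact_Icc)+
  obtain A where "\<forall>x\<in>sj \<nu> ` {0..1}. norm x \<le> A"
    using compact_imp_bounded[OF c(1)] unfolding bounded_iff by blast
  then have A: "\<bar>sj \<nu> z\<bar> \<le> A" if "z \<in> {0..1}" for z using that by auto
  obtain B where "\<forall>x\<in>sj1 \<nu> ` {0..1}. norm x \<le> B"
    using compact_imp_bounded[OF c(2)] unfolding bounded_iff by blast
  then have B: "\<bar>sj1 \<nu> z\<bar> \<le> B" if "z \<in> {0..1}" for z using that by auto
  have big: "\<bar>sj \<nu> z\<bar> \<le> sqrt D" "\<bar>sj1 \<nu> z\<bar> \<le> sqrt D + ?m * sqrt D" if z: "z \<ge> 1" for z
  proof -
    have p: "1 \<le> z powr ?m" using z nu by (intro ge_one_powr_ge_zero) auto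
    have "(su z)\<^sup>2 \<le> D" "(su1 z)\<^sup>2 \<le> D" using D(2)[OF z] zero_le_power2[of "su1 z"] zero_le_power2[of "su z"] by linarith+
    from this[THEN real_sqrt_le_mono] have s: "\<bar>su z\<bar> \<le> sqrt D" "\<bar>su1 z\<bar> \<le> sqrt D" by simp_all
    have "1 * \<bar>sj \<nu> z\<bar> \<le> z powr ?m * \<bar>sj \<nu> z\<bar>" by (intro mult_right_mono p) auto
    with s show 1: "\<bar>sj \<nu> z\<bar> \<le> sqrt D" by (simp add: su_def abs_mult)
    have "1 * \<bar>sj1 \<nu> z + ?m / z * sj \<nu> z\<bar> \<le> z powr ?m * \<bar>sj1 \<nu> z + ?m / z * sj \<nu> z\<bar>"
      by (intro mult_right_mono p) auto
    with s have 2: "\<bar>sj1 \<nu> z + ?m / z * sj \<nu> z\<bar> \<le> sqrt D" by (simp add: su1_def abs_mult)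
    have "\<bar>?m / z * sj \<nu> z\<bar> \<le> ?m * sqrt D"
    proof -
      have "?m / z \<le> ?m / 1" using z nu by (intro divide_left_mono) auto
      then have "\<bar>?m / z\<bar> \<le> ?m" using z nu by simp
      then show ?thesis using 1 nu unfolding abs_mult by (intro mult_mono) auto
    qed
    with 2 show "\<bar>sj1 \<nu> z\<bar> \<le> sqrt D + ?m * sqrt D" by linarith
  qed
  show ?thesis
  proof (intro exI[of _ "1 + \<bar>A\<bar> + \<bar>B\<bar> + sqrt D + ?m * sqrt D"] conjI allI impI)
    have nn: "sqrt D \<ge> 0" "?m * sqrt D \<ge> 0" using D nu by auto
    then show "0 < 1 + \<bar>A\<bar> + \<bar>B\<bar> + sqrt D + ?m * sqrt D" by linarith
    fix z :: real assume z: "0 \<le> z"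
    show "\<bar>sj \<nu> z\<bar> \<le> 1 + \<bar>A\<bar> + \<bar>B\<bar> + sqrt D + ?m * sqrt D"
    proof (cases "z \<le> 1")
      case True then show ?thesis using A[of z] z nn abs_ge_self[of A] abs_ge_zero[of B] by (simp, linarith)
    next
      case False then show ?thesis using big(1)[of z] nn by simp
    qed
    show "\<bar>sj1 \<nu> z\<bar> \<le> 1 + \<bar>A\<bar> + \<bar>B\<bar> + sqrt D + ?m * sqrt D"
    proof (cases "z \<le> 1")
      case True then show ?thesis using B[of z] z nn abs_ge_self[of B] abs_ge_zero[of A] by (simp, linarith)
    next
      case False then show ?thesis using big(2)[of z] nn by simp
    qed
  qed
qed

text \<open>For \<open>z < 1\<close> both terms are merely bounded, which the minimum records. The
  remainder is thus square integrable over the half line, also after rescaling, and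
  \<open>curve_selected_bound\<close> relies on this.\<close>

lemma sj_asymp:
  "\<exists>w::complex. \<exists>D\<ge>0. \<forall>z>0. \<bar>z powr (\<nu> + 1/2) * sj \<nu> z - Im (w * cexp z)\<bar> \<le> D * min 1 (1 / z)"
proof -
  obtain w D where D: "D \<ge> 0" "\<And>z. z \<ge> 1 \<Longrightarrow> \<bar>su z - Im (w * cexp z)\<bar> \<le> D / z"
    using su_asymp_aux by blast
  obtain C where C: "C > 0" "\<And>z. z \<ge> 0 \<Longrightarrow> \<bar>sj \<nu> z\<bar> \<le> C" using sj_bounded by blast
  have "\<bar>su z - Im (w * cexp z)\<bar> \<le> (D + C + norm w) * min 1 (1 / z)" if z: "z > 0" for z
  proof (cases "z \<ge> 1")
    case True
    have "D / z \<le> (D + C + norm w) / z" using z C by (intro divide_right_mono) auto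
    moreover have "(D + C + norm w) * min 1 (1 / z) = (D + C + norm w) / z" using True by (simp add: min_def)
    ultimately show ?thesis using D(2)[OF True] by linarith
  next
    case False
    have "z powr (\<nu> + 1/2) \<le> 1" using False z nu by (intro powr_le1) auto
    then have "\<bar>su z\<bar> \<le> 1 * C" unfolding su_def abs_mult using C z by (intro mult_mono) auto
    moreover have "\<bar>Im (w * cexp z)\<bar> \<le> norm w" using abs_Im_le_cmod[of "w * cexp z"] by (simp add: norm_mult)
    ultimately show ?thesis using False z D by (simp add: min_def field_simps)
  qed
  moreover have "D + C + norm w \<ge> 0" using D C by simp
  ultimately show ?thesis unfolding su_def by blast
qed

end

subsection \<open>The maximal estimate along the curves\<close>

lemma borel_measurable_cnj [measurable]: "cnj \<in> borel_measurable borel"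
  by (intro borel_measurable_continuous_onI continuous_intros)

text \<open>A nonintegrable function has integral 0, and \<open>B\<close> is nonnegative as a bound
  for norms, so the estimate covers that case as well.\<close>

lemma (in finite_measure) norm_integral_le_measure:
  fixes f :: "'a \<Rightarrow> 'b::{banach, second_countable_topology}"
  assumes "\<And>x. norm (f x) \<le> B"
  shows "norm (\<integral>x. f x \<partial>M) \<le> B * measure M (space M)"
proof (cases "integrable M f")
  case True
  have "norm (\<integral>x. f x \<partial>M) \<le> (\<integral>x. norm (f x) \<partial>M)" by simp
  also have "\<dots> \<le> (\<integral>x. B \<partial>M)" using True assms by (intro integral_mono) auto
  finally show ?thesis by (simp add: mult.commute)
next
  case False
  have "B \<ge> 0" using assms[of undefined] norm_ge_zero order_trans by blast
  with False show ?thesis by (simp add: not_integrable_integral_eq)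
qed

lemma (in finite_measure) integrable_bounded:
  fixes f :: "'a \<Rightarrow> 'b::{banach, second_countable_topology}"
  assumes "f \<in> borel_measurable M" "\<And>x. norm (f x) \<le> B"
  shows "integrable M f"
  using assms by (intro integrable_const_bound[where B = B]) auto

text \<open>Let \<open>v\<close> be the image of \<open>k\<close>, and \<open>Q\<close> the image of
  \<open>v\<close> under the adjoint, up to conjugation. The square norm \<open>a\<close> of
  \<open>v\<close> equals the pairing of \<open>k\<close> with \<open>Q\<close>. The square norm
  \<open>b\<close> of \<open>Q\<close> is a double integral of values of \<open>v\<close> against
  the kernel of the composition, at most \<open>A * a\<close> by Schur's test. Together these give
  \<open>a \<le> A * w\<close>. Finite measures and bounded functions justify every use of Fubini;
  \<open>\<kappa>\<close> takes values in \<open>[0, \<infinity>]\<close> so that it may be infinite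
  on the diagonal.\<close>

lemma TT_star_bound:
  fixes E :: "'s \<Rightarrow> 'e \<Rightarrow> complex" and k :: "'e \<Rightarrow> complex" and \<kappa> :: "'s \<Rightarrow> 's \<Rightarrow> ennreal"
  assumes M: "finite_measure M" and P: "finite_measure P"
    and E [measurable]: "(\<lambda>(s, \<eta>). E s \<eta>) \<in> borel_measurable (M \<Otimes>\<^sub>M P)" and E1: "\<And>s \<eta>. norm (E s \<eta>) \<le> 1"
    and k [measurable]: "k \<in> borel_measurable P" and kb: "\<And>\<eta>. norm (k \<eta>) \<le> Bk"
    and \<kappa> [measurable]: "(\<lambda>(s, s'). \<kappa> s s') \<in> borel_measurable (M \<Otimes>\<^sub>M M)"
    and sym: "\<And>s s'. \<kappa> s s' = \<kappa> s' s"
    and kern: "\<And>s s'. s \<in> space M \<Longrightarrow> s' \<in> space M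
        \<Longrightarrow> ennreal (norm (\<integral>\<eta>. E s \<eta> * cnj (E s' \<eta>) \<partial>P)) \<le> \<kappa> s s'"
    and A: "A > 0" "\<And>s. s \<in> space M \<Longrightarrow> (\<integral>\<^sup>+s'. \<kappa> s s' \<partial>M) \<le> ennreal A"
  shows "(\<integral>s. (norm (\<integral>\<eta>. E s \<eta> * k \<eta> \<partial>P))\<^sup>2 \<partial>M)
      \<le> A * (\<integral>\<eta>. (norm (k \<eta>))\<^sup>2 \<partial>P)"
proof -
  interpret M: finite_measure M by (rule M)
  interpret P: finite_measure P by (rule P)
  interpret MP: pair_sigma_finite M P ..
  interpret MM: pair_sigma_finite M M ..
  interpret fMP: finite_measure "M \<Otimes>\<^sub>M P" by (rule finite_measure_pair_measure[OF P M])
  define v where "v s = (\<integral>\<eta>. E s \<eta> * k \<eta> \<partial>P)" for s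
  define Q where "Q \<eta> = (\<integral>s. E s \<eta> * cnj (v s) \<partial>M)" for \<eta>
  have v_meas [measurable]: "v \<in> borel_measurable M" unfolding v_def by measurable
  have Bk: "Bk \<ge> 0" using kb[of undefined] norm_ge_zero order_trans by blast
  define V where "V = Bk * measure P (space P)"
  define W where "W = V * measure M (space M)"
  have vb: "norm (v s) \<le> V" for s unfolding v_def V_def
    by (rule P.norm_integral_le_measure) (use mult_mono[OF E1 kb] in \<open>auto simp: norm_mult\<close>)
  have V: "V \<ge> 0" using vb norm_ge_zero order_trans by blast
  have Q_meas [measurable]: "Q \<in> borel_measurable P"
    unfolding Q_def by measurable
  have Ev: "norm (E s \<eta> * cnj (v s')) \<le> V" for s s' \<eta>
    using mult_mono[OF E1 vb[of s'], of s \<eta>] V by (simp add: norm_mult)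
  have Qb: "norm (Q \<eta>) \<le> W" for \<eta> unfolding Q_def W_def
    by (rule M.norm_integral_le_measure) (rule Ev)
  have W: "W \<ge> 0" using Qb norm_ge_zero order_trans by blast
  define a where "a = (\<integral>s. (norm (v s))\<^sup>2 \<partial>M)"
  define b where "b = (\<integral>\<eta>. (norm (Q \<eta>))\<^sup>2 \<partial>P)"
  define w where "w = (\<integral>\<eta>. (norm (k \<eta>))\<^sup>2 \<partial>P)"
  have iv: "integrable M (\<lambda>s. (norm (v s))\<^sup>2)"
    by (rule M.integrable_bounded[where B = "V\<^sup>2"]) (use vb in \<open>auto intro: power_mono\<close>)
  have iQ: "integrable P (\<lambda>\<eta>. (norm (Q \<eta>))\<^sup>2)"
    by (rule P.integrable_bounded[where B = "W\<^sup>2"]) (use Qb in \<open>auto intro: power_mono\<close>)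
  have ik: "integrable P (\<lambda>\<eta>. (norm (k \<eta>))\<^sup>2)"
    by (rule P.integrable_bounded[where B = "Bk\<^sup>2"]) (use kb in \<open>auto intro: power_mono\<close>)
  have a_eq: "complex_of_real a = (\<integral>\<eta>. k \<eta> * Q \<eta> \<partial>P)"
  proof -
    have "complex_of_real a = (\<integral>s. v s * cnj (v s) \<partial>M)"
      unfolding a_def by (simp only: complex_norm_square[symmetric] integral_complex_of_real)
    also have "\<dots> = (\<integral>s. (\<integral>\<eta>. E s \<eta> * k \<eta> * cnj (v s) \<partial>P) \<partial>M)"
      by (subst v_def) (simp add: integral_mult_left_zero)
    also have "\<dots> = (\<integral>\<eta>. (\<integral>s. E s \<eta> * k \<eta> * cnj (v s) \<partial>M) \<partial>P)"
    proof (rule MP.Fubini_integral[symmetric])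
      show "integrable (M \<Otimes>\<^sub>M P) (\<lambda>(s, \<eta>). E s \<eta> * k \<eta> * cnj (v s))"
        by (rule fMP.integrable_bounded[where B = "V * Bk"])
           (use mult_mono[OF Ev kb] V in \<open>auto simp: norm_mult mult_ac\<close>)
    qed
    also have "\<dots> = (\<integral>\<eta>. k \<eta> * Q \<eta> \<partial>P)"
      unfolding Q_def by (simp only: integral_mult_right_zero[symmetric] mult_ac)
    finally show ?thesis .
  qed
  have b_eq: "complex_of_real b = (\<integral>s. (\<integral>s'. (\<integral>\<eta>. E s \<eta> * cnj (E s' \<eta>) \<partial>P)
      * (cnj (v s) * v s') \<partial>M) \<partial>M)"
  proof -
    have "complex_of_real b = (\<integral>\<eta>. Q \<eta> * cnj (Q \<eta>) \<partial>P)"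
      unfolding b_def by (simp only: complex_norm_square[symmetric] integral_complex_of_real)
    also have "\<dots> = (\<integral>\<eta>. (\<integral>s. E s \<eta> * cnj (v s) * cnj (Q \<eta>) \<partial>M) \<partial>P)"
      by (subst Q_def) (simp add: integral_mult_left_zero)
    also have "\<dots> = (\<integral>s. (\<integral>\<eta>. E s \<eta> * cnj (v s) * cnj (Q \<eta>) \<partial>P) \<partial>M)"
    proof (rule MP.Fubini_integral)
      show "integrable (M \<Otimes>\<^sub>M P) (\<lambda>(s, \<eta>). E s \<eta> * cnj (v s) * cnj (Q \<eta>))"
        by (rule fMP.integrable_bounded[where B = "V * W"])
           (use mult_mono[OF Ev Qb] V in \<open>auto simp: norm_mult mult_ac\<close>)
    qed
    also have "\<dots> = (\<integral>s. (\<integral>s'. (\<integral>\<eta>. E s \<eta> * cnj (E s' \<eta>) \<partial>P) * (cnj (v s) * v s') \<partial>M) \<partial>M)"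
    proof (rule Bochner_Integration.integral_cong[OF refl])
      fix s assume s [simp]: "s \<in> space M"
      have [measurable]: "(\<lambda>\<eta>. E s \<eta>) \<in> borel_measurable P" by measurable
      have "(\<integral>\<eta>. E s \<eta> * cnj (v s) * cnj (Q \<eta>) \<partial>P)
        = (\<integral>\<eta>. (\<integral>s'. E s \<eta> * cnj (v s) * (cnj (E s' \<eta>) * v s') \<partial>M) \<partial>P)"
      proof -
        have "cnj (\<integral>s. E s \<eta> * cnj (v s) \<partial>M) = (\<integral>s'. cnj (E s' \<eta>) * v s' \<partial>M)" for \<eta>
          by (subst Bochner_Integration.integral_cnj[symmetric]) simp
        then show ?thesis unfolding Q_def by simp
      qed
      also have "\<dots> = (\<integral>s'. (\<integral>\<eta>. E s \<eta> * cnj (v s) * (cnj (E s' \<eta>) * v s') \<partial>P) \<partial>M)"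
      proof (rule MP.Fubini_integral)
        show "integrable (M \<Otimes>\<^sub>M P) (\<lambda>(s', \<eta>). E s \<eta> * cnj (v s) * (cnj (E s' \<eta>) * v s'))"
          by (rule fMP.integrable_bounded[where B = "V * V"])
             (use mult_mono[OF Ev Ev] V in \<open>auto simp: norm_mult mult_ac\<close>)
      qed
      also have "\<dots> = (\<integral>s'. (\<integral>\<eta>. E s \<eta> * cnj (E s' \<eta>) \<partial>P) * (cnj (v s) * v s') \<partial>M)"
        by (simp add: mult_ac)
      finally show "(\<integral>\<eta>. E s \<eta> * cnj (v s) * cnj (Q \<eta>) \<partial>P)
        = (\<integral>s'. (\<integral>\<eta>. E s \<eta> * cnj (E s' \<eta>) \<partial>P) * (cnj (v s) * v s') \<partial>M)" .
    qed
    finally show ?thesis .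
  qed
  have nnint: "ennreal (norm (integral\<^sup>L N f)) \<le> (\<integral>\<^sup>+x. ennreal (norm (f x)) \<partial>N)" for N and f :: "_ \<Rightarrow> complex"
  proof (cases "integrable N f")
    case True
    then show ?thesis by (rule integral_norm_bound_ennreal)
  qed (simp add: not_integrable_integral_eq)
  let ?v = "\<lambda>s. ennreal ((norm (v s))\<^sup>2)"
  have b0: "b \<ge> 0" and a0: "a \<ge> 0" and w0: "w \<ge> 0" unfolding a_def b_def w_def by simp_all
  have "ennreal b = ennreal (norm (complex_of_real b))" using b0 by simp
  also have "\<dots> \<le> (\<integral>\<^sup>+s. ennreal (norm (\<integral>s'. (\<integral>\<eta>. E s \<eta> * cnj (E s' \<eta>) \<partial>P)
      * (cnj (v s) * v s') \<partial>M)) \<partial>M)"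
    unfolding b_eq by (rule nnint)
  also have "\<dots> \<le> (\<integral>\<^sup>+s. (\<integral>\<^sup>+s'. ennreal (norm ((\<integral>\<eta>. E s \<eta> * cnj
      (E s' \<eta>) \<partial>P) * (cnj (v s) * v s'))) \<partial>M) \<partial>M)"
    by (intro nn_integral_mono nnint)
  \<comment> \<open>Schur's test: the product of two values of \<open>v\<close> is split into half
    the sum of the squares. By symmetry of \<open>\<kappa>\<close> both halves contribute equally,
    and each is controlled by the marginal integral of \<open>\<kappa>\<close>.\<close>
  also have "\<dots> \<le> (\<integral>\<^sup>+s. (\<integral>\<^sup>+s'. \<kappa> s s' * (?v s * ennreal (1/2))
      + \<kappa> s s' * (?v s' * ennreal (1/2)) \<partial>M) \<partial>M)"
  proof (intro nn_integral_mono)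
    fix s s' assume s: "s \<in> space M" "s' \<in> space M"
    have "norm (cnj (v s) * v s') \<le> (norm (v s))\<^sup>2 * (1/2) + (norm (v s'))\<^sup>2 * (1/2)"
      using sum_squares_bound[of "norm (v s)" "norm (v s')"] by (simp add: norm_mult)
    then have "ennreal (norm (cnj (v s) * v s')) \<le> ?v s * ennreal (1/2) + ?v s' * ennreal (1/2)"
      by (subst ennreal_mult''[symmetric], simp)+ (simp flip: ennreal_plus)
    then have "ennreal (norm (\<integral>\<eta>. E s \<eta> * cnj (E s' \<eta>) \<partial>P)) * ennreal (norm (cnj (v s) * v s'))
       \<le> \<kappa> s s' * (?v s * ennreal (1/2) + ?v s' * ennreal (1/2))"
      using kern[OF s] by (intro mult_mono) auto
    then show "ennreal (norm ((\<integral>\<eta>. E s \<eta> * cnj (E s' \<eta>) \<partial>P) * (cnj (v s) * v s')))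
       \<le> \<kappa> s s' * (?v s * ennreal (1/2)) + \<kappa> s s' * (?v s' * ennreal (1/2))"
      by (simp add: norm_mult ennreal_mult distrib_left)
  qed
  also have "\<dots> = (\<integral>\<^sup>+s. (\<integral>\<^sup>+s'. \<kappa> s s' * (?v s * ennreal (1/2)) \<partial>M)
     + (\<integral>\<^sup>+s'. \<kappa> s s' * (?v s' * ennreal (1/2)) \<partial>M) \<partial>M)"
    by (intro nn_integral_cong nn_integral_add) measurable
  also have "\<dots> = (\<integral>\<^sup>+s. (\<integral>\<^sup>+s'. \<kappa> s s' * (?v s * ennreal (1/2)) \<partial>M) \<partial>M)
     + (\<integral>\<^sup>+s. (\<integral>\<^sup>+s'. \<kappa> s s' * (?v s' * ennreal (1/2)) \<partial>M) \<partial>M)"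
    by (rule nn_integral_add) measurable
  also have "(\<integral>\<^sup>+s. (\<integral>\<^sup>+s'. \<kappa> s s' * (?v s' * ennreal (1/2)) \<partial>M) \<partial>M)
     = (\<integral>\<^sup>+s'. (\<integral>\<^sup>+s. \<kappa> s s' * (?v s' * ennreal (1/2)) \<partial>M) \<partial>M)"
    by (rule MM.Fubini') measurable
  also have "\<dots> = (\<integral>\<^sup>+s. (\<integral>\<^sup>+s'. \<kappa> s s' * (?v s * ennreal (1/2)) \<partial>M) \<partial>M)"
    by (subst sym) (rule refl)
  also have "(\<integral>\<^sup>+s. (\<integral>\<^sup>+s'. \<kappa> s s' * (?v s * ennreal (1/2)) \<partial>M) \<partial>M)
      \<le> (\<integral>\<^sup>+s. ennreal A * (?v s * ennreal (1/2)) \<partial>M)"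
  proof (intro nn_integral_mono)
    fix s assume s [simp]: "s \<in> space M"
    have "(\<integral>\<^sup>+s'. \<kappa> s s' * (?v s * ennreal (1/2)) \<partial>M) = (\<integral>\<^sup>+s'. \<kappa> s s' \<partial>M) * (?v s * ennreal (1/2))"
      by (rule nn_integral_multc) measurable
    also have "\<dots> \<le> ennreal A * (?v s * ennreal (1/2))"
      by (intro mult_right_mono A) auto
    finally show "(\<integral>\<^sup>+s'. \<kappa> s s' * (?v s * ennreal (1/2)) \<partial>M) \<le> ennreal A * (?v s * ennreal (1/2))" .
  qed
  also have "(\<integral>\<^sup>+s. ennreal A * (?v s * ennreal (1/2)) \<partial>M) = ennreal (A * (a * (1/2)))"
  proof -
    have "(\<integral>\<^sup>+s. ?v s \<partial>M) = ennreal a"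
      unfolding a_def by (rule nn_integral_eq_integral[OF iv]) simp
    moreover have "(\<integral>\<^sup>+s. ennreal A * (?v s * ennreal (1/2)) \<partial>M) = ennreal A * ((\<integral>\<^sup>+s. ?v s \<partial>M) * ennreal (1/2))"
      by (subst nn_integral_cmult, measurable) (subst nn_integral_multc, measurable)
    moreover have "ennreal (A * (a * (1/2))) = ennreal A * (ennreal a * ennreal (1/2))"
      using A(1) a0 by (simp only: ennreal_mult[symmetric] mult_nonneg_nonneg less_imp_le zero_le_divide_1_iff zero_le_numeral)
    ultimately show ?thesis by simp
  qed
  finally have "ennreal b \<le> ennreal (A * (a * (1/2))) + ennreal (A * (a * (1/2)))"
    using add_mono by blast
  then have bA: "b \<le> A * a" using A(1) a0 by (simp flip: ennreal_plus)
  have "a = norm (complex_of_real a)" using a0 by simp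
  also have "\<dots> \<le> (\<integral>\<eta>. norm (k \<eta> * Q \<eta>) \<partial>P)" unfolding a_eq by (rule integral_norm_bound)
  \<comment> \<open>Young's inequality, weighted so that the term in \<open>Q\<close> becomes at
    most half of \<open>a\<close> and can be absorbed on the left.\<close>
  also have "\<dots> \<le> (\<integral>\<eta>. (A / 2) * (norm (k \<eta>))\<^sup>2 + (1 / (2 * A)) * (norm (Q \<eta>))\<^sup>2 \<partial>P)"
  proof (rule integral_mono)
    show "integrable P (\<lambda>\<eta>. norm (k \<eta> * Q \<eta>))"
      by (intro integrable_norm P.integrable_bounded[where B = "Bk * W"])
         (use mult_mono[OF kb Qb] Bk in \<open>auto simp: norm_mult\<close>)
    fix \<eta>
    have "0 \<le> (A * norm (k \<eta>) - norm (Q \<eta>))\<^sup>2 / (2 * A)" using A(1) by simp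
    also have "\<dots> = (A / 2) * (norm (k \<eta>))\<^sup>2 + (1 / (2 * A)) * (norm (Q \<eta>))\<^sup>2 - norm (k \<eta> * Q \<eta>)"
      using A(1) by (simp add: norm_mult field_simps power2_eq_square)
    finally show "norm (k \<eta> * Q \<eta>) \<le> (A / 2) * (norm (k \<eta>))\<^sup>2 + (1 / (2 * A)) * (norm (Q \<eta>))\<^sup>2" by simp
  qed (use ik iQ in auto)
  also have "\<dots> = (A / 2) * w + (1 / (2 * A)) * b"
    unfolding w_def b_def using ik iQ by simp
  also have "\<dots> \<le> (A / 2) * w + (1 / (2 * A)) * (A * a)"
    using bA A(1) by (intro add_left_mono mult_left_mono) auto
  also have "\<dots> = (A * w + a) / 2" using A(1) by (simp add: field_simps)
  finally have "a \<le> A * w" by simp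
  then show ?thesis unfolding a_def v_def w_def .
qed


section \<open>The kernel of the composition along the curves\<close>

lemma nn_integral_inverse_sqrt:
  assumes "l \<ge> 0"
  shows "(\<integral>\<^sup>+u. indicator {0..l} u * ennreal (1 / sqrt \<bar>u\<bar>) \<partial>lborel) = ennreal (2 * sqrt l)"
proof -
  have I: "((\<lambda>u. u powr (-1/2)) has_integral (2 * sqrt l)) {0..l}"
    using has_integral_powr_from_0[of "-1/2" l] assms by (simp add: powr_half_sqrt mult.commute)
  have "(\<integral>\<^sup>+u. indicator {0..l} u * ennreal (1 / sqrt \<bar>u\<bar>) \<partial>lborel)
     = (\<integral>\<^sup>+u. ennreal (indicator {0..l} u * (u powr (-1/2))) \<partial>lborel)"
    by (rule nn_integral_cong) (auto simp: indicator_def powr_minus_divide powr_half_sqrt)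
  also have "\<dots> = ennreal (2 * sqrt l)"
    using nn_integral_has_integral_lebesgue[OF _ I] by simp
  finally show ?thesis .
qed

lemma nn_integral_inverse_sqrt_dist:
  assumes "s \<in> {a..b}"
  shows "(\<integral>\<^sup>+s'. indicator {a..b} s' * ennreal (1 / sqrt \<bar>s - s'\<bar>) \<partial>lborel) \<le> ennreal (4 * sqrt (b - a))"
proof -
  let ?l = "b - a" and ?f = "\<lambda>u. indicator {0..b - a} u * ennreal (1 / sqrt \<bar>u\<bar>)"
  have "(\<integral>\<^sup>+s'. indicator {a..b} s' * ennreal (1 / sqrt \<bar>s - s'\<bar>) \<partial>lborel)
     \<le> (\<integral>\<^sup>+s'. ?f (s - s') + ?f (s' - s) \<partial>lborel)"
    using assms by (intro nn_integral_mono) (auto simp: indicator_def abs_minus_commute)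
  also have "\<dots> = (\<integral>\<^sup>+s'. ?f (s - s') \<partial>lborel) + (\<integral>\<^sup>+s'. ?f (s' - s) \<partial>lborel)"
    by (rule nn_integral_add) measurable
  also have "(\<integral>\<^sup>+s'. ?f (s - s') \<partial>lborel) = (\<integral>\<^sup>+u. ?f u \<partial>lborel)"
    using nn_integral_real_affine[of ?f "-1" s] by simp
  also have "(\<integral>\<^sup>+s'. ?f (s' - s) \<partial>lborel) = (\<integral>\<^sup>+u. ?f u \<partial>lborel)"
    using nn_integral_real_affine[of ?f 1 "-s"] by simp
  also have "(\<integral>\<^sup>+u. ?f u \<partial>lborel) = ennreal (2 * sqrt ?l)"
    using assms by (intro nn_integral_inverse_sqrt) auto
  also have "ennreal (2 * sqrt ?l) + ennreal (2 * sqrt ?l) = ennreal (4 * sqrt ?l)"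
    using assms by (simp flip: ennreal_plus)
  finally show ?thesis .
qed

text \<open>The sign \<open>\<sigma>\<close> distinguishes the two exponentials of the Bessel
  asymptotics. If the curve points are at least half as far apart as \<open>s\<close> and
  \<open>s'\<close>, decay in the quadratic coefficient applies; weakening the half to a quarter,
  whose root is rational, gives 104 as twice 52. Otherwise the square roots of the times must
  compensate, so \<open>\<bar>t - t'\<bar>\<close> is at least the square of
  \<open>\<bar>s - s'\<bar> / (2 * C)\<close>, and its fourth root yields
  \<open>22 * sqrt (2 * C)\<close>.\<close>

lemma curve_kernel_bound:
  fixes C L :: real
  assumes C: "C \<ge> 0" and L: "L \<ge> 0" and sg: "\<bar>\<sigma>\<bar> = 1" and ne: "s \<noteq> s'"
  shows "norm (integral {0..L} (\<lambda>\<eta>. cexp (\<sigma> * ((s + C * sqrt \<bar>t\<bar>) - (s' + C * sqrt \<bar>t'\<bar>)) * \<eta>\<^sup>2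
      + (t - t') * \<eta> ^ 4)))
     \<le> (104 + 22 * sqrt (2 * C)) / sqrt \<bar>s - s'\<bar>"
proof -
  let ?d = "\<bar>s - s'\<bar>" and ?z = "(s + C * sqrt \<bar>t\<bar>) - (s' + C * sqrt \<bar>t'\<bar>)"
  let ?x = "\<sigma> * ?z"
  let ?I = "integral {0..L} (\<lambda>\<eta>. cexp (?x * \<eta>\<^sup>2 + (t - t') * \<eta> ^ 4))"
  have d: "?d > 0" using ne by simp
  have ax: "\<bar>?x\<bar> = \<bar>?z\<bar>" using sg by (simp add: abs_mult)
  show ?thesis
  proof (cases "?d / 2 \<le> \<bar>?z\<bar>")
    case True
    have p: "0 < \<bar>?z\<bar>" by (rule less_le_trans[OF _ True]) (use d in simp)
    have "norm ?I \<le> 52 / sqrt \<bar>?z\<bar>"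
      by (rule quartic_osc_x) (use L p ax in auto)
    also have "\<dots> \<le> 52 / sqrt (?d / 4)"
    proof (intro divide_left_mono mult_pos_pos real_sqrt_le_mono)
      show "?d / 4 \<le> \<bar>?z\<bar>" by (rule order_trans[OF _ True]) (use d in simp)
    qed (use d p in auto)
    also have "\<dots> = 104 / sqrt ?d" using d by (simp add: real_sqrt_divide)
    also have "\<dots> \<le> (104 + 22 * sqrt (2 * C)) / sqrt ?d" using C d by (intro divide_right_mono) auto
    finally show ?thesis .
  next
    case False
    let ?e = "\<bar>sqrt \<bar>t\<bar> - sqrt \<bar>t'\<bar>\<bar>"
    have Ce: "?d / 2 < C * ?e"
    proof -
      have "?z = (s - s') + C * (sqrt \<bar>t\<bar> - sqrt \<bar>t'\<bar>)" by (simp add: algebra_simps)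
      then have "?d \<le> \<bar>?z\<bar> + \<bar>C * (sqrt \<bar>t\<bar> - sqrt \<bar>t'\<bar>)\<bar>" by linarith
      then show ?thesis using False C by (simp add: abs_mult)
    qed
    then have Cp: "C > 0" using C d by (cases "C = 0") auto
    have e: "?d / (2 * C) \<le> ?e" using Ce Cp by (simp add: field_simps)
    have tt: "?e\<^sup>2 \<le> \<bar>t - t'\<bar>"
    proof -
      have "?e * ?e \<le> ?e * (sqrt \<bar>t\<bar> + sqrt \<bar>t'\<bar>)"
        by (intro mult_left_mono) (auto simp: abs_le_iff)
      also have "\<dots> = \<bar>(sqrt \<bar>t\<bar> - sqrt \<bar>t'\<bar>) * (sqrt \<bar>t\<bar> + sqrt \<bar>t'\<bar>)\<bar>" by (simp add: abs_mult)
      also have "\<dots> = \<bar>\<bar>t\<bar> - \<bar>t'\<bar>\<bar>" by (simp add: algebra_simps)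
      also have "\<dots> \<le> \<bar>t - t'\<bar>" by (rule abs_triangle_ineq3)
      finally show ?thesis by (simp add: power2_eq_square)
    qed
    define m where "m = root 4 \<bar>t - t'\<bar>"
    have ep: "?e > 0" using e d Cp by (smt (verit) divide_pos_pos mult_pos_pos)
    have tp: "\<bar>t - t'\<bar> > 0" using tt ep by (smt (verit) zero_less_power)
    have m: "m > 0" "\<bar>t - t'\<bar> = m ^ 4" using tp by (auto simp: m_def)
    have "sqrt (?d / (2 * C)) \<le> m"
    proof -
      have "?e\<^sup>2 \<le> (m\<^sup>2)\<^sup>2" using tt m by (simp flip: power_mult)
      then have "?e \<le> m\<^sup>2" by (rule power2_le_imp_le) simp
      then have "?d / (2 * C) \<le> m\<^sup>2" using e by linarith
      then show ?thesis using m by (simp add: real_le_lsqrt)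
    qed
    have "norm ?I \<le> 22 / m" by (rule quartic_osc_t[OF _ L m]) simp
    also have "\<dots> \<le> 22 / sqrt (?d / (2 * C))"
      using \<open>sqrt (?d / (2 * C)) \<le> m\<close> m d Cp by (intro divide_left_mono mult_pos_pos) auto
    also have "\<dots> = 22 * sqrt (2 * C) / sqrt ?d" by (simp add: real_sqrt_divide)
    also have "\<dots> \<le> (104 + 22 * sqrt (2 * C)) / sqrt ?d" using d by (intro divide_right_mono) auto
    finally show ?thesis .
  qed
qed

text \<open>\<open>A\<close> is the kernel constant times a bound for the integral of the inverse
  square root of the distance over \<open>{a..b}\<close>. It depends neither on the selected time
  \<open>t\<close> nor on \<open>L\<close>: the former leads to the maximal estimate, the latter
  permits the frequency cut-off to tend to infinity.\<close>

lemma curve_TT_star: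
  fixes C a b :: real
  assumes C: "C \<ge> 0" and ab: "a < b"
  defines "A \<equiv> (104 + 22 * sqrt (2 * C)) * (4 * sqrt (b - a))"
  assumes t [measurable]: "t \<in> borel_measurable borel" and sg: "\<bar>\<sigma>\<bar> = 1" and L: "L \<ge> 0"
    and k [measurable]: "k \<in> borel_measurable borel" and kb: "\<And>\<eta>. norm (k \<eta>) \<le> Bk"
  shows "(\<integral>s. (norm (\<integral>\<eta>. cexp (\<sigma> * (s + C * sqrt \<bar>t s\<bar>) * \<eta>\<^sup>2 + t s * \<eta> ^ 4) * k \<eta>
       \<partial>restrict_space lborel {0..L}))\<^sup>2 \<partial>restrict_space lborel {a..b})
     \<le> A * (\<integral>\<eta>. (norm (k \<eta>))\<^sup>2 \<partial>restrict_space lborel {0..L})"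
proof -
  let ?M = "restrict_space lborel {a..b}" and ?P = "restrict_space lborel {0..L}"
  let ?K = "104 + 22 * sqrt (2 * C)"
  have fin: "finite_measure (restrict_space lborel {u..v})" for u v :: real
    by (rule finite_measureI) (simp add: space_restrict_space emeasure_restrict_space emeasure_lborel_Icc_eq)
  have Kp: "?K > 0" using C by (simp add: add_pos_nonneg)
  have id: "(\<lambda>x. x) \<in> borel_measurable (restrict_space lborel X)" for X :: "real set"
    by (rule measurable_restrict_space1) simp
  show ?thesis
  \<comment> \<open>On the diagonal the phase vanishes and the kernel grows with \<open>L\<close>,
    so \<open>\<kappa>\<close> is set to infinity there; for each fixed \<open>s\<close> this
    concerns a null set of \<open>s'\<close>.\<close>
  proof (rule TT_star_bound[where \<kappa> = "\<lambda>s s'. if s = s' then \<infinity> else ennreal (?K / sqrt \<bar>s - s'\<bar>)" and Bk = Bk])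
    show "finite_measure ?M" "finite_measure ?P" by (rule fin)+
    show "A > 0" unfolding A_def using Kp ab by simp
    show "(\<lambda>(s, \<eta>). cexp (\<sigma> * (s + C * sqrt \<bar>t s\<bar>) * \<eta>\<^sup>2 + t s * \<eta> ^ 4)) \<in> borel_measurable (?M \<Otimes>\<^sub>M ?P)"
    proof -
      note id[measurable]
      show ?thesis by measurable
    qed
    show "k \<in> borel_measurable ?P" by (rule measurable_restrict_space1) simp
    show "(\<lambda>(s, s'). if s = s' then \<infinity> else ennreal (?K / sqrt \<bar>s - s'\<bar>)) \<in> borel_measurable (?M \<Otimes>\<^sub>M ?M)"
    proof -
      note id[measurable]
      show ?thesis by measurable
    qed
    show "(if s = s' then \<infinity> else ennreal (?K / sqrt \<bar>s - s'\<bar>)) = (if s'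
        = s then \<infinity> else ennreal (?K / sqrt \<bar>s' - s\<bar>))" for s s' :: real
      by (auto simp: abs_minus_commute)
    show "ennreal (norm (\<integral>\<eta>. cexp (\<sigma> * (s + C * sqrt \<bar>t s\<bar>) * \<eta>\<^sup>2 + t s * \<eta> ^ 4) *
          cnj (cexp (\<sigma> * (s' + C * sqrt \<bar>t s'\<bar>) * \<eta>\<^sup>2 + t s' * \<eta> ^ 4)) \<partial>?P))
        \<le> (if s = s' then \<infinity> else ennreal (?K / sqrt \<bar>s - s'\<bar>))" for s s'
    proof (cases "s = s'")
      case False
      let ?p = "\<lambda>\<eta>. \<sigma> * ((s + C * sqrt \<bar>t s\<bar>) - (s' + C * sqrt \<bar>t s'\<bar>)) * \<eta>\<^sup>2 + (t s - t s') * \<eta> ^ 4"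
      have "(\<integral>\<eta>. cexp (\<sigma> * (s + C * sqrt \<bar>t s\<bar>) * \<eta>\<^sup>2 + t s * \<eta> ^ 4) *
          cnj (cexp (\<sigma> * (s' + C * sqrt \<bar>t s'\<bar>) * \<eta>\<^sup>2 + t s' * \<eta> ^ 4)) \<partial>?P)
              = (\<integral>\<eta>. cexp (?p \<eta>) \<partial>?P)"
        by (simp add: cnj_cexp flip: cexp_add) (simp add: algebra_simps)
      also have "\<dots> = (LINT \<eta>:{0..L}|lborel. cexp (?p \<eta>))"
        by (subst integral_restrict_space) (simp_all add: set_lebesgue_integral_def)
      also have "\<dots> = integral {0..L} (\<lambda>\<eta>. cexp (?p \<eta>))"
        by (intro set_borel_integral_eq_integral borel_integrable_atLeastAtMost' continuous_intros)
      finally show ?thesis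
        using curve_kernel_bound[OF C L sg False, of "t s" "t s'"] False by (simp add: ennreal_leI)
    qed simp
    fix s assume "s \<in> space ?M"
    then have s: "s \<in> {a..b}" by (simp add: space_restrict_space)
    have "(\<integral>\<^sup>+s'. (if s = s' then \<infinity> else ennreal (?K / sqrt \<bar>s - s'\<bar>)) \<partial>?M)
      = (\<integral>\<^sup>+s'. ennreal ?K * (indicator {a..b} s' * ennreal (1 / sqrt \<bar>s - s'\<bar>)) \<partial>lborel)"
    proof (subst nn_integral_restrict_space, simp, rule nn_integral_cong_AE)
      show "AE s' in lborel. (if s = s' then \<infinity> else ennreal (?K / sqrt \<bar>s - s'\<bar>)) * indicator {a..b} s'
         = ennreal ?K * (indicator {a..b} s' * ennreal (1 / sqrt \<bar>s - s'\<bar>))"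
        using AE_lborel_singleton[of s]
      proof eventually_elim
        case (elim s')
        have "ennreal (?K / sqrt \<bar>s - s'\<bar>) = ennreal ?K * ennreal (1 / sqrt \<bar>s - s'\<bar>)"
          using Kp by (subst ennreal_mult[symmetric]) auto
        then show ?case using elim by (auto simp: indicator_def)
      qed
    qed
    also have "\<dots> = ennreal ?K * (\<integral>\<^sup>+s'. indicator {a..b} s' * ennreal (1 / sqrt \<bar>s - s'\<bar>) \<partial>lborel)"
      by (rule nn_integral_cmult) measurable
    also have "\<dots> \<le> ennreal ?K * ennreal (4 * sqrt (b - a))"
      by (intro mult_left_mono nn_integral_inverse_sqrt_dist s) auto
    also have "\<dots> = ennreal A" unfolding A_def using Kp ab by (subst ennreal_mult) auto
    finally show "(\<integral>\<^sup>+s'. (if s = s' then \<infinity> else ennreal (?K / sqrt \<bar>s - s'\<bar>)) \<partial>?M) \<le> ennreal A" .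
  qed (use kb in auto)
qed

lemma integral_restrict_Icc:
  fixes f :: "real \<Rightarrow> 'b::euclidean_space"
  assumes "continuous_on {a..b} f"
  shows "integral\<^sup>L (restrict_space lborel {a..b}) f = integral {a..b} f"
proof -
  have "integral\<^sup>L (restrict_space lborel {a..b}) f = (LINT x:{a..b}|lborel. f x)"
    by (subst integral_restrict_space) (simp_all add: set_lebesgue_integral_def)
  also have "\<dots> = integral {a..b} f"
    by (intro set_borel_integral_eq_integral borel_integrable_atLeastAtMost' assms)
  finally show ?thesis .
qed

lemma nn_integral_Icc_continuous:
  fixes f :: "real \<Rightarrow> real"
  assumes "continuous_on {a..b} f" "\<And>x. x \<in> {a..b} \<Longrightarrow> f x \<ge> 0"
  shows "(\<integral>\<^sup>+x\<in>{a..b}. ennreal (f x) \<partial>lborel) = ennreal (integral {a..b} f)"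
proof -
  have "(f has_integral integral {a..b} f) {a..b}"
    using assms(1) by (simp add: integrable_continuous_real integrable_integral)
  from nn_integral_has_integral_lebesgue[OF assms(2) this]
  have "integral\<^sup>N lborel (\<lambda>x. ennreal (indicator {a..b} x * f x)) = ennreal (integral {a..b} f)" by simp
  also have "integral\<^sup>N lborel (\<lambda>x. ennreal (indicator {a..b} x * f x)) = (\<integral>\<^sup>+x\<in>{a..b}. ennreal (f x) \<partial>lborel)"
    by (intro nn_integral_cong) (auto simp: indicator_def)
  finally show ?thesis .
qed

text \<open>In the variable \<open>\<eta>\<close> the amplitude is
  \<open>k \<eta> = 2 * \<eta> * h (\<eta>\<^sup>2)\<close>. In its square, one factor
  \<open>2 * \<eta>\<close> is the Jacobian and the other is \<open>2 * sqrt \<xi>\<close>: this is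
  the origin of the weight and of the 2 in front of \<open>A\<close>. The cut-off at
  \<open>N\<close> provides the finite measure and the bounded amplitude for
  \<open>curve_TT_star\<close>.\<close>

lemma curve_bound_truncated:
  fixes C a b :: real and h :: "real \<Rightarrow> complex"
  assumes C: "C \<ge> 0" and ab: "a < b"
  defines "A \<equiv> (104 + 22 * sqrt (2 * C)) * (4 * sqrt (b - a))"
  assumes t [measurable]: "t \<in> borel_measurable borel" and sg: "\<bar>\<sigma>\<bar> = 1" and N: "N \<ge> 0"
    and h: "continuous_on {0..} h"
  shows "(\<integral>\<^sup>+s\<in>{a..b}. ennreal ((norm (LINT \<xi>:{0..N}|lborel. cexp (\<sigma> * (s + C * sqrt \<bar>t s\<bar>) * \<xi>
      + t s * \<xi>\<^sup>2) * h \<xi>))\<^sup>2) \<partial>lborel)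
     \<le> ennreal (2 * A) * (\<integral>\<^sup>+\<xi>\<in>{0..N}. ennreal (sqrt \<xi> * (norm (h \<xi>))\<^sup>2) \<partial>lborel)"
proof -
  define L where "L = sqrt N"
  have L: "L \<ge> 0" "L\<^sup>2 = N" using N by (auto simp: L_def)
  define k where "k \<eta> = indicator {0..L} \<eta> *\<^sub>R (of_real (2 * \<eta>) * h (\<eta>\<^sup>2))" for \<eta>
  have ch: "continuous_on {0..L} (\<lambda>\<eta>. h (\<eta>\<^sup>2))"
    by (rule continuous_on_compose2[OF h]) (auto intro!: continuous_intros)
  have ck: "continuous_on {0..L} (\<lambda>\<eta>. of_real (2 * \<eta>) * h (\<eta>\<^sup>2))"
    by (intro continuous_intros ch)
  have km [measurable]: "k \<in> borel_measurable borel"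
    unfolding k_def by (rule borel_measurable_continuous_on_indicator[OF _ ck]) simp
  obtain B where B: "\<And>\<eta>. norm (k \<eta>) \<le> B"
  proof -
    have "bounded ((\<lambda>\<eta>. of_real (2 * \<eta>) * h (\<eta>\<^sup>2)) ` {0..L})"
      by (intro compact_imp_bounded compact_continuous_image ck) simp
    then obtain B where "B > 0" "\<forall>z\<in>(\<lambda>\<eta>. of_real (2 * \<eta>) * h (\<eta>\<^sup>2)) ` {0..L}. norm z \<le> B"
      unfolding bounded_pos by blast
    then show ?thesis by (intro that[of B]) (auto simp: k_def indicator_def)
  qed
  have sub: "(\<integral>\<eta>. cexp (\<sigma> * r * \<eta>\<^sup>2 + u * \<eta> ^ 4) * k \<eta> \<partial>restrict_space lborel {0..L})
     = (LINT \<xi>:{0..N}|lborel. cexp (\<sigma> * r * \<xi> + u * \<xi>\<^sup>2) * h \<xi>)" for r u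
  proof -
    have ch': "continuous_on {0..N} (\<lambda>\<xi>. cexp (\<sigma> * r * \<xi> + u * \<xi>\<^sup>2) * h \<xi>)"
      by (intro continuous_intros continuous_on_subset[OF h]) auto
    have "(\<integral>\<eta>. cexp (\<sigma> * r * \<eta>\<^sup>2 + u * \<eta> ^ 4) * k \<eta> \<partial>restrict_space lborel {0..L})
      = (\<integral>\<eta>. (2 * \<eta>) *\<^sub>R (cexp (\<sigma> * r * \<eta>\<^sup>2
          + u * (\<eta>\<^sup>2)\<^sup>2) * h (\<eta>\<^sup>2)) \<partial>restrict_space lborel {0..L})"
      by (rule Bochner_Integration.integral_cong)
         (auto simp: k_def space_restrict_space scaleR_conv_of_real simp flip: power_mult)
    also have "\<dots> = integral {0..L} (\<lambda>\<eta>. (2 * \<eta>) *\<^sub>R (cexp (\<sigma> * r * \<eta>\<^sup>2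
        + u * (\<eta>\<^sup>2)\<^sup>2) * h (\<eta>\<^sup>2)))"
      by (intro integral_restrict_Icc continuous_intros ch)
    also have "\<dots> = integral {0\<^sup>2..L\<^sup>2} (\<lambda>\<xi>. cexp (\<sigma> * r * \<xi> + u * \<xi>\<^sup>2) * h \<xi>)"
      by (intro integral_unique has_integral_substitution[where c = 0 and d = N] ch')
         (use L in \<open>auto intro!: derivative_eq_intros power_mono simp flip: L(2)\<close>)
    also have "\<dots> = (LINT \<xi>:{0..N}|lborel. cexp (\<sigma> * r * \<xi> + u * \<xi>\<^sup>2) * h \<xi>)"
      unfolding L(2) by (simp add: set_borel_integral_eq_integral(2)[OF borel_integrable_atLeastAtMost'[OF ch']])
    finally show ?thesis .
  qed
  have rhs: "(\<integral>\<eta>. (norm (k \<eta>))\<^sup>2 \<partial>restrict_space lborel {0..L})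
      = 2 * integral {0..N} (\<lambda>\<xi>. sqrt \<xi> * (norm (h \<xi>))\<^sup>2)"
  proof -
    have cf: "continuous_on {0..N} (\<lambda>\<xi>. 2 * (sqrt \<xi> * (norm (h \<xi>))\<^sup>2))"
      by (intro continuous_intros continuous_on_subset[OF h]) auto
    have "(\<integral>\<eta>. (norm (k \<eta>))\<^sup>2 \<partial>restrict_space lborel {0..L})
      = (\<integral>\<eta>. (2 * \<eta>) *\<^sub>R (2 * (sqrt (\<eta>\<^sup>2) * (norm (h (\<eta>\<^sup>2)))\<^sup>2)) \<partial>restrict_space lborel {0..L})"
      by (rule Bochner_Integration.integral_cong)
         (auto simp: k_def space_restrict_space norm_mult power_mult_distrib power2_eq_square)
    also have "\<dots> = integral {0..L} (\<lambda>\<eta>. (2 * \<eta>) *\<^sub>R (2 * (sqrt (\<eta>\<^sup>2) * (norm (h (\<eta>\<^sup>2)))\<^sup>2)))"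
      by (intro integral_restrict_Icc continuous_intros ch)
    also have "\<dots> = integral {0\<^sup>2..L\<^sup>2} (\<lambda>\<xi>. 2 * (sqrt \<xi> * (norm (h \<xi>))\<^sup>2))"
      by (intro integral_unique has_integral_substitution[where c = 0 and d = N] cf)
         (use L in \<open>auto intro!: derivative_eq_intros power_mono simp flip: L(2)\<close>)
    also have "\<dots> = 2 * integral {0..N} (\<lambda>\<xi>. sqrt \<xi> * (norm (h \<xi>))\<^sup>2)"
      unfolding L(2) by simp
    finally show ?thesis .
  qed
  let ?F = "\<lambda>s. (norm (LINT \<xi>:{0..N}|lborel. cexp (\<sigma> * (s + C * sqrt \<bar>t s\<bar>) * \<xi> + t s * \<xi>\<^sup>2) * h \<xi>))\<^sup>2"
  let ?R = "integral {0..N} (\<lambda>\<xi>. sqrt \<xi> * (norm (h \<xi>))\<^sup>2)"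
  have main: "(\<integral>s. ?F s \<partial>restrict_space lborel {a..b}) \<le> A * (2 * ?R)"
    using curve_TT_star[OF C ab t sg L(1) km B] unfolding A_def[symmetric] sub rhs .
  interpret P: finite_measure "restrict_space lborel {a..b}"
    by (rule finite_measureI) (simp add: space_restrict_space emeasure_restrict_space emeasure_lborel_Icc_eq)
  interpret Q: finite_measure "restrict_space lborel {0..L}"
    by (rule finite_measureI) (simp add: space_restrict_space emeasure_restrict_space emeasure_lborel_Icc_eq)
  have hm [measurable]: "(\<lambda>\<xi>. indicator {0..N} \<xi> *\<^sub>R h \<xi>) \<in> borel_measurable borel"
    by (rule borel_measurable_continuous_on_indicator) (auto intro: continuous_on_subset[OF h])
  have Fm: "?F \<in> borel_measurable borel"
  proof -
    have "(\<lambda>s. (norm (\<integral>\<xi>. cexp (\<sigma> * (s + C * sqrt \<bar>t s\<bar>) * \<xi>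
        + t s * \<xi>\<^sup>2) * (indicator {0..N} \<xi> *\<^sub>R h \<xi>) \<partial>lborel))\<^sup>2) \<in> borel_measurable borel"
      by measurable
    then show ?thesis by (simp add: set_lebesgue_integral_def)
  qed
  have Fb: "norm (?F s) \<le> (B * measure (restrict_space lborel {0..L}) (space (restrict_space lborel {0..L})))\<^sup>2" for s
  proof -
    have "norm (LINT \<xi>:{0..N}|lborel. cexp (\<sigma> * (s + C * sqrt \<bar>t s\<bar>) * \<xi> + t s * \<xi>\<^sup>2) * h \<xi>)
      \<le> B * measure (restrict_space lborel {0..L}) (space (restrict_space lborel {0..L}))"
      unfolding sub[symmetric] by (rule Q.norm_integral_le_measure) (use B in \<open>auto simp: norm_mult\<close>)
    from power_mono[OF this norm_ge_zero, of 2] show ?thesis by simp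
  qed
  have iF: "integrable (restrict_space lborel {a..b}) ?F"
    by (rule P.integrable_bounded[OF measurable_restrict_space1 Fb]) (use Fm in simp)
  have "(\<integral>\<^sup>+s\<in>{a..b}. ennreal (?F s) \<partial>lborel) = (\<integral>\<^sup>+s. ennreal (?F s) \<partial>restrict_space lborel {a..b})"
    by (subst nn_integral_restrict_space) auto
  also have "\<dots> = ennreal (\<integral>s. ?F s \<partial>restrict_space lborel {a..b})"
    by (rule nn_integral_eq_integral[OF iF]) simp
  also have "\<dots> \<le> ennreal (A * (2 * ?R))" by (rule ennreal_leI[OF main])
  also have "\<dots> = ennreal (2 * A) * ennreal ?R"
  proof -
    have "A \<ge> 0" using C ab unfolding A_def by simp
    moreover have "?R \<ge> 0" by (intro integral_nonneg integrable_continuous_real continuous_intros continuous_on_subset[OF h]) auto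
    ultimately show ?thesis by (subst ennreal_mult[symmetric]) (simp_all add: mult_ac)
  qed
  also have "ennreal ?R = (\<integral>\<^sup>+\<xi>\<in>{0..N}. ennreal (sqrt \<xi> * (norm (h \<xi>))\<^sup>2) \<partial>lborel)"
    by (rule nn_integral_Icc_continuous[symmetric]) (auto intro!: continuous_intros continuous_on_subset[OF h])
  finally show ?thesis .
qed

text \<open>The constant of the truncated estimate does not involve \<open>N\<close>. For fixed
  \<open>s\<close> the truncated integrals converge by dominated convergence, and Fatou's lemma
  carries the estimate to the limit.\<close>

lemma curve_bound:
  fixes C a b :: real and h :: "real \<Rightarrow> complex"
  assumes C: "C \<ge> 0" and ab: "a < b"
  defines "A \<equiv> (104 + 22 * sqrt (2 * C)) * (4 * sqrt (b - a))"
  assumes t [measurable]: "t \<in> borel_measurable borel" and sg: "\<bar>\<sigma>\<bar> = 1"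
    and h: "continuous_on {0..} h" and hi: "set_integrable lborel {0..} h"
  shows "(\<integral>\<^sup>+s\<in>{a..b}. ennreal ((norm (LINT \<xi>:{0..}|lborel. cexp (\<sigma> * (s + C * sqrt \<bar>t s\<bar>) * \<xi>
      + t s * \<xi>\<^sup>2) * h \<xi>))\<^sup>2) \<partial>lborel)
     \<le> ennreal (2 * A) * (\<integral>\<^sup>+\<xi>\<in>{0..}. ennreal (sqrt \<xi> * (norm (h \<xi>))\<^sup>2) \<partial>lborel)"
proof -
  let ?T = "\<lambda>X s. LINT \<xi>:X|lborel. cexp (\<sigma> * (s + C * sqrt \<bar>t s\<bar>) * \<xi> + t s * \<xi>\<^sup>2) * h \<xi>"
  let ?R = "ennreal (2 * A) * (\<integral>\<^sup>+\<xi>\<in>{0..}. ennreal (sqrt \<xi> * (norm (h \<xi>))\<^sup>2) \<partial>lborel)"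
  have hm [measurable]: "(\<lambda>\<xi>. indicator X \<xi> *\<^sub>R h \<xi>) \<in> borel_measurable borel" if "X \<subseteq> {0..}" "X \<in> sets borel" for X
    by (rule borel_measurable_continuous_on_indicator) (use that in \<open>auto intro: continuous_on_subset[OF h]\<close>)
  have lim: "(\<lambda>N::nat. ?T {0..real N} s) \<longlonglongrightarrow> ?T {0..} s" for s
    unfolding set_lebesgue_integral_def
  proof (rule integral_dominated_convergence[where w = "\<lambda>\<xi>. norm (indicator {0..} \<xi> *\<^sub>R h \<xi>)"])
    have eq: "(\<lambda>\<xi>. indicator X \<xi> *\<^sub>R (cexp (\<sigma> * (s + C * sqrt \<bar>t s\<bar>) * \<xi> + t s * \<xi>\<^sup>2) * h \<xi>))
       = (\<lambda>\<xi>. cexp (\<sigma> * (s + C * sqrt \<bar>t s\<bar>) * \<xi> + t s * \<xi>\<^sup>2) * (indicator X \<xi> *\<^sub>R h \<xi>))" for X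
      by (auto simp: indicator_def)
    have m: "(\<lambda>\<xi>. indicator X \<xi> *\<^sub>R (cexp (\<sigma> * (s + C * sqrt \<bar>t s\<bar>) * \<xi>
        + t s * \<xi>\<^sup>2) * h \<xi>)) \<in> borel_measurable lborel"
      if "X \<subseteq> {0..}" "X \<in> sets borel" for X
    proof -
      note hm[OF that, measurable]
      show ?thesis unfolding eq by measurable
    qed
    show "(\<lambda>\<xi>. indicator {0..} \<xi> *\<^sub>R (cexp (\<sigma> * (s + C * sqrt \<bar>t s\<bar>) * \<xi>
        + t s * \<xi>\<^sup>2) * h \<xi>)) \<in> borel_measurable lborel"
      "(\<lambda>\<xi>. indicator {0..real N} \<xi> *\<^sub>R (cexp (\<sigma> * (s + C * sqrt \<bar>t s\<bar>) * \<xi>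
          + t s * \<xi>\<^sup>2) * h \<xi>)) \<in> borel_measurable lborel" for N
      by (rule m; auto)+
    show "integrable lborel (\<lambda>\<xi>. norm (indicator {0..} \<xi> *\<^sub>R h \<xi>))"
      using hi unfolding set_integrable_def by (rule integrable_norm)
    show "AE \<xi> in lborel. (\<lambda>N. indicator {0..real N} \<xi> *\<^sub>R (cexp (\<sigma> * (s + C * sqrt \<bar>t s\<bar>) * \<xi>
        + t s * \<xi>\<^sup>2) * h \<xi>))
       \<longlonglongrightarrow> indicator {0..} \<xi> *\<^sub>R (cexp (\<sigma> * (s + C * sqrt \<bar>t s\<bar>) * \<xi> + t s * \<xi>\<^sup>2) * h \<xi>)"
    proof (rule AE_I2)
      fix \<xi> :: real
      obtain M :: nat where M: "\<xi> \<le> real M" using real_arch_simple by blast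
      show "(\<lambda>N. indicator {0..real N} \<xi> *\<^sub>R (cexp (\<sigma> * (s + C * sqrt \<bar>t s\<bar>) * \<xi> + t s * \<xi>\<^sup>2) * h \<xi>))
       \<longlonglongrightarrow> indicator {0..} \<xi> *\<^sub>R (cexp (\<sigma> * (s + C * sqrt \<bar>t s\<bar>) * \<xi> + t s * \<xi>\<^sup>2) * h \<xi>)"
        by (rule tendsto_eventually, rule eventually_sequentiallyI[of M]) (use M in \<open>auto simp: indicator_def\<close>)
    qed
    show "AE \<xi> in lborel. norm (indicator {0..real N} \<xi> *\<^sub>R (cexp (\<sigma> * (s + C * sqrt \<bar>t s\<bar>) * \<xi> + t s * \<xi>\<^sup>2) * h \<xi>))
       \<le> norm (indicator {0..} \<xi> *\<^sub>R h \<xi>)" for N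
      by (rule AE_I2) (auto simp: indicator_def norm_mult)
  qed
  have Tm: "(\<lambda>s. ennreal ((norm (?T {0..real N} s))\<^sup>2) * indicator {a..b} s) \<in> borel_measurable lborel" for N
  proof -
    note hm[of "{0..real N}", measurable]
    have "(\<lambda>s. \<integral>\<xi>. cexp (\<sigma> * (s + C * sqrt \<bar>t s\<bar>) * \<xi>
        + t s * \<xi>\<^sup>2) * (indicator {0..real N} \<xi> *\<^sub>R h \<xi>) \<partial>lborel) \<in> borel_measurable borel"
      by measurable
    then have [measurable]: "?T {0..real N} \<in> borel_measurable borel" by (simp add: set_lebesgue_integral_def)
    show ?thesis by measurable
  qed
  have "(\<integral>\<^sup>+s\<in>{a..b}. ennreal ((norm (?T {0..} s))\<^sup>2) \<partial>lborel)
     = (\<integral>\<^sup>+s. liminf (\<lambda>N::nat. ennreal ((norm (?T {0..real N} s))\<^sup>2) * indicator {a..b} s) \<partial>lborel)"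
  proof (rule nn_integral_cong)
    fix s
    have "(\<lambda>N::nat. ennreal ((norm (?T {0..real N} s))\<^sup>2) * indicator {a..b} s) \<longlonglongrightarrow> ennreal ((norm
        (?T {0..} s))\<^sup>2) * indicator {a..b} s"
      by (cases "s \<in> {a..b}") (auto intro!: tendsto_intros tendsto_ennrealI lim)
    then show "ennreal ((norm (?T {0..} s))\<^sup>2) * indicator {a..b} s = liminf (\<lambda>N::nat. ennreal ((norm (?T {0..real N} s))\<^sup>2) * indicator {a..b} s)"
      by (simp add: lim_imp_Liminf)
  qed
  also have "\<dots> \<le> liminf (\<lambda>N::nat. \<integral>\<^sup>+s. ennreal ((norm (?T {0..real N} s))\<^sup>2) * indicator {a..b} s \<partial>lborel)"
    by (rule nn_integral_liminf) (rule Tm)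
  also have "\<dots> \<le> liminf (\<lambda>N::nat. ?R)"
  proof (rule Liminf_mono, rule always_eventually, rule allI)
    fix N :: nat
    have "(\<integral>\<^sup>+s. ennreal ((norm (?T {0..real N} s))\<^sup>2) * indicator {a..b} s \<partial>lborel)
      \<le> ennreal (2 * A) * (\<integral>\<^sup>+\<xi>\<in>{0..real N}. ennreal (sqrt \<xi> * (norm (h \<xi>))\<^sup>2) \<partial>lborel)"
      unfolding A_def by (rule curve_bound_truncated[OF C ab t sg _ h]) simp
    also have "\<dots> \<le> ?R"
      by (intro mult_left_mono nn_integral_mono) (auto simp: indicator_def)
    finally show "(\<integral>\<^sup>+s. ennreal ((norm (?T {0..real N} s))\<^sup>2) * indicator {a..b} s \<partial>lborel) \<le> ?R" .
  qed
  also have "\<dots> = ?R" by (simp add: Liminf_const)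
  finally show ?thesis .
qed

text \<open>Continuity and decay without derivatives: such functions are only integrated against
  polynomially bounded kernels. Both the restriction of a radial Schwartz function to a line and its
  transform belong to this class.\<close>

definition rapid :: "(real \<Rightarrow> complex) \<Rightarrow> bool" where
  "rapid g \<longleftrightarrow> continuous_on UNIV g \<and> (\<forall>N::nat. \<exists>C. \<forall>x. (1 + \<bar>x\<bar>) ^ N * norm (g x) \<le> C)"

lemma rapid_measurable: "rapid g \<Longrightarrow> g \<in> borel_measurable borel"
  by (auto simp: rapid_def intro: borel_measurable_continuous_onI)

lemma integrable_inverse_1_plus_square: "integrable lborel (\<lambda>x::real. 1 / (1 + x\<^sup>2))"
proof -
  let ?f = "\<lambda>x::real. 1 / (1 + x\<^sup>2)" and ?g = "\<lambda>x::real. indicator {0..} x * (1 / (1 + x\<^sup>2))"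
  have pos: "1 + x\<^sup>2 > 0" for x :: real by (simp add: add_pos_nonneg)
  have "(\<integral>\<^sup>+x. ennreal (?f x) * indicator {0..} x \<partial>lborel) = ennreal (pi / 2 - arctan 0)"
  proof (rule nn_integral_FTC_atLeast)
    show "(arctan has_real_derivative ?f x) (at x)" for x
      using DERIV_arctan[of x] by (simp add: inverse_eq_divide)
    show "0 \<le> ?f x" for x using pos[of x] by simp
  qed (auto intro!: tendsto_arctan_at_top)
  then have "(\<integral>\<^sup>+x. ennreal (norm (?g x)) \<partial>lborel) < \<infinity>"
    using pos by (subst nn_integral_cong[where v = "\<lambda>x. ennreal (?f x) * indicator {0..} x"]) (auto simp: indicator_def less_imp_le)
  then have g: "integrable lborel ?g" by (intro integrableI_bounded) auto
  have "integrable lborel (\<lambda>x. ?g x + ?g (0 + (-1) * x))"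
    by (intro Bochner_Integration.integrable_add g lborel_integrable_real_affine) simp
  then show ?thesis
    by (rule Bochner_Integration.integrable_bound) (use pos in \<open>auto intro!: AE_I2 simp: indicator_def\<close>)
qed

lemma rapid_integrable:
  assumes g: "rapid g" and p [measurable]: "p \<in> borel_measurable borel"
    and pb: "\<And>x. norm (p x) \<le> K * (1 + \<bar>x\<bar>) ^ N"
  shows "integrable lborel (\<lambda>x. p x * g x)"
proof -
  note rapid_measurable[OF g, measurable]
  \<comment> \<open>Two powers beyond the growth of \<open>p\<close> leave the integrable majorant
    \<open>1 / (1 + x\<^sup>2)\<close>.\<close>
  obtain C where C: "\<And>x. (1 + \<bar>x\<bar>) ^ (N + 2) * norm (g x) \<le> C" using g unfolding rapid_def by blast
  have K: "K \<ge> 0" using order_trans[OF norm_ge_zero pb[of 0]] by simp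
  show ?thesis
  proof (rule Bochner_Integration.integrable_bound)
    show "integrable lborel (\<lambda>x::real. K * C * (1 / (1 + x\<^sup>2)))"
      by (rule integrable_mult_right[OF integrable_inverse_1_plus_square])
    show "AE x in lborel. norm (p x * g x) \<le> norm (K * C * (1 / (1 + x\<^sup>2)))"
    proof (rule AE_I2)
      fix x :: real
      have sq: "1 + x\<^sup>2 \<le> (1 + \<bar>x\<bar>)\<^sup>2" by (simp add: power2_eq_square algebra_simps)
      have pos: "1 + x\<^sup>2 > 0" by (simp add: add_pos_nonneg)
      have "norm (p x) * norm (g x) * (1 + x\<^sup>2) \<le> (K * (1 + \<bar>x\<bar>) ^ N) * norm (g x) * (1 + \<bar>x\<bar>)\<^sup>2"
        using pb sq K pos by (intro mult_mono) auto
      also have "\<dots> = K * ((1 + \<bar>x\<bar>) ^ (N + 2) * norm (g x))" by (simp add: power_add power2_eq_square)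
      also have "\<dots> \<le> K * C" by (rule mult_left_mono[OF C K])
      finally have "norm (p x * g x) \<le> K * C / (1 + x\<^sup>2)" using pos by (simp add: field_simps norm_mult)
      also have "\<dots> \<le> norm (K * C * (1 / (1 + x\<^sup>2)))" by (simp only: real_norm_def times_divide_eq_right mult_1_right abs_ge_self)
      finally show "norm (p x * g x) \<le> norm (K * C * (1 / (1 + x\<^sup>2)))" .
    qed
  qed measurable
qed

text \<open>
  Up to the inversion constant, \<open>spec_prop n g t r\<close> is the Schroedinger propagation, at time \<open>t\<close>
  and radius \<open>r\<close>, of the function with spherical transform \<open>g\<close>.
\<close>

definition spec_prop :: "nat \<Rightarrow> (real \<Rightarrow> complex) \<Rightarrow> real \<Rightarrow> real \<Rightarrow> complex" where
  "spec_prop n g t r = (LINT \<xi>:{0..}|lborel.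
     of_real (sj ((real n - 2) / 2) (\<xi> * r)) * cexp (t * \<xi>\<^sup>2) * g \<xi> * of_real (\<xi> ^ (n - 1)))"

lemma curve_integral_measurable:
  assumes t [measurable]: "t \<in> borel_measurable borel" and h: "continuous_on {0..} h"
  shows "(\<lambda>s. LINT \<xi>:{0..}|lborel. cexp (\<sigma> * (s + C * sqrt \<bar>t s\<bar>) * \<xi> + t s * \<xi>\<^sup>2) * h \<xi>) \<in> borel_measurable borel"
proof -
  have [measurable]: "(\<lambda>\<xi>. indicator {0..} \<xi> *\<^sub>R h \<xi>) \<in> borel_measurable borel"
    by (rule borel_measurable_continuous_on_indicator[OF _ h]) simp
  have "(\<lambda>s. \<integral>\<xi>. cexp (\<sigma> * (s + C * sqrt \<bar>t s\<bar>) * \<xi>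
      + t s * \<xi>\<^sup>2) * (indicator {0..} \<xi> *\<^sub>R h \<xi>) \<partial>lborel) \<in> borel_measurable borel"
    by measurable
  then show ?thesis by (simp add: set_lebesgue_integral_def)
qed

lemma of_real_Im_cexp: "of_real (Im (w * cexp x)) = w / (2 * \<i>) * cexp x - cnj w / (2 * \<i>) * cexp (- x)"
proof -
  have "of_real (Im z) = z / (2 * \<i>) - cnj z / (2 * \<i>)" for z
    by (simp add: complex_eq_iff Re_divide Im_divide)
  from this[of "w * cexp x"] show ?thesis by (simp only: complex_cnj_mult cnj_cexp times_divide_eq_left)
qed

text \<open>With \<open>m = (n - 1) / 2\<close> the weight \<open>\<xi> ^ (n - 1)\<close> is split
  into two factors \<open>\<xi> powr m\<close>. One, together with \<open>r powr m\<close>,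
  completes the kernel to the oscillating function of \<open>sj_asymp\<close>; the other goes into
  \<open>h\<close>. The main term consists of two exponential integrals, treated by
  \<open>curve_bound\<close>. The remainder is at most \<open>D * q \<xi>\<close> with
  \<open>q\<close> square integrable, so Cauchy-Schwarz bounds it by the L2 norm of
  \<open>h\<close>, which is the 1 in \<open>1 + sqrt \<xi>\<close>. Since \<open>C \<ge> 0\<close>,
  the radius on the curve is never below \<open>a\<close>.\<close>

lemma curve_selected_bound:
  fixes C a b :: real and n :: nat
  assumes n: "n \<ge> 2" and C: "C \<ge> 0" and ab: "0 < a" "a < b"
  shows "\<exists>K\<ge>0. \<forall>g t. rapid g \<longrightarrow> t \<in> borel_measurable borel \<longrightarrow>
     (\<integral>\<^sup>+s\<in>{a..b}. ennreal ((norm (spec_prop n g (t s) (s + C * sqrt \<bar>t s\<bar>)))\<^sup>2) \<partial>lborel)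
     \<le> ennreal K * (\<integral>\<^sup>+\<xi>\<in>{0..}. ennreal ((1 + sqrt \<xi>) * (norm (g \<xi>))\<^sup>2 * \<xi> ^ (n - 1)) \<partial>lborel)"
proof -
  define \<nu> where "\<nu> = (real n - 2) / 2"
  define m where "m = \<nu> + 1/2"
  have nu: "\<nu> \<ge> 0" using n by (simp add: \<nu>_def)
  have m0: "m > 0" and m2: "m + m = real (n - 1)" using n by (auto simp: m_def \<nu>_def of_nat_diff field_simps)
  obtain w D where D: "D \<ge> 0" "\<And>z. z > 0 \<Longrightarrow> \<bar>z powr m * sj \<nu> z - Im (w * cexp z)\<bar> \<le> D * min 1 (1 / z)"
    using sj_asymp[OF nu] unfolding m_def by blast
  \<comment> \<open>A majorant of \<open>min 1 (1 / (\<xi> * r))\<close> for all radii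
    \<open>r \<ge> a\<close> at once, hence independent of \<open>s\<close> and of the selected
    time.\<close>
  define q where "q \<xi> = (if \<xi> \<le> 0 then 1 else min 1 (1 / (a * \<xi>)))" for \<xi> :: real
  define Ka where "Ka = 2 * (1 + 1 / a\<^sup>2) * (\<integral>\<xi>. 1 / (1 + \<xi>\<^sup>2) \<partial>lborel)"
  have Ka0: "Ka \<ge> 0" unfolding Ka_def by (intro mult_nonneg_nonneg integral_nonneg_AE AE_I2) (auto intro: add_nonneg_nonneg)
  have qm [measurable]: "q \<in> borel_measurable borel" unfolding q_def by measurable
  have q2: "(\<integral>\<^sup>+\<xi>\<in>{0..}. ennreal ((q \<xi>)\<^sup>2) \<partial>lborel) \<le> ennreal Ka"
  proof -
    have "(\<integral>\<^sup>+\<xi>\<in>{0..}. ennreal ((q \<xi>)\<^sup>2) \<partial>lborel)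
        \<le> (\<integral>\<^sup>+\<xi>. ennreal (2 * (1 + 1 / a\<^sup>2) * (1 / (1 + \<xi>\<^sup>2))) \<partial>lborel)"
    proof (rule nn_integral_mono)
      fix \<xi> :: real
      have "(q \<xi>)\<^sup>2 \<le> 2 * (1 + 1 / a\<^sup>2) * (1 / (1 + \<xi>\<^sup>2))" if x: "\<xi> \<ge> 0"
      proof -
        have pos: "1 + \<xi>\<^sup>2 > 0" by (simp add: add_pos_nonneg)
        have q1: "(q \<xi>)\<^sup>2 \<le> 1" using x ab by (auto simp: q_def power_le_one)
        have "(q \<xi>)\<^sup>2 * \<xi>\<^sup>2 \<le> 1 / a\<^sup>2"
        proof (cases "\<xi> = 0")
          case False
          then have "q \<xi> * \<xi> \<le> (1 / (a * \<xi>)) * \<xi>" using x by (intro mult_right_mono) (auto simp: q_def)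
          then have "q \<xi> * \<xi> \<le> 1 / a" using False by simp
          moreover have "0 \<le> q \<xi> * \<xi>" using x ab by (auto simp: q_def)
          ultimately have "(q \<xi> * \<xi>)\<^sup>2 \<le> (1 / a)\<^sup>2" by (intro power_mono)
          then show ?thesis by (simp only: power_mult_distrib power_one_over)
        qed simp
        with q1 have "(q \<xi>)\<^sup>2 * (1 + \<xi>\<^sup>2) \<le> 1 + 1 / a\<^sup>2" by (simp only: distrib_left mult_1_right)
        also have "\<dots> \<le> 2 * (1 + 1 / a\<^sup>2)"
        proof -
          have "1 * (1 + 1 / a\<^sup>2) \<le> 2 * (1 + 1 / a\<^sup>2)" by (intro mult_right_mono add_nonneg_nonneg) auto
          then show ?thesis by (simp only: mult_1_left)
        qed
        finally show ?thesis using pos by (simp only: times_divide_eq_right mult_1_right pos_le_divide_eq)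
      qed
      then show "ennreal ((q \<xi>)\<^sup>2) * indicator {0..} \<xi> \<le> ennreal (2 * (1 + 1 / a\<^sup>2) * (1 / (1 + \<xi>\<^sup>2)))"
        by (cases "\<xi> \<ge> 0") (simp_all add: ennreal_leI)
    qed
    also have "\<dots> = ennreal (\<integral>\<xi>. 2 * (1 + 1 / a\<^sup>2) * (1 / (1 + \<xi>\<^sup>2)) \<partial>lborel)"
    proof (rule nn_integral_eq_integral)
      show "integrable lborel (\<lambda>\<xi>. 2 * (1 + 1 / a\<^sup>2) * (1 / (1 + \<xi>\<^sup>2)))"
        by (rule integrable_mult_right[OF integrable_inverse_1_plus_square])
      show "AE \<xi> in lborel. 0 \<le> 2 * (1 + 1 / a\<^sup>2) * (1 / (1 + \<xi>\<^sup>2))"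
        by (intro AE_I2 mult_nonneg_nonneg add_nonneg_nonneg divide_nonneg_nonneg) auto
    qed
    also have "\<dots> = ennreal Ka" unfolding Ka_def by (subst Bochner_Integration.integral_mult_right_zero) simp
    finally show ?thesis .
  qed
  define A where "A = (104 + 22 * sqrt (2 * C)) * (4 * sqrt (b - a))"
  have A0: "A \<ge> 0" using C ab by (simp add: A_def)
  \<comment> \<open>The 3 comes from squaring a sum of three terms, \<open>norm w / 2\<close> is the
    modulus of the coefficients of the two exponentials, and \<open>a powr m\<close> bounds from
    below the factor \<open>r powr m\<close> that is divided out.\<close>
  define c1 where "c1 = 3 * (norm w)\<^sup>2 / 4 / (a powr m)\<^sup>2"
  define c2 where "c2 = 3 * D\<^sup>2 / (a powr m)\<^sup>2"
  have c0: "c1 \<ge> 0" "c2 \<ge> 0" by (auto simp: c1_def c2_def)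
  define K where "K = c1 * (2 * A) + c1 * (2 * A) + c2 * Ka * (b - a)"
  have K0: "K \<ge> 0" using c0 A0 Ka0 ab by (simp add: K_def)
  show ?thesis
  proof (intro exI[of _ K] conjI allI impI K0)
    fix g :: "real \<Rightarrow> complex" and t :: "real \<Rightarrow> real"
    assume g: "rapid g" and t [measurable]: "t \<in> borel_measurable borel"
    note rapid_measurable[OF g, measurable]
    let ?R = "\<integral>\<^sup>+\<xi>\<in>{0..}. ennreal ((1 + sqrt \<xi>) * (norm (g \<xi>))\<^sup>2 * \<xi> ^ (n - 1)) \<partial>lborel"
    define h where "h \<xi> = of_real (\<xi> powr m) * g \<xi>" for \<xi>
    have [measurable]: "h \<in> borel_measurable borel" unfolding h_def by measurable
    have cg: "continuous_on S g" for S using g continuous_on_subset unfolding rapid_def by blast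
    have hc: "continuous_on {0..} h" unfolding h_def
      by (intro continuous_intros cg continuous_on_powr') (use m0 in auto)
    have powr_le: "\<bar>x powr m\<bar> \<le> 1 * (1 + \<bar>x\<bar>) ^ n" for x
    proof -
      have "\<bar>x\<bar> powr m \<le> (1 + \<bar>x\<bar>) powr m" using m0 by (intro powr_mono2) auto
      also have "\<dots> \<le> (1 + \<bar>x\<bar>) powr real n" using m0 m2 by (intro powr_mono) auto
      also have "\<dots> = (1 + \<bar>x\<bar>) ^ n" by (simp add: powr_realpow)
      finally have "\<bar>x\<bar> powr m \<le> (1 + \<bar>x\<bar>) ^ n" .
      then show ?thesis by (cases "x \<ge> 0") (auto simp: uminus_powr_eq)
    qed
    have hi: "integrable lborel h" unfolding h_def
      by (rule rapid_integrable[OF g, where K = 1 and N = n]) (use powr_le in \<open>simp_all\<close>)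
    have hsi: "set_integrable lborel {0..} h" unfolding set_integrable_def
      by (rule integrable_mult_indicator[OF _ hi]) simp
    have h2: "(norm (h \<xi>))\<^sup>2 = (norm (g \<xi>))\<^sup>2 * \<xi> ^ (n - 1)" if "\<xi> \<ge> 0" for \<xi>
    proof (cases "\<xi> = 0")
      case True then show ?thesis using n m0 by (simp add: h_def)
    next
      case False
      then have "(\<xi> powr m)\<^sup>2 = \<xi> ^ (n - 1)"
        using that unfolding power2_eq_square powr_add[symmetric] m2 by (simp add: powr_realpow)
      then show ?thesis by (simp add: h_def norm_mult power_mult_distrib)
    qed
    define e where "e = (LINT \<xi>:{0..}|lborel. q \<xi> * norm (h \<xi>))"
    have qb: "0 \<le> q \<xi>" "q \<xi> \<le> 1" for \<xi> using ab by (auto simp: q_def)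
    have ei: "set_integrable lborel {0..} (\<lambda>\<xi>. q \<xi> * norm (h \<xi>))"
      unfolding set_integrable_def
    proof (rule integrable_mult_indicator)
      show "integrable lborel (\<lambda>\<xi>. q \<xi> * norm (h \<xi>))"
        by (rule Bochner_Integration.integrable_bound[OF hi])
           (use mult_right_mono[OF qb(2) norm_ge_zero] qb(1) in \<open>auto intro!: AE_I2 simp: abs_mult\<close>)
    qed simp
    have e0: "e \<ge> 0" unfolding e_def set_lebesgue_integral_def using qb(1)
      by (intro integral_nonneg_AE AE_I2) (auto simp: indicator_def)
    have e2: "ennreal (e\<^sup>2) \<le> ennreal Ka * ?R"
    proof -
      have "ennreal e = (\<integral>\<^sup>+\<xi>. ennreal (indicator {0..} \<xi> *\<^sub>R (q \<xi> * norm (h \<xi>))) \<partial>lborel)"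
        unfolding e_def set_lebesgue_integral_def using ei qb(1) unfolding set_integrable_def
        by (intro nn_integral_eq_integral[symmetric] AE_I2) (auto simp: indicator_def)
      also have "\<dots> = (\<integral>\<^sup>+\<xi>. (ennreal (q \<xi>) * indicator {0..} \<xi>) * (ennreal (norm (h \<xi>)) * indicator {0..} \<xi>) \<partial>lborel)"
        using qb(1) by (intro nn_integral_cong) (auto simp: indicator_def ennreal_mult)
      finally have ee: "ennreal e = \<dots>" .
      have "ennreal (e\<^sup>2) = (ennreal e)\<^sup>2" using e0 by (simp add: ennreal_power)
      also have "\<dots> \<le> (\<integral>\<^sup>+\<xi>. (ennreal (q \<xi>) * indicator {0..} \<xi>)\<^sup>2 \<partial>lborel)
          * (\<integral>\<^sup>+\<xi>. (ennreal (norm (h \<xi>)) * indicator {0..} \<xi>)\<^sup>2 \<partial>lborel)"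
        unfolding ee by (rule Cauchy_Schwarz_nn_integral) measurable
      also have "(\<integral>\<^sup>+\<xi>. (ennreal (q \<xi>) * indicator {0..} \<xi>)\<^sup>2 \<partial>lborel)
          = (\<integral>\<^sup>+\<xi>\<in>{0..}. ennreal ((q \<xi>)\<^sup>2) \<partial>lborel)"
      proof (rule nn_integral_cong)
        fix \<xi> show "(ennreal (q \<xi>) * indicator {0..} \<xi>)\<^sup>2 = ennreal ((q \<xi>)\<^sup>2) * indicator {0..} \<xi>"
          using ennreal_power[OF qb(1)[of \<xi>], of 2] by (cases "\<xi> \<in> {0..}") (simp_all)
      qed
      also have "(\<integral>\<^sup>+\<xi>. (ennreal (norm (h \<xi>)) * indicator {0..} \<xi>)\<^sup>2 \<partial>lborel) \<le> ?R"
      proof (rule nn_integral_mono)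
        fix \<xi>
        have "(norm (h \<xi>))\<^sup>2 \<le> (1 + sqrt \<xi>) * (norm (g \<xi>))\<^sup>2 * \<xi> ^ (n - 1)" if x: "\<xi> \<ge> 0"
          using mult_right_mono[of 1 "1 + sqrt \<xi>" "(norm (g \<xi>))\<^sup>2 * \<xi> ^ (n - 1)"] x unfolding h2[OF x]
          by (simp add: mult.assoc)
        then show "(ennreal (norm (h \<xi>)) * indicator {0..} \<xi>)\<^sup>2
            \<le> ennreal ((1 + sqrt \<xi>) * (norm (g \<xi>))\<^sup>2 * \<xi> ^ (n - 1)) * indicator {0..} \<xi>"
          by (cases "\<xi> \<ge> 0") (simp_all add: ennreal_power ennreal_leI)
      qed
      finally show ?thesis using q2 by (meson mult_left_mono mult_right_mono order_trans zero_le)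
    qed
    define T where "T \<sigma> s = (LINT \<xi>:{0..}|lborel. cexp (\<sigma> * (s + C * sqrt \<bar>t s\<bar>) * \<xi> + t s * \<xi>\<^sup>2) * h \<xi>)" for \<sigma> s
    have Tm [measurable]: "T \<sigma> \<in> borel_measurable borel" for \<sigma>
      unfolding T_def by (rule curve_integral_measurable[OF t hc])
    have TB: "(\<integral>\<^sup>+s\<in>{a..b}. ennreal ((norm (T \<sigma> s))\<^sup>2) \<partial>lborel)
        \<le> ennreal (2 * A) * ?R" if "\<bar>\<sigma>\<bar> = 1" for \<sigma>
    proof -
      have "(\<integral>\<^sup>+s\<in>{a..b}. ennreal ((norm (T \<sigma> s))\<^sup>2) \<partial>lborel)
          \<le> ennreal (2 * A) * (\<integral>\<^sup>+\<xi>\<in>{0..}. ennreal (sqrt \<xi> * (norm (h \<xi>))\<^sup>2) \<partial>lborel)"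
        unfolding T_def A_def by (rule curve_bound[OF C ab(2) t that hc hsi])
      also have "\<dots> \<le> ennreal (2 * A) * ?R"
      proof (intro mult_left_mono nn_integral_mono)
        fix \<xi>
        have "sqrt \<xi> * (norm (h \<xi>))\<^sup>2 \<le> (1 + sqrt \<xi>) * (norm (g \<xi>))\<^sup>2 * \<xi> ^ (n - 1)" if x: "\<xi> \<ge> 0"
          using mult_right_mono[of "sqrt \<xi>" "1 + sqrt \<xi>" "(norm (g \<xi>))\<^sup>2 * \<xi> ^ (n - 1)"] x unfolding h2[OF x]
          by (simp add: mult.assoc)
        then show "ennreal (sqrt \<xi> * (norm (h \<xi>))\<^sup>2) * indicator {0..} \<xi>
            \<le> ennreal ((1 + sqrt \<xi>) * (norm (g \<xi>))\<^sup>2 * \<xi> ^ (n - 1)) * indicator {0..} \<xi>"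
          by (cases "\<xi> \<ge> 0") (simp_all add: ennreal_leI)
      qed simp
      finally show ?thesis .
    qed
    have point: "(norm (spec_prop n g (t s) (s + C * sqrt \<bar>t s\<bar>)))\<^sup>2 \<le> c1 * (norm (T 1 s))\<^sup>2 + c1 * (norm (T (-1) s))\<^sup>2 + c2 * e\<^sup>2"
      if s: "s \<in> {a..b}" for s
    proof -
      define r where "r = s + C * sqrt \<bar>t s\<bar>"
      have "0 \<le> C * sqrt \<bar>t s\<bar>" using C by simp
      then have r: "r \<ge> a" using s by (simp add: r_def)
      have r0: "r > 0" using r ab by simp
      define \<rho> where "\<rho> \<xi> = (if \<xi> \<le> 0 then 0 else (\<xi> * r) powr m * sj \<nu> (\<xi> * r) - Im (w * cexp (\<xi> * r)))" for \<xi>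
      have sjm [measurable]: "sj \<nu> \<in> borel_measurable borel"
        by (intro borel_measurable_continuous_onI continuous_on_sj[OF nu] continuous_on_id)
      have [measurable]: "\<rho> \<in> borel_measurable borel" unfolding \<rho>_def by measurable
      have \<rho>b: "\<bar>\<rho> \<xi>\<bar> \<le> D * q \<xi>" for \<xi>
      proof (cases "\<xi> \<le> 0")
        case False
        then have x: "\<xi> > 0" by simp
        have "\<bar>\<rho> \<xi>\<bar> \<le> D * min 1 (1 / (\<xi> * r))" unfolding \<rho>_def using False D(2)[of "\<xi> * r"] x r0 by simp
        also have "1 / (\<xi> * r) \<le> 1 / (a * \<xi>)"
          using r x ab by (intro divide_left_mono) (auto simp: mult.commute)
        then have "D * min 1 (1 / (\<xi> * r)) \<le> D * min 1 (1 / (a * \<xi>))"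
          using D(1) by (intro mult_left_mono) auto
        finally show ?thesis using False by (simp add: q_def)
      qed (use D in \<open>simp add: \<rho>_def q_def\<close>)
      have si: "set_integrable lborel {0..} (\<lambda>\<xi>. f \<xi> * h \<xi>)" if "f \<in> borel_measurable borel" "\<And>\<xi>. norm (f \<xi>)
          \<le> B" for f and B :: real
        unfolding set_integrable_def
      proof (rule integrable_mult_indicator)
        have "integrable lborel (\<lambda>\<xi>. of_real B * h \<xi>)" by (rule integrable_mult_right[OF hi])
        then show "integrable lborel (\<lambda>\<xi>. f \<xi> * h \<xi>)"
        proof (rule Bochner_Integration.integrable_bound)
          show "(\<lambda>\<xi>. f \<xi> * h \<xi>) \<in> borel_measurable lborel" using that(1) by measurable
          show "AE \<xi> in lborel. norm (f \<xi> * h \<xi>) \<le> norm (of_real B * h \<xi>)"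
            using that(2) order_trans[OF norm_ge_zero that(2)[of 0]]
            by (intro AE_I2) (auto simp: norm_mult intro!: mult_right_mono)
        qed
      qed simp
      have i1: "set_integrable lborel {0..} (\<lambda>\<xi>. cexp (\<sigma> * r * \<xi> + t s * \<xi>\<^sup>2) * h \<xi>)" for \<sigma>
        by (rule si[where B = 1]) simp_all
      have i3: "set_integrable lborel {0..} (\<lambda>\<xi>. (of_real (\<rho> \<xi>) * cexp (t s * \<xi>\<^sup>2)) * h \<xi>)"
      proof (rule si[where B = D])
        fix \<xi>
        have "\<bar>\<rho> \<xi>\<bar> \<le> D * 1" using \<rho>b[of \<xi>] mult_left_mono[OF qb(2)[of \<xi>] D(1)] by linarith
        then show "norm (of_real (\<rho> \<xi>) * cexp (t s * \<xi>\<^sup>2)) \<le> D" by (simp add: norm_mult)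
      qed measurable
      let ?G = "LINT \<xi>:{0..}|lborel. (of_real (\<rho> \<xi>) * cexp (t s * \<xi>\<^sup>2)) * h \<xi>"
      have "of_real (r powr m) * spec_prop n g (t s) r
        = (LINT \<xi>:{0..}|lborel. of_real (r powr m) * (of_real (sj \<nu> (\<xi> * r)) * cexp (t s * \<xi>\<^sup>2) * g \<xi> * of_real (\<xi> ^ (n - 1))))"
        unfolding spec_prop_def \<nu>_def by (rule set_integral_mult_right[symmetric])
      also have "\<dots> = (LINT \<xi>:{0..}|lborel. w / (2 * \<i>) * (cexp (1 * r * \<xi> + t s * \<xi>\<^sup>2) * h \<xi>)
          - cnj w / (2 * \<i>) * (cexp ((-1) * r * \<xi> + t s * \<xi>\<^sup>2) * h \<xi>) + (of_real (\<rho> \<xi>) * cexp (t s * \<xi>\<^sup>2)) * h \<xi>)"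
      proof (rule set_lebesgue_integral_cong)
        show "\<forall>\<xi>. \<xi> \<in> {0..} \<longrightarrow> of_real (r powr m)
            * (of_real (sj \<nu> (\<xi> * r)) * cexp (t s * \<xi>\<^sup>2) * g \<xi> * of_real (\<xi> ^ (n - 1)))
          = w / (2 * \<i>) * (cexp (1 * r * \<xi> + t s * \<xi>\<^sup>2) * h \<xi>)
          - cnj w / (2 * \<i>) * (cexp ((-1) * r * \<xi> + t s * \<xi>\<^sup>2) * h \<xi>) + (of_real (\<rho> \<xi>) * cexp (t s * \<xi>\<^sup>2)) * h \<xi>"
        proof (intro allI impI)
          fix \<xi> :: real assume "\<xi> \<in> {0..}"
          then consider "\<xi> = 0" | "\<xi> > 0" by fastforce
          then show "of_real (r powr m) * (of_real (sj \<nu> (\<xi> * r)) * cexp (t s * \<xi>\<^sup>2) * g \<xi> * of_real (\<xi> ^ (n - 1)))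
          = w / (2 * \<i>) * (cexp (1 * r * \<xi> + t s * \<xi>\<^sup>2) * h \<xi>)
          - cnj w / (2 * \<i>) * (cexp ((-1) * r * \<xi> + t s * \<xi>\<^sup>2) * h \<xi>) + (of_real (\<rho> \<xi>) * cexp (t s * \<xi>\<^sup>2)) * h \<xi>"
          proof cases
            case 1 then show ?thesis using n m0 by (simp add: h_def)
          next
            case 2
            have pw: "\<xi> ^ (n - 1) = \<xi> powr m * \<xi> powr m"
              using 2 unfolding powr_add[symmetric] m2 by (simp add: powr_realpow)
            have rr: "(\<xi> * r) powr m = \<xi> powr m * r powr m" using 2 r0 by (simp add: powr_mult)
            have "of_real (r powr m) * (of_real (sj \<nu> (\<xi> * r)) * cexp (t s * \<xi>\<^sup>2) * g \<xi> * of_real (\<xi> ^ (n - 1)))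
              = of_real ((\<xi> * r) powr m * sj \<nu> (\<xi> * r)) * cexp (t s * \<xi>\<^sup>2) * h \<xi>"
              unfolding pw rr h_def by simp
            also have "(\<xi> * r) powr m * sj \<nu> (\<xi> * r) = Im (w * cexp (\<xi> * r)) + \<rho> \<xi>"
              using 2 by (simp add: \<rho>_def)
            also have "complex_of_real (Im (w * cexp (\<xi> * r)) + \<rho> \<xi>)
                = w / (2 * \<i>) * cexp (\<xi> * r) - cnj w / (2 * \<i>) * cexp (- (\<xi> * r)) + of_real (\<rho> \<xi>)"
              by (simp only: of_real_add of_real_Im_cexp)
            finally show ?thesis by (simp only: cexp_add) (simp add: algebra_simps)
          qed
        qed
      qed simp
      also have "\<dots> = w / (2 * \<i>) * T 1 s - cnj w / (2 * \<i>) * T (-1) s + ?G"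
        unfolding T_def r_def[symmetric]
        by (simp only: set_integral_add set_integral_diff set_integral_mult_right set_integrable_mult_right i1 i3 simp_thms)
      finally have eq: "of_real (r powr m) * spec_prop n g (t s) r = w / (2 * \<i>) * T 1 s - cnj w / (2 * \<i>) * T (-1) s + ?G" .
      have Gb: "norm ?G \<le> D * e"
      proof -
        have "norm ?G \<le> (LINT \<xi>:{0..}|lborel. norm ((of_real (\<rho> \<xi>) * cexp (t s * \<xi>\<^sup>2)) * h \<xi>))"
          by (rule set_integral_norm_bound[OF i3])
        also have "\<dots> \<le> (LINT \<xi>:{0..}|lborel. D * (q \<xi> * norm (h \<xi>)))"
        proof (rule set_integral_mono)
          show "set_integrable lborel {0..} (\<lambda>\<xi>. norm ((of_real (\<rho> \<xi>) * cexp (t s * \<xi>\<^sup>2)) * h \<xi>))"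
            using i3 by (rule set_integrable_norm)
          show "set_integrable lborel {0..} (\<lambda>\<xi>. D * (q \<xi> * norm (h \<xi>)))" using ei by simp
          fix \<xi> show "norm ((of_real (\<rho> \<xi>) * cexp (t s * \<xi>\<^sup>2)) * h \<xi>) \<le> D * (q \<xi> * norm (h \<xi>))"
            using mult_right_mono[OF \<rho>b[of \<xi>] norm_ge_zero[of "h \<xi>"]] by (simp only: norm_mult norm_cexp norm_of_real mult_1_right mult.assoc)
        qed
        also have "\<dots> = D * e" unfolding e_def by (rule set_integral_mult_right)
        finally show ?thesis .
      qed
      define X where "X = norm w / 2 * norm (T 1 s) + norm w / 2 * norm (T (-1) s) + D * e"
      have "r powr m * norm (spec_prop n g (t s) r) = norm (of_real (r powr m) * spec_prop n g (t s) r)"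
        using r0 by (simp add: norm_mult)
      also have "\<dots> \<le> X" unfolding eq X_def using Gb
        by (intro norm_triangle_le add_mono norm_triangle_le_diff) (auto simp: norm_mult norm_divide)
      finally have rX: "r powr m * norm (spec_prop n g (t s) r) \<le> X" .
      have "a powr m * norm (spec_prop n g (t s) r) \<le> r powr m * norm (spec_prop n g (t s) r)"
        using r ab m0 by (intro mult_right_mono powr_mono2) auto
      with rX have "(a powr m * norm (spec_prop n g (t s) r))\<^sup>2 \<le> X\<^sup>2" by (intro power_mono) auto
      also have "X\<^sup>2 \<le> 3 * ((norm w / 2 * norm (T 1 s))\<^sup>2 + (norm w / 2 * norm (T (-1) s))\<^sup>2 + (D * e)\<^sup>2)"
      proof -
        have "(x + y + z)\<^sup>2 \<le> 3 * (x\<^sup>2 + y\<^sup>2 + z\<^sup>2)" for x y z :: real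
          using zero_le_power2[of "x - y"] zero_le_power2[of "y - z"] zero_le_power2[of "x - z"]
          by (simp add: power2_eq_square algebra_simps)
        then show ?thesis unfolding X_def .
      qed
      finally have "(norm (spec_prop n g (t s) r))\<^sup>2 \<le> 3 * ((norm w / 2 * norm (T 1 s))\<^sup>2 + (norm w / 2 * norm (T (-1) s))\<^sup>2
          + (D * e)\<^sup>2) / (a powr m)\<^sup>2"
        using ab by (simp add: power_mult_distrib pos_le_divide_eq mult.commute)
      also have "\<dots> = c1 * (norm (T 1 s))\<^sup>2 + c1 * (norm (T (-1) s))\<^sup>2 + c2 * e\<^sup>2"
        by (simp add: c1_def c2_def power_mult_distrib power_divide add_divide_distrib algebra_simps)
      finally show ?thesis unfolding r_def .
    qed
    have "(\<integral>\<^sup>+s\<in>{a..b}. ennreal ((norm (spec_prop n g (t s) (s + C * sqrt \<bar>t s\<bar>)))\<^sup>2) \<partial>lborel)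
      \<le> (\<integral>\<^sup>+s. ennreal c1 * (ennreal ((norm (T 1 s))\<^sup>2) * indicator {a..b} s)
          + ennreal c1 * (ennreal ((norm (T (-1) s))\<^sup>2) * indicator {a..b} s)
          + ennreal (c2 * e\<^sup>2) * indicator {a..b} s \<partial>lborel)"
    proof (rule nn_integral_mono)
      fix s
      show "ennreal ((norm (spec_prop n g (t s) (s + C * sqrt \<bar>t s\<bar>)))\<^sup>2) * indicator {a..b} s
        \<le> ennreal c1 * (ennreal ((norm (T 1 s))\<^sup>2) * indicator {a..b} s) + ennreal c1 * (ennreal ((norm (T (-1) s))\<^sup>2) * indicator {a..b} s)
          + ennreal (c2 * e\<^sup>2) * indicator {a..b} s"
      proof (cases "s \<in> {a..b}")
        case True
        then show ?thesis using ennreal_leI[OF point[OF True]] c0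
          by (simp add: ennreal_plus ennreal_mult)
      qed simp
    qed
    also have "\<dots> = ennreal c1 * (\<integral>\<^sup>+s\<in>{a..b}. ennreal ((norm (T 1 s))\<^sup>2) \<partial>lborel)
        + ennreal c1 * (\<integral>\<^sup>+s\<in>{a..b}. ennreal ((norm (T (-1) s))\<^sup>2) \<partial>lborel)
          + ennreal (c2 * e\<^sup>2) * emeasure lborel {a..b}"
      by (simp add: nn_integral_add nn_integral_cmult)
    also have "\<dots> \<le> ennreal c1 * (ennreal (2 * A) * ?R) + ennreal c1 * (ennreal (2 * A) * ?R) + (ennreal c2 * (ennreal Ka * ?R)) * ennreal (b - a)"
    proof (intro add_mono mult_left_mono TB mult_mono)
      have "ennreal (c2 * e\<^sup>2) = ennreal c2 * ennreal (e\<^sup>2)" using c0 by (simp add: ennreal_mult)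
      also have "\<dots> \<le> ennreal c2 * (ennreal Ka * ?R)" by (rule mult_left_mono[OF e2]) simp
      finally show "ennreal (c2 * e\<^sup>2) \<le> ennreal c2 * (ennreal Ka * ?R)" .
    qed (use ab in \<open>simp_all\<close>)
    also have "\<dots> = (ennreal c1 * ennreal (2 * A) + ennreal c1 * ennreal (2 * A) + ennreal c2 * ennreal Ka * ennreal (b - a)) * ?R"
      by (simp only: distrib_right mult_ac)
    also have "ennreal c1 * ennreal (2 * A) + ennreal c1 * ennreal (2 * A) + ennreal c2 * ennreal Ka * ennreal (b - a) = ennreal K"
    proof -
      have nn: "0 \<le> c1 * (2 * A)" "0 \<le> c2 * Ka" "0 \<le> c2 * Ka * (b - a)" "0 \<le> 2 * A" "0 \<le> b - a"
        using c0 A0 Ka0 ab by auto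
      have "ennreal K = ennreal (c1 * (2 * A)) + ennreal (c1 * (2 * A)) + ennreal (c2 * Ka * (b - a))"
        unfolding K_def using nn by (simp only: ennreal_plus add_nonneg_nonneg)
      then show ?thesis by (simp only: ennreal_mult c0 nn Ka0)
    qed
    finally show "(\<integral>\<^sup>+s\<in>{a..b}. ennreal ((norm (spec_prop n g (t s) (s + C * sqrt \<bar>t s\<bar>)))\<^sup>2) \<partial>lborel)
        \<le> ennreal K * ?R" .
  qed
qed

section \<open>From selected times to all times\<close>

lemma sj_abs: "sj \<nu> \<bar>z\<bar> = sj \<nu> z"
  by (simp add: sj_def)

lemma sj_measurable: "\<nu> \<ge> 0 \<Longrightarrow> sj \<nu> \<in> borel_measurable borel"
  by (intro borel_measurable_continuous_onI continuous_on_sj continuous_on_id)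

lemma sj_bounded_all:
  assumes "\<nu> \<ge> 0"
  obtains D where "D > 0" "\<And>z. \<bar>sj \<nu> z\<bar> \<le> D"
  using sj_bounded[OF assms] by (metis abs_ge_zero sj_abs)

lemma spec_prop_measurable:
  assumes n: "n \<ge> 2" and g: "rapid g" and [measurable]: "t \<in> borel_measurable borel" "r \<in> borel_measurable borel"
  shows "(\<lambda>s. spec_prop n g (t s) (r s)) \<in> borel_measurable borel"
proof -
  note rapid_measurable[OF g, measurable]
  have [measurable]: "sj ((real n - 2) / 2) \<in> borel_measurable borel" using n by (intro sj_measurable) simp
  show ?thesis unfolding spec_prop_def set_lebesgue_integral_def by measurable
qed

lemma power_le_1_plus: "norm (complex_of_real (x ^ k)) \<le> 1 * (1 + \<bar>x\<bar>) ^ k"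
  by (simp add: norm_power power_mono)

text \<open>Joint continuity in time and radius, with a majorant from the boundedness of
  \<open>sj\<close>. At time 0 it is continuity of the transform; along a curve it is continuity of
  the propagation in \<open>t\<close>.\<close>

lemma spec_prop_tendsto:
  assumes n: "n \<ge> 2" and g: "rapid g" and t: "t \<longlonglongrightarrow> t0" and r: "r \<longlonglongrightarrow> r0"
  shows "(\<lambda>k. spec_prop n g (t k) (r k)) \<longlonglongrightarrow> spec_prop n g t0 r0"
proof -
  let ?\<nu> = "(real n - 2) / 2"
  have nu: "?\<nu> \<ge> 0" using n by simp
  note rapid_measurable[OF g, measurable] sj_measurable[OF nu, measurable]
  obtain D where D: "D > 0" "\<And>z. \<bar>sj ?\<nu> z\<bar> \<le> D" by (rule sj_bounded_all[OF nu]) blast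
  let ?f = "\<lambda>t r \<xi>. of_real (sj ?\<nu> (\<xi> * r)) * cexp (t * \<xi>\<^sup>2) * g \<xi> * of_real (\<xi> ^ (n - 1))"
  show ?thesis unfolding spec_prop_def set_lebesgue_integral_def
  proof (rule integral_dominated_convergence[where w = "\<lambda>\<xi>. D * norm (of_real (\<xi> ^ (n - 1)) * g \<xi>)"])
    show "integrable lborel (\<lambda>\<xi>. D * norm (of_real (\<xi> ^ (n - 1)) * g \<xi>))"
      by (intro integrable_mult_right integrable_norm rapid_integrable[OF g _ power_le_1_plus]) measurable
    show "AE \<xi> in lborel. (\<lambda>k. indicator {0..} \<xi> *\<^sub>R ?f (t k) (r k) \<xi>) \<longlonglongrightarrow> indicator {0..} \<xi> *\<^sub>R ?f t0 r0 \<xi>"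
    proof (rule AE_I2)
      fix \<xi> :: real
      have "(\<lambda>k. sj ?\<nu> (\<xi> * r k)) \<longlonglongrightarrow> sj ?\<nu> (\<xi> * r0)"
        by (rule isCont_tendsto_compose[OF DERIV_isCont[OF sj_deriv[OF nu]]]) (intro tendsto_intros r)
      moreover have "(\<lambda>k. cexp (t k * \<xi>\<^sup>2)) \<longlonglongrightarrow> cexp (t0 * \<xi>\<^sup>2)"
        unfolding cexp_def by (intro tendsto_intros t)
      ultimately show "(\<lambda>k. indicator {0..} \<xi> *\<^sub>R ?f (t k) (r k) \<xi>) \<longlonglongrightarrow> indicator {0..} \<xi> *\<^sub>R ?f t0 r0 \<xi>"
        by (intro tendsto_intros)
    qed
    show "AE \<xi> in lborel. norm (indicator {0..} \<xi> *\<^sub>R ?f (t k) (r k) \<xi>) \<le> D * norm (of_real (\<xi> ^ (n - 1)) * g \<xi>)" for k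
    proof (rule AE_I2)
      fix \<xi> :: real
      have "norm (?f (t k) (r k) \<xi>) = \<bar>sj ?\<nu> (\<xi> * r k)\<bar> * norm (of_real (\<xi> ^ (n - 1)) * g \<xi>)"
        by (simp add: norm_mult mult_ac)
      also have "\<dots> \<le> D * norm (of_real (\<xi> ^ (n - 1)) * g \<xi>)" by (intro mult_right_mono D) simp
      finally show "norm (indicator {0..} \<xi> *\<^sub>R ?f (t k) (r k) \<xi>) \<le> D * norm (of_real (\<xi> ^ (n - 1)) * g \<xi>)"
        using D(1) by (auto simp: indicator_def)
    qed
  qed measurable
qed

lemma spec_prop_curve_continuous:
  assumes "n \<ge> 2" "rapid g"
  shows "continuous_on UNIV (\<lambda>t. spec_prop n g t (s + C * sqrt \<bar>t\<bar>))"
  by (rule continuous_on_sequentiallyI)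
     (auto intro!: spec_prop_tendsto assms tendsto_intros simp: o_def)

text \<open>\<open>M\<close> is the supremum over rational times, hence measurable, and by
  continuity in \<open>t\<close> it dominates all times. It is the increasing limit of maxima over
  finitely many rationals. Each maximum is the value at one measurably selected time, so
  \<open>curve_selected_bound\<close> applies with a constant \<open>K\<close> that does not see the
  selection, and monotone convergence concludes.\<close>

theorem maximal_curve_bound:
  fixes C a b :: real and n :: nat
  assumes n: "n \<ge> 2" and C: "C \<ge> 0" and ab: "0 < a" "a < b"
  obtains K where "K \<ge> 0" "\<And>g. rapid g \<Longrightarrow> \<exists>M. M \<in> borel_measurable borel \<and>
     (\<forall>s t. ennreal ((norm (spec_prop n g t (s + C * sqrt \<bar>t\<bar>)))\<^sup>2) \<le> M s) \<and>
     (\<integral>\<^sup>+s\<in>{a..b}. M s \<partial>lborel)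
         \<le> ennreal K * (\<integral>\<^sup>+\<xi>\<in>{0..}. ennreal ((1 + sqrt \<xi>) * (norm (g \<xi>))\<^sup>2 * \<xi> ^ (n - 1)) \<partial>lborel)"
proof -
  obtain K where K: "K \<ge> 0" "\<And>g t. rapid g \<Longrightarrow> t \<in> borel_measurable borel \<Longrightarrow>
     (\<integral>\<^sup>+s\<in>{a..b}. ennreal ((norm (spec_prop n g (t s) (s + C * sqrt \<bar>t s\<bar>)))\<^sup>2) \<partial>lborel)
     \<le> ennreal K * (\<integral>\<^sup>+\<xi>\<in>{0..}. ennreal ((1 + sqrt \<xi>) * (norm (g \<xi>))\<^sup>2 * \<xi> ^ (n - 1)) \<partial>lborel)"
    using curve_selected_bound[OF n C ab] by blast
  show ?thesis
  proof (rule that[OF K(1)])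
    fix g assume g: "rapid g"
    define F where "F t s = (norm (spec_prop n g t (s + C * sqrt \<bar>t\<bar>)))\<^sup>2" for t s
    have Fm: "(\<lambda>s. F (t s) s) \<in> borel_measurable borel" if [measurable]: "t \<in> borel_measurable borel" for t
    proof -
      have [measurable]: "(\<lambda>s. spec_prop n g (t s) (s + C * sqrt \<bar>t s\<bar>)) \<in> borel_measurable borel"
        by (rule spec_prop_measurable[OF n g that]) measurable
      show ?thesis unfolding F_def by measurable
    qed
    obtain \<tau> :: "nat \<Rightarrow> real" where \<tau>: "range \<tau> = \<rat>"
      by (metis Rats_0 countable_rat empty_iff range_from_nat_into)
    \<comment> \<open>\<open>sel k s\<close> is one of \<open>\<tau> 0, \<dots>, \<tau> k\<close> at which \<open>F\<close> is maximal, chosen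
        measurably in \<open>s\<close>.\<close>
    define sel where "sel = rec_nat (\<lambda>_. \<tau> 0) (\<lambda>k u s. if F (\<tau> (Suc k)) s > F (u s) s then \<tau> (Suc k) else u s)"
    have sel_0: "sel 0 = (\<lambda>_. \<tau> 0)"
      and sel_Suc: "sel (Suc k) = (\<lambda>s. if F (\<tau> (Suc k)) s > F (sel k s) s then \<tau> (Suc k) else sel k s)" for k
      unfolding sel_def by simp_all
    have selm [measurable]: "sel k \<in> borel_measurable borel" for k
    proof (induction k)
      case (Suc k)
      note Suc [measurable] Fm[OF Suc, measurable]
      have [measurable]: "(\<lambda>s. F (\<tau> (Suc k)) s) \<in> borel_measurable borel" by (rule Fm) simp
      show ?case unfolding sel_Suc by measurable
    qed (simp add: sel_0)
    define M where "M s = (SUP k. ennreal (F (sel k s) s))" for s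
    have inc: "F (sel k s) s \<le> F (sel (Suc k) s) s" for k s by (simp add: sel_Suc)
    have ge: "F (\<tau> k) s \<le> F (sel k s) s" for k s by (cases k) (simp_all add: sel_0 sel_Suc)
    have Mm: "M \<in> borel_measurable borel" unfolding M_def
      by (intro borel_measurable_SUP measurable_compose[OF Fm measurable_ennreal] selm) simp
    have "ennreal (F t s) \<le> M s" for s t
    proof (cases "M s")
      case (real c)
      have "closed {t. F t s \<le> c}"
        unfolding F_def by (intro closed_Collect_le continuous_intros spec_prop_curve_continuous[OF n g])
      moreover have "\<rat> \<subseteq> {t. F t s \<le> c}"
      proof -
        have "F (\<tau> k) s \<le> c" for k
        proof -
          have "ennreal (F (\<tau> k) s) \<le> ennreal (F (sel k s) s)" by (rule ennreal_leI[OF ge])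
          also have "\<dots> \<le> M s" unfolding M_def by (rule SUP_upper) simp
          finally show ?thesis using real by simp
        qed
        then show ?thesis using \<tau> by (auto simp flip: \<tau>)
      qed
      ultimately have "closure \<rat> \<subseteq> {t. F t s \<le> c}" by (rule closure_minimal[rotated])
      then have "F t s \<le> c" using Rats_closure_real by blast
      then show ?thesis using real by (simp add: ennreal_leI)
    qed simp
    moreover have "(\<integral>\<^sup>+s\<in>{a..b}. M s \<partial>lborel)
        \<le> ennreal K * (\<integral>\<^sup>+\<xi>\<in>{0..}. ennreal ((1 + sqrt \<xi>) * (norm (g \<xi>))\<^sup>2 * \<xi> ^ (n - 1)) \<partial>lborel)"
    proof -
      have "(\<integral>\<^sup>+s\<in>{a..b}. M s \<partial>lborel) = (\<integral>\<^sup>+s. (SUP k. ennreal (F (sel k s) s) * indicator {a..b} s) \<partial>lborel)"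
        by (rule nn_integral_cong) (simp add: M_def SUP_mult_right_ennreal)
      also have "\<dots> = (SUP k. \<integral>\<^sup>+s. ennreal (F (sel k s) s) * indicator {a..b} s \<partial>lborel)"
      proof (rule nn_integral_monotone_convergence_SUP)
        show "incseq (\<lambda>k s. ennreal (F (sel k s) s) * indicator {a..b} s)"
          by (intro incseq_SucI le_funI mult_right_mono ennreal_leI inc) simp
        show "(\<lambda>s. ennreal (F (sel k s) s) * indicator {a..b} s) \<in> borel_measurable lborel" for k
          using measurable_compose[OF Fm[OF selm] measurable_ennreal] by simp
      qed
      also have "\<dots> \<le> ennreal K * (\<integral>\<^sup>+\<xi>\<in>{0..}. ennreal ((1 + sqrt \<xi>) * (norm (g \<xi>))\<^sup>2 * \<xi> ^ (n - 1)) \<partial>lborel)"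
        unfolding F_def by (intro SUP_least K g selm)
      finally show ?thesis .
    qed
    ultimately show "\<exists>M. M \<in> borel_measurable borel \<and>
     (\<forall>s t. ennreal ((norm (spec_prop n g t (s + C * sqrt \<bar>t\<bar>)))\<^sup>2) \<le> M s) \<and>
     (\<integral>\<^sup>+s\<in>{a..b}. M s \<partial>lborel)
         \<le> ennreal K * (\<integral>\<^sup>+\<xi>\<in>{0..}. ennreal ((1 + sqrt \<xi>) * (norm (g \<xi>))\<^sup>2 * \<xi> ^ (n - 1)) \<partial>lborel)"
      using Mm unfolding F_def by blast
  qed
qed

subsection \<open>The Hankel transform of even Schwartz functions\<close>

text \<open>The sequence \<open>d\<close> of all derivatives is part of the existential statement,
  so that derivatives can be exhibited by formulas. Evenness is what keeps the quotient of the first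
  derivative by \<open>s\<close> smooth at 0.\<close>

definition even_schwartz :: "(real \<Rightarrow> complex) set" where
  "even_schwartz = {\<phi>. (\<forall>x. \<phi> (- x) = \<phi> x) \<and> (\<exists>d. d 0 = \<phi> \<and>
     (\<forall>k x. (d k has_vector_derivative d (Suc k) x) (at x)) \<and>
     (\<forall>k m. \<exists>C. \<forall>x. \<bar>x\<bar> ^ m * norm (d k x) \<le> C))}"

lemma one_plus_power_le: "(1 + x) ^ N \<le> 2 ^ N * (1 + x ^ N)" if "x \<ge> 0" for x :: real
proof (cases "x \<le> 1")
  case True
  have "(1 + x) ^ N \<le> 2 ^ N" using that True by (intro power_mono) auto
  also have "\<dots> \<le> 2 ^ N * (1 + x ^ N)" using that by simp
  finally show ?thesis .
next
  case False
  have "(1 + x) ^ N \<le> (2 * x) ^ N" using False by (intro power_mono) auto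
  also have "\<dots> \<le> 2 ^ N * (1 + x ^ N)" by (simp add: power_mult_distrib)
  finally show ?thesis .
qed

lemma rapidI:
  assumes "continuous_on UNIV g" "\<And>m::nat. \<exists>C. \<forall>x. \<bar>x\<bar> ^ m * norm (g x) \<le> C"
  shows "rapid g"
  unfolding rapid_def
proof (intro conjI allI assms(1))
  fix N :: nat
  obtain C0 where C0: "\<And>x. \<bar>x\<bar> ^ 0 * norm (g x) \<le> C0" using assms(2) by blast
  obtain C1 where C1: "\<And>x. \<bar>x\<bar> ^ N * norm (g x) \<le> C1" using assms(2) by blast
  show "\<exists>C. \<forall>x. (1 + \<bar>x\<bar>) ^ N * norm (g x) \<le> C"
  proof (intro exI allI)
    fix x
    have "(1 + \<bar>x\<bar>) ^ N * norm (g x) \<le> 2 ^ N * (1 + \<bar>x\<bar> ^ N) * norm (g x)"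
      by (intro mult_right_mono one_plus_power_le) auto
    also have "\<dots> = 2 ^ N * (\<bar>x\<bar> ^ 0 * norm (g x) + \<bar>x\<bar> ^ N * norm (g x))" by (simp add: algebra_simps)
    also have "\<dots> \<le> 2 ^ N * (C0 + C1)" by (intro mult_left_mono add_mono C0 C1) simp
    finally show "(1 + \<bar>x\<bar>) ^ N * norm (g x) \<le> 2 ^ N * (C0 + C1)" .
  qed
qed

lemma even_schwartz_rapid:
  assumes "\<phi> \<in> even_schwartz"
  shows "rapid \<phi>"
proof -
  obtain d where d: "d 0 = \<phi>" "\<And>k x. (d k has_vector_derivative d (Suc k) x) (at x)"
    "\<And>k m. \<exists>C. \<forall>x. \<bar>x\<bar> ^ m * norm (d k x) \<le> C" using assms unfolding even_schwartz_def by blast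
  show ?thesis
  proof (rule rapidI)
    show "continuous_on UNIV \<phi>" using d(2)[of 0] unfolding d(1)
      by (meson continuous_at_imp_continuous_on has_vector_derivative_continuous)
    show "\<exists>C. \<forall>x. \<bar>x\<bar> ^ m * norm (\<phi> x) \<le> C" for m using d(3)[of m 0] unfolding d(1) .
  qed
qed

lemma even_schwartz_add:
  assumes "\<phi> \<in> even_schwartz" "\<psi> \<in> even_schwartz"
  shows "(\<lambda>x. \<phi> x + c * \<psi> x) \<in> even_schwartz"
proof -
  obtain d where d: "d 0 = \<phi>" "\<And>k x. (d k has_vector_derivative d (Suc k) x) (at x)"
    "\<And>k m. \<exists>C. \<forall>x. \<bar>x\<bar> ^ m * norm (d k x) \<le> C" using assms(1) unfolding even_schwartz_def by blast
  obtain e where e: "e 0 = \<psi>" "\<And>k x. (e k has_vector_derivative e (Suc k) x) (at x)"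
    "\<And>k m. \<exists>C. \<forall>x. \<bar>x\<bar> ^ m * norm (e k x) \<le> C" using assms(2) unfolding even_schwartz_def by blast
  show ?thesis unfolding even_schwartz_def mem_Collect_eq
  proof (intro conjI allI exI[of _ "\<lambda>k x. d k x + c * e k x"])
    show "\<phi> (- x) + c * \<psi> (- x) = \<phi> x + c * \<psi> x" for x using assms by (simp add: even_schwartz_def)
    show "((\<lambda>x. d k x + c * e k x) has_vector_derivative d (Suc k) x + c * e (Suc k) x) (at x)" for k x
      by (intro has_vector_derivative_add has_vector_derivative_mult_right d e)
    fix k m
    obtain A where A: "\<And>x. \<bar>x\<bar> ^ m * norm (d k x) \<le> A" using d(3) by blast
    obtain B where B: "\<And>x. \<bar>x\<bar> ^ m * norm (e k x) \<le> B" using e(3) by blast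
    show "\<exists>C. \<forall>x. \<bar>x\<bar> ^ m * norm (d k x + c * e k x) \<le> C"
    proof (intro exI allI)
      fix x
      have "\<bar>x\<bar> ^ m * norm (d k x + c * e k x) \<le> \<bar>x\<bar> ^ m * (norm (d k x) + norm c * norm (e k x))"
        by (intro mult_left_mono norm_triangle_le) (auto simp: norm_mult)
      also have "\<dots> = \<bar>x\<bar> ^ m * norm (d k x) + norm c * (\<bar>x\<bar> ^ m * norm (e k x))" by (simp add: algebra_simps)
      also have "\<dots> \<le> A + norm c * B" by (intro add_mono A mult_left_mono B) simp
      finally show "\<bar>x\<bar> ^ m * norm (d k x + c * e k x) \<le> A + norm c * B" .
    qed
  qed (simp add: d e)
qed

text \<open>The quotient \<open>\<phi>'(s) / s\<close> of an even function is \<open>\<integral>\<^sub>0\<^sup>1 \<phi>''(us) du\<close>, hence again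
    smooth and even.\<close>

lemma even_schwartz_radial_laplacian:
  assumes "\<phi> \<in> even_schwartz"
  obtains \<phi>1 \<phi>2 \<omega> where
    "\<And>x. (\<phi> has_vector_derivative \<phi>1 x) (at x)" "\<And>x. (\<phi>1 has_vector_derivative \<phi>2 x) (at x)"
    "\<And>x. \<phi>1 x = of_real x * \<omega> x" "\<And>m. \<exists>C. \<forall>x. \<bar>x\<bar> ^ m * norm (\<phi>1 x) \<le> C"
    "\<And>c. (\<lambda>x. \<phi>2 x + c * \<omega> x) \<in> even_schwartz"
proof -
  obtain d where d: "d 0 = \<phi>" "\<And>k x. (d k has_vector_derivative d (Suc k) x) (at x)"
    "\<And>k m. \<exists>C. \<forall>x. \<bar>x\<bar> ^ m * norm (d k x) \<le> C" using assms unfolding even_schwartz_def by blast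
  have parity: "d k (- x) = (-1) ^ k * d k x" for k x
  proof (induction k arbitrary: x)
    case 0 then show ?case using assms unfolding d(1) even_schwartz_def by simp
  next
    case (Suc k)
    have "((\<lambda>x. d k (- x)) has_vector_derivative (-1) *\<^sub>R d (Suc k) (- x)) (at x)"
      by (rule vector_diff_chain_at[OF _ d(2), unfolded o_def])
         (auto intro!: derivative_eq_intros simp flip: has_real_derivative_iff_has_vector_derivative)
    moreover have "((\<lambda>x. (-1) ^ k * d k x) has_vector_derivative (-1) ^ k * d (Suc k) x) (at x)"
      by (intro has_vector_derivative_mult_right d)
    ultimately have "(-1) *\<^sub>R d (Suc k) (- x) = (-1) ^ k * d (Suc k) x"
      unfolding Suc.IH by (rule vector_derivative_unique_at)
    then show ?case by (simp add: minus_equation_iff) (metis minus_minus)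
  qed
  have d10: "d 1 0 = 0" using parity[of 1 0] by simp
  have cd: "continuous_on UNIV (d k)" for k
    using d(2)[of k] by (meson continuous_at_imp_continuous_on has_vector_derivative_continuous)
  have cd': "continuous_on S (\<lambda>x. d k (f x))" if "continuous_on S f" for S :: "'b::topological_space set" and f k
    by (rule continuous_on_compose2[OF cd that]) simp
  have dl: "((\<lambda>x. d k (u * x)) has_vector_derivative of_real u * d (Suc k) (u * x)) (at x within S)" for k u x S
  proof -
    have "((\<lambda>x. d k (u * x)) has_vector_derivative u *\<^sub>R d (Suc k) (u * x)) (at x)"
      by (rule vector_diff_chain_at[OF _ d(2), unfolded o_def])
         (auto intro!: derivative_eq_intros simp flip: has_real_derivative_iff_has_vector_derivative)
    then show ?thesis by (simp add: scaleR_conv_of_real has_vector_derivative_at_within)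
  qed
  \<comment> \<open>\<open>e 0 s\<close> is the mean of the second derivative over the segment from
    0 to \<open>s\<close>; differentiation under the integral makes \<open>e k\<close> its
    \<open>k\<close>-th derivative.\<close>
  define e where "e k s = integral {0..1} (\<lambda>u. of_real (u ^ k) * d (k + 2) (u * s))" for k s
  have ce: "continuous_on S (\<lambda>u. of_real (u ^ k) * d j (u * s))" for S k j s
    by (intro continuous_intros cd')
  have de: "(e k has_vector_derivative e (Suc k) s) (at s)" for k s
  proof -
    have "((\<lambda>s. integral (cbox 0 1) (\<lambda>u. of_real (u ^ k) * d (k + 2) (u * s))) has_vector_derivative
       integral (cbox 0 1) (\<lambda>u. of_real (u ^ Suc k) * d (Suc k + 2) (u * s))) (at s within UNIV)"
    proof (rule leibniz_rule_vector_derivative)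
      fix s u :: real
      have "((\<lambda>s. of_real (u ^ k) * d (k + 2) (u * s)) has_vector_derivative of_real (u ^ k) * (of_real u * d (Suc (k + 2)) (u * s))) (at s within UNIV)"
        by (intro has_vector_derivative_mult_right dl)
      then show "((\<lambda>s. of_real (u ^ k) * d (k + 2) (u * s)) has_vector_derivative of_real (u ^ Suc k) * d (Suc k + 2) (u * s)) (at s within UNIV)"
        by (simp add: mult_ac)
    next
      show "(\<lambda>u. of_real (u ^ k) * d (k + 2) (u * s)) integrable_on cbox 0 1" for s
        unfolding cbox_interval by (intro integrable_continuous_real ce)
      show "continuous_on (UNIV \<times> cbox 0 1) (\<lambda>(s, u). complex_of_real (u ^ Suc k) * d (Suc k + 2) (u * s))"
        unfolding case_prod_unfold by (intro continuous_intros cd')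
    qed auto
    then show ?thesis by (simp only: e_def[abs_def] cbox_interval)
  qed
  \<comment> \<open>Integration by parts in \<open>u\<close>. The lower boundary term vanishes: for
    \<open>k = 0\<close> because the odd function \<open>d 1\<close> is 0 at 0, otherwise because of
    the factor \<open>0 ^ k\<close>. For \<open>k = 0\<close> the truncated value
    \<open>k - 1 = 0\<close> is harmless, being multiplied by 0, and the identity is the
    factorisation of \<open>d 1\<close>.\<close>
  have ibp: "of_real s * e k s + of_nat k * e (k - 1) s = d (Suc k) s" for k s
  proof -
    have "((\<lambda>u. of_real (u ^ k) * (of_real s * d (Suc (Suc k)) (u * s)) + of_real (real k * u ^ (k - 1)) * d (Suc k) (u * s))
       has_integral (of_real (1 ^ k) * d (Suc k) (1 * s) - of_real (0 ^ k) * d (Suc k) (0 * s))) {0..1}"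
    proof (rule fundamental_theorem_of_calculus)
      fix u :: real assume "u \<in> {0..1}"
      have 1: "((\<lambda>u. complex_of_real (u ^ k)) has_vector_derivative of_real (real k * u ^ (k - 1))) (at u within {0..1})"
        by (rule has_vector_derivative_of_real) (auto intro!: derivative_eq_intros)
      have 2: "((\<lambda>u. d (Suc k) (u * s)) has_vector_derivative of_real s * d (Suc (Suc k)) (u * s)) (at u within {0..1})"
        using dl[of "Suc k" s u "{0..1}"] by (simp add: mult.commute)
      show "((\<lambda>u. of_real (u ^ k) * d (Suc k) (u * s)) has_vector_derivative
        of_real (u ^ k) * (of_real s * d (Suc (Suc k)) (u * s)) + of_real (real k * u ^ (k - 1)) * d (Suc k) (u * s)) (at u within {0..1})"
        by (rule has_vector_derivative_mult[OF 1 2])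
    qed simp
    then have "integral {0..1} (\<lambda>u. of_real (u ^ k) * (of_real s * d (Suc (Suc k)) (u * s)) + of_real (real k * u ^ (k - 1)) * d (Suc k) (u * s))
       = d (Suc k) s - of_real (0 ^ k) * d (Suc k) 0" by (simp add: integral_unique)
    also have "of_real (0 ^ k) * d (Suc k) 0 = 0" using d10 by (cases k) auto
    also have "integral {0..1} (\<lambda>u. of_real (u ^ k) * (of_real s * d (Suc (Suc k)) (u * s)) + of_real (real k * u ^ (k - 1)) * d (Suc k) (u * s))
       = integral {0..1} (\<lambda>u. of_real s * (of_real (u ^ k) * d (Suc (Suc k)) (u * s)) + of_nat k * (of_real (u ^ (k - 1)) * d (Suc k) (u * s)))"
      by (simp add: mult_ac)
    also have "\<dots> = of_real s * integral {0..1} (\<lambda>u. of_real (u ^ k) * d (Suc (Suc k)) (u * s))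
        + of_nat k * integral {0..1} (\<lambda>u. of_real (u ^ (k - 1)) * d (Suc k) (u * s))"
      by (subst Henstock_Kurzweil_Integration.integral_add)
         (auto intro!: integrable_continuous_real ce integrable_on_mult_right simp del: of_real_power)
    also have "\<dots> = of_real s * e k s + of_nat k * e (k - 1) s"
      by (cases k) (simp_all add: e_def)
    finally show ?thesis by simp
  qed
  have e_bdd: "\<exists>C. \<forall>s. norm (e k s) \<le> C" for k
  proof -
    obtain C where C: "\<And>x. \<bar>x\<bar> ^ 0 * norm (d (k + 2) x) \<le> C" using d(3) by blast
    have "norm (e k s) \<le> C * (1 - 0)" for s unfolding e_def
    proof (rule integral_bound)
      fix u :: real assume u: "u \<in> {0..1}"
      have "\<bar>u ^ k\<bar> * norm (d (k + 2) (u * s)) \<le> 1 * C"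
        using C[of "u * s"] u by (intro mult_mono) (auto simp: power_le_one)
      then show "norm (of_real (u ^ k) * d (k + 2) (u * s)) \<le> C" by (simp only: norm_mult norm_of_real mult_1_left)
    qed (use ce in auto)
    then show ?thesis by auto
  qed
  \<comment> \<open>By \<open>ibp\<close> a power of \<open>s\<close> in front of \<open>e k\<close>
    is traded for \<open>d (Suc k)\<close>, which decays, and for \<open>e (k - 1)\<close>, which
    decays by induction.\<close>
  have e_decay: "\<exists>C. \<forall>s. \<bar>s\<bar> ^ m * norm (e k s) \<le> C" for k m
  proof (induction k)
    case 0
    show ?case
    proof (cases m)
      case 0 then show ?thesis using e_bdd by simp
    next
      case (Suc m')
      obtain C where C: "\<And>x. \<bar>x\<bar> ^ m' * norm (d 1 x) \<le> C" using d(3) by blast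
      have "\<bar>s\<bar> ^ m * norm (e 0 s) \<le> C" for s
        using C[of s] ibp[of s 0] by (simp add: Suc norm_mult mult_ac flip: \<open>_ = d (Suc 0) s\<close>)
      then show ?thesis by blast
    qed
  next
    case (Suc k)
    show ?case
    proof (cases m)
      case 0 then show ?thesis using e_bdd by simp
    next
      case m: (Suc m')
      obtain C where C: "\<And>x. \<bar>x\<bar> ^ m' * norm (d (Suc (Suc k)) x) \<le> C" using d(3) by blast
      obtain C0 where C0: "\<And>s. norm (e k s) \<le> C0" using e_bdd by blast
      obtain C1 where C1: "\<And>s. \<bar>s\<bar> ^ m * norm (e k s) \<le> C1" using Suc by blast
      have pm: "\<bar>s\<bar> ^ m' \<le> 1 + \<bar>s\<bar> ^ m" for s :: real
      proof (cases "\<bar>s\<bar> \<le> 1")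
        case True
        then have "\<bar>s\<bar> ^ m' \<le> 1" by (intro power_le_one) auto
        then show ?thesis by (simp add: add_increasing2)
      next
        case False
        then have "\<bar>s\<bar> ^ m' \<le> \<bar>s\<bar> ^ m" unfolding m by (intro power_increasing) auto
        then show ?thesis by simp
      qed
      have "\<bar>s\<bar> ^ m * norm (e (Suc k) s) \<le> C + real (Suc k) * (C0 + C1)" for s
      proof -
        have "of_real s * e (Suc k) s = d (Suc (Suc k)) s - of_nat (Suc k) * e k s"
          using ibp[of s "Suc k"] by (simp add: eq_diff_eq)
        then have "\<bar>s\<bar> * norm (e (Suc k) s) = norm (d (Suc (Suc k)) s - of_nat (Suc k) * e k s)"
          by (metis norm_mult norm_of_real)
        also have "\<dots> \<le> norm (d (Suc (Suc k)) s) + real (Suc k) * norm (e k s)"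
          by (metis norm_mult norm_of_nat norm_triangle_ineq4)
        finally have "\<bar>s\<bar> ^ m' * (\<bar>s\<bar> * norm (e (Suc k) s)) \<le> \<bar>s\<bar> ^ m' * (norm (d (Suc (Suc k)) s) + real (Suc k) * norm (e k s))"
          by (rule mult_left_mono) simp
        also have "\<dots> = \<bar>s\<bar> ^ m' * norm (d (Suc (Suc k)) s) + real (Suc k) * (\<bar>s\<bar> ^ m' * norm (e k s))"
          by (simp add: algebra_simps)
        also have "\<dots> \<le> C + real (Suc k) * (C0 + C1)"
        proof (intro add_mono mult_left_mono C)
          have "\<bar>s\<bar> ^ m' * norm (e k s) \<le> (1 + \<bar>s\<bar> ^ m) * norm (e k s)" by (intro mult_right_mono pm) simp
          also have "\<dots> \<le> C0 + C1" using C0[of s] C1[of s] by (simp add: algebra_simps)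
          finally show "\<bar>s\<bar> ^ m' * norm (e k s) \<le> C0 + C1" .
        qed simp
        finally show ?thesis by (simp add: m mult_ac)
      qed
      then show ?thesis by blast
    qed
  qed
  have e0_es: "e 0 \<in> even_schwartz" unfolding even_schwartz_def mem_Collect_eq
  proof (intro conjI allI exI[of _ e])
    show "e 0 (- x) = e 0 x" for x using parity[of "Suc (Suc 0)"] by (simp add: e_def)
  qed (use de e_decay in auto)
  have d2_es: "d 2 \<in> even_schwartz" unfolding even_schwartz_def mem_Collect_eq
  proof (intro conjI allI exI[of _ "\<lambda>k. d (k + 2)"])
    show "d 2 (- x) = d 2 x" for x using parity[of 2 x] by simp
    show "(d (k + 2) has_vector_derivative d (Suc k + 2) x) (at x)" for k x using d(2)[of "k + 2" x] by simp
  qed (use d(3) in \<open>auto simp: numeral_2_eq_2\<close>)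
  show ?thesis
  proof (rule that[of "d 1" "d 2" "e 0"])
    show "(\<phi> has_vector_derivative d 1 x) (at x)" for x using d(2)[of 0 x] unfolding d(1) by simp
    show "(d 1 has_vector_derivative d 2 x) (at x)" for x using d(2)[of 1 x] by (simp add: numeral_2_eq_2)
    show "d 1 x = of_real x * e 0 x" for x using ibp[of x 0] by simp
    show "\<exists>C. \<forall>x. \<bar>x\<bar> ^ m * norm (d 1 x) \<le> C" for m by (rule d(3))
    show "(\<lambda>x. d 2 x + c * e 0 x) \<in> even_schwartz" for c by (rule even_schwartz_add[OF d2_es e0_es])
  qed
qed

lemma set_integral_FTC_half_line:
  fixes F f :: "real \<Rightarrow> 'b::euclidean_space"
  assumes f: "set_integrable lborel {0..} f" and F: "\<And>x. x \<ge> 0 \<Longrightarrow> (F has_vector_derivative f x) (at x)"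
    and c: "continuous_on {0..} f" and lim: "(F \<longlongrightarrow> 0) at_top"
  shows "(LINT x:{0..}|lborel. f x) = - F 0"
proof -
  have "((\<lambda>b. LINT x:{0..b}|lborel. f x) \<longlongrightarrow> (LINT x:{0..}|lborel. f x)) at_top"
    by (rule tendsto_set_lebesgue_integral_at_top) (use f in auto)
  moreover have "((\<lambda>b. LINT x:{0..b}|lborel. f x) \<longlongrightarrow> 0 - F 0) at_top"
  proof (rule Lim_transform_eventually)
    show "((\<lambda>b. F b - F 0) \<longlongrightarrow> 0 - F 0) at_top" by (intro tendsto_intros lim)
    show "\<forall>\<^sub>F b in at_top. F b - F 0 = (LINT x:{0..b}|lborel. f x)"
      using eventually_ge_at_top[of 0]
    proof eventually_elim
      case (elim b)
      have "(f has_integral (F b - F 0)) {0..b}"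
        by (rule fundamental_theorem_of_calculus) (use elim F in \<open>auto intro: has_vector_derivative_at_within\<close>)
      moreover have "set_integrable lborel {0..b} f"
        by (intro borel_integrable_atLeastAtMost' continuous_on_subset[OF c]) auto
      ultimately show ?case by (simp add: set_borel_integral_eq_integral integral_unique)
    qed
  qed
  ultimately have "(LINT x:{0..}|lborel. f x) = 0 - F 0" by (rule tendsto_unique[rotated]) simp
  then show ?thesis by simp
qed

lemma at_top_tendsto_0I:
  fixes F :: "real \<Rightarrow> 'b::real_normed_vector"
  assumes "\<And>x. x \<ge> 1 \<Longrightarrow> norm (F x) \<le> C / x"
  shows "(F \<longlongrightarrow> 0) at_top"
proof (rule Lim_null_comparison)
  show "\<forall>\<^sub>F x in at_top. norm (F x) \<le> C / x"
    using eventually_ge_at_top[of 1] by eventually_elim (rule assms)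
  show "((\<lambda>x. C / x) \<longlongrightarrow> 0) at_top"
    by (rule real_tendsto_divide_at_top[OF tendsto_const filterlim_ident])
qed

text \<open>The kernel depends only on the product of radius and frequency, so the transform and the
  inversion integral are the same operator up to a constant. It is the propagation at time 0, which
  makes the continuity results above available.\<close>

abbreviation hankel :: "nat \<Rightarrow> (real \<Rightarrow> complex) \<Rightarrow> real \<Rightarrow> complex" where
  "hankel n \<phi> \<equiv> spec_prop n \<phi> 0"

lemma hankel_def: "hankel n \<phi> \<xi> = (LINT s:{0..}|lborel. of_real (sj ((real n - 2) / 2) (s * \<xi>) * s ^ (n - 1)) * \<phi> s)"
  by (simp add: spec_prop_def cexp_def mult_ac)

lemma rapid_set_integrable:
  assumes "rapid g" "p \<in> borel_measurable borel" "\<And>x. norm (p x) \<le> K * (1 + \<bar>x\<bar>) ^ N"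
  shows "set_integrable lborel {0..} (\<lambda>x. p x * g x)"
  unfolding set_integrable_def by (rule integrable_mult_indicator[OF _ rapid_integrable[OF assms]]) simp

context
  fixes n :: nat and \<nu> :: real
  defines "\<nu> \<equiv> (real n - 2) / 2"
  assumes n: "n \<ge> 2"
begin

lemma hankel_order_nonneg: "\<nu> \<ge> 0" using n by (simp add: \<nu>_def)

lemma sj_power_bound:
  obtains D where "D > 0" "\<And>\<xi> s. norm (complex_of_real (sj \<nu> (s * \<xi>) * s ^ k)) \<le> D * (1 + \<bar>s\<bar>) ^ k"
proof -
  obtain D where D: "D > 0" "\<And>z. \<bar>sj \<nu> z\<bar> \<le> D" by (rule sj_bounded_all[OF hankel_order_nonneg]) blast
  show ?thesis
  proof (rule that[OF D(1)])
    fix \<xi> s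
    have "\<bar>sj \<nu> (s * \<xi>)\<bar> * \<bar>s\<bar> ^ k \<le> D * (1 + \<bar>s\<bar>) ^ k"
      using D by (intro mult_mono power_mono) auto
    then show "norm (complex_of_real (sj \<nu> (s * \<xi>) * s ^ k)) \<le> D * (1 + \<bar>s\<bar>) ^ k"
      by (simp add: norm_mult norm_power)
  qed
qed

lemma hankel_integrable:
  assumes "rapid \<phi>"
  shows "set_integrable lborel {0..} (\<lambda>s. of_real (sj \<nu> (s * \<xi>) * s ^ k) * \<phi> s)"
proof -
  note sj_measurable[OF hankel_order_nonneg, measurable]
  obtain D where D: "D > 0" "\<And>\<xi> s. norm (complex_of_real (sj \<nu> (s * \<xi>) * s ^ k)) \<le> D * (1 + \<bar>s\<bar>) ^ k"
    by (rule sj_power_bound) blast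
  show ?thesis by (rule rapid_set_integrable[OF assms _ D(2)]) measurable
qed

lemma hankel_bounded:
  assumes "rapid \<phi>"
  shows "\<exists>C. \<forall>\<xi>. norm (hankel n \<phi> \<xi>) \<le> C"
proof -
  obtain D where D: "D > 0" "\<And>z. \<bar>sj \<nu> z\<bar> \<le> D" by (rule sj_bounded_all[OF hankel_order_nonneg]) blast
  have i: "set_integrable lborel {0..} (\<lambda>s. complex_of_real (s ^ (n - 1)) * \<phi> s)"
    by (rule rapid_set_integrable[OF assms _ power_le_1_plus]) measurable
  have "norm (hankel n \<phi> \<xi>) \<le> (LINT s:{0..}|lborel. D * norm (complex_of_real (s ^ (n - 1)) * \<phi> s))" for \<xi>
  proof -
    have h: "set_integrable lborel {0..} (\<lambda>s. of_real (sj \<nu> (s * \<xi>) * s ^ (n - 1)) * \<phi> s)" by (rule hankel_integrable[OF assms])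
    have "norm (hankel n \<phi> \<xi>) \<le> (LINT s:{0..}|lborel. norm (of_real (sj \<nu> (s * \<xi>) * s ^ (n - 1)) * \<phi> s))"
      unfolding hankel_def \<nu>_def[symmetric] by (rule set_integral_norm_bound[OF h])
    also have "\<dots> \<le> (LINT s:{0..}|lborel. D * norm (complex_of_real (s ^ (n - 1)) * \<phi> s))"
    proof (rule set_integral_mono)
      show "set_integrable lborel {0..} (\<lambda>s. norm (of_real (sj \<nu> (s * \<xi>) * s ^ (n - 1)) * \<phi> s))" by (rule set_integrable_norm[OF h])
      show "set_integrable lborel {0..} (\<lambda>s. D * norm (complex_of_real (s ^ (n - 1)) * \<phi> s))"
        using set_integrable_norm[OF i] by simp
      show "norm (of_real (sj \<nu> (s * \<xi>) * s ^ (n - 1)) * \<phi> s) \<le> D * norm (complex_of_real (s ^ (n - 1)) * \<phi> s)" for s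
        using mult_right_mono[OF D(2)[of "s * \<xi>"], of "norm (complex_of_real (s ^ (n - 1)) * \<phi> s)"]
        by (simp add: norm_mult mult_ac)
    qed
    finally show ?thesis .
  qed
  then show ?thesis by blast
qed

lemma hankel_continuous: "rapid \<phi> \<Longrightarrow> continuous_on UNIV (hankel n \<phi>)"
  by (rule continuous_on_sequentiallyI) (auto intro!: spec_prop_tendsto n simp: o_def)

text \<open>Green's formula on the half line. By \<open>sj_ode\<close> the function
  \<open>sj \<nu> (s * \<xi>)\<close> of \<open>s\<close> is an eigenfunction of the radial
  Laplacian with eigenvalue \<open>- \<xi>\<^sup>2\<close>, and \<open>\<psi>\<close> is the radial
  Laplacian of \<open>\<phi>\<close>. The auxiliary \<open>F\<close> is the Wronskian of
  \<open>\<phi>\<close> and this kernel, times \<open>s ^ (n - 1)\<close>; it vanishes at 0 because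
  \<open>n \<ge> 2\<close>, and at infinity by decay.\<close>

lemma sj_laplacian_sq:
  assumes "\<phi> \<in> even_schwartz"
  obtains \<psi> where "\<psi> \<in> even_schwartz" "\<And>\<xi>. \<xi>\<^sup>2 * hankel n \<phi> \<xi> = - hankel n \<psi> \<xi>"
proof -
  obtain \<phi>1 \<phi>2 \<omega> where L:
    "\<And>x. (\<phi> has_vector_derivative \<phi>1 x) (at x)" "\<And>x. (\<phi>1 has_vector_derivative \<phi>2 x) (at x)"
    "\<And>x. \<phi>1 x = of_real x * \<omega> x" "\<And>m. \<exists>C. \<forall>x. \<bar>x\<bar> ^ m * norm (\<phi>1 x) \<le> C"
    "\<And>c. (\<lambda>x. \<phi>2 x + c * \<omega> x) \<in> even_schwartz"
    using even_schwartz_radial_laplacian[OF assms] by blast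
  define \<psi> where "\<psi> x = \<phi>2 x + of_real (real (n - 1)) * \<omega> x" for x
  have \<psi>: "\<psi> \<in> even_schwartz" unfolding \<psi>_def by (rule L(5))
  have r: "rapid \<phi>" "rapid \<psi>" using assms \<psi> by (auto intro: even_schwartz_rapid)
  obtain D where D: "D > 0" "\<And>z. z \<ge> 0 \<Longrightarrow> \<bar>sj \<nu> z\<bar> \<le> D \<and> \<bar>sj1 \<nu> z\<bar>
      \<le> D" using sj_bounded[OF hankel_order_nonneg] by blast
  have n1: "2 * \<nu> + 1 = real (n - 1)" using n by (simp add: \<nu>_def of_nat_diff field_simps)
  have pos: "\<xi>\<^sup>2 * hankel n \<phi> \<xi> = - hankel n \<psi> \<xi>" if xi: "\<xi> \<ge> 0" for \<xi>
  proof -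
    define f where "f s = - (of_real (\<xi>\<^sup>2) * (of_real (sj \<nu> (s * \<xi>) * s ^ (n - 1)) * \<phi> s)
        + of_real (sj \<nu> (s * \<xi>) * s ^ (n - 1)) * \<psi> s)" for s
    define F where "F s = of_real (s ^ (n - 1)) * (\<phi> s * of_real (\<xi> * sj1 \<nu> (s * \<xi>)) - \<phi>1 s * of_real (sj \<nu> (s * \<xi>)))" for s
    have c: "continuous_on S \<phi>" "continuous_on S \<psi>" for S
      using r continuous_on_subset unfolding rapid_def by blast+
    have i: "set_integrable lborel {0..} (\<lambda>s. of_real (sj \<nu> (s * \<xi>) * s ^ (n - 1)) * \<phi> s)"
      "set_integrable lborel {0..} (\<lambda>s. of_real (sj \<nu> (s * \<xi>) * s ^ (n - 1)) * \<psi> s)"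
      by (rule hankel_integrable[OF r(1)], rule hankel_integrable[OF r(2)])
    have fi: "set_integrable lborel {0..} f"
      using set_integral_add(1)[OF set_integrable_mult_right[OF i(1), of "of_real (\<xi>\<^sup>2)"] i(2)]
      unfolding f_def set_integrable_def scaleR_minus_right by (rule Bochner_Integration.integrable_minus)
    have "(LINT s:{0..}|lborel. f s) = - F 0"
    proof (rule set_integral_FTC_half_line[OF fi])
      show "continuous_on {0..} f" unfolding f_def by (intro continuous_intros c continuous_on_sj[OF hankel_order_nonneg])
      show "(F \<longlongrightarrow> 0) at_top"
      proof -
        obtain A where A: "\<And>x. \<bar>x\<bar> ^ n * norm (\<phi>1 x) \<le> A" using L(4) by blast
        obtain B where B: "\<And>x. (1 + \<bar>x\<bar>) ^ n * norm (\<phi> x) \<le> B" using r(1) unfolding rapid_def by blast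
        show ?thesis
        proof (rule at_top_tendsto_0I)
          fix x :: real assume x: "x \<ge> 1"
          have xp: "x * x ^ (n - 1) = x ^ n" using n by (metis One_nat_def Suc_1 Suc_le_lessD less_imp_le_nat not0_implies_Suc not_less_eq_eq
              power_eq_if power_minus_mult mult.commute zero_less_iff_neq_zero)
          have B': "x ^ n * norm (\<phi> x) \<le> B"
            by (rule order_trans[OF mult_right_mono B[of x]]) (use x in \<open>auto intro: power_mono\<close>)
          have A': "x ^ n * norm (\<phi>1 x) \<le> A" using A[of x] x by simp
          have "norm (\<phi> x * of_real (\<xi> * sj1 \<nu> (x * \<xi>)) - \<phi>1 x * of_real (sj \<nu> (x * \<xi>)))
              \<le> norm (\<phi> x) * (\<xi> * D) + norm (\<phi>1 x) * D"
          proof (intro norm_triangle_le_diff add_mono)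
            show "norm (\<phi> x * of_real (\<xi> * sj1 \<nu> (x * \<xi>))) \<le> norm (\<phi> x) * (\<xi> * D)"
              unfolding norm_mult norm_of_real abs_mult using D(2)[of "x * \<xi>"] x xi
              by (intro mult_left_mono mult_mono) auto
            show "norm (\<phi>1 x * of_real (sj \<nu> (x * \<xi>))) \<le> norm (\<phi>1 x) * D"
              unfolding norm_mult norm_of_real using D(2)[of "x * \<xi>"] x xi
              by (intro mult_left_mono) auto
          qed
          then have "x * norm (F x) \<le> x * (x ^ (n - 1) * (norm (\<phi> x) * (\<xi> * D) + norm (\<phi>1 x) * D))"
            unfolding F_def norm_mult using x by (intro mult_left_mono mult_mono) (auto simp: norm_power)
          also have "\<dots> = (x ^ n * norm (\<phi> x)) * (\<xi> * D) + (x ^ n * norm (\<phi>1 x)) * D"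
            unfolding xp[symmetric] by (simp add: algebra_simps)
          also have "\<dots> \<le> B * (\<xi> * D) + A * D"
            using A' B' D(1) xi by (intro add_mono mult_right_mono) auto
          finally show "norm (F x) \<le> (B * (\<xi> * D) + A * D) / x" using x by (simp add: field_simps)
        qed
      qed
      fix s :: real assume s: "s \<ge> 0"
      have d1: "((\<lambda>s. complex_of_real (s ^ (n - 1))) has_vector_derivative of_real (real (n - 1) * s ^ (n - 2))) (at s)"
        by (rule has_vector_derivative_of_real) (auto intro!: derivative_eq_intros simp: numeral_2_eq_2)
      have d2: "((\<lambda>s. complex_of_real (\<xi> * sj1 \<nu> (s * \<xi>))) has_vector_derivative of_real (\<xi> * (sj2 \<nu> (s * \<xi>) * \<xi>))) (at s)"
        by (rule has_vector_derivative_of_real) (auto intro!: derivative_eq_intros DERIV_chain2[OF sj1_deriv[OF hankel_order_nonneg]])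
      have d3: "((\<lambda>s. complex_of_real (sj \<nu> (s * \<xi>))) has_vector_derivative of_real (sj1 \<nu> (s * \<xi>) * \<xi>)) (at s)"
        by (rule has_vector_derivative_of_real) (auto intro!: derivative_eq_intros DERIV_chain2[OF sj_deriv[OF hankel_order_nonneg]])
      have "(F has_vector_derivative (of_real (s ^ (n - 1)) * ((\<phi> s * of_real (\<xi> * (sj2 \<nu> (s * \<xi>) * \<xi>))
          + \<phi>1 s * of_real (\<xi> * sj1 \<nu> (s * \<xi>)))
           - (\<phi>1 s * of_real (sj1 \<nu> (s * \<xi>) * \<xi>) + \<phi>2 s * of_real (sj \<nu> (s * \<xi>))))
         + of_real (real (n - 1) * s ^ (n - 2)) * (\<phi> s * of_real (\<xi> * sj1 \<nu> (s * \<xi>)) - \<phi>1 s * of_real (sj \<nu> (s * \<xi>))))) (at s)"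
        unfolding F_def by (intro has_vector_derivative_mult has_vector_derivative_diff d1 d2 d3 L(1,2))
      moreover have "of_real (s ^ (n - 1)) * ((\<phi> s * of_real (\<xi> * (sj2 \<nu> (s * \<xi>) * \<xi>)) + \<phi>1 s * of_real (\<xi> * sj1 \<nu> (s * \<xi>)))
           - (\<phi>1 s * of_real (sj1 \<nu> (s * \<xi>) * \<xi>) + \<phi>2 s * of_real (sj \<nu> (s * \<xi>))))
         + of_real (real (n - 1) * s ^ (n - 2)) * (\<phi> s * of_real (\<xi> * sj1 \<nu> (s * \<xi>)) - \<phi>1 s * of_real (sj \<nu> (s * \<xi>))) = f s"
      proof -
        obtain j where "n = 2 + j" using n le_Suc_ex by blast
        then have j: "n = Suc (Suc j)" by simp
        have ode: "s * (\<xi> * sj2 \<nu> (s * \<xi>)) = - real (n - 1) * sj1 \<nu> (s * \<xi>) - s * \<xi> * sj \<nu> (s * \<xi>)"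
          using sj_ode[OF hankel_order_nonneg, of "s * \<xi>"] unfolding n1 by (simp add: algebra_simps)
        have "of_real (s ^ (n - 1)) * (\<phi> s * of_real (\<xi> * (sj2 \<nu> (s * \<xi>) * \<xi>)))
            = of_real (s ^ j * \<xi> * (s * (\<xi> * sj2 \<nu> (s * \<xi>)))) * \<phi> s"
          by (simp add: j mult_ac)
        also have "\<dots> = of_real (s ^ j * \<xi> * (- real (n - 1) * sj1 \<nu> (s * \<xi>) - s * \<xi> * sj \<nu> (s * \<xi>))) * \<phi> s"
          unfolding ode ..
        finally have "of_real (s ^ (n - 1)) * (\<phi> s * of_real (\<xi> * (sj2 \<nu> (s * \<xi>) * \<xi>)))
          = of_real (s ^ j * \<xi> * (- real (n - 1) * sj1 \<nu> (s * \<xi>) - s * \<xi> * sj \<nu> (s * \<xi>))) * \<phi> s" .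
        then show ?thesis unfolding f_def \<psi>_def L(3)
          by (simp add: j algebra_simps power2_eq_square)
      qed
      ultimately show "(F has_vector_derivative f s) (at s)" by simp
    qed
    also have "F 0 = 0" unfolding F_def using n by simp
    also have "(LINT s:{0..}|lborel. f s) = - (\<xi>\<^sup>2 * hankel n \<phi> \<xi> + hankel n \<psi> \<xi>)"
    proof -
      let ?A = "\<lambda>s. of_real (sj \<nu> (s * \<xi>) * s ^ (n - 1)) * \<phi> s"
      let ?B = "\<lambda>s. of_real (sj \<nu> (s * \<xi>) * s ^ (n - 1)) * \<psi> s"
      have "(LINT s:{0..}|lborel. f s) = - (LINT s:{0..}|lborel. of_real (\<xi>\<^sup>2) * ?A s + ?B s)"
        unfolding f_def set_lebesgue_integral_def scaleR_minus_right by (rule Bochner_Integration.integral_minus)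
      also have "(LINT s:{0..}|lborel. of_real (\<xi>\<^sup>2) * ?A s + ?B s) = (LINT s:{0..}|lborel. of_real (\<xi>\<^sup>2) * ?A s) + (LINT s:{0..}|lborel. ?B s)"
        by (rule set_integral_add(2)[OF set_integrable_mult_right[OF i(1)] i(2)])
      also have "(LINT s:{0..}|lborel. of_real (\<xi>\<^sup>2) * ?A s) = of_real (\<xi>\<^sup>2) * (LINT s:{0..}|lborel. ?A s)"
        by (rule set_integral_mult_right)
      finally show ?thesis unfolding hankel_def \<nu>_def[symmetric] by simp
    qed
    finally have "\<xi>\<^sup>2 * hankel n \<phi> \<xi> + hankel n \<psi> \<xi> = 0" by (simp only: neg_equal_iff_equal)
    then show ?thesis by (simp only: of_real_power eq_neg_iff_add_eq_0)
  qed
  \<comment> \<open>The boundary terms were estimated for nonnegative frequencies, where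
    \<open>D\<close> bounds \<open>sj1\<close>; evenness of the transform gives the rest.\<close>
  have ev: "hankel n g (- \<xi>) = hankel n g \<xi>" for g \<xi> by (simp add: hankel_def sj_def)
  show ?thesis
  proof (rule that[OF \<psi>])
    show "\<xi>\<^sup>2 * hankel n \<phi> \<xi> = - hankel n \<psi> \<xi>" for \<xi>
      using pos[of \<xi>] pos[of "- \<xi>"] ev by (cases "\<xi> \<ge> 0") auto
  qed
qed

text \<open>Each radial Laplacian on the function side produces a factor
  \<open>\<xi>\<^sup>2\<close> on the spectral side, and the transform of an even Schwartz function
  is bounded. Iteration gives all even powers, and the power \<open>m\<close> is dominated by 1 plus
  the power \<open>2 * m\<close>.\<close>

lemma hankel_rapid:
  assumes "\<phi> \<in> even_schwartz"
  shows "rapid (hankel n \<phi>)"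
proof (rule rapidI)
  show "continuous_on UNIV (hankel n \<phi>)" using assms by (intro hankel_continuous even_schwartz_rapid)
  have even: "\<exists>C. \<forall>\<xi>. \<bar>\<xi>\<bar> ^ (2 * N) * norm (hankel n \<phi> \<xi>) \<le> C" if "\<phi> \<in> even_schwartz" for N \<phi>
    using that
  proof (induction N arbitrary: \<phi>)
    case 0 then show ?case using hankel_bounded[OF even_schwartz_rapid[OF 0]] by simp
  next
    case (Suc N)
    obtain \<psi> where \<psi>: "\<psi> \<in> even_schwartz" "\<And>\<xi>. \<xi>\<^sup>2 * hankel n \<phi> \<xi> = - hankel n \<psi> \<xi>"
      using sj_laplacian_sq[OF Suc.prems] by blast
    have "\<bar>\<xi>\<bar> ^ (2 * Suc N) * norm (hankel n \<phi> \<xi>) = \<bar>\<xi>\<bar> ^ (2 * N) * norm (hankel n \<psi> \<xi>)" for \<xi>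
    proof -
      have "hankel n \<psi> \<xi> = - (\<xi>\<^sup>2 * hankel n \<phi> \<xi>)" using \<psi>(2)[of \<xi>] by simp
      then show ?thesis by (simp add: norm_mult norm_power power_add power2_eq_square)
    qed
    then show ?case using Suc.IH[OF \<psi>(1)] by (simp only:)
  qed
  fix m :: nat
  obtain C where C: "\<And>\<xi>. \<bar>\<xi>\<bar> ^ (2 * m) * norm (hankel n \<phi> \<xi>) \<le> C" using even[OF assms] by blast
  obtain C0 where C0: "\<And>\<xi>. \<bar>\<xi>\<bar> ^ (2 * 0) * norm (hankel n \<phi> \<xi>) \<le> C0" using even[OF assms] by blast
  have "\<bar>\<xi>\<bar> ^ m * norm (hankel n \<phi> \<xi>) \<le> C0 + C" for \<xi>
  proof -
    have "\<bar>\<xi>\<bar> ^ m \<le> 1 + \<bar>\<xi>\<bar> ^ (2 * m)"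
    proof -
      have e: "\<bar>\<xi>\<bar> ^ (2 * m) = (\<bar>\<xi>\<bar> ^ m)\<^sup>2" by (simp add: mult_2 power_add power2_eq_square)
      have "2 * \<bar>\<xi>\<bar> ^ m \<le> (\<bar>\<xi>\<bar> ^ m)\<^sup>2 + 1" using sum_squares_bound[of "\<bar>\<xi>\<bar> ^ m" 1] by simp
      moreover have "0 \<le> \<bar>\<xi>\<bar> ^ m" by simp
      ultimately show ?thesis unfolding e by linarith
    qed
    then have "\<bar>\<xi>\<bar> ^ m * norm (hankel n \<phi> \<xi>) \<le> (1 + \<bar>\<xi>\<bar> ^ (2 * m)) * norm (hankel n \<phi> \<xi>)" by (rule mult_right_mono) simp
    also have "\<dots> \<le> C0 + C" using C0[of \<xi>] C[of \<xi>] by (simp add: algebra_simps)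
    finally show ?thesis .
  qed
  then show "\<exists>C. \<forall>\<xi>. \<bar>\<xi>\<bar> ^ m * norm (hankel n \<phi> \<xi>) \<le> C" by blast
qed

text \<open>Fubini with a bounded kernel that is symmetric in radius and frequency. The pairing is
  bilinear, without conjugation.\<close>

lemma hankel_self_adjoint:
  assumes "rapid \<phi>" "rapid \<psi>"
  shows "(LINT \<xi>:{0..}|lborel. hankel n \<phi> \<xi> * \<psi> \<xi> * of_real (\<xi> ^ (n - 1)))
       = (LINT s:{0..}|lborel. \<phi> s * hankel n \<psi> s * of_real (s ^ (n - 1)))"
proof -
  note sj_measurable[OF hankel_order_nonneg, measurable] assms[THEN rapid_measurable, measurable]
  obtain D where D: "D > 0" "\<And>z. \<bar>sj \<nu> z\<bar> \<le> D" by (rule sj_bounded_all[OF hankel_order_nonneg]) blast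
  define p where "p s = indicator {0..} s *\<^sub>R (complex_of_real (s ^ (n - 1)) * \<phi> s)" for s
  define q where "q s = indicator {0..} s *\<^sub>R (complex_of_real (s ^ (n - 1)) * \<psi> s)" for s
  have [measurable]: "p \<in> borel_measurable borel" "q \<in> borel_measurable borel" unfolding p_def q_def by measurable
  have ip: "integrable lborel p" and iq: "integrable lborel q"
    using rapid_set_integrable[OF assms(1) _ power_le_1_plus] rapid_set_integrable[OF assms(2) _ power_le_1_plus]
    unfolding set_integrable_def p_def q_def by simp_all
  have i2: "integrable (lborel \<Otimes>\<^sub>M lborel) (\<lambda>(s, \<xi>). of_real (sj \<nu> (s * \<xi>)) * (p s * q \<xi>))"
  proof (rule Bochner_Integration.integrable_bound)
    show "integrable (lborel \<Otimes>\<^sub>M lborel) (\<lambda>(s, \<xi>). of_real D * (p s * q \<xi>))"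
    proof (rule lborel_pair.Fubini_integrable)
      show "integrable lborel (\<lambda>s. \<integral>\<xi>. norm (case (s, \<xi>) of (s, \<xi>) \<Rightarrow> of_real D * (p s * q \<xi>)) \<partial>lborel)"
        using ip iq by (simp add: norm_mult)
      show "AE s in lborel. integrable lborel (\<lambda>\<xi>. case (s, \<xi>) of (s, \<xi>) \<Rightarrow> of_real D * (p s * q \<xi>))"
        using iq by (intro AE_I2) simp
    qed measurable
    show "AE x in lborel \<Otimes>\<^sub>M lborel. norm (case x of (s, \<xi>) \<Rightarrow> of_real (sj \<nu> (s * \<xi>)) * (p s * q \<xi>))
        \<le> norm (case x of (s, \<xi>) \<Rightarrow> of_real D * (p s * q \<xi>))"
      using D by (intro AE_I2) (auto simp: norm_mult intro!: mult_right_mono)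
  qed measurable
  have "(LINT \<xi>:{0..}|lborel. hankel n \<phi> \<xi> * \<psi> \<xi> * of_real (\<xi> ^ (n - 1)))
     = (\<integral>\<xi>. (\<integral>s. of_real (sj \<nu> (s * \<xi>)) * (p s * q \<xi>) \<partial>lborel) \<partial>lborel)"
    unfolding set_lebesgue_integral_def[of _ "{0..}" "\<lambda>\<xi>. hankel n \<phi> \<xi> * \<psi> \<xi> * of_real (\<xi> ^ (n - 1))"]
  proof (rule Bochner_Integration.integral_cong[OF refl])
    fix \<xi>
    have "(\<integral>s. of_real (sj \<nu> (s * \<xi>)) * (p s * q \<xi>) \<partial>lborel)
        = (\<integral>s. indicator {0..} s *\<^sub>R (of_real (sj \<nu> (s * \<xi>) * s ^ (n - 1)) * \<phi> s) * q \<xi> \<partial>lborel)"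
      by (rule Bochner_Integration.integral_cong) (auto simp: p_def q_def indicator_def mult_ac)
    also have "\<dots> = hankel n \<phi> \<xi> * q \<xi>"
      unfolding hankel_def \<nu>_def[symmetric] set_lebesgue_integral_def by (rule integral_mult_left_zero)
    finally show "indicator {0..} \<xi> *\<^sub>R (hankel n \<phi> \<xi> * \<psi> \<xi> * of_real (\<xi> ^ (n - 1)))
        = (\<integral>s. of_real (sj \<nu> (s * \<xi>)) * (p s * q \<xi>) \<partial>lborel)"
      by (simp add: p_def q_def mult_ac)
  qed
  also have "\<dots> = (\<integral>s. (\<integral>\<xi>. of_real (sj \<nu> (s * \<xi>)) * (p s * q \<xi>) \<partial>lborel) \<partial>lborel)"
    by (rule lborel_pair.Fubini_integral[OF i2])
  also have "\<dots> = (LINT s:{0..}|lborel. \<phi> s * hankel n \<psi> s * of_real (s ^ (n - 1)))"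
    unfolding set_lebesgue_integral_def[of _ "{0..}" "\<lambda>s. \<phi> s * hankel n \<psi> s * of_real (s ^ (n - 1))"]
  proof (rule Bochner_Integration.integral_cong[OF refl])
    fix s
    have "(\<integral>\<xi>. of_real (sj \<nu> (s * \<xi>)) * (p s * q \<xi>) \<partial>lborel)
        = (\<integral>\<xi>. indicator {0..} \<xi> *\<^sub>R (of_real (sj \<nu> (\<xi> * s) * \<xi> ^ (n - 1)) * \<psi> \<xi>) * p s \<partial>lborel)"
      by (rule Bochner_Integration.integral_cong) (auto simp: p_def q_def indicator_def mult_ac)
    also have "\<dots> = hankel n \<psi> s * p s"
      unfolding hankel_def \<nu>_def[symmetric] set_lebesgue_integral_def by (rule integral_mult_left_zero)
    finally show "(\<integral>\<xi>. of_real (sj \<nu> (s * \<xi>)) * (p s * q \<xi>) \<partial>lborel)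
        = indicator {0..} s *\<^sub>R (\<phi> s * hankel n \<psi> s * of_real (s ^ (n - 1)))"
      by (simp add: p_def q_def mult_ac)
  qed
  finally show ?thesis .
qed

end

subsection \<open>Hankel inversion and the Plancherel formula\<close>

definition gauss :: "real \<Rightarrow> real \<Rightarrow> complex" where "gauss a s = of_real (exp (- (a * s\<^sup>2)))"

definition gauss_moment :: "real \<Rightarrow> nat \<Rightarrow> real" where
  "gauss_moment a j = (LINT s:{0..}|lborel. s ^ j * exp (- (a * s\<^sup>2)))"

text \<open>The inequality \<open>y ^ N \<le> fact N * exp y\<close>, from a single term of the
  exponential series, is applied to \<open>y = a * (1 + x\<^sup>2)\<close>.\<close>

lemma gauss_rapid:
  assumes a: "a > 0"
  shows "rapid (gauss a)"
  unfolding rapid_def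
proof (intro conjI allI exI)
  show "continuous_on UNIV (gauss a)" unfolding gauss_def[abs_def] by (intro continuous_intros)
  fix N :: nat and x :: real
  have pos: "1 + x\<^sup>2 \<ge> 0" by (simp add: add_nonneg_nonneg)
  have "1 + \<bar>x\<bar> \<le> 2 * (1 + x\<^sup>2)"
  proof -
    have "2 * \<bar>x\<bar> \<le> x\<^sup>2 + 1" using sum_squares_bound[of "\<bar>x\<bar>" 1] by simp
    moreover have "0 \<le> x\<^sup>2" by simp
    ultimately have "1 + \<bar>x\<bar> \<le> 2 + 2 * x\<^sup>2" by linarith
    then show ?thesis by (simp add: distrib_left)
  qed
  then have "(1 + \<bar>x\<bar>) ^ N \<le> (2 * (1 + x\<^sup>2)) ^ N" by (intro power_mono) auto
  also have "\<dots> = (2 / a) ^ N * (a * (1 + x\<^sup>2)) ^ N" using a by (simp flip: power_mult_distrib)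
  also have "(a * (1 + x\<^sup>2)) ^ N \<le> fact N * exp (a * (1 + x\<^sup>2))"
  proof -
    have y: "0 \<le> a * (1 + x\<^sup>2)" using a pos by simp
    have "(\<lambda>k. inverse (fact k) *\<^sub>R (a * (1 + x\<^sup>2)) ^ k) N \<le> (\<Sum>k. inverse (fact k) *\<^sub>R (a * (1 + x\<^sup>2)) ^ k)"
      using sum_le_suminf[OF summable_exp_generic[of "a * (1 + x\<^sup>2)"], of "{N}"] y by simp
    then show ?thesis by (simp add: exp_def field_simps)
  qed
  finally have "(1 + \<bar>x\<bar>) ^ N \<le> (2 / a) ^ N * (fact N * exp (a * (1 + x\<^sup>2)))"
    using a by (simp add: mult_left_mono)
  then have "(1 + \<bar>x\<bar>) ^ N * exp (- (a * x\<^sup>2)) \<le> (2 / a) ^ N * (fact N * exp (a * (1 + x\<^sup>2))) * exp (- (a * x\<^sup>2))"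
    by (rule mult_right_mono) simp
  also have "\<dots> = (2 / a) ^ N * (fact N * (exp (a * (1 + x\<^sup>2)) * exp (- (a * x\<^sup>2))))" by simp
  also have "exp (a * (1 + x\<^sup>2)) * exp (- (a * x\<^sup>2)) = exp a" by (simp add: algebra_simps flip: exp_add)
  finally show "(1 + \<bar>x\<bar>) ^ N * norm (gauss a x) \<le> (2 / a) ^ N * (fact N * exp a)" by (simp add: gauss_def)
qed

lemma gauss_moment_integrable:
  fixes a :: real
  assumes a: "a > 0"
  shows "set_integrable lborel {0..} (\<lambda>s. s ^ j * exp (- (a * s\<^sup>2)))"
proof -
  have "set_integrable lborel {0..} (\<lambda>s. complex_of_real (s ^ j) * gauss a s)"
    by (rule rapid_set_integrable[OF gauss_rapid[OF a] _ power_le_1_plus]) measurable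
  then have "integrable lborel (\<lambda>s. complex_of_real (indicator {0..} s *\<^sub>R (s ^ j * exp (- (a * s\<^sup>2)))))"
    unfolding set_integrable_def gauss_def by (simp add: scaleR_conv_of_real)
  then show ?thesis unfolding set_integrable_def by (simp only: complex_of_real_integrable_eq)
qed

text \<open>The derivative of \<open>s ^ (j + 1) * exp (- (a * s\<^sup>2))\<close> integrates to 0
  over the half line. Together with \<open>sj_coeff_Suc\<close> this recurrence gives the transform
  of a Gaussian while the first moment stays unevaluated.\<close>

lemma gauss_moment_Suc_Suc:
  assumes a: "a > 0"
  shows "gauss_moment a (j + 2) = (real j + 1) / (2 * a) * gauss_moment a j"
proof -
  let ?e = "\<lambda>s. exp (- (a * s\<^sup>2))"
  note i = gauss_moment_integrable[OF a]
  have "(LINT s:{0..}|lborel. (real j + 1) * (s ^ j * ?e s) - (2 * a) * (s ^ (j + 2) * ?e s)) = - (0 ^ (j + 1) * ?e 0)"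
  proof (rule set_integral_FTC_half_line[where F = "\<lambda>s. s ^ (j + 1) * ?e s"])
    show "set_integrable lborel {0..} (\<lambda>s. (real j + 1) * (s ^ j * ?e s) - (2 * a) * (s ^ (j + 2) * ?e s))"
      by (intro set_integral_diff(1) set_integrable_mult_right i)
    show "((\<lambda>s. s ^ (j + 1) * ?e s) has_vector_derivative (real j + 1) * (s ^ j * ?e s) - (2 * a) * (s ^ (j + 2) * ?e s)) (at s)" for s
    proof -
      have 1: "((\<lambda>s. s ^ (j + 1)) has_real_derivative (real j + 1) * s ^ j) (at s)"
        using DERIV_pow[of "j + 1" s UNIV] by (simp add: add.commute)
      have 2: "(?e has_real_derivative - (2 * a * s) * ?e s) (at s)"
        by (auto intro!: derivative_eq_intros)
      from DERIV_mult[OF 1 2] show ?thesis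
        unfolding has_real_derivative_iff_has_vector_derivative[symmetric]
        by (simp add: algebra_simps power2_eq_square)
    qed
    show "continuous_on {0..} (\<lambda>s. (real j + 1) * (s ^ j * ?e s) - (2 * a) * (s ^ (j + 2) * ?e s))"
      by (intro continuous_intros)
    obtain C where C: "\<And>x. (1 + \<bar>x\<bar>) ^ (j + 2) * norm (gauss a x) \<le> C"
      using gauss_rapid[OF a] unfolding rapid_def by blast
    show "((\<lambda>s. s ^ (j + 1) * ?e s) \<longlongrightarrow> 0) at_top"
    proof (rule at_top_tendsto_0I)
      fix x :: real assume x: "x \<ge> 1"
      have "x ^ (j + 2) * ?e x \<le> (1 + \<bar>x\<bar>) ^ (j + 2) * ?e x" using x by (intro mult_right_mono power_mono) auto
      also have "\<dots> \<le> C" using C[of x] by (simp add: gauss_def)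
      finally show "norm (x ^ (j + 1) * ?e x) \<le> C / x" using x by (simp add: field_simps)
    qed
  qed
  also have "(LINT s:{0..}|lborel. (real j + 1) * (s ^ j * ?e s) - (2 * a) * (s ^ (j + 2) * ?e s))
     = (real j + 1) * gauss_moment a j - (2 * a) * gauss_moment a (j + 2)"
    unfolding gauss_moment_def
    by (subst set_integral_diff(2)) (auto intro!: set_integrable_mult_right i simp del: power_Suc)
  finally show ?thesis using a by (simp add: field_simps)
qed

lemma gauss_moment_scale:
  assumes b: "b > 0"
  shows "gauss_moment (b\<^sup>2) j * b ^ (j + 1) = gauss_moment 1 j"
proof -
  let ?f = "\<lambda>s. indicator {0..} s *\<^sub>R (s ^ j * exp (- (b\<^sup>2 * s\<^sup>2)))"
  have "gauss_moment (b\<^sup>2) j = \<bar>1 / b\<bar> *\<^sub>R (\<integral>x. ?f (0 + 1 / b * x) \<partial>lborel)"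
    unfolding gauss_moment_def set_lebesgue_integral_def by (rule lborel_integral_real_affine) (use b in simp)
  also have "(\<integral>x. ?f (0 + 1 / b * x) \<partial>lborel)
      = (\<integral>x. (1 / b) ^ j * (indicator {0..} x *\<^sub>R (x ^ j * exp (- (1 * x\<^sup>2)))) \<partial>lborel)"
    using b by (intro Bochner_Integration.integral_cong) (auto simp: indicator_def power_divide zero_le_divide_iff power_mult_distrib)
  also have "\<dots> = (1 / b) ^ j * gauss_moment 1 j"
    unfolding gauss_moment_def set_lebesgue_integral_def by (rule integral_mult_right_zero)
  finally show ?thesis using b by (simp add: power_divide)
qed

lemma gauss_moment_pos:
  assumes a: "a > 0"
  shows "gauss_moment a j > 0"
proof -
  let ?f = "\<lambda>s. indicator {0..} s *\<^sub>R (s ^ j * exp (- (a * s\<^sup>2)))"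
  have i: "integrable lborel ?f" using gauss_moment_integrable[OF a] unfolding set_integrable_def .
  have nn: "AE s in lborel. 0 \<le> ?f s" by (intro AE_I2) (auto simp: indicator_def)
  have "gauss_moment a j \<ge> 0" unfolding gauss_moment_def set_lebesgue_integral_def by (rule integral_nonneg_AE[OF nn])
  moreover have "gauss_moment a j \<noteq> 0"
  proof
    assume "gauss_moment a j = 0"
    then have "AE s in lborel. ?f s = 0"
      unfolding gauss_moment_def set_lebesgue_integral_def using integral_nonneg_eq_0_iff_AE[OF i nn] by simp
    then have "AE s in lborel. s \<notin> {1..2::real}" by eventually_elim (auto simp: indicator_def)
    then have "emeasure lborel {1..2::real} = 0" by (subst (asm) AE_iff_measurable[where N = "{1..2}"]) auto
    then show False by simp
  qed
  ultimately show ?thesis by simp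
qed

lemma summable_abs_sj:
  assumes "\<nu> \<ge> 0"
  shows "summable (\<lambda>k. \<bar>sj_coeff \<nu> k\<bar> * \<bar>y\<bar> ^ k)"
proof (rule summable_comparison_test')
  show "summable (\<lambda>k. \<bar>sj_coeff \<nu> 0\<bar> * (inverse (fact k) * \<bar>y\<bar> ^ k))"
    by (intro summable_mult summable_exp)
  show "norm (\<bar>sj_coeff \<nu> k\<bar> * \<bar>y\<bar> ^ k) \<le> \<bar>sj_coeff \<nu> 0\<bar> * (inverse (fact k) * \<bar>y\<bar> ^ k)" for k
    using mult_right_mono[OF abs_sj_coeff_le[OF assms, of k], of "\<bar>y\<bar> ^ k"]
    by (simp add: abs_mult power_abs field_simps)
qed

lemma sj_coeff_0_pos: "\<nu> \<ge> 0 \<Longrightarrow> sj_coeff \<nu> 0 > 0"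
  by (auto simp: sj_coeff_def intro!: divide_pos_pos mult_pos_pos Gamma_real_pos)

text \<open>The Gaussian moments cancel the Gamma factors of the Bessel series, leaving an exponential series.\<close>

lemma hankel_gauss:
  assumes n: "n \<ge> 2" and a: "a > 0"
  shows "hankel n (gauss a) \<xi> = of_real (sj_coeff ((real n - 2) / 2) 0 * gauss_moment a (n - 1)) * gauss (1 / (4 * a)) \<xi>"
proof -
  define \<nu> where "\<nu> = (real n - 2) / 2"
  have nu: "\<nu> \<ge> 0" using n by (simp add: \<nu>_def)
  let ?c = "sj_coeff \<nu>" and ?e = "\<lambda>s. exp (- (a * s\<^sup>2))" and ?m = "gauss_moment a"
  \<comment> \<open>The quotient of consecutive coefficients is
    \<open>-1 / (4 * (k + 1) * (k + 1 + \<nu>))\<close>, that of moments two degrees apart is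
    \<open>(k + 1 + \<nu>) / a\<close>; the factor with \<open>\<nu>\<close> cancels.\<close>
  have cm: "?c k * ?m (n - 1 + 2 * k) = ?c 0 * ?m (n - 1) * ((- 1 / (4 * a)) ^ k / fact k)" for k
  proof (induction k)
    case (Suc k)
    have np: "real (n - 1 + 2 * k) + 1 = 2 * (real (Suc k) + \<nu>)" using n by (simp add: \<nu>_def of_nat_diff field_simps)
    have nz: "real (Suc k) + \<nu> > 0" using nu by simp
    have c1: "?c (Suc k) = - ?c k / (4 * real (Suc k) * (real (Suc k) + \<nu>))"
    proof -
      have "4 * real (Suc k) * (real (Suc k) + \<nu>) \<noteq> 0" using nz by simp
      then show ?thesis using sj_coeff_Suc[OF nu, of k] by (metis nonzero_mult_div_cancel_left)
    qed
    have m1: "?m (n - 1 + 2 * Suc k) = 2 * (real (Suc k) + \<nu>) / (2 * a) * ?m (n - 1 + 2 * k)"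
      using gauss_moment_Suc_Suc[OF a, of "n - 1 + 2 * k"] unfolding np by simp
    have "?c (Suc k) * ?m (n - 1 + 2 * Suc k) = (- 1 / (4 * a)) / real (Suc k) * (?c k * ?m (n - 1 + 2 * k))"
    proof -
      have alg: "(- c / (4 * K * B)) * (2 * B / (2 * a) * m) = (- 1 / (4 * a)) / K * (c * m)" if "K > 0" "B > 0" for c K B m :: real
        using that a by (simp add: divide_simps)
      show ?thesis unfolding c1 m1 by (rule alg) (use nz in auto)
    qed
    then show ?case unfolding Suc.IH by (simp del: of_nat_Suc)
  qed simp
  let ?f = "\<lambda>k s. indicator {0..} s *\<^sub>R (?c k * \<xi> ^ (2 * k) * (s ^ (n - 1 + 2 * k) * ?e s))"
  have int_f: "integrable lborel (?f k)" for k
    using set_integrable_mult_right[OF gauss_moment_integrable[OF a], of "?c k * \<xi> ^ (2 * k)" "n - 1 + 2 * k"]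
    unfolding set_integrable_def by simp
  have int_val: "(\<integral>s. ?f k s \<partial>lborel) = ?c k * \<xi> ^ (2 * k) * ?m (n - 1 + 2 * k)" for k
    unfolding gauss_moment_def set_lebesgue_integral_def[symmetric] by (rule set_integral_mult_right)
  have int_norm: "(\<integral>s. norm (?f k s) \<partial>lborel) = \<bar>?c k\<bar> * \<xi> ^ (2 * k) * ?m (n - 1 + 2 * k)" for k
  proof -
    have "(\<integral>s. norm (?f k s) \<partial>lborel) = (LINT s:{0..}|lborel. \<bar>?c k\<bar> * \<xi> ^ (2 * k) * (s ^ (n - 1 + 2 * k) * ?e s))"
      unfolding set_lebesgue_integral_def
      by (rule Bochner_Integration.integral_cong) (auto simp: indicator_def abs_mult power_mult)
    then show ?thesis unfolding gauss_moment_def by (simp only: set_integral_mult_right)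
  qed
  have fsum: "(\<lambda>k. ?f k s) sums (indicator {0..} s *\<^sub>R (sj \<nu> (s * \<xi>) * s ^ (n - 1) * ?e s))" for s
  proof -
    have "(\<lambda>k. ?c k * ((s * \<xi>)\<^sup>2) ^ k) sums sj \<nu> (s * \<xi>)"
      unfolding sj_def by (rule summable_sums[OF summable_sj[OF nu]])
    then have "(\<lambda>k. indicator {0..} s * (s ^ (n - 1) * ?e s) * (?c k * ((s * \<xi>)\<^sup>2) ^ k)) sums (indicator {0..} s
        * (s ^ (n - 1) * ?e s) * sj \<nu> (s * \<xi>))"
      by (rule sums_mult)
    then show ?thesis by (simp only: power_add power_mult power_mult_distrib real_scaleR_def) (simp only: mult_ac)
  qed
  \<comment> \<open>Termwise integration is legitimate because the integrals of the absolute values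
    form the same series with positive signs, a multiple of that of the exponential at
    \<open>\<xi>\<^sup>2 / (4 * a)\<close>.\<close>
  have S: "(\<integral>s. (\<Sum>k. ?f k s) \<partial>lborel) = (\<Sum>k. \<integral>s. ?f k s \<partial>lborel)"
  proof (rule integral_suminf[OF int_f])
    show "AE s in lborel. summable (\<lambda>k. norm (?f k s))"
    proof (rule AE_I2)
      fix s
      have "summable (\<lambda>k. indicator {0..} s * (\<bar>s\<bar> ^ (n - 1) * ?e s) * (\<bar>?c k\<bar> * \<bar>(s * \<xi>)\<^sup>2\<bar> ^ k))"
        by (intro summable_mult summable_abs_sj[OF nu])
      then show "summable (\<lambda>k. norm (?f k s))"
        by (simp only: real_norm_def abs_mult power_add power_mult power_mult_distrib power_abs real_scaleR_def abs_indicator abs_exp_cancel) (simp only: mult_ac)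
    qed
    have "summable (\<lambda>k. ?c 0 * ?m (n - 1) * (inverse (fact k) * (\<xi>\<^sup>2 / (4 * a)) ^ k))"
      by (intro summable_mult summable_exp)
    moreover have "?c 0 * ?m (n - 1) * (inverse (fact k) * (\<xi>\<^sup>2 / (4 * a)) ^ k) = (\<integral>s. norm (?f k s) \<partial>lborel)" for k
    proof -
      have "\<bar>?c k\<bar> * ?m (n - 1 + 2 * k) = \<bar>?c k * ?m (n - 1 + 2 * k)\<bar>"
        using gauss_moment_pos[OF a, of "n - 1 + 2 * k"] by (simp add: abs_mult)
      also have "\<dots> = ?c 0 * ?m (n - 1) * ((1 / (4 * a)) ^ k / fact k)"
        unfolding cm using gauss_moment_pos[OF a, of "n - 1"] sj_coeff_0_pos[OF nu] a by (simp add: abs_mult power_abs)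
      finally have *: "\<bar>?c k\<bar> * ?m (n - 1 + 2 * k) = ?c 0 * ?m (n - 1) * ((1 / (4 * a)) ^ k / fact k)" .
      have reorder: "x * y * z = y * (x * z)" for x y z :: real by simp
      have "\<bar>?c k\<bar> * \<xi> ^ (2 * k) * ?m (n - 1 + 2 * k) = \<xi> ^ (2 * k) * (\<bar>?c k\<bar> * ?m (n - 1 + 2 * k))"
        by (rule reorder)
      also have "\<dots> = \<xi> ^ (2 * k) * (?c 0 * ?m (n - 1) * ((1 / (4 * a)) ^ k / fact k))"
        by (simp only: *)
      finally have val: "(\<integral>s. norm (?f k s) \<partial>lborel) = \<xi> ^ (2 * k) * (?c 0 * ?m (n - 1) * ((1 / (4 * a)) ^ k / fact k))"
        unfolding int_norm .
      have pw: "(\<xi>\<^sup>2 / (4 * a)) ^ k = \<xi> ^ (2 * k) * (1 / (4 * a)) ^ k"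
        by (simp only: power_mult power_mult_distrib[symmetric]) simp
      have alg: "x * y * (inverse F * (A * B)) = A * (x * y * (B / F))" for x y F A B :: real
        by (simp add: divide_inverse)
      show ?thesis unfolding val pw by (rule alg)
    qed
    ultimately show "summable (\<lambda>k. \<integral>s. norm (?f k s) \<partial>lborel)" by (simp only:)
  qed
  have "(\<Sum>k. \<integral>s. ?f k s \<partial>lborel) = (\<Sum>k. ?c 0 * ?m (n - 1) * ((- (1 / (4 * a) * \<xi>\<^sup>2)) ^ k /\<^sub>R fact k))"
  proof (rule suminf_cong)
    fix k
    have reorder: "x * y * z = y * (x * z)" for x y z :: real by simp
    have "(\<integral>s. ?f k s \<partial>lborel) = \<xi> ^ (2 * k) * (?c k * ?m (n - 1 + 2 * k))" unfolding int_val by (rule reorder)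
    also have "\<dots> = \<xi> ^ (2 * k) * (?c 0 * ?m (n - 1) * ((- 1 / (4 * a)) ^ k / fact k))" unfolding cm ..
    also have "\<dots> = ?c 0 * ?m (n - 1) * ((- (1 / (4 * a) * \<xi>\<^sup>2)) ^ k /\<^sub>R fact k)"
    proof -
      have pw: "(- (1 / (4 * a) * \<xi>\<^sup>2)) ^ k = \<xi> ^ (2 * k) * (- 1 / (4 * a)) ^ k"
        by (simp only: power_mult power_mult_distrib[symmetric]) simp
      have alg: "A * (x * y * (B / F)) = x * y * ((A * B) /\<^sub>R F)" for x y F A B :: real
        by (simp add: divide_inverse)
      show ?thesis unfolding pw by (rule alg)
    qed
    finally show "(\<integral>s. ?f k s \<partial>lborel) = ?c 0 * ?m (n - 1) * ((- (1 / (4 * a) * \<xi>\<^sup>2)) ^ k /\<^sub>R fact k)" .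
  qed
  also have "\<dots> = ?c 0 * ?m (n - 1) * exp (- (1 / (4 * a) * \<xi>\<^sup>2))"
    unfolding exp_def by (rule suminf_mult[OF summable_exp_generic])
  finally have val: "(\<Sum>k. \<integral>s. ?f k s \<partial>lborel) = ?c 0 * ?m (n - 1) * exp (- (1 / (4 * a) * \<xi>\<^sup>2))" .
  have "hankel n (gauss a) \<xi> = (\<integral>s. complex_of_real (indicator {0..} s *\<^sub>R (sj \<nu> (s * \<xi>) * s ^ (n - 1) * ?e s)) \<partial>lborel)"
    unfolding hankel_def \<nu>_def[symmetric] set_lebesgue_integral_def gauss_def
    by (rule Bochner_Integration.integral_cong) (simp_all add: scaleR_conv_of_real)
  also have "\<dots> = complex_of_real (\<integral>s. indicator {0..} s *\<^sub>R (sj \<nu> (s * \<xi>) * s ^ (n - 1) * ?e s) \<partial>lborel)"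
    by (rule integral_complex_of_real)
  also have "(\<integral>s. indicator {0..} s *\<^sub>R (sj \<nu> (s * \<xi>) * s ^ (n - 1) * ?e s) \<partial>lborel)
      = (\<integral>s. (\<Sum>k. ?f k s) \<partial>lborel)"
    by (rule Bochner_Integration.integral_cong[OF refl]) (rule sums_unique[OF fsum])
  finally have "hankel n (gauss a) \<xi> = complex_of_real (?c 0 * ?m (n - 1) * exp (- (1 / (4 * a) * \<xi>\<^sup>2)))"
    unfolding S val .
  then show ?thesis unfolding gauss_def[of "1 / (4 * a)" \<xi>] of_real_mult[symmetric] \<nu>_def .
qed

text \<open>The exponents are 1, 2, ..., so the sum is \<open>exp (- s\<^sup>2)\<close> times a
  polynomial in \<open>exp (- s\<^sup>2)\<close>. The common factor makes possible an error
  \<open>e * exp (- s\<^sup>2)\<close>, which is integrable against any polynomial weight.\<close>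

definition gauss_sum :: "(nat \<Rightarrow> complex) \<Rightarrow> nat \<Rightarrow> real \<Rightarrow> complex" where
  "gauss_sum c m s = (\<Sum>i\<le>m. c i * gauss (real i + 1) s)"

text \<open>In the variable \<open>y = exp (- s\<^sup>2)\<close> this is the Weierstrass theorem on \<open>[0, 1]\<close>.\<close>

lemma gauss_sum_approx:
  fixes f :: "real \<Rightarrow> complex"
  assumes f: "continuous_on {0..} f" and R: "\<And>s. s \<ge> R \<Longrightarrow> f s = 0" and e: "e > 0"
  obtains c m where "\<And>s. s \<ge> 0 \<Longrightarrow> norm (f s - gauss_sum c m s) \<le> e * exp (- s\<^sup>2)"
proof -
  define R' where "R' = max R 1"
  have R': "R' \<ge> 1" "\<And>s. s \<ge> R' \<Longrightarrow> f s = 0" using R by (auto simp: R'_def)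
  define y0 where "y0 = exp (- R'\<^sup>2)"
  have y0: "0 < y0" "y0 < 1" using R'(1) by (auto simp: y0_def)
  \<comment> \<open>The value of \<open>f\<close> divided by the common factor \<open>y\<close> of
    Gaussian sums. As \<open>f\<close> vanishes beyond \<open>R'\<close>, the quotient is 0 near
    \<open>y = 0\<close>, hence continuous there; \<open>R' \<ge> 1\<close> ensures
    \<open>y0 < 1\<close>.\<close>
  define F where "F y = (if y \<le> y0 then 0 else f (sqrt (- ln y)) / of_real y)" for y
  have cF: "continuous_on {0..1} F"
  proof -
    have "continuous_on ({0..y0} \<union> {y0..1}) (\<lambda>y. if y \<le> y0 then 0 else f (sqrt (- ln y)) / of_real y)"
    proof (rule continuous_on_cases)
      show "continuous_on {y0..1} (\<lambda>y. f (sqrt (- ln y)) / of_real y)"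
        by (intro continuous_on_divide continuous_on_compose2[OF f] continuous_intros)
           (use y0 in \<open>auto simp: ln_le_zero_iff\<close>)
      show "\<forall>x. x \<in> {0..y0} \<and> \<not> x \<le> y0 \<or> x \<in> {y0..1} \<and> x \<le> y0 \<longrightarrow> 0 = f (sqrt (- ln x)) / of_real x"
      proof (intro allI impI)
        fix x assume "x \<in> {0..y0} \<and> \<not> x \<le> y0 \<or> x \<in> {y0..1} \<and> x \<le> y0"
        then have "x = y0" by auto
        then have "sqrt (- ln x) = R'" using R'(1) by (simp add: y0_def)
        then show "0 = f (sqrt (- ln x)) / of_real x" using R'(2)[of R'] by simp
      qed
    qed auto
    moreover have "{0..y0} \<union> {y0..1} = {0..1}" using y0 by auto
    ultimately show ?thesis by (simp add: F_def[abs_def])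
  qed
  obtain p where p: "real_polynomial_function p" "\<And>y. y \<in> {0..1} \<Longrightarrow> \<bar>Re (F y) - p y\<bar> < e / 2"
    by (rule Stone_Weierstrass_real_polynomial_function[of "{0..1}" "\<lambda>y. Re (F y)" "e / 2"]) (use cF e in \<open>auto intro: continuous_on_Re\<close>)
  obtain q where q: "real_polynomial_function q" "\<And>y. y \<in> {0..1} \<Longrightarrow> \<bar>Im (F y) - q y\<bar> < e / 2"
    by (rule Stone_Weierstrass_real_polynomial_function[of "{0..1}" "\<lambda>y. Im (F y)" "e / 2"]) (use cF e in \<open>auto intro: continuous_on_Im\<close>)
  obtain a k where a: "p = (\<lambda>x. \<Sum>i\<le>k. a i * x ^ i)" using p(1) real_polynomial_function_iff_sum by blast
  obtain b l where b: "q = (\<lambda>x. \<Sum>i\<le>l. b i * x ^ i)" using q(1) real_polynomial_function_iff_sum by blast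
  define m where "m = max k l"
  define c where "c i = Complex (if i \<le> k then a i else 0) (if i \<le> l then b i else 0)" for i
  have pm: "p x = (\<Sum>i\<le>m. Re (c i) * x ^ i)" and qm: "q x = (\<Sum>i\<le>m. Im (c i) * x ^ i)" for x
    unfolding a b c_def by (auto intro!: sum.mono_neutral_cong_left simp: m_def split: if_splits)
  show ?thesis
  proof (rule that[of c m])
    fix s :: real assume s: "s \<ge> 0"
    define y where "y = exp (- s\<^sup>2)"
    have y: "y \<in> {0..1}" "y > 0" by (auto simp: y_def)
    have fs: "f s = of_real y * F y"
    proof (cases "y \<le> y0")
      case True
      then have "R'\<^sup>2 \<le> s\<^sup>2" by (simp add: y_def y0_def)
      then have "R' \<le> s" using s by (rule power2_le_imp_le)
      then show ?thesis using R' True by (simp add: F_def)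
    next
      case False then show ?thesis using y s by (simp add: F_def y_def)
    qed
    have gs: "gauss_sum c m s = of_real y * (\<Sum>i\<le>m. c i * of_real y ^ i)"
    proof -
      have "gauss (real i + 1) s = of_real y * of_real y ^ i" for i
        by (simp add: gauss_def y_def algebra_simps flip: exp_of_nat_mult of_real_mult of_real_power exp_add)
      then show ?thesis by (simp add: gauss_sum_def sum_distrib_left mult_ac)
    qed
    have sumc: "(\<Sum>i\<le>m. c i * of_real y ^ i) = Complex (p y) (q y)"
      unfolding pm qm by (simp add: complex_eq_iff flip: of_real_power)
    have "norm (F y - Complex (p y) (q y)) \<le> \<bar>Re (F y) - p y\<bar> + \<bar>Im (F y) - q y\<bar>"
      using cmod_le[of "F y - Complex (p y) (q y)"] by simp
    also have "\<dots> \<le> e" using p(2)[OF y(1)] q(2)[OF y(1)] by simp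
    finally have "y * norm (F y - Complex (p y) (q y)) \<le> y * e" using y by (intro mult_left_mono) auto
    moreover have "norm (f s - gauss_sum c m s) = y * norm (F y - Complex (p y) (q y))"
      unfolding fs gs sumc right_diff_distrib[symmetric] using y by (simp add: norm_mult)
    ultimately show "norm (f s - gauss_sum c m s) \<le> e * exp (- s\<^sup>2)" by (simp add: y_def mult.commute)
  qed
qed

text \<open>The factor by which the transform applied twice multiplies a Gaussian, with the moment
  at parameter 1 left unevaluated.\<close>

definition hankel_const :: "nat \<Rightarrow> real" where
  "hankel_const n = (sj_coeff ((real n - 2) / 2) 0 * gauss_moment 1 (n - 1))\<^sup>2 * 2 ^ n"

lemma hankel_const_pos: "n \<ge> 2 \<Longrightarrow> hankel_const n > 0"
  using sj_coeff_0_pos[of "(real n - 2) / 2"] gauss_moment_pos[of 1 "n - 1"] by (simp add: hankel_const_def)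

lemma hankel_scale: "hankel n (\<lambda>s. c * \<phi> s) \<xi> = c * hankel n \<phi> \<xi>"
proof -
  have "hankel n (\<lambda>s. c * \<phi> s) \<xi> = (LINT s:{0..}|lborel. c * (of_real (sj ((real n - 2) / 2) (s * \<xi>) * s ^ (n - 1)) * \<phi> s))"
    unfolding hankel_def by (simp only: mult_ac)
  then show ?thesis unfolding hankel_def by (simp only: set_integral_mult_right)
qed

lemma hankel_add:
  assumes "n \<ge> 2" "rapid \<phi>" "rapid \<psi>"
  shows "hankel n (\<lambda>s. \<phi> s + \<psi> s) \<xi> = hankel n \<phi> \<xi> + hankel n \<psi> \<xi>"
  unfolding hankel_def distrib_left
  by (rule set_integral_add(2)) (intro hankel_integrable assms)+

lemma hankel_cnj: "hankel n (\<lambda>s. cnj (\<phi> s)) \<xi> = cnj (hankel n \<phi> \<xi>)"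
  unfolding hankel_def set_lebesgue_integral_def
  by (subst Bochner_Integration.integral_cnj[symmetric]) simp

lemma rapid_cnj: "rapid \<phi> \<Longrightarrow> rapid (\<lambda>s. cnj (\<phi> s))"
  unfolding rapid_def by (auto intro: continuous_intros)

lemma rapid_scale:
  assumes "rapid \<phi>"
  shows "rapid (\<lambda>s. c * \<phi> s)"
  unfolding rapid_def
proof (intro conjI allI)
  show "continuous_on UNIV (\<lambda>s. c * \<phi> s)" using assms unfolding rapid_def by (intro continuous_intros) auto
  fix N
  obtain C where C: "\<And>x. (1 + \<bar>x\<bar>) ^ N * norm (\<phi> x) \<le> C" using assms unfolding rapid_def by blast
  have "(1 + \<bar>x\<bar>) ^ N * norm (c * \<phi> x) \<le> norm c * C" for x
    using mult_left_mono[OF C[of x], of "norm c"] by (simp add: norm_mult mult_ac)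
  then show "\<exists>C. \<forall>x. (1 + \<bar>x\<bar>) ^ N * norm (c * \<phi> x) \<le> C" by blast
qed

lemma rapid_add:
  assumes "rapid \<phi>" "rapid \<psi>"
  shows "rapid (\<lambda>s. \<phi> s + \<psi> s)"
  unfolding rapid_def
proof (intro conjI allI)
  show "continuous_on UNIV (\<lambda>s. \<phi> s + \<psi> s)" using assms unfolding rapid_def by (intro continuous_intros) auto
  fix N
  obtain A where A: "\<And>x. (1 + \<bar>x\<bar>) ^ N * norm (\<phi> x) \<le> A" using assms unfolding rapid_def by blast
  obtain B where B: "\<And>x. (1 + \<bar>x\<bar>) ^ N * norm (\<psi> x) \<le> B" using assms unfolding rapid_def by blast
  have "(1 + \<bar>x\<bar>) ^ N * norm (\<phi> x + \<psi> x) \<le> A + B" for x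
  proof -
    have "(1 + \<bar>x\<bar>) ^ N * norm (\<phi> x + \<psi> x) \<le> (1 + \<bar>x\<bar>) ^ N * (norm (\<phi> x) + norm (\<psi> x))"
      by (intro mult_left_mono norm_triangle_ineq) simp
    also have "\<dots> \<le> A + B" unfolding distrib_left by (intro add_mono A B)
    finally show ?thesis .
  qed
  then show "\<exists>C. \<forall>x. (1 + \<bar>x\<bar>) ^ N * norm (\<phi> x + \<psi> x) \<le> C" by blast
qed

lemma rapid_diff: "rapid \<phi> \<Longrightarrow> rapid \<psi> \<Longrightarrow> rapid (\<lambda>s. \<phi> s - \<psi> s)"
  using rapid_add[of \<phi> "\<lambda>s. (-1) * \<psi> s"] rapid_scale[of \<psi> "-1"] by simp

lemma hankel_diff:
  assumes "n \<ge> 2" "rapid \<phi>" "rapid \<psi>"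
  shows "hankel n (\<lambda>s. \<phi> s - \<psi> s) \<xi> = hankel n \<phi> \<xi> - hankel n \<psi> \<xi>"
  using hankel_add[OF assms(1,2) rapid_scale[OF assms(3), of "-1"]] hankel_scale[of n "-1" \<psi>] by simp

lemma rapid_gauss_sum: "rapid (gauss_sum c m)"
proof -
  have z: "rapid (\<lambda>_. 0)" by (auto simp: rapid_def)
  have "rapid (\<lambda>s. \<Sum>i\<in>I. c i * gauss (real i + 1) s)" if "finite I" for I
    using that
  proof (induction I rule: finite_induct)
    case (insert i I)
    have "rapid (\<lambda>s. c i * gauss (real i + 1) s + (\<Sum>i\<in>I. c i * gauss (real i + 1) s))"
      by (intro rapid_add rapid_scale gauss_rapid insert) auto
    then show ?case using insert by simp
  qed (use z in simp)
  then show ?thesis by (simp add: gauss_sum_def[abs_def])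
qed

lemma bounded_rapid_integrable:
  assumes g: "continuous_on UNIV g" "\<And>x. norm (g x) \<le> C" and h: "rapid h"
  shows "set_integrable lborel {0..} (\<lambda>s. g s * h s * of_real (s ^ k))"
proof -
  note rapid_measurable[OF h, measurable] borel_measurable_continuous_onI[OF g(1), measurable]
  have C0: "C \<ge> 0" using order_trans[OF norm_ge_zero g(2)] .
  have "set_integrable lborel {0..} (\<lambda>s. (g s * of_real (s ^ k)) * h s)"
  proof (rule rapid_set_integrable[OF h])
    fix x
    have "norm (g x) * \<bar>x\<bar> ^ k \<le> C * (1 + \<bar>x\<bar>) ^ k"
      using g(2)[of x] C0 by (intro mult_mono power_mono) auto
    then show "norm (g x * of_real (x ^ k)) \<le> C * (1 + \<bar>x\<bar>) ^ k" by (simp add: norm_mult norm_power)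
  qed measurable
  then show ?thesis by (simp only: mult_ac)
qed

lemma rapid_bounded:
  assumes "rapid g"
  obtains C where "\<And>x. norm (g x) \<le> C"
proof -
  obtain C where "\<And>x. (1 + \<bar>x\<bar>) ^ 0 * norm (g x) \<le> C" using assms unfolding rapid_def by blast
  then show ?thesis by (intro that) simp
qed

lemma rapid_measure_integrable:
  assumes "rapid g" "rapid h"
  shows "set_integrable lborel {0..} (\<lambda>s. g s * h s * of_real (s ^ k))"
proof -
  obtain C where "\<And>x. norm (g x) \<le> C" by (rule rapid_bounded[OF assms(1)]) blast
  with assms show ?thesis unfolding rapid_def[of g] by (intro bounded_rapid_integrable) auto
qed

lemma hankel_gauss_sum_rapid:
  assumes n: "n \<ge> 2"
  shows "rapid (hankel n (gauss_sum c m))"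
proof -
  have z: "rapid (\<lambda>_. 0)" by (auto simp: rapid_def)
  have "rapid (\<lambda>s. \<Sum>i\<in>I. c i * gauss (real i + 1) s) \<and> rapid (hankel n (\<lambda>s. \<Sum>i\<in>I. c i * gauss (real i + 1) s))" if "finite I" for I
    using that
  proof (induction I rule: finite_induct)
    case empty
    have "hankel n (\<lambda>s. 0) = (\<lambda>_. 0)" by (simp add: hankel_def fun_eq_iff)
    then show ?case using z by simp
  next
    case (insert i I)
    have g: "rapid (gauss (real i + 1))" by (rule gauss_rapid) simp
    have eq: "hankel n (\<lambda>s. c i * gauss (real i + 1) s + (\<Sum>i\<in>I. c i * gauss (real i + 1) s))
      = (\<lambda>\<xi>. c i * (of_real (sj_coeff ((real n - 2) / 2) 0 * gauss_moment (real i + 1) (n - 1)) * gauss (1 / (4 * (real i + 1))) \<xi>)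
          + hankel n (\<lambda>s. \<Sum>i\<in>I. c i * gauss (real i + 1) s) \<xi>)"
      using insert n g by (intro ext, subst hankel_add) (auto intro!: rapid_scale simp: hankel_scale hankel_gauss)
    have "rapid (\<lambda>s. c i * gauss (real i + 1) s + (\<Sum>i\<in>I. c i * gauss (real i + 1) s))"
      using insert g by (intro rapid_add rapid_scale) auto
    moreover have "rapid (hankel n (\<lambda>s. c i * gauss (real i + 1) s + (\<Sum>i\<in>I. c i * gauss (real i + 1) s)))"
      unfolding eq using insert by (intro rapid_add rapid_scale gauss_rapid) auto
    ultimately show ?case using insert by simp
  qed
  then show ?thesis by (simp add: gauss_sum_def[abs_def])
qed

text \<open>The transform sends the parameter \<open>a\<close> to \<open>1 / (4 * a)\<close>, and a
  second application sends it back. The product of the two moments does not depend on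
  \<open>a\<close>: with \<open>a = b\<^sup>2\<close> the scaling factors are \<open>b ^ n\<close>
  and \<open>(1 / (2 * b)) ^ n\<close>, whose product is \<open>1 / 2 ^ n\<close>.\<close>

lemma hankel_hankel_gauss:
  assumes n: "n \<ge> 2" and a: "a > 0"
  shows "hankel n (hankel n (gauss a)) s = of_real (hankel_const n) * gauss a s"
proof -
  let ?\<kappa> = "sj_coeff ((real n - 2) / 2) 0"
  have "hankel n (gauss a) = (\<lambda>\<xi>. of_real (?\<kappa> * gauss_moment a (n - 1)) * gauss (1 / (4 * a)) \<xi>)"
    by (rule ext) (rule hankel_gauss[OF n a])
  then have "hankel n (hankel n (gauss a)) s = of_real (?\<kappa> * gauss_moment a (n - 1)) * hankel n (gauss (1 / (4 * a))) s"
    by (simp only: hankel_scale)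
  also have "\<dots> = of_real (?\<kappa> * gauss_moment a (n - 1)) * (of_real (?\<kappa> * gauss_moment (1 / (4 * a)) (n - 1)) * gauss a s)"
    using a by (subst hankel_gauss[OF n]) simp_all
  also have "\<dots> = of_real (?\<kappa>\<^sup>2 * (gauss_moment a (n - 1) * gauss_moment (1 / (4 * a)) (n - 1))) * gauss a s"
    by (simp add: power2_eq_square)
  also have "gauss_moment a (n - 1) * gauss_moment (1 / (4 * a)) (n - 1) = (gauss_moment 1 (n - 1))\<^sup>2 * 2 ^ n"
  proof -
    define b where "b = sqrt a"
    have b: "b > 0" "b\<^sup>2 = a" using a by (auto simp: b_def)
    have n1: "n - 1 + 1 = n" using n by simp
    have 1: "gauss_moment a (n - 1) * b ^ n = gauss_moment 1 (n - 1)"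
      using gauss_moment_scale[OF b(1), of "n - 1"] unfolding b(2) n1 .
    have b2: "(1 / (2 * b))\<^sup>2 = 1 / (4 * a)" unfolding b(2)[symmetric] by (simp add: power_divide power_mult_distrib)
    have 2: "gauss_moment (1 / (4 * a)) (n - 1) * (1 / (2 * b)) ^ n = gauss_moment 1 (n - 1)"
      using gauss_moment_scale[of "1 / (2 * b)" "n - 1"] b(1) unfolding b2 n1 by simp
    have e: "b ^ n * (1 / (2 * b)) ^ n = 1 / 2 ^ n" using b(1) by (simp add: power_divide power_mult_distrib)
    have "(gauss_moment 1 (n - 1))\<^sup>2 = (gauss_moment a (n - 1) * b ^ n) * (gauss_moment (1 / (4 * a)) (n - 1) * (1 / (2 * b)) ^ n)"
      unfolding 1 2 by (simp add: power2_eq_square)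
    also have "\<dots> = (gauss_moment a (n - 1) * gauss_moment (1 / (4 * a)) (n - 1)) * (b ^ n * (1 / (2 * b)) ^ n)"
      by (simp only: mult_ac)
    finally show ?thesis unfolding e by simp
  qed
  finally show ?thesis by (simp add: hankel_const_def power_mult_distrib mult_ac)
qed

text \<open>Uniqueness for the Laplace transform in the variable \<open>s\<^sup>2\<close>.\<close>

lemma gauss_orthogonal_imp_zero:
  fixes u :: "real \<Rightarrow> complex"
  assumes u: "continuous_on UNIV u" "\<And>x. norm (u x) \<le> C" and orth: "\<And>a. a > 0
      \<Longrightarrow> (LINT s:{0..}|lborel. u s * gauss a s * of_real (s ^ k)) = 0"
    and s0: "s0 \<ge> 0"
  shows "u s0 = 0"
proof -
  have cu: "continuous_on S u" for S using u(1) continuous_on_subset by blast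
  define R where "R = s0 + 1"
  \<comment> \<open>The conjugate of \<open>u\<close> times a tent that is positive up to
    \<open>R > s0\<close>: bounded support permits approximation by Gaussian sums, and the pairing
    with \<open>u\<close> is the integral of a nonnegative function.\<close>
  define f where "f s = cnj (u s) * of_real (max 0 (R - s))" for s
  have cf: "continuous_on S f" for S unfolding f_def by (intro continuous_intros cu)
  have f0: "f s = 0" if "s \<ge> R" for s using that by (simp add: f_def)
  have fi: "set_integrable lborel {0..} (\<lambda>s. u s * f s * of_real (s ^ k))"
  proof -
    have "set_integrable lborel {0..R} (\<lambda>s. u s * f s * of_real (s ^ k))"
      by (intro borel_integrable_atLeastAtMost' continuous_intros cu cf)
    moreover have "(\<lambda>s. indicator {0..R} s *\<^sub>R (u s * f s * of_real (s ^ k))) = (\<lambda>s. indicator {0..} s *\<^sub>R (u s * f s * of_real (s ^ k)))"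
      using f0 by (auto simp: fun_eq_iff indicator_def)
    ultimately show ?thesis unfolding set_integrable_def by simp
  qed
  have g1: "rapid (gauss 1)" by (rule gauss_rapid) simp
  let ?E = "LINT s:{0..}|lborel. norm (u s * gauss 1 s * of_real (s ^ k))"
  have E0: "?E \<ge> 0" unfolding set_lebesgue_integral_def by (intro integral_nonneg_AE AE_I2) (auto simp: indicator_def)
  \<comment> \<open>Orthogonality removes the Gaussian sum, so only the approximation error remains,
    and its Gaussian factor makes it integrable against the bounded \<open>u\<close>.\<close>
  have small: "norm (LINT s:{0..}|lborel. u s * f s * of_real (s ^ k)) \<le> e * ?E" if e: "e > 0" for e
  proof -
    obtain c m where cm: "\<And>s. s \<ge> 0 \<Longrightarrow> norm (f s - gauss_sum c m s) \<le> e * exp (- s\<^sup>2)"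
      using gauss_sum_approx[OF cf f0 e] by blast
    have gi: "set_integrable lborel {0..} (\<lambda>s. u s * gauss_sum c m s * of_real (s ^ k))"
      by (rule bounded_rapid_integrable[OF u rapid_gauss_sum])
    have "(LINT s:{0..}|lborel. u s * gauss_sum c m s * of_real (s ^ k))
      = (LINT s:{0..}|lborel. (\<Sum>i\<le>m. c i * (u s * gauss (real i + 1) s * of_real (s ^ k))))"
      by (simp add: gauss_sum_def sum_distrib_left sum_distrib_right mult_ac)
    also have "\<dots> = (\<Sum>i\<le>m. LINT s:{0..}|lborel. c i * (u s * gauss (real i + 1) s * of_real (s ^ k)))"
      unfolding set_lebesgue_integral_def scaleR_sum_right
    proof (rule Bochner_Integration.integral_sum)
      fix i
      have "set_integrable lborel {0..} (\<lambda>s. c i * (u s * gauss (real i + 1) s * of_real (s ^ k)))"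
        by (intro set_integrable_mult_right bounded_rapid_integrable[OF u] gauss_rapid) simp
      then show "integrable lborel (\<lambda>s. indicator {0..} s *\<^sub>R (c i * (u s * gauss (real i + 1) s * of_real (s ^ k))))"
        unfolding set_integrable_def .
    qed
    also have "\<dots> = 0" using orth by (simp only: set_integral_mult_right) simp
    finally have g0: "(LINT s:{0..}|lborel. u s * gauss_sum c m s * of_real (s ^ k)) = 0" .
    have "(LINT s:{0..}|lborel. u s * f s * of_real (s ^ k)) = (LINT s:{0..}|lborel. u s * f s * of_real (s ^ k) - u s * gauss_sum c m s * of_real (s ^ k))"
      unfolding set_integral_diff(2)[OF fi gi] g0 by simp
    also have "norm \<dots> \<le> (LINT s:{0..}|lborel. norm (u s * f s * of_real (s ^ k) - u s * gauss_sum c m s * of_real (s ^ k)))"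
      by (intro set_integral_norm_bound set_integral_diff(1) fi gi)
    also have "\<dots> \<le> (LINT s:{0..}|lborel. e * norm (u s * gauss 1 s * of_real (s ^ k)))"
    proof (rule set_integral_mono)
      show "set_integrable lborel {0..} (\<lambda>s. norm (u s * f s * of_real (s ^ k) - u s * gauss_sum c m s * of_real (s ^ k)))"
        by (intro set_integrable_norm set_integral_diff(1) fi gi)
      show "set_integrable lborel {0..} (\<lambda>s. e * norm (u s * gauss 1 s * of_real (s ^ k)))"
        by (intro set_integrable_mult_right set_integrable_norm bounded_rapid_integrable[OF u] g1)
      fix s :: real assume s: "s \<in> {0..}"
      have "u s * f s * of_real (s ^ k) - u s * gauss_sum c m s * of_real (s ^ k) = u s * (f s - gauss_sum c m s) * of_real (s ^ k)"
        by (simp add: algebra_simps)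
      then have "norm (u s * f s * of_real (s ^ k) - u s * gauss_sum c m s * of_real (s ^ k)) = norm (f s - gauss_sum c m s) * norm (u s * of_real (s ^ k))"
        by (simp add: norm_mult)
      also have "\<dots> \<le> (e * exp (- s\<^sup>2)) * norm (u s * of_real (s ^ k))" using cm[of s] s by (intro mult_right_mono) auto
      also have "\<dots> = e * norm (u s * gauss 1 s * of_real (s ^ k))" by (simp add: norm_mult gauss_def)
      finally show "norm (u s * f s * of_real (s ^ k) - u s * gauss_sum c m s * of_real (s ^ k)) \<le> e * norm (u s * gauss 1 s * of_real (s ^ k))" .
    qed
    also have "\<dots> = e * ?E" by (rule set_integral_mult_right)
    finally show ?thesis .
  qed
  have zero: "(LINT s:{0..}|lborel. u s * f s * of_real (s ^ k)) = 0"
  proof (rule ccontr)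
    assume "\<not> ?thesis"
    then have p: "0 < norm (LINT s:{0..}|lborel. u s * f s * of_real (s ^ k))" by simp
    define e where "e = norm (LINT s:{0..}|lborel. u s * f s * of_real (s ^ k)) / (2 * (?E + 1))"
    have e: "e > 0" unfolding e_def using p E0 by (intro divide_pos_pos) auto
    have "norm (LINT s:{0..}|lborel. u s * f s * of_real (s ^ k)) \<le> e * (?E + 1)"
      using small[OF e] e by (simp add: distrib_left)
    also have "\<dots> = norm (LINT s:{0..}|lborel. u s * f s * of_real (s ^ k)) / 2" unfolding e_def using E0 by (simp add: field_simps)
    finally show False using p by simp
  qed
  let ?h = "\<lambda>s. (norm (u s))\<^sup>2 * max 0 (R - s) * s ^ k"
  have hpos: "?h s = 0" if "s \<in> {0..R}" for s
  proof -
    have ch: "continuous_on {0..R} ?h" by (intro continuous_intros cu)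
    have "complex_of_real (LINT s:{0..R}|lborel. ?h s) = (LINT s:{0..}|lborel. u s * f s * of_real (s ^ k))"
      unfolding set_lebesgue_integral_def integral_complex_of_real[symmetric]
    proof (rule Bochner_Integration.integral_cong[OF refl])
      fix s
      have "u s * cnj (u s) = of_real ((norm (u s))\<^sup>2)" by (simp only: complex_norm_square)
      then have "u s * f s * of_real (s ^ k) = of_real (?h s)" by (simp add: f_def mult.assoc[symmetric])
      then show "complex_of_real (indicator {0..R} s *\<^sub>R ?h s) = indicator {0..} s *\<^sub>R (u s * f s * of_real (s ^ k))"
        by (auto simp: indicator_def scaleR_conv_of_real)
    qed
    then have "(LINT s:{0..R}|lborel. ?h s) = 0" using zero by simp
    then have "integral {0..R} ?h = 0"
      using set_borel_integral_eq_integral(2)[OF borel_integrable_atLeastAtMost'[OF ch]] by simp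
    then have "(?h has_integral 0) {0..R}" using integrable_continuous_real[OF ch] by (metis integrable_integral)
    then show ?thesis
      using has_integral_0_cbox_imp_0[of 0 R ?h s] ch that s0 by (auto simp: R_def)
  qed
  have u0: "u s = 0" if "0 < s" "s < R" for s using hpos[of s] that by auto
  show ?thesis
  \<comment> \<open>The weight \<open>s ^ k\<close> may vanish at 0, so that point is reached by
    continuity.\<close>
  proof (cases "s0 = 0")
    case False then show ?thesis using u0[of s0] s0 by (simp add: R_def)
  next
    case True
    have "(\<lambda>j. u (s0 + inverse (real (Suc (Suc j))))) \<longlonglongrightarrow> u s0"
    proof (rule continuous_on_tendsto_compose[OF cu[of UNIV]])
      have "(\<lambda>j. inverse (real (Suc (Suc j)))) \<longlonglongrightarrow> 0" using LIMSEQ_Suc[OF LIMSEQ_inverse_real_of_nat] .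
      from tendsto_add[OF tendsto_const[of s0] this] show "(\<lambda>j. s0 + inverse (real (Suc (Suc j)))) \<longlonglongrightarrow> s0" by simp
    qed auto
    moreover have "u (s0 + inverse (real (Suc (Suc j)))) = 0" for j
      using True by (intro u0) (auto simp: R_def field_simps)
    ultimately show ?thesis by (simp add: LIMSEQ_const_iff)
  qed
qed

text \<open>The difference \<open>u\<close> of the two sides is continuous and bounded. Paired with
  a Gaussian, both transforms move over by self-adjointness and act on the Gaussian, where inversion
  is the computation \<open>hankel_hankel_gauss\<close>. Hence \<open>u\<close> is orthogonal to all
  Gaussians and vanishes.\<close>

theorem hankel_inversion:
  assumes n: "n \<ge> 2" and \<phi>: "rapid \<phi>" and h: "rapid (hankel n \<phi>)" and s: "s \<ge> 0"
  shows "hankel n (hankel n \<phi>) s = of_real (hankel_const n) * \<phi> s"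
proof -
  define u where "u s = hankel n (hankel n \<phi>) s - of_real (hankel_const n) * \<phi> s" for s
  obtain C1 where C1: "\<And>x. norm (\<phi> x) \<le> C1" by (rule rapid_bounded[OF \<phi>]) blast
  obtain C2 where C2: "\<And>x. norm (hankel n (hankel n \<phi>) x) \<le> C2" using hankel_bounded[OF n h] by blast
  have chh: "continuous_on UNIV (hankel n (hankel n \<phi>))" by (rule hankel_continuous[OF n h])
  have "u s = 0"
  proof (rule gauss_orthogonal_imp_zero[OF _ _ _ s, where k = "n - 1"])
    show "continuous_on UNIV u" unfolding u_def using \<phi> unfolding rapid_def by (intro continuous_intros chh) auto
    show "norm (u x) \<le> C2 + norm (complex_of_real (hankel_const n)) * C1" for x
      unfolding u_def by (intro norm_triangle_le_diff add_mono C2) (simp only: norm_mult mult_left_mono[OF C1] norm_ge_zero)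
    fix a :: real assume a: "a > 0"
    have g: "rapid (gauss a)" by (rule gauss_rapid[OF a])
    have hg: "rapid (hankel n (gauss a))"
    proof -
      have "hankel n (gauss a) = (\<lambda>\<xi>. of_real (sj_coeff ((real n - 2) / 2) 0 * gauss_moment a (n - 1)) * gauss (1 / (4 * a)) \<xi>)"
        by (rule ext) (rule hankel_gauss[OF n a])
      then show ?thesis using a by (simp only:) (intro rapid_scale gauss_rapid, simp)
    qed
    have i: "set_integrable lborel {0..} (\<lambda>s. hankel n (hankel n \<phi>) s * gauss a s * of_real (s ^ (n - 1)))"
      "set_integrable lborel {0..} (\<lambda>s. of_real (hankel_const n) * (\<phi> s * gauss a s * of_real (s ^ (n - 1))))"
      by (rule bounded_rapid_integrable[OF chh C2 g]) (intro set_integrable_mult_right rapid_measure_integrable \<phi> g)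
    have "(LINT s:{0..}|lborel. u s * gauss a s * of_real (s ^ (n - 1)))
      = (LINT s:{0..}|lborel. hankel n (hankel n \<phi>) s * gauss a s * of_real (s ^ (n - 1)) - of_real (hankel_const n)
          * (\<phi> s * gauss a s * of_real (s ^ (n - 1))))"
      unfolding u_def by (simp only: left_diff_distrib mult.assoc)
    also have "\<dots> = (LINT s:{0..}|lborel. hankel n (hankel n \<phi>) s * gauss a s * of_real (s ^ (n - 1)))
        - (LINT s:{0..}|lborel. of_real (hankel_const n) * (\<phi> s * gauss a s * of_real (s ^ (n - 1))))"
      by (rule set_integral_diff(2)[OF i])
    also have "(LINT s:{0..}|lborel. hankel n (hankel n \<phi>) s * gauss a s * of_real (s ^ (n - 1)))
       = (LINT s:{0..}|lborel. \<phi> s * hankel n (hankel n (gauss a)) s * of_real (s ^ (n - 1)))"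
      unfolding hankel_self_adjoint[OF n h g] hankel_self_adjoint[OF n \<phi> hg] ..
    also have "\<dots> = (LINT s:{0..}|lborel. of_real (hankel_const n) * (\<phi> s * gauss a s * of_real (s ^ (n - 1))))"
      unfolding hankel_hankel_gauss[OF n a] by (simp only: mult_ac)
    finally show "(LINT s:{0..}|lborel. u s * gauss a s * of_real (s ^ (n - 1))) = 0" by simp
  qed
  then show ?thesis by (simp add: u_def)
qed

text \<open>Self-adjointness is applied to \<open>\<phi>\<close> and the conjugate of its transform;
  the kernel is real, so conjugation commutes with the transform and inversion applies.\<close>

theorem hankel_plancherel:
  assumes n: "n \<ge> 2" and \<phi>: "rapid \<phi>" and h: "rapid (hankel n \<phi>)"
  shows "(LINT \<xi>:{0..}|lborel. (norm (hankel n \<phi> \<xi>))\<^sup>2 * \<xi> ^ (n - 1))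
       = hankel_const n * (LINT s:{0..}|lborel. (norm (\<phi> s))\<^sup>2 * s ^ (n - 1))"
proof -
  have sq: "complex_of_real (LINT s:{0..}|lborel. (norm (g s))\<^sup>2 * s ^ (n - 1)) = (LINT s:{0..}|lborel. g s * cnj (g s) * of_real (s ^ (n - 1)))"
    for g :: "real \<Rightarrow> complex"
    unfolding set_lebesgue_integral_def integral_complex_of_real[symmetric]
    unfolding complex_norm_square[symmetric]
    by (rule Bochner_Integration.integral_cong) (simp_all add: scaleR_conv_of_real)
  have "complex_of_real (LINT \<xi>:{0..}|lborel. (norm (hankel n \<phi> \<xi>))\<^sup>2 * \<xi> ^ (n - 1))
     = (LINT s:{0..}|lborel. \<phi> s * hankel n (\<lambda>\<xi>. cnj (hankel n \<phi> \<xi>)) s * of_real (s ^ (n - 1)))"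
    unfolding sq by (rule hankel_self_adjoint[OF n \<phi> rapid_cnj[OF h]])
  also have "\<dots> = (LINT s:{0..}|lborel. of_real (hankel_const n) * (\<phi> s * cnj (\<phi> s) * of_real (s ^ (n - 1))))"
    unfolding hankel_cnj
    by (rule set_lebesgue_integral_cong) (simp_all add: hankel_inversion[OF n \<phi> h])
  also have "\<dots> = complex_of_real (hankel_const n * (LINT s:{0..}|lborel. (norm (\<phi> s))\<^sup>2 * s ^ (n - 1)))"
    by (simp only: set_integral_mult_right of_real_mult sq)
  finally show ?thesis by (simp only: of_real_eq_iff)
qed

subsection \<open>Radial Schwartz functions\<close>

text \<open>In contrast to \<open>profile\<close>, which evaluates at an arbitrarily chosen point of
  norm \<open>s\<close>, \<open>ray\<close> follows one coordinate axis. It is meaningful for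
  negative \<open>s\<close> as well, and differentiable when \<open>f\<close> is.\<close>

definition ray :: "('a::euclidean_space \<Rightarrow> complex) \<Rightarrow> real \<Rightarrow> complex" where
  "ray f s = f (s *\<^sub>R (SOME b. b \<in> Basis))"

lemma some_Basis: "(SOME b. b \<in> (Basis :: 'a::euclidean_space set)) \<in> Basis"
  by (rule someI_ex) (use nonempty_Basis in blast)

lemma norm_some_Basis [simp]: "norm (SOME b. b \<in> (Basis :: 'a::euclidean_space set)) = 1"
  by (rule norm_Basis[OF some_Basis])

lemma norm_some_norm:
  assumes "s \<ge> 0"
  shows "norm (SOME x::'a::euclidean_space. norm x = s) = s"
proof (rule someI)
  show "norm (s *\<^sub>R (SOME b. b \<in> (Basis :: 'a set))) = s" using assms by simp
qed

lemma profile_radial: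
  fixes f :: "'a::euclidean_space \<Rightarrow> 'b"
  assumes "radial f"
  shows "profile f (norm x) = f x"
  using assms norm_some_norm[of "norm x"] unfolding radial_def profile_def by (metis norm_ge_zero)

lemma profile_eq_ray:
  assumes "radial f" "s \<ge> 0"
  shows "profile f s = ray f s"
  using profile_radial[OF assms(1), of "s *\<^sub>R (SOME b. b \<in> Basis)"] assms(2) by (simp add: ray_def)

text \<open>Along the axis the derivatives are iterated partials in the direction of that one basis
  vector; evenness holds because opposite points have the same norm.\<close>

lemma ray_even_schwartz:
  fixes f :: "'a::euclidean_space \<Rightarrow> complex"
  assumes "f \<in> schwartz_o"
  shows "ray f \<in> even_schwartz"
proof -
  define e where "e = (SOME b. b \<in> (Basis :: 'a set))"
  have e: "e \<in> Basis" "norm e = 1" unfolding e_def by (rule some_Basis, rule norm_some_Basis)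
  define d where "d k s = iterated_partial (replicate k e) f (s *\<^sub>R e)" for k s
  have S: "f \<in> schwartz" "radial f" using assms by (auto simp: schwartz_o_def)
  have sub: "set (replicate k e) \<subseteq> Basis" for k using e by auto
  show ?thesis unfolding even_schwartz_def mem_Collect_eq
  proof (intro conjI allI exI[of _ d])
    show "ray f (- x) = ray f x" for x using S(2) unfolding ray_def radial_def by (metis norm_minus_cancel scaleR_minus_left)
    show "d 0 = ray f" by (simp add: d_def ray_def e_def fun_eq_iff)
    fix k
    show "(d k has_vector_derivative d (Suc k) s) (at s)" for s
    proof -
      let ?g = "iterated_partial (replicate k e) f"
      have "?g differentiable (at (s *\<^sub>R e))" using S(1) sub[of k] unfolding schwartz_def by blast
      then have D: "(?g has_derivative frechet_derivative ?g (at (s *\<^sub>R e))) (at (s *\<^sub>R e))"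
        by (rule frechet_derivative_works[THEN iffD1])
      have "((\<lambda>s. ?g (s *\<^sub>R e)) has_derivative (\<lambda>h. frechet_derivative ?g (at (s *\<^sub>R e)) (h *\<^sub>R e))) (at s)"
        by (rule has_derivative_compose[where f = "\<lambda>s. s *\<^sub>R e" and f' = "\<lambda>h. h *\<^sub>R e", OF _ D])
           (auto intro!: derivative_eq_intros)
      moreover have "frechet_derivative ?g (at (s *\<^sub>R e)) (h *\<^sub>R e) = h *\<^sub>R d (Suc k) s" for h
        using linear_scale[OF has_derivative_linear[OF D]] by (simp add: d_def)
      ultimately show ?thesis unfolding has_vector_derivative_def d_def[abs_def] by simp
    qed
    fix m :: nat
    obtain C where C: "\<And>x. norm x ^ m * norm (iterated_partial (replicate k e) f x) \<le> C"
      using S(1) sub[of k] unfolding schwartz_def by blast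
    show "\<exists>C. \<forall>s. \<bar>s\<bar> ^ m * norm (d k s) \<le> C"
      using C[of "_ *\<^sub>R e"] e(2) by (intro exI[of _ C]) (simp add: d_def)
  qed
qed

lemma ray_rapid: "f \<in> schwartz_o \<Longrightarrow> rapid (ray f)"
  by (rule even_schwartz_rapid[OF ray_even_schwartz])

lemma set_lebesgue_eq_lborel:
  fixes f :: "real \<Rightarrow> 'b::{banach, second_countable_topology}"
  assumes "f \<in> borel_measurable borel" "A \<in> sets borel"
  shows "(LINT s:A|lebesgue. f s) = (LINT s:A|lborel. f s)"
  unfolding set_lebesgue_integral_def
  by (rule integral_completion) (use assms in measurable)

lemma sph_kernel_eq:
  assumes "DIM('a::euclidean_space) \<ge> 2" "z \<ge> 0"
  shows "sph_kernel TYPE('a) z = sj ((real DIM('a) - 2) / 2) z"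
  unfolding sph_kernel_def using assms by (intro spherical_J_eq_sj) auto

lemma sft_eq_hankel:
  fixes f :: "'a::euclidean_space \<Rightarrow> complex"
  assumes n: "DIM('a) \<ge> 2" and f: "f \<in> schwartz_o" and xi: "\<xi> \<ge> 0"
  shows "sft f \<xi> = hankel DIM('a) (ray f) \<xi>"
proof -
  let ?\<nu> = "(real DIM('a) - 2) / 2" and ?n = "DIM('a)"
  have nu: "?\<nu> \<ge> 0" using n by simp
  note rapid_measurable[OF ray_rapid[OF f], measurable] sj_measurable[OF nu, measurable]
  have r: "radial f" using f by (simp add: schwartz_o_def)
  have "sft f \<xi> = (LINT s:{0..}|lebesgue. of_real (sj ?\<nu> (s * \<xi>) * s ^ (?n - 1)) * ray f s)"
    unfolding sft_def
    by (rule set_lebesgue_integral_cong) (use xi in \<open>simp_all add: profile_eq_ray[OF r] sph_kernel_eq[OF n] mult_ac\<close>)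
  also have "\<dots> = (LINT s:{0..}|lborel. of_real (sj ?\<nu> (s * \<xi>) * s ^ (?n - 1)) * ray f s)"
    by (rule set_lebesgue_eq_lborel) measurable
  finally show ?thesis unfolding hankel_def .
qed

lemma sft_rapid: "DIM('a) \<ge> 2 \<Longrightarrow> (f :: 'a::euclidean_space \<Rightarrow> complex) \<in> schwartz_o \<Longrightarrow> rapid (hankel DIM('a) (ray f))"
  by (intro hankel_rapid ray_even_schwartz)

lemma spectral_integral_eq:
  fixes f :: "'a::euclidean_space \<Rightarrow> complex"
  assumes n: "DIM('a) \<ge> 2" and f: "f \<in> schwartz_o" and s: "s \<ge> 0"
  shows "(LINT \<xi>:{0..}|lebesgue. of_real (sph_kernel TYPE('a) (\<xi> * s)) * cexp (t * \<xi>\<^sup>2) * sft f \<xi> * of_real (\<xi> ^ (DIM('a) - 1)))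
     = spec_prop DIM('a) (hankel DIM('a) (ray f)) t s"
proof -
  let ?\<nu> = "(real DIM('a) - 2) / 2" and ?n = "DIM('a)"
  have nu: "?\<nu> \<ge> 0" using n by simp
  note rapid_measurable[OF sft_rapid[OF n f], measurable] sj_measurable[OF nu, measurable]
  have "(LINT \<xi>:{0..}|lebesgue. of_real (sph_kernel TYPE('a) (\<xi> * s)) * cexp (t * \<xi>\<^sup>2) * sft f \<xi> * of_real (\<xi> ^ (?n - 1)))
    = (LINT \<xi>:{0..}|lebesgue. of_real (sj ?\<nu> (\<xi> * s)) * cexp (t * \<xi>\<^sup>2) * hankel ?n (ray f) \<xi> * of_real (\<xi> ^ (?n - 1)))"
    by (rule set_lebesgue_integral_cong) (use s in \<open>simp_all add: sft_eq_hankel[OF n f] sph_kernel_eq[OF n]\<close>)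
  also have "\<dots> = (LINT \<xi>:{0..}|lborel. of_real (sj ?\<nu> (\<xi> * s)) * cexp (t * \<xi>\<^sup>2) * hankel ?n (ray f) \<xi> * of_real (\<xi> ^ (?n - 1)))"
    by (rule set_lebesgue_eq_lborel) measurable
  finally show ?thesis unfolding spec_prop_def[of ?n "hankel ?n (ray f)"] .
qed

lemma inversion_integral:
  fixes f :: "'a::euclidean_space \<Rightarrow> complex"
  assumes n: "DIM('a) \<ge> 2" and f: "f \<in> schwartz_o" and s: "s \<ge> 0"
  shows "(LINT \<xi>:{0..}|lebesgue. of_real (sph_kernel TYPE('a) (\<xi> * s)) * sft f \<xi> * of_real (\<xi> ^ (DIM('a) - 1)))
     = of_real (hankel_const DIM('a)) * profile f s"
proof -
  have r: "radial f" using f by (simp add: schwartz_o_def)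
  show ?thesis
    using spectral_integral_eq[OF n f s, of 0] hankel_inversion[OF n ray_rapid[OF f] sft_rapid[OF n f] s]
    by (simp add: cexp_def profile_eq_ray[OF r s])
qed

subsection \<open>Gaussian sums are Schwartz functions\<close>

text \<open>A class that contains Gaussians and is closed under directional derivatives, with decay
  inherited by each rule. Membership in \<open>schwartz\<close> then follows by induction on the
  list of directions. Sums may mix different exponents, as transforms of Gaussian sums do.\<close>

inductive poly_gauss :: "('a::euclidean_space \<Rightarrow> complex) \<Rightarrow> bool" where
  base: "a > 0 \<Longrightarrow> poly_gauss (\<lambda>x. of_real (exp (- (a * (x \<bullet> x)))))"
| coord: "poly_gauss f \<Longrightarrow> poly_gauss (\<lambda>x. of_real (x \<bullet> b) * f x)"
| scale: "poly_gauss f \<Longrightarrow> poly_gauss (\<lambda>x. c * f x)"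
| add: "poly_gauss f \<Longrightarrow> poly_gauss g \<Longrightarrow> poly_gauss (\<lambda>x. f x + g x)"

lemma poly_gauss_derivative:
  assumes "poly_gauss f"
  shows "\<exists>D. (\<forall>b. poly_gauss (\<lambda>x. D x b)) \<and> (\<forall>x. (f has_derivative D x) (at x))"
  using assms
proof (induction rule: poly_gauss.induct)
  case (base a)
  show ?case
  proof (intro exI[of _ "\<lambda>x h. of_real (- 2 * a) * (of_real (x \<bullet> h) * of_real (exp (- (a * (x \<bullet> x)))))"] conjI allI)
    show "poly_gauss (\<lambda>x. of_real (- 2 * a) * (of_real (x \<bullet> b) * of_real (exp (- (a * (x \<bullet> x))))))" for b
      by (intro poly_gauss.scale poly_gauss.coord poly_gauss.base base)
    show "((\<lambda>x. complex_of_real (exp (- (a * (x \<bullet> x))))) has_derivative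
       (\<lambda>h. of_real (- 2 * a) * (of_real (x \<bullet> h) * of_real (exp (- (a * (x \<bullet> x))))))) (at x)" for x
      by (rule has_derivative_eq_rhs, rule has_derivative_of_real, (rule derivative_intros)+)
         (auto simp: fun_eq_iff inner_commute algebra_simps)
  qed
next
  case (coord f b)
  then obtain D where D: "\<And>b. poly_gauss (\<lambda>x. D x b)" "\<And>x. (f has_derivative D x) (at x)" by blast
  show ?case
  proof (intro exI[of _ "\<lambda>x h. of_real (x \<bullet> b) * D x h + of_real (h \<bullet> b) * f x"] conjI allI)
    show "poly_gauss (\<lambda>x. of_real (x \<bullet> b) * D x h + of_real (h \<bullet> b) * f x)" for h
      by (intro poly_gauss.intros D coord)
    show "((\<lambda>x. of_real (x \<bullet> b) * f x) has_derivative (\<lambda>h. of_real (x \<bullet> b) * D x h + of_real (h \<bullet> b) * f x)) (at x)" for x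
      by (rule has_derivative_mult[OF _ D(2)]) (auto intro!: derivative_eq_intros)
  qed
next
  case (scale f c)
  then obtain D where D: "\<And>b. poly_gauss (\<lambda>x. D x b)" "\<And>x. (f has_derivative D x) (at x)" by blast
  show ?case
    by (intro exI[of _ "\<lambda>x h. c * D x h"] conjI allI poly_gauss.scale D has_derivative_mult_right)
next
  case (add f g)
  then obtain D E where D: "\<And>b. poly_gauss (\<lambda>x. D x b)" "\<And>x. (f has_derivative D x) (at x)"
    and E: "\<And>b. poly_gauss (\<lambda>x. E x b)" "\<And>x. (g has_derivative E x) (at x)" by blast
  show ?case
    by (intro exI[of _ "\<lambda>x h. D x h + E x h"] conjI allI poly_gauss.add D E has_derivative_add)
qed

lemma poly_gauss_decay:
  assumes "poly_gauss f"
  shows "\<exists>C. \<forall>x. norm x ^ k * norm (f x) \<le> C"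
  using assms
proof (induction arbitrary: k rule: poly_gauss.induct)
  case (base a)
  obtain C where C: "\<And>x. (1 + \<bar>x\<bar>) ^ k * norm (gauss a x) \<le> C" using gauss_rapid[OF base] unfolding rapid_def by blast
  have "norm x ^ k * norm (complex_of_real (exp (- (a * (x \<bullet> x))))) \<le> C" for x :: 'a
  proof -
    have "norm x ^ k * exp (- (a * (x \<bullet> x))) \<le> (1 + \<bar>norm x\<bar>) ^ k * exp (- (a * (x \<bullet> x)))"
      by (intro mult_right_mono power_mono) auto
    also have "\<dots> \<le> C" using C[of "norm x"] by (simp add: gauss_def power2_norm_eq_inner)
    finally show ?thesis by simp
  qed
  then show ?case by blast
next
  case (coord f b)
  obtain C where C: "\<And>x. norm x ^ Suc k * norm (f x) \<le> C" using coord.IH by blast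
  have "norm x ^ k * norm (of_real (x \<bullet> b) * f x) \<le> norm b * C" for x
  proof -
    have "norm x ^ k * norm (of_real (x \<bullet> b) * f x) \<le> norm x ^ k * ((norm x * norm b) * norm (f x))"
      unfolding norm_mult norm_of_real by (intro mult_left_mono mult_right_mono Cauchy_Schwarz_ineq2) auto
    also have "\<dots> = norm b * (norm x ^ Suc k * norm (f x))" by simp
    also have "\<dots> \<le> norm b * C" by (intro mult_left_mono C) simp
    finally show ?thesis .
  qed
  then show ?case by blast
next
  case (scale f c)
  obtain C where C: "\<And>x. norm x ^ k * norm (f x) \<le> C" using scale.IH by blast
  have "norm x ^ k * norm (c * f x) \<le> norm c * C" for x
    using mult_left_mono[OF C[of x], of "norm c"] by (simp add: norm_mult mult_ac)
  then show ?case by blast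
next
  case (add f g)
  obtain A where A: "\<And>x. norm x ^ k * norm (f x) \<le> A" using add.IH by blast
  obtain B where B: "\<And>x. norm x ^ k * norm (g x) \<le> B" using add.IH by blast
  have "norm x ^ k * norm (f x + g x) \<le> A + B" for x
  proof -
    have "norm x ^ k * norm (f x + g x) \<le> norm x ^ k * (norm (f x) + norm (g x))"
      by (intro mult_left_mono norm_triangle_ineq) simp
    also have "\<dots> \<le> A + B" unfolding distrib_left by (intro add_mono A B)
    finally show ?thesis .
  qed
  then show ?case by blast
qed

lemma poly_gauss_iterated_partial: "poly_gauss f \<Longrightarrow> poly_gauss (iterated_partial bs f)"
proof (induction bs)
  case (Cons b bs)
  obtain D where D: "\<And>b. poly_gauss (\<lambda>x. D x b)" "\<And>x. (iterated_partial bs f has_derivative D x) (at x)"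
    using poly_gauss_derivative[OF Cons.IH[OF Cons.prems]] by blast
  have "iterated_partial (b # bs) f = (\<lambda>x. D x b)"
    using frechet_derivative_at[OF D(2)] by (simp add: fun_eq_iff)
  then show ?case using D(1) by simp
qed simp

lemma poly_gauss_schwartz:
  assumes "poly_gauss f"
  shows "f \<in> schwartz"
  unfolding schwartz_def mem_Collect_eq
proof (intro allI impI conjI)
  fix bs x k
  have p: "poly_gauss (iterated_partial bs f)" by (rule poly_gauss_iterated_partial[OF assms])
  then show "iterated_partial bs f differentiable (at x)"
    using poly_gauss_derivative unfolding differentiable_def by blast
  show "\<exists>C. \<forall>x. norm x ^ k * norm (iterated_partial bs f x) \<le> C" by (rule poly_gauss_decay[OF p])
qed

lemma gauss_sum_schwartz: "(\<lambda>x::'a::euclidean_space. gauss_sum c m (norm x)) \<in> schwartz_o"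
proof -
  have g: "poly_gauss (\<lambda>x::'a. c i * gauss (real i + 1) (norm x))" for i
    unfolding gauss_def power2_norm_eq_inner by (intro poly_gauss.scale poly_gauss.base) simp
  have "poly_gauss (\<lambda>x::'a. \<Sum>i\<le>m. c i * gauss (real i + 1) (norm x))"
  proof (induction m)
    case 0 then show ?case using g[of 0] by simp
  next
    case (Suc m) then show ?case using poly_gauss.add[OF Suc g[of "Suc m"]] by simp
  qed
  then have "(\<lambda>x::'a. gauss_sum c m (norm x)) \<in> schwartz" by (intro poly_gauss_schwartz) (simp add: gauss_sum_def)
  then show ?thesis by (simp add: schwartz_o_def radial_def)
qed

lemma gauss_sum_even: "gauss_sum c m \<bar>s\<bar> = gauss_sum c m s"
  by (simp add: gauss_sum_def gauss_def)

lemma ray_gauss_sum: "ray (\<lambda>x::'a::euclidean_space. gauss_sum c m (norm x)) = gauss_sum c m"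
  by (simp add: fun_eq_iff ray_def gauss_sum_even)

lemma schwartz_diff:
  assumes "f \<in> schwartz" "g \<in> schwartz"
  shows "(\<lambda>x. f x - g x) \<in> schwartz"
proof -
  have it: "iterated_partial bs (\<lambda>x. f x - g x) = (\<lambda>x. iterated_partial bs f x - iterated_partial bs g x)"
    if "set bs \<subseteq> Basis" for bs using that
  proof (induction bs)
    case (Cons b bs)
    have d: "iterated_partial bs f differentiable (at x)" "iterated_partial bs g differentiable (at x)" for x
      using assms Cons.prems unfolding schwartz_def by auto
    have "frechet_derivative (\<lambda>x. iterated_partial bs f x - iterated_partial bs g x) (at x)
      = (\<lambda>h. frechet_derivative (iterated_partial bs f) (at x) h - frechet_derivative (iterated_partial bs g) (at x) h)" for x
      by (rule frechet_derivative_at[symmetric]) (intro has_derivative_diff frechet_derivative_works[THEN iffD1] d)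
    then show ?case using Cons by simp
  qed simp
  show ?thesis unfolding schwartz_def mem_Collect_eq
  proof (intro allI impI conjI)
    fix bs :: "'a list" and x k assume bs: "set bs \<subseteq> Basis"
    show "iterated_partial bs (\<lambda>x. f x - g x) differentiable (at x)"
      unfolding it[OF bs] using assms bs unfolding schwartz_def by (intro differentiable_diff) auto
    obtain A where A: "\<And>x. norm x ^ k * norm (iterated_partial bs f x) \<le> A" using assms(1) bs unfolding schwartz_def by blast
    obtain B where B: "\<And>x. norm x ^ k * norm (iterated_partial bs g x) \<le> B" using assms(2) bs unfolding schwartz_def by blast
    have "norm x ^ k * norm (iterated_partial bs f x - iterated_partial bs g x) \<le> A + B" for x
    proof -
      have "norm x ^ k * norm (iterated_partial bs f x - iterated_partial bs g x) \<le> norm x ^ k * (norm (iterated_partial bs f x) + norm (iterated_partial bs g x))"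
        by (intro mult_left_mono norm_triangle_ineq4) simp
      also have "\<dots> \<le> A + B" unfolding distrib_left by (intro add_mono A B)
      finally show ?thesis .
    qed
    then show "\<exists>C. \<forall>x. norm x ^ k * norm (iterated_partial bs (\<lambda>x. f x - g x) x) \<le> C" unfolding it[OF bs] by blast
  qed
qed

lemma schwartz_o_diff:
  assumes "f \<in> schwartz_o" "g \<in> schwartz_o"
  shows "(\<lambda>x. f x - g x) \<in> schwartz_o"
  using assms schwartz_diff[of f g] unfolding schwartz_o_def radial_def mem_Collect_eq by metis

text \<open>The definite description calls for uniqueness of the constant, for which one test
  function with nonzero value at the origin, a Gaussian, is enough.\<close>

lemma inv_const_eq:
  assumes n: "DIM('a::euclidean_space) \<ge> 2"
  shows "inv_const TYPE('a) = 1 / hankel_const DIM('a)"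
  unfolding inv_const_def
proof (rule the_equality)
  note K = hankel_const_pos[OF n]
  show "1 / hankel_const DIM('a) > 0 \<and> (\<forall>f \<in> (schwartz_o :: ('a \<Rightarrow> complex) set). \<forall>s\<ge>0. profile f s =
        of_real (1 / hankel_const DIM('a)) * (LINT \<xi>:{0..}|lebesgue.
          of_real (sph_kernel TYPE('a) (\<xi> * s)) * sft f \<xi> * of_real (\<xi> ^ (DIM('a) - 1))))"
    using K by (intro conjI ballI allI impI, simp, subst inversion_integral[OF n]) auto
  fix c assume c: "c > 0 \<and> (\<forall>f \<in> (schwartz_o :: ('a \<Rightarrow> complex) set). \<forall>s\<ge>0. profile f s =
        of_real c * (LINT \<xi>:{0..}|lebesgue.
          of_real (sph_kernel TYPE('a) (\<xi> * s)) * sft f \<xi> * of_real (\<xi> ^ (DIM('a) - 1))))"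
  let ?f = "\<lambda>x::'a. gauss_sum (\<lambda>_. 1) 0 (norm x)"
  have f: "?f \<in> schwartz_o" by (rule gauss_sum_schwartz)
  then have r: "radial ?f" by (simp add: schwartz_o_def)
  have "profile ?f 0 = of_real c * (of_real (hankel_const DIM('a)) * profile ?f 0)"
    using c f inversion_integral[OF n f, of 0] by auto
  moreover have "profile ?f 0 = 1"
    unfolding profile_eq_ray[OF r order_refl] ray_gauss_sum by (simp add: gauss_sum_def gauss_def)
  ultimately have "complex_of_real (c * hankel_const DIM('a)) = complex_of_real 1" by simp
  then have "c * hankel_const DIM('a) = 1" by (simp only: of_real_eq_iff)
  then show "c = 1 / hankel_const DIM('a)" using K by (simp add: field_simps)
qed

lemma schroedinger_eq:
  fixes f :: "'a::euclidean_space \<Rightarrow> complex"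
  assumes n: "DIM('a) \<ge> 2" and f: "f \<in> schwartz_o" and s: "s \<ge> 0"
  shows "schroedinger f t s = of_real (1 / hankel_const DIM('a)) * spec_prop DIM('a) (hankel DIM('a) (ray f)) t s"
  unfolding schroedinger_def inv_const_eq[OF n] cexp_def[symmetric] spectral_integral_eq[OF n f s] ..

lemma schroedinger_0:
  fixes f :: "'a::euclidean_space \<Rightarrow> complex"
  assumes n: "DIM('a) \<ge> 2" and f: "f \<in> schwartz_o" and s: "s \<ge> 0"
  shows "schroedinger f 0 s = profile f s"
proof -
  have r: "radial f" using f by (simp add: schwartz_o_def)
  show ?thesis
    using hankel_const_pos[OF n] hankel_inversion[OF n ray_rapid[OF f] sft_rapid[OF n f] s]
    by (simp add: schroedinger_eq[OF n f s] profile_eq_ray[OF r s])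
qed

subsection \<open>Polar coordinates\<close>

definition sphere_const :: "'a::euclidean_space itself \<Rightarrow> real" where
  "sphere_const _ = real DIM('a) * unit_ball_vol (real DIM('a))"

lemma sphere_const_pos: "sphere_const TYPE('a::euclidean_space) > 0"
  by (simp add: sphere_const_def)

text \<open>Both measures agree on every \<open>{..r}\<close>, since the volume of a ball,
  \<open>unit_ball_vol n * r ^ n\<close>, has the given density as its derivative, and these half
  lines generate the Borel sets.\<close>

lemma distr_norm_lborel:
  "distr (lborel :: 'a::euclidean_space measure) borel norm =
     density lborel (\<lambda>s. ennreal (sphere_const TYPE('a) * s ^ (DIM('a) - 1)) * indicator {0..} s)"
  (is "?L = ?R")
proof (rule measure_eqI_generator_eq[where E = "range atMost" and \<Omega> = UNIV and A = "\<lambda>i. {..real i}"])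
  let ?n = "DIM('a)"
  have n: "?n > 0" by simp
  show "Int_stable (range (atMost :: real \<Rightarrow> real set))" by (auto simp: Int_stable_def)
  show "range (\<lambda>i. {..real i}) \<subseteq> range atMost" by auto
  show "(\<Union>i. {..real i}) = UNIV" using real_arch_simple by auto
  have eL: "emeasure ?L {..r} = ennreal (unit_ball_vol ?n * (max 0 r) ^ ?n)" for r
  proof -
    have "emeasure ?L {..r} = emeasure lborel (cball (0::'a) r)"
      by (subst emeasure_distr) (auto intro!: arg_cong[where f = "emeasure lborel"] simp: cball_def)
    also have "\<dots> = ennreal (unit_ball_vol ?n * (max 0 r) ^ ?n)"
    proof (cases "r \<ge> 0")
      case True then show ?thesis by (simp add: emeasure_cball)
    qed simp
    finally show ?thesis .
  qed
  show "emeasure ?L {..real i} \<noteq> \<infinity>" for i by (simp add: eL)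
  show "emeasure ?L X = emeasure ?R X" if X: "X \<in> range atMost" for X
  proof -
    obtain r where r: "X = {..r}" using X by auto
    have "emeasure ?R {..r} = (\<integral>\<^sup>+s. ennreal (sphere_const TYPE('a) * s ^ (?n - 1)) * indicator {0..max 0 r} s \<partial>lborel)"
    proof (cases "r \<ge> 0")
      case True
      then show ?thesis
        by (subst emeasure_density) (auto intro!: nn_integral_cong simp: indicator_def)
    next
      case False
      have "emeasure ?R {..r} = (\<integral>\<^sup>+s. ennreal (sphere_const TYPE('a) * s ^ (?n - 1)) * indicator {0..} s * indicator {..r} s \<partial>lborel)"
        by (rule emeasure_density) auto
      also have "\<dots> = (\<integral>\<^sup>+s. 0 \<partial>(lborel :: real measure))"
        by (rule nn_integral_cong) (use False in \<open>auto simp: indicator_def\<close>)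
      also have "\<dots> = (\<integral>\<^sup>+s. ennreal (sphere_const TYPE('a) * s ^ (?n - 1)) * indicator {0..max 0 r} s \<partial>lborel)"
        using False AE_lborel_singleton[of "0::real"] by (intro nn_integral_cong_AE) (auto simp: indicator_def)
      finally show ?thesis .
    qed
    also have "\<dots> = ennreal (unit_ball_vol ?n * (max 0 r) ^ ?n - unit_ball_vol ?n * 0 ^ ?n)"
    proof (rule nn_integral_FTC_Icc)
      show "((\<lambda>s. unit_ball_vol ?n * s ^ ?n) has_real_derivative sphere_const TYPE('a) * s ^ (?n - 1)) (at s)" for s
        by (auto intro!: derivative_eq_intros simp: sphere_const_def)
      show "0 \<le> sphere_const TYPE('a) * s ^ (?n - 1)" if "s \<in> {0..max 0 r}" for s
        using that sphere_const_pos[where 'a = 'a] by simp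
    qed auto
    also have "\<dots> = emeasure ?L {..r}" using n by (simp add: eL)
    finally show ?thesis unfolding r ..
  qed
qed (auto simp: borel_eq_atMost)

lemma nn_integral_radial:
  assumes [measurable]: "g \<in> borel_measurable borel"
  shows "(\<integral>\<^sup>+x. g (norm (x::'a::euclidean_space)) \<partial>lborel)
     = ennreal (sphere_const TYPE('a)) * (\<integral>\<^sup>+s\<in>{0..}. g s * ennreal (s ^ (DIM('a) - 1)) \<partial>lborel)"
proof -
  have "(\<integral>\<^sup>+x. g (norm (x::'a)) \<partial>lborel) = (\<integral>\<^sup>+s. g s \<partial>distr (lborel :: 'a measure) borel norm)"
    by (simp add: nn_integral_distr)
  also have "\<dots> = (\<integral>\<^sup>+s. ennreal (sphere_const TYPE('a)) * (g s * ennreal (s ^ (DIM('a) - 1)) * indicator {0..} s) \<partial>lborel)"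
    unfolding distr_norm_lborel using sphere_const_pos[where 'a = 'a]
    by (subst nn_integral_density) (auto intro!: nn_integral_cong simp: indicator_def ennreal_mult mult_ac)
  also have "\<dots> = ennreal (sphere_const TYPE('a)) * (\<integral>\<^sup>+s\<in>{0..}. g s * ennreal (s ^ (DIM('a) - 1)) \<partial>lborel)"
    by (rule nn_integral_cmult) measurable
  finally show ?thesis .
qed

lemma AE_lebesgue_on_half_line: "(AE s in lebesgue_on {0::real..}. P s) \<longleftrightarrow> (AE s in lborel. 0 \<le> s \<longrightarrow> P s)"
  by (subst AE_restrict_space_iff) (auto simp: AE_completion_iff)

lemma AE_radial:
  assumes "AE s in lebesgue_on {0..}. P s"
  shows "AE x in lebesgue. P (norm (x::'a::euclidean_space))"
proof -
  have "AE s in lborel. 0 \<le> s \<longrightarrow> P s" using assms by (simp add: AE_lebesgue_on_half_line)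
  then obtain N where N: "N \<in> null_sets lborel" "{s. \<not> (0 \<le> s \<longrightarrow> P s)} \<subseteq> N"
    by (auto simp: eventually_ae_filter)
  have "AE s in lborel. s \<notin> N" by (rule AE_not_in[OF N(1)])
  then have "AE s in distr (lborel :: 'a measure) borel norm. s \<notin> N"
    unfolding distr_norm_lborel by (subst AE_density) auto
  then have "AE x in (lborel :: 'a measure). norm x \<notin> N"
    using N(1) by (subst (asm) AE_distr_iff) (auto simp: null_sets_def)
  then have "AE x in (lborel :: 'a measure). P (norm x)"
    by eventually_elim (use N(2) norm_ge_zero in blast)
  then show ?thesis by (simp add: AE_completion_iff)
qed

text \<open>Exhaustion by compact sets, whose continuous images are compact. It makes the set of
  radii of spheres meeting a closed set measurable.\<close>

lemma norm_image_closed: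
  assumes "closed (C :: 'a::euclidean_space set)"
  shows "norm ` C \<in> sets borel"
proof -
  have "norm ` C = (\<Union>k::nat. norm ` (C \<inter> cball 0 (real k)))"
  proof -
    have "C = (\<Union>k::nat. C \<inter> cball 0 (real k))" using real_arch_simple by auto
    then show ?thesis by (metis image_UN)
  qed
  moreover have "norm ` (C \<inter> cball 0 (real k)) \<in> sets borel" for k :: nat
    by (intro borel_closed compact_imp_closed compact_continuous_image closed_Int_compact assms continuous_intros) auto
  ultimately show ?thesis by auto
qed

text \<open>Converse of the previous transfer: a radial null set lies in open sets of small measure, and
  such an open set contains the union of the spheres that lie in it.\<close>

lemma AE_profile:
  assumes "AE x in lebesgue. P (norm (x::'a::euclidean_space))"
  shows "AE s in lebesgue_on {0..}. P s"
proof -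
  have "AE x in (lborel :: 'a measure). P (norm x)" using assms by (simp add: AE_completion_iff)
  then obtain N where N: "N \<in> null_sets (lborel :: 'a measure)" "{x. \<not> P (norm x)} \<subseteq> N"
    by (auto simp: eventually_ae_filter)
  have "\<exists>U. open U \<and> N \<subseteq> U \<and> emeasure lborel U \<le> ennreal (inverse (real (Suc k)))" for k
  proof -
    have NL: "N \<in> sets lebesgue" "emeasure lebesgue N = 0" using N(1) by (auto simp: null_sets_def)
    obtain U where U: "open U" "N \<subseteq> U" "emeasure lebesgue (U - N) < ennreal (inverse (real (Suc k)))"
      by (rule sets_lebesgue_outer_open[OF NL(1), of "inverse (real (Suc k))"]) simp_all
    have UN: "U - N \<in> sets lebesgue" using U(1) NL(1) by (intro sets.Diff) auto
    have "emeasure lebesgue ((U - N) \<union> N) \<le> emeasure lebesgue (U - N) + emeasure lebesgue N"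
      by (rule emeasure_subadditive[OF UN NL(1)])
    moreover have "(U - N) \<union> N = U" using U(2) by blast
    ultimately have "emeasure lebesgue U \<le> emeasure lebesgue (U - N)" by (simp only: NL(2) add_0_right)
    moreover have "emeasure lebesgue U = emeasure lborel U" using U(1) by simp
    ultimately have "emeasure lborel U \<le> ennreal (inverse (real (Suc k)))"
      using U(3) by (metis order_less_imp_le order_trans)
    with U show ?thesis by blast
  qed
  then obtain U where U: "\<And>k. open (U k)" "\<And>k. N \<subseteq> U k" "\<And>k. emeasure lborel (U k) \<le> ennreal (inverse (real (Suc k)))"
    by metis
  \<comment> \<open>The radii whose whole sphere lies in every \<open>U k\<close>. The preimage of
    \<open>G\<close> under the norm is contained in each \<open>U k\<close>, so it has measure 0,
    and \<open>G\<close> contains every radius at which \<open>P\<close> fails.\<close>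
  define G where "G = (\<Inter>k. {0..} - norm ` (- U k))"
  have Gm: "G \<in> sets borel" unfolding G_def using norm_image_closed[of "- U _"] U(1) by (auto simp: closed_Compl)
  have "emeasure (distr (lborel :: 'a measure) borel norm) G = 0"
  proof -
    have "emeasure (distr (lborel :: 'a measure) borel norm) G \<le> ennreal (inverse (real (Suc k)))" for k
    proof -
      have "emeasure (distr (lborel :: 'a measure) borel norm) G = emeasure lborel (norm -` G :: 'a set)"
        using Gm by (simp add: emeasure_distr)
      also have "\<dots> \<le> emeasure lborel (U k)"
        by (rule emeasure_mono) (use U(1) in \<open>auto simp: G_def\<close>)
      finally show ?thesis using U(3)[of k] by simp
    qed
    then have "emeasure (distr (lborel :: 'a measure) borel norm) G \<le> ennreal 0"
      by (intro tendsto_lowerbound[OF tendsto_ennrealI[OF LIMSEQ_inverse_real_of_nat]]) auto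
    then show ?thesis by simp
  qed
  then have "AE s in distr (lborel :: 'a measure) borel norm. s \<notin> G"
    using Gm by (intro AE_not_in) (auto simp: null_sets_def)
  then have "AE s in lborel. 0 < ennreal (sphere_const TYPE('a) * s ^ (DIM('a) - 1)) * indicator {0..} s \<longrightarrow> s \<notin> G"
    unfolding distr_norm_lborel by (subst (asm) AE_density) auto
  with AE_lborel_singleton[of "0::real"] have "AE s in lborel. 0 \<le> s \<longrightarrow> P s"
  proof eventually_elim
    case (elim s)
    show ?case
    proof (rule impI, rule ccontr)
      assume s: "0 \<le> s" "\<not> P s"
      have "s \<notin> norm ` (- U k)" for k
      proof
        assume "s \<in> norm ` (- U k)"
        then obtain x where "x \<notin> U k" "s = norm x" by auto
        then show False using s(2) N(2) U(2)[of k] by auto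
      qed
      then have "s \<in> G" using s by (auto simp: G_def)
      moreover have "0 < sphere_const TYPE('a) * s ^ (DIM('a) - 1)"
        using s elim(1) sphere_const_pos[where 'a = 'a] by simp
      ultimately show False using elim(2) s by simp
    qed
  qed
  then show ?thesis by (simp add: AE_lebesgue_on_half_line)
qed

text \<open>\<open>A\<close> is an F-sigma set \<open>C\<close> up to a null set. The radii of
  \<open>C\<close> form a Borel set because \<open>C\<close> is a countable union of compact sets,
  and the remaining radii of \<open>B\<close> have a null preimage under the norm, so they are null
  by \<open>AE_profile\<close>.\<close>

lemma radial_set_profile:
  fixes A :: "'a::euclidean_space set"
  assumes A: "A \<in> sets lebesgue" and B: "B \<subseteq> {0..}" "A = norm -` B"
  shows "B \<in> sets lebesgue"
proof -
  obtain C T where CT: "fsigma C" "T \<in> null_sets lebesgue" "C \<union> T = A" "disjnt C T"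
    using lebesgue_set_almost_fsigma[OF A] by blast
  have "\<exists>F::nat \<Rightarrow> 'a set. range F \<subseteq> Collect compact \<and> C = \<Union>(range F)"
    using CT(1) by (simp only: fsigma_Union_compact)
  then obtain F :: "nat \<Rightarrow> 'a set" where F: "range F \<subseteq> Collect compact" "C = \<Union>(range F)"
    by (elim exE conjE) (rule that)
  have nC: "norm ` C \<in> sets borel"
  proof -
    have "norm ` C = (\<Union>k. norm ` F k)" unfolding F(2) by auto
    moreover have "norm ` F k \<in> sets borel" for k
      using F(1) by (intro norm_image_closed compact_imp_closed) auto
    ultimately show ?thesis by auto
  qed
  have "AE x in lebesgue. x \<notin> T" by (rule AE_not_in[OF CT(2)])
  then have "AE x in lebesgue. norm (x::'a) \<notin> B - norm ` C"
  proof eventually_elim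
    case (elim x)
    show ?case
    proof
      assume *: "norm x \<in> B - norm ` C"
      then have "x \<in> A" using B by auto
      then have "x \<in> C" using CT(3) elim by auto
      then show False using * by auto
    qed
  qed
  then have "AE s in lebesgue_on {0..}. s \<notin> B - norm ` C" by (rule AE_profile)
  then have "AE s in lborel. s \<notin> B - norm ` C" unfolding AE_lebesgue_on_half_line using B by (auto elim: eventually_mono)
  then have "AE s in lebesgue. s \<notin> B - norm ` C" by (simp add: AE_completion_iff)
  then obtain N where N: "N \<in> null_sets lebesgue" "{s \<in> space lebesgue. \<not> s \<notin> B - norm ` C} \<subseteq> N"
    unfolding eventually_ae_filter by blast
  then have "negligible N" by (simp add: negligible_iff_null_sets)
  then have "negligible (B - norm ` C)" by (rule negligible_subset) (use N(2) in auto)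
  then have "B - norm ` C \<in> sets lebesgue" by (simp add: negligible_imp_sets)
  moreover have "norm ` C \<subseteq> B" using CT(3) B by auto
  moreover have "norm ` C \<in> sets lebesgue" using nC by simp
  ultimately have "norm ` C \<union> (B - norm ` C) \<in> sets lebesgue" by blast
  with \<open>norm ` C \<subseteq> B\<close> show ?thesis by (simp add: Un_absorb1)
qed

lemma completion_ex_borel_measurable_complex:
  fixes g :: "'b \<Rightarrow> complex"
  assumes "g \<in> borel_measurable (completion M)"
  obtains h where "h \<in> borel_measurable M" "AE x in M. g x = h x"
proof -
  obtain a where a: "a \<in> borel_measurable M" "AE x in M. Re (g x) = a x"
    using completion_ex_borel_measurable_real[of "\<lambda>x. Re (g x)" M] assms by auto
  obtain b where b: "b \<in> borel_measurable M" "AE x in M. Im (g x) = b x"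
    using completion_ex_borel_measurable_real[of "\<lambda>x. Im (g x)" M] assms by auto
  show ?thesis
  proof (rule that[of "\<lambda>x. of_real (a x) + \<i> * of_real (b x)"])
    show "(\<lambda>x. of_real (a x) + \<i> * of_real (b x)) \<in> borel_measurable M" using a b by measurable
    show "AE x in M. g x = of_real (a x) + \<i> * of_real (b x)"
      using a(2) b(2) by eventually_elim (simp add: complex_eq_iff)
  qed
qed

text \<open>Elements of \<open>L2_o\<close> are only Lebesgue measurable, whereas
  \<open>nn_integral_radial\<close> integrates Borel functions of the norm. The Borel function
  \<open>f0\<close> replaces the profile up to null sets both of radii and of points.\<close>

lemma radial_borel_profile:
  fixes f :: "'a::euclidean_space \<Rightarrow> complex"
  assumes r: "radial f" and f: "f \<in> borel_measurable lebesgue"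
  obtains f0 where "f0 \<in> borel_measurable borel" "AE s in lebesgue_on {0..}. profile f s = f0 s"
    "AE x in lebesgue. f x = f0 (norm x)"
proof -
  let ?p = "\<lambda>s. if s \<ge> 0 then profile f s else 0"
  have "?p \<in> borel_measurable lebesgue"
  proof (rule measurableI)
    fix S :: "complex set" assume S: "S \<in> sets borel"
    define B where "B = {s \<in> {0..}. profile f s \<in> S}"
    have "f -` S \<inter> space lebesgue \<in> sets lebesgue" using f S by (rule measurable_sets)
    then have "f -` S \<in> sets lebesgue" by simp
    moreover have "f -` S = norm -` B" by (auto simp: B_def profile_radial[OF r])
    ultimately have "B \<in> sets lebesgue" by (intro radial_set_profile[of "f -` S"]) (auto simp: B_def)
    moreover have "?p -` S \<inter> space lebesgue = B \<union> (if 0 \<in> S then {..<0} else {})" by (auto simp: B_def split: if_splits)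
    ultimately show "?p -` S \<inter> space lebesgue \<in> sets lebesgue" by auto
  qed simp
  then obtain f0 where f0: "f0 \<in> borel_measurable lborel" "AE s in lborel. ?p s = f0 s"
    using completion_ex_borel_measurable_complex by blast
  have 1: "AE s in lebesgue_on {0..}. profile f s = f0 s"
    unfolding AE_lebesgue_on_half_line using f0(2) by eventually_elim auto
  have 2: "AE x in lebesgue. f x = f0 (norm x)"
    using AE_radial[OF 1, where 'a = 'a] by (simp add: profile_radial[OF r])
  show ?thesis by (rule that[OF _ 1 2]) (use f0(1) in simp)
qed

subsection \<open>Fast convergence and completeness\<close>

text \<open>The sum of \<open>2 ^ k * u k x\<close> has integral at most \<open>2 * C\<close>, hence
  is finite almost everywhere, and its value serves as \<open>K\<close>. Half of the geometric decay
  of the integrals survives pointwise, along the full sequence.\<close>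

lemma fast_decay_AE:
  fixes u :: "nat \<Rightarrow> 'b \<Rightarrow> ennreal"
  assumes [measurable]: "\<And>k. u k \<in> borel_measurable M"
    and C: "C \<ge> 0" "\<And>k. (\<integral>\<^sup>+x. u k x \<partial>M) \<le> ennreal (C / 4 ^ k)"
  shows "AE x in M. \<exists>K\<ge>0. \<forall>k. u k x \<le> ennreal (K / 2 ^ k)"
proof -
  define S where "S x = (\<Sum>k. ennreal (2 ^ k) * u k x)" for x
  have Sm [measurable]: "S \<in> borel_measurable M" unfolding S_def by measurable
  have "(\<integral>\<^sup>+x. S x \<partial>M) = (\<Sum>k. \<integral>\<^sup>+x. ennreal (2 ^ k) * u k x \<partial>M)"
    unfolding S_def by (rule nn_integral_suminf) measurable
  also have "\<dots> \<le> (\<Sum>k. ennreal (C * (1/2) ^ k))"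
  proof (rule suminf_le)
    fix k
    have "(\<integral>\<^sup>+x. ennreal (2 ^ k) * u k x \<partial>M) = ennreal (2 ^ k) * (\<integral>\<^sup>+x. u k x \<partial>M)"
      by (rule nn_integral_cmult) measurable
    also have "\<dots> \<le> ennreal (2 ^ k) * ennreal (C / 4 ^ k)" by (intro mult_left_mono C) simp
    also have "\<dots> = ennreal (2 ^ k * (C / 4 ^ k))" using C(1) by (subst ennreal_mult) auto
    also have "2 ^ k * (C / 4 ^ k) = C * (1/2) ^ k"
    proof -
      have "(4::real) ^ k = 2 ^ k * 2 ^ k" by (simp flip: power_mult_distrib)
      then show ?thesis by (simp add: power_one_over)
    qed
    finally show "(\<integral>\<^sup>+x. ennreal (2 ^ k) * u k x \<partial>M) \<le> ennreal (C * (1/2) ^ k)" .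
  qed auto
  also have "\<dots> = ennreal (\<Sum>k. C * (1/2) ^ k)"
    using C(1) by (intro suminf_ennreal2) (auto intro!: summable_mult summable_geometric)
  also have "\<dots> < \<infinity>" by simp
  finally have "AE x in M. S x \<noteq> \<infinity>" by (intro nn_integral_noteq_infinite) auto
  then show ?thesis
  proof eventually_elim
    case (elim x)
    show ?case
    proof (intro exI[of _ "enn2real (S x)"] conjI allI)
      fix k
      have "ennreal (2 ^ k) * u k x \<le> S x"
        unfolding S_def using sum_le_suminf[of "\<lambda>k. ennreal (2 ^ k) * u k x" "{k}"] by simp
      also have "S x = ennreal (enn2real (S x))" using elim by (simp add: ennreal_enn2real_if)
      finally have "ennreal (1 / 2 ^ k) * (ennreal (2 ^ k) * u k x) \<le> ennreal (1 / 2 ^ k) * ennreal (enn2real (S x))"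
        by (intro mult_left_mono) auto
      also have "\<dots> = ennreal (enn2real (S x) / 2 ^ k)" by (simp flip: ennreal_mult)
      also have "ennreal (1 / 2 ^ k) * (ennreal (2 ^ k) * u k x) = u k x"
        by (simp add: mult.assoc[symmetric] flip: ennreal_mult)
      finally show "u k x \<le> ennreal (enn2real (S x) / 2 ^ k)" .
    qed simp
  qed
qed

lemma summable_sqrt_geometric: "summable (\<lambda>k. sqrt (K / 2 ^ k))"
proof -
  have "sqrt (K / 2 ^ k) = sqrt K * (1 / sqrt 2) ^ k" for k
    by (simp add: real_sqrt_divide real_sqrt_power power_one_over)
  then show ?thesis by (simp add: summable_mult summable_geometric)
qed

lemma norm_le_sqrtI: "ennreal ((norm z)\<^sup>2) \<le> ennreal b \<Longrightarrow> b \<ge> 0 \<Longrightarrow> norm z \<le> sqrt b"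
  by (simp add: real_le_rsqrt)

lemma fast_Cauchy_convergent:
  fixes f :: "nat \<Rightarrow> 'b::banach"
  assumes "\<And>k. norm (f (Suc k) - f k) \<le> sqrt (K / 2 ^ k)"
  shows "convergent f"
proof -
  have "summable (\<lambda>k. f (Suc k) - f k)"
    by (rule summable_comparison_test'[OF summable_sqrt_geometric]) (rule assms)
  then have "convergent (\<lambda>n. \<Sum>k<n. f (Suc k) - f k)" by (simp add: summable_iff_convergent)
  then have "convergent (\<lambda>n. f n - f 0)" by (simp only: sum_lessThan_telescope)
  then have "convergent (\<lambda>n. (f n - f 0) + f 0)" by (intro convergent_add convergent_const)
  then show ?thesis by simp
qed

lemma ennreal_sq_triangle: "ennreal ((norm (x - z))\<^sup>2 * w) \<le> 2 * ennreal ((norm (x - y))\<^sup>2 * w) + 2 * ennreal ((norm (y - z))\<^sup>2 * w)"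
  if "w \<ge> 0" for x y z :: "'b::real_normed_vector"
proof -
  have "(norm (x - z))\<^sup>2 \<le> (norm (x - y) + norm (y - z))\<^sup>2" using norm_triangle_ineq[of "x - y" "y - z"] by (intro power_mono) auto
  also have "\<dots> \<le> 2 * (norm (x - y))\<^sup>2 + 2 * (norm (y - z))\<^sup>2"
    using sum_squares_bound[of "norm (x - y)" "norm (y - z)"] by (simp add: power2_sum)
  finally have "(norm (x - z))\<^sup>2 * w \<le> (2 * (norm (x - y))\<^sup>2 + 2 * (norm (y - z))\<^sup>2) * w"
    using that by (rule mult_right_mono)
  then have "ennreal ((norm (x - z))\<^sup>2 * w) \<le> ennreal (2 * ((norm (x - y))\<^sup>2 * w) + 2 * ((norm (y - z))\<^sup>2 * w))"
    by (intro ennreal_leI) (simp add: algebra_simps)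
  also have "\<dots> = 2 * ennreal ((norm (x - y))\<^sup>2 * w) + 2 * ennreal ((norm (y - z))\<^sup>2 * w)"
    using that by (simp add: ennreal_plus ennreal_mult)
  finally show ?thesis .
qed

lemma nn_integral_sq_triangle:
  fixes f g h :: "'b \<Rightarrow> complex"
  assumes [measurable]: "f \<in> borel_measurable M" "g \<in> borel_measurable M" "h \<in> borel_measurable M" "w \<in> borel_measurable M"
    and w: "\<And>x. x \<in> space M \<Longrightarrow> w x \<ge> 0"
  shows "(\<integral>\<^sup>+x. ennreal ((norm (f x - h x))\<^sup>2 * w x) \<partial>M)
    \<le> 2 * (\<integral>\<^sup>+x. ennreal ((norm (f x - g x))\<^sup>2 * w x) \<partial>M)
        + 2 * (\<integral>\<^sup>+x. ennreal ((norm (g x - h x))\<^sup>2 * w x) \<partial>M)"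
proof -
  have "(\<integral>\<^sup>+x. ennreal ((norm (f x - h x))\<^sup>2 * w x) \<partial>M)
     \<le> (\<integral>\<^sup>+x. 2 * ennreal ((norm (f x - g x))\<^sup>2 * w x) + 2 * ennreal ((norm (g x - h x))\<^sup>2 * w x) \<partial>M)"
    by (intro nn_integral_mono ennreal_sq_triangle w)
  also have "\<dots> = 2 * (\<integral>\<^sup>+x. ennreal ((norm (f x - g x))\<^sup>2 * w x) \<partial>M)
      + 2 * (\<integral>\<^sup>+x. ennreal ((norm (g x - h x))\<^sup>2 * w x) \<partial>M)"
    by (subst nn_integral_add) (simp_all add: nn_integral_cmult)
  finally show ?thesis .
qed

text \<open>Riesz-Fischer in squared distances: a subsequence with squared gaps at most
  \<open>1 / 4 ^ k\<close> converges almost everywhere by \<open>fast_decay_AE\<close>, and Fatou's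
  lemma gives mean square convergence of the whole sequence.\<close>

lemma L2_complete:
  fixes F :: "nat \<Rightarrow> 'b \<Rightarrow> complex"
  assumes F [measurable]: "\<And>j. F j \<in> borel_measurable M"
    and cauchy: "\<And>e. e > 0 \<Longrightarrow> \<exists>N. \<forall>i\<ge>N. \<forall>j\<ge>N. (\<integral>\<^sup>+x. ennreal ((norm
        (F i x - F j x))\<^sup>2) \<partial>M) \<le> ennreal e"
  obtains g where "g \<in> borel_measurable M" "(\<lambda>j. \<integral>\<^sup>+x. ennreal ((norm (F j x - g x))\<^sup>2) \<partial>M) \<longlonglongrightarrow> 0"
proof -
  have "\<exists>N. \<forall>k. \<forall>i\<ge>N k. \<forall>j\<ge>N k. (\<integral>\<^sup>+x. ennreal ((norm (F i x - F j x))\<^sup>2) \<partial>M)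
      \<le> ennreal (1 / 4 ^ k)"
    by (rule choice) (use cauchy in auto)
  then obtain N where N: "\<And>k i j. i \<ge> N k \<Longrightarrow> j \<ge> N k
      \<Longrightarrow> (\<integral>\<^sup>+x. ennreal ((norm (F i x - F j x))\<^sup>2) \<partial>M) \<le> ennreal (1 / 4 ^ k)"
    by blast
  \<comment> \<open>Adding all thresholds up to \<open>k\<close> makes both \<open>r k\<close> and
    \<open>r (Suc k)\<close> at least \<open>N k\<close> even if \<open>N\<close> is not monotone;
    the summand \<open>k\<close> makes \<open>r\<close> tend to infinity.\<close>
  define r where "r k = k + (\<Sum>i\<le>k. N i)" for k
  have r: "r k \<ge> N k" "r (Suc k) \<ge> N k" "r k \<ge> k" for k
  proof -
    have "N k \<le> (\<Sum>i\<le>k. N i)" by (rule member_le_sum) auto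
    then show "r k \<ge> N k" "r (Suc k) \<ge> N k" "r k \<ge> k" by (auto simp: r_def)
  qed
  define g where "g x = lim (\<lambda>k. F (r k) x)" for x
  have gm [measurable]: "g \<in> borel_measurable M" unfolding g_def by measurable
  have "AE x in M. \<exists>K\<ge>0. \<forall>k. ennreal ((norm (F (r (Suc k)) x - F (r k) x))\<^sup>2) \<le> ennreal (K / 2 ^ k)"
    by (rule fast_decay_AE[where C = 1]) (use N[OF r(2,1)] in auto)
  then have conv: "AE x in M. (\<lambda>k. F (r k) x) \<longlonglongrightarrow> g x"
  proof eventually_elim
    case (elim x)
    then obtain K where K: "K \<ge> 0" "\<And>k. ennreal ((norm (F (r (Suc k)) x - F (r k) x))\<^sup>2) \<le> ennreal (K / 2 ^ k)" by blast
    have "convergent (\<lambda>k. F (r k) x)"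
      by (rule fast_Cauchy_convergent[where K = K]) (use K in \<open>intro norm_le_sqrtI; simp\<close>)
    then show ?case by (simp add: g_def convergent_LIMSEQ_iff)
  qed
  have est: "(\<integral>\<^sup>+x. ennreal ((norm (F j x - g x))\<^sup>2) \<partial>M) \<le> ennreal e"
    if e: "\<And>i j. i \<ge> L \<Longrightarrow> j \<ge> L \<Longrightarrow> (\<integral>\<^sup>+x. ennreal ((norm
        (F i x - F j x))\<^sup>2) \<partial>M) \<le> ennreal e" "j \<ge> L" for e L j
  proof -
    have "(\<integral>\<^sup>+x. ennreal ((norm (F j x - g x))\<^sup>2) \<partial>M)
        = (\<integral>\<^sup>+x. liminf (\<lambda>k. ennreal ((norm (F j x - F (r k) x))\<^sup>2)) \<partial>M)"
    proof (rule nn_integral_cong_AE, use conv in eventually_elim)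
      case (elim x)
      have "(\<lambda>k. ennreal ((norm (F j x - F (r k) x))\<^sup>2)) \<longlonglongrightarrow> ennreal ((norm (F j x - g x))\<^sup>2)"
        by (intro tendsto_ennrealI tendsto_intros elim)
      then show ?case by (rule lim_imp_Liminf[OF trivial_limit_sequentially, symmetric])
    qed
    also have "\<dots> \<le> liminf (\<lambda>k. \<integral>\<^sup>+x. ennreal ((norm (F j x - F (r k) x))\<^sup>2) \<partial>M)"
      by (rule nn_integral_liminf) measurable
    also have "\<dots> \<le> liminf (\<lambda>k. ennreal e)"
    proof (rule Liminf_mono)
      show "\<forall>\<^sub>F k in sequentially. (\<integral>\<^sup>+x. ennreal ((norm (F j x - F (r k) x))\<^sup>2) \<partial>M) \<le> ennreal e"
        using eventually_ge_at_top[of L]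
        by eventually_elim (rule e(1)[OF e(2)], use r(3) order_trans in blast)
    qed
    also have "\<dots> = ennreal e" by (simp add: Liminf_const)
    finally show ?thesis .
  qed
  show ?thesis
  proof (rule that[OF gm])
    show "(\<lambda>j. \<integral>\<^sup>+x. ennreal ((norm (F j x - g x))\<^sup>2) \<partial>M) \<longlonglongrightarrow> 0"
    proof (rule order_tendstoI)
      fix a :: ennreal assume "0 < a"
      obtain e where e: "e > 0" "ennreal e < a"
      proof -
        obtain b where "0 < b" "b < a" using \<open>0 < a\<close> dense by blast
        then show ?thesis by (intro that[of "enn2real b"]) (auto simp: enn2real_positive_iff ennreal_enn2real_if less_top[symmetric])
      qed
      obtain L where L: "\<forall>i\<ge>L. \<forall>j\<ge>L. (\<integral>\<^sup>+x. ennreal ((norm (F i x - F j x))\<^sup>2) \<partial>M) \<le> ennreal e"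
        using cauchy[OF e(1)] by blast
      show "\<forall>\<^sub>F j in sequentially. (\<integral>\<^sup>+x. ennreal ((norm (F j x - g x))\<^sup>2) \<partial>M) < a"
        using eventually_ge_at_top[of L]
      proof eventually_elim
        case (elim j)
        have "(\<integral>\<^sup>+x. ennreal ((norm (F j x - g x))\<^sup>2) \<partial>M) \<le> ennreal e"
          by (rule est[where L = L]) (use L elim in auto)
        then show ?case using e(2) by simp
      qed
    qed simp
  qed
qed

subsection \<open>Density of Gaussian sums\<close>

text \<open>For \<open>k > 0\<close>, the radial retraction onto the ball of radius
  \<open>k\<close>: continuous, bounded by \<open>k\<close> and the identity inside. It supplies
  dominating functions for limits.\<close>

definition clip :: "real \<Rightarrow> complex \<Rightarrow> complex" where "clip k z = (k / max k (norm z)) *\<^sub>R z"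

lemma norm_clip:
  assumes k: "k > 0"
  shows "norm (clip k z) \<le> k" "norm z \<le> k \<Longrightarrow> clip k z = z"
proof -
  have m: "norm z \<le> max k (norm z)" "max k (norm z) > 0" using assms by auto
  have "norm (clip k z) = k * (norm z / max k (norm z))" using assms by (simp add: clip_def)
  also have "\<dots> \<le> k * 1" using assms m by (intro mult_left_mono) (auto simp: divide_le_eq)
  finally show "norm (clip k z) \<le> k" by simp
  show "clip k z = z" if "norm z \<le> k" using that assms by (simp add: clip_def max_def)
qed

lemma norm_diff_clip_le:
  assumes k: "k > 0" and c: "0 \<le> c" "c \<le> 1"
  shows "norm (z - c *\<^sub>R clip k z) \<le> norm z"
proof -
  have p: "0 < k / max k (norm z)" "k / max k (norm z) \<le> 1" using assms by auto
  have "z - c *\<^sub>R clip k z = (1 - c * (k / max k (norm z))) *\<^sub>R z" by (simp add: clip_def scaleR_left_diff_distrib)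
  moreover have "0 \<le> c * (k / max k (norm z))"
    by (rule mult_nonneg_nonneg) (use p c in auto)
  moreover have "c * (k / max k (norm z)) \<le> 1"
    by (rule mult_le_one) (use p c in auto)
  ultimately show ?thesis by (simp add: mult_left_le_one_le)
qed

lemma clip_continuous: "k > 0 \<Longrightarrow> continuous_on S f \<Longrightarrow> continuous_on S (\<lambda>x. clip k (f x))"
  unfolding clip_def by (intro continuous_intros) auto

text \<open>\<open>G k\<close> truncates \<open>g\<close> in range and support, \<open>H j\<close>
  replaces the truncated function by a continuous one, and a Gaussian sum approximates that with
  error \<open>\<delta> * exp (- s\<^sup>2)\<close>. Each squared triangle inequality costs a factor
  2, so the shares \<open>e / 6\<close>, \<open>e / 12\<close>, \<open>e / 12\<close> add up to
  \<open>e\<close>. The general weight \<open>W\<close> allows approximation in L2 and in the order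
  1/4 norm at the same time.\<close>

lemma gauss_sum_dense:
  fixes g :: "real \<Rightarrow> complex" and W :: "real \<Rightarrow> real"
  assumes W: "continuous_on UNIV W" "\<And>s. s \<ge> 0 \<Longrightarrow> W s \<ge> 0" "\<And>s. \<bar>W s\<bar> \<le> K * (1 + \<bar>s\<bar>) ^ N"
    and g [measurable]: "g \<in> borel_measurable borel"
    and fin: "(\<integral>\<^sup>+s\<in>{0..}. ennreal ((norm (g s))\<^sup>2 * W s) \<partial>lborel) < \<infinity>" and e: "e > 0"
  obtains c m where "(\<integral>\<^sup>+s\<in>{0..}. ennreal ((norm (g s - gauss_sum c m s))\<^sup>2 * W s) \<partial>lborel) \<le> ennreal e"
proof -
  have [measurable]: "W \<in> borel_measurable borel" by (rule borel_measurable_continuous_onI[OF W(1)])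
  define cut where "cut k s = max 0 (min 1 (real k + 1 - s))" for k :: nat and s :: real
  have cut: "0 \<le> cut k s" "cut k s \<le> 1" "s \<le> real k \<Longrightarrow> cut k s = 1" "real k + 1 \<le> s \<Longrightarrow> cut k s = 0" for k s
    by (auto simp: cut_def)
  have ccut: "continuous_on S (cut k)" for S k unfolding cut_def by (intro continuous_intros)
  have [measurable]: "cut k \<in> borel_measurable borel" for k by (intro borel_measurable_continuous_onI ccut)
  have clipm [measurable]: "clip k \<in> borel_measurable borel" if "k > 0" for k
    using clip_continuous[OF that continuous_on_id] by (intro borel_measurable_continuous_onI) simp
  define G where "G k s = cut k s *\<^sub>R clip (real (Suc k)) (g s)" for k s
  have [measurable]: "G k \<in> borel_measurable borel" for k
  proof -
    note clipm[of "real (Suc k)", measurable (raw)]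
    have "(\<lambda>s. clip (real (Suc k)) (g s)) \<in> borel_measurable borel"
      by (rule measurable_compose[OF g clipm]) simp
    then show ?thesis unfolding G_def by measurable
  qed
  have e6: "ennreal (e / 6) > 0" using e by simp
  have "(\<lambda>k. \<integral>\<^sup>+s. ennreal ((norm (g s - G k s))\<^sup>2 * W s) * indicator {0..} s \<partial>lborel)
      \<longlonglongrightarrow> (\<integral>\<^sup>+s. 0 \<partial>(lborel :: real measure))"
  proof (rule nn_integral_dominated_convergence[where w = "\<lambda>s. ennreal ((norm (g s))\<^sup>2 * W s) * indicator {0..} s"])
    show "AE s in lborel. ennreal ((norm (g s - G k s))\<^sup>2 * W s) * indicator {0..} s \<le> ennreal ((norm (g s))\<^sup>2 * W s) * indicator {0..} s" for k
    proof (rule AE_I2)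
      fix s
      have "norm (g s - G k s) \<le> norm (g s)" unfolding G_def by (rule norm_diff_clip_le) (use cut in auto)
      then have "(norm (g s - G k s))\<^sup>2 \<le> (norm (g s))\<^sup>2" by (rule power_mono) simp
      then show "ennreal ((norm (g s - G k s))\<^sup>2 * W s) * indicator {0..} s \<le> ennreal ((norm (g s))\<^sup>2 * W s) * indicator {0..} s"
        using W(2)[of s] by (auto simp: indicator_def intro!: ennreal_leI mult_right_mono)
    qed
    show "AE s in lborel. (\<lambda>k. ennreal ((norm (g s - G k s))\<^sup>2 * W s) * indicator {0..} s) \<longlonglongrightarrow> 0"
    proof (rule AE_I2)
      fix s
      obtain k0 :: nat where k0: "max s (norm (g s)) \<le> real k0" using real_arch_simple by blast
      show "(\<lambda>k. ennreal ((norm (g s - G k s))\<^sup>2 * W s) * indicator {0..} s) \<longlonglongrightarrow> 0"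
      proof (rule tendsto_eventually, rule eventually_sequentiallyI[of k0])
        fix k assume k: "k0 \<le> k"
        then have "s \<le> real k" "norm (g s) \<le> real (Suc k)" using k0 by auto
        then have "G k s = g s" by (simp add: G_def cut norm_clip(2))
        then show "ennreal ((norm (g s - G k s))\<^sup>2 * W s) * indicator {0..} s = 0" by simp
      qed
    qed
  qed (use fin in auto)
  then have "\<forall>\<^sub>F k in sequentially. (\<integral>\<^sup>+s. ennreal ((norm
      (g s - G k s))\<^sup>2 * W s) * indicator {0..} s \<partial>lborel) < ennreal (e / 6)"
    using e6 by (intro order_tendstoD(2)) auto
  then obtain k where k: "(\<integral>\<^sup>+s. ennreal ((norm (g s - G k s))\<^sup>2 * W s) * indicator {0..} s \<partial>lborel) < ennreal (e / 6)"
    by (auto simp: eventually_sequentially)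
  \<comment> \<open>A Lebesgue measurable function is almost everywhere the limit of continuous
    ones. Applying the same cut-off and retraction to them keeps continuity and convergence and adds
    a common bound.\<close>
  have "g measurable_on UNIV" by (rule lebesgue_measurable_imp_measurable_on) (auto intro: measurable_completion)
  then obtain Z h where Z: "negligible Z" and h: "\<And>j. continuous_on UNIV (h j)" "\<And>x. x \<notin> Z
      \<Longrightarrow> (\<lambda>j. h j x) \<longlonglongrightarrow> g x"
    unfolding measurable_on_def by auto
  define H where "H j s = cut k s *\<^sub>R clip (real (Suc k)) (h j s)" for j :: nat and s
  have cH: "continuous_on UNIV (H j)" for j unfolding H_def by (intro continuous_intros ccut clip_continuous h) simp
  have [measurable]: "H j \<in> borel_measurable borel" for j by (rule borel_measurable_continuous_onI[OF cH])
  have Hk: "norm (G k s) \<le> real (Suc k)" "norm (H j s) \<le> real (Suc k)" for j s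
  proof -
    have "norm (cut k s *\<^sub>R clip (real (Suc k)) z) \<le> 1 * real (Suc k)" for z
      unfolding norm_scaleR using cut(1,2)[of k s] norm_clip(1)[of "real (Suc k)" z] by (intro mult_mono) auto
    then show "norm (G k s) \<le> real (Suc k)" "norm (H j s) \<le> real (Suc k)" by (simp_all add: G_def H_def)
  qed
  have "(\<lambda>j. \<integral>\<^sup>+s. ennreal ((norm (G k s - H j s))\<^sup>2 * W s) * indicator {0..} s \<partial>lborel)
      \<longlonglongrightarrow> (\<integral>\<^sup>+s. 0 \<partial>(lborel :: real measure))"
  proof (rule nn_integral_dominated_convergence[where w = "\<lambda>s. ennreal ((2 * real (Suc k))\<^sup>2 * W s) * indicator {0..real k + 1} s"])
    show "AE s in lborel. ennreal ((norm (G k s - H j s))\<^sup>2 * W s) * indicator {0..} s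
        \<le> ennreal ((2 * real (Suc k))\<^sup>2 * W s) * indicator {0..real k + 1} s" for j
    proof (rule AE_I2)
      fix s
      have "norm (G k s - H j s) \<le> 2 * real (Suc k)" using norm_triangle_ineq4[of "G k s" "H j s"] Hk(1)[of s] Hk(2)[of j s] by simp
      then have "(norm (G k s - H j s))\<^sup>2 \<le> (2 * real (Suc k))\<^sup>2" by (rule power_mono) simp
      moreover have "G k s - H j s = 0" if "\<not> s \<le> real k + 1" using that by (simp add: G_def H_def cut)
      ultimately show "ennreal ((norm (G k s - H j s))\<^sup>2 * W s) * indicator {0..} s \<le> ennreal ((2 * real (Suc k))\<^sup>2 * W s) * indicator {0..real k + 1} s"
        using W(2)[of s] by (cases "s \<le> real k + 1") (auto simp: indicator_def intro!: ennreal_leI mult_right_mono simp del: of_nat_Suc)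
    qed
    show "(\<integral>\<^sup>+s. ennreal ((2 * real (Suc k))\<^sup>2 * W s) * indicator {0..real k + 1} s \<partial>lborel) < \<infinity>"
      by (subst nn_integral_Icc_continuous) (auto intro!: continuous_intros continuous_on_subset[OF W(1)] mult_nonneg_nonneg W(2))
    show "AE s in lborel. (\<lambda>j. ennreal ((norm (G k s - H j s))\<^sup>2 * W s) * indicator {0..} s) \<longlonglongrightarrow> 0"
    proof -
      have "AE s in lborel. s \<notin> Z"
        using AE_not_in[of Z lebesgue] Z by (simp add: negligible_iff_null_sets AE_completion_iff)
      then show ?thesis
      proof eventually_elim
        case (elim s)
        have cc: "isCont (clip (real (Suc k))) (g s)"
          using clip_continuous[OF _ continuous_on_id, of "real (Suc k)" UNIV] by (simp add: continuous_on_eq_continuous_at)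
        have "(\<lambda>j. H j s) \<longlonglongrightarrow> G k s" unfolding G_def H_def
          by (intro tendsto_intros isCont_tendsto_compose[OF cc] h(2) elim)
        then have "(\<lambda>j. ennreal ((norm (G k s - H j s))\<^sup>2 * W s)) \<longlonglongrightarrow> ennreal ((norm (G k s - G k s))\<^sup>2 * W s)"
          by (intro tendsto_ennrealI tendsto_intros)
        then show ?case by (cases "s \<ge> 0") auto
      qed
    qed
  qed auto
  then have "\<forall>\<^sub>F j in sequentially. (\<integral>\<^sup>+s. ennreal ((norm
      (G k s - H j s))\<^sup>2 * W s) * indicator {0..} s \<partial>lborel) < ennreal (e / 12)"
    using e by (intro order_tendstoD(2)) auto
  then obtain j where j: "(\<integral>\<^sup>+s. ennreal ((norm (G k s - H j s))\<^sup>2 * W s) * indicator {0..} s \<partial>lborel) < ennreal (e / 12)"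
    by (auto simp: eventually_sequentially)
  define E where "E = (\<integral>\<^sup>+s. ennreal ((exp (- s\<^sup>2))\<^sup>2 * W s) * indicator {0..} s \<partial>lborel)"
  have Efin: "E < \<infinity>"
  proof -
    have "integrable lborel (\<lambda>s. complex_of_real (W s) * gauss 2 s)"
      by (rule rapid_integrable[OF gauss_rapid]) (use W(3) in auto)
    then have "(\<integral>\<^sup>+s. ennreal (norm (complex_of_real (W s) * gauss 2 s)) \<partial>lborel) < \<infinity>" by (simp add: integrable_iff_bounded)
    moreover have "E \<le> (\<integral>\<^sup>+s. ennreal (norm (complex_of_real (W s) * gauss 2 s)) \<partial>lborel)"
      unfolding E_def
      by (rule nn_integral_mono) (auto simp: indicator_def gauss_def norm_mult W(2) mult.commute simp flip: exp_double)
    ultimately show ?thesis by simp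
  qed
  then obtain E' where E': "E = ennreal E'" "E' \<ge> 0" by (cases E) auto
  \<comment> \<open>\<open>E'\<close> is the weighted integral of the squared Gaussian factor; the
    added 1 avoids division by 0.\<close>
  define \<delta> where "\<delta> = sqrt (e / (12 * (E' + 1)))"
  have \<delta>: "\<delta> > 0" "\<delta>\<^sup>2 = e / (12 * (E' + 1))" using e E' by (auto simp: \<delta>_def)
  obtain c m where cm: "\<And>s. s \<ge> 0 \<Longrightarrow> norm (H j s - gauss_sum c m s) \<le> \<delta> * exp (- s\<^sup>2)"
  proof (rule gauss_sum_approx[of "H j" "real k + 1", OF _ _ \<delta>(1)])
    show "continuous_on {0..} (H j)" using cH continuous_on_subset by blast
    show "H j s = 0" if "real k + 1 \<le> s" for s using that by (simp add: H_def cut)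
  qed blast
  have gsm [measurable]: "gauss_sum c m \<in> borel_measurable borel" by (rule rapid_measurable[OF rapid_gauss_sum])
  have 3: "(\<integral>\<^sup>+s. ennreal ((norm (H j s - gauss_sum c m s))\<^sup>2 * W s) * indicator {0..} s \<partial>lborel) \<le> ennreal (e / 12)"
  proof -
    have "(\<integral>\<^sup>+s. ennreal ((norm (H j s - gauss_sum c m s))\<^sup>2 * W s) * indicator {0..} s \<partial>lborel)
      \<le> (\<integral>\<^sup>+s. ennreal (\<delta>\<^sup>2) * (ennreal ((exp (- s\<^sup>2))\<^sup>2 * W s) * indicator {0..} s) \<partial>lborel)"
    proof (rule nn_integral_mono)
      fix s
      have "ennreal ((norm (H j s - gauss_sum c m s))\<^sup>2 * W s) \<le> ennreal (\<delta>\<^sup>2) * ennreal ((exp (- s\<^sup>2))\<^sup>2 * W s)" if s: "s \<ge> 0"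
      proof -
        have "(norm (H j s - gauss_sum c m s))\<^sup>2 \<le> (\<delta> * exp (- s\<^sup>2))\<^sup>2" by (rule power_mono[OF cm[OF s]]) simp
        then have "(norm (H j s - gauss_sum c m s))\<^sup>2 * W s \<le> (\<delta> * exp (- s\<^sup>2))\<^sup>2 * W s" by (rule mult_right_mono) (rule W(2)[OF s])
        also have "\<dots> = \<delta>\<^sup>2 * ((exp (- s\<^sup>2))\<^sup>2 * W s)" by (simp add: power_mult_distrib)
        finally show ?thesis using W(2)[OF s] by (simp add: ennreal_leI flip: ennreal_mult)
      qed
      then show "ennreal ((norm (H j s - gauss_sum c m s))\<^sup>2 * W s) * indicator {0..} s
          \<le> ennreal (\<delta>\<^sup>2) * (ennreal ((exp (- s\<^sup>2))\<^sup>2 * W s) * indicator {0..} s)"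
        by (cases "s \<ge> 0") auto
    qed
    also have "\<dots> = ennreal (\<delta>\<^sup>2) * E" unfolding E_def by (rule nn_integral_cmult) measurable
    also have "\<dots> = ennreal (\<delta>\<^sup>2 * E')" unfolding E' using E' by (simp add: ennreal_mult)
    also have "\<dots> \<le> ennreal (e / 12)"
    proof (rule ennreal_leI)
      have "e / (12 * (E' + 1)) * E' \<le> e / (12 * (E' + 1)) * (E' + 1)" using e E' by (intro mult_left_mono) auto
      also have "\<dots> = e / 12"
      proof -
        have "e / (12 * x) * x = e / 12" if "x > 0" for x using that by simp
        then show ?thesis using E' by (simp only: add_nonneg_pos zero_less_one)
      qed
      finally show "\<delta>\<^sup>2 * E' \<le> e / 12" unfolding \<delta>(2) .
    qed
    finally show ?thesis .
  qed
  have ind: "ennreal ((norm z)\<^sup>2 * W s) * indicator {0..} s = ennreal ((norm z)\<^sup>2 * (W s * indicator {0..} s))" for z :: complex and s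
    by (auto simp: indicator_def)
  have w0: "0 \<le> W s * indicator {0..} s" for s using W(2)[of s] by (auto simp: indicator_def)
  have "(\<integral>\<^sup>+s\<in>{0..}. ennreal ((norm (g s - gauss_sum c m s))\<^sup>2 * W s) \<partial>lborel)
    \<le> 2 * (\<integral>\<^sup>+s\<in>{0..}. ennreal ((norm (g s - G k s))\<^sup>2 * W s) \<partial>lborel)
        + 2 * (\<integral>\<^sup>+s\<in>{0..}. ennreal ((norm (G k s - gauss_sum c m s))\<^sup>2 * W s) \<partial>lborel)"
    unfolding ind by (rule nn_integral_sq_triangle) (use w0 in auto)
  also have "\<dots> \<le> 2 * ennreal (e / 6) + 2 * (2 * ennreal (e / 12) + 2 * ennreal (e / 12))"
  proof (intro add_mono mult_left_mono)
    show "(\<integral>\<^sup>+s\<in>{0..}. ennreal ((norm (g s - G k s))\<^sup>2 * W s) \<partial>lborel) \<le> ennreal (e / 6)" using k by simp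
    have "(\<integral>\<^sup>+s\<in>{0..}. ennreal ((norm (G k s - gauss_sum c m s))\<^sup>2 * W s) \<partial>lborel)
      \<le> 2 * (\<integral>\<^sup>+s\<in>{0..}. ennreal ((norm (G k s - H j s))\<^sup>2 * W s) \<partial>lborel)
          + 2 * (\<integral>\<^sup>+s\<in>{0..}. ennreal ((norm (H j s - gauss_sum c m s))\<^sup>2 * W s) \<partial>lborel)"
      unfolding ind by (rule nn_integral_sq_triangle) (use w0 in auto)
    also have "\<dots> \<le> 2 * ennreal (e / 12) + 2 * ennreal (e / 12)"
      using j 3 by (intro add_mono mult_left_mono) auto
    finally show "(\<integral>\<^sup>+s\<in>{0..}. ennreal ((norm (G k s - gauss_sum c m s))\<^sup>2 * W s) \<partial>lborel)
        \<le> 2 * ennreal (e / 12) + 2 * ennreal (e / 12)" .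
  qed auto
  also have "\<dots> = ennreal (2 * (e / 6) + 2 * (2 * (e / 12) + 2 * (e / 12)))"
  proof -
    have two: "2 * ennreal x + 2 * ennreal y = ennreal (2 * x + 2 * y)" if "x \<ge> 0" "y \<ge> 0" for x y
      using that by (simp add: ennreal_plus ennreal_mult)
    have a: "2 * ennreal (e / 12) + 2 * ennreal (e / 12) = ennreal (2 * (e / 12) + 2 * (e / 12))"
      by (rule two) (use e in auto)
    show ?thesis unfolding a by (rule two) (use e in auto)
  qed
  also have "2 * (e / 6) + 2 * (2 * (e / 12) + 2 * (e / 12)) = e" by simp
  finally show ?thesis by (rule that)
qed

subsection \<open>The spherical transform on square integrable functions\<close>

abbreviation half_line :: "real measure" where "half_line \<equiv> lebesgue_on {0..}"

lemma nn_integral_half_line: "(\<integral>\<^sup>+\<xi>. u \<xi> \<partial>half_line) = (\<integral>\<^sup>+\<xi>\<in>{0..}. u \<xi> \<partial>lborel)"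
  by (subst nn_integral_restrict_space) (simp_all add: nn_integral_completion)

lemma borel_measurable_half_line: "f \<in> borel_measurable borel \<Longrightarrow> f \<in> borel_measurable half_line"
  by (intro measurable_restrict_space1 measurable_completion) simp

lemma nn_integral_half_line_cong: "(\<And>\<xi>. \<xi> \<ge> 0 \<Longrightarrow> u \<xi>
    = v \<xi>) \<Longrightarrow> (\<integral>\<^sup>+\<xi>. u \<xi> \<partial>half_line) = (\<integral>\<^sup>+\<xi>. v \<xi> \<partial>half_line)"
  by (rule nn_integral_cong) (simp add: space_restrict_space)

lemma rapid_nn_integral:
  assumes g: "rapid g"
  shows "(\<integral>\<^sup>+s. ennreal ((norm (g s))\<^sup>2 * s ^ k) \<partial>half_line) = ennreal (LINT s:{0..}|lborel. (norm (g s))\<^sup>2 * s ^ k)"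
proof -
  have "set_integrable lborel {0..} (\<lambda>s. norm (g s * cnj (g s) * of_real (s ^ k)))"
    by (intro set_integrable_norm rapid_measure_integrable g rapid_cnj)
  also have "?this \<longleftrightarrow> set_integrable lborel {0..} (\<lambda>s. (norm (g s))\<^sup>2 * s ^ k)"
    by (rule set_integrable_cong) (auto simp: norm_mult power2_eq_square norm_power)
  finally have i: "integrable lborel (\<lambda>s. indicator {0..} s *\<^sub>R ((norm (g s))\<^sup>2 * s ^ k))"
    unfolding set_integrable_def .
  have "(\<integral>\<^sup>+s. ennreal ((norm (g s))\<^sup>2 * s ^ k) \<partial>half_line)
      = (\<integral>\<^sup>+s. ennreal (indicator {0..} s *\<^sub>R ((norm (g s))\<^sup>2 * s ^ k)) \<partial>lborel)"
    unfolding nn_integral_half_line by (rule nn_integral_cong) (auto simp: indicator_def)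
  also have "\<dots> = ennreal (LINT s:{0..}|lborel. (norm (g s))\<^sup>2 * s ^ k)"
    unfolding set_lebesgue_integral_def by (rule nn_integral_eq_integral[OF i]) (auto simp: indicator_def)
  finally show ?thesis .
qed

lemma rapid_nn_integral_finite: "rapid g \<Longrightarrow> (\<integral>\<^sup>+\<xi>. ennreal ((norm (g \<xi>))\<^sup>2 * \<xi> ^ k) \<partial>half_line) < \<infinity>"
  by (simp add: rapid_nn_integral)

lemma hankel_plancherel_nn:
  assumes n: "n \<ge> 2" and \<phi>: "rapid \<phi>" and h: "rapid (hankel n \<phi>)"
  shows "(\<integral>\<^sup>+\<xi>. ennreal ((norm (hankel n \<phi> \<xi>))\<^sup>2 * \<xi> ^ (n - 1)) \<partial>half_line)
    = ennreal (hankel_const n) * (\<integral>\<^sup>+s. ennreal ((norm (\<phi> s))\<^sup>2 * s ^ (n - 1)) \<partial>half_line)"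
  unfolding rapid_nn_integral[OF \<phi>] rapid_nn_integral[OF h] hankel_plancherel[OF n \<phi> h]
  using hankel_const_pos[OF n]
  by (intro ennreal_mult'') (auto simp: set_lebesgue_integral_def indicator_def intro!: integral_nonneg_AE)

lemma nn_integral_sq_triangle1:
  fixes f g h :: "'b \<Rightarrow> complex"
  assumes "f \<in> borel_measurable M" "g \<in> borel_measurable M" "h \<in> borel_measurable M"
  shows "(\<integral>\<^sup>+x. ennreal ((norm (f x - h x))\<^sup>2) \<partial>M)
    \<le> 2 * (\<integral>\<^sup>+x. ennreal ((norm (f x - g x))\<^sup>2) \<partial>M) + 2 * (\<integral>\<^sup>+x. ennreal ((norm (g x - h x))\<^sup>2) \<partial>M)"
  using nn_integral_sq_triangle[OF assms, of "\<lambda>_. 1"] by simp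

lemma schwartz_o_eq_ray: "f \<in> schwartz_o \<Longrightarrow> f x = ray f (norm x)"
  by (metis (mono_tags, lifting) mem_Collect_eq norm_ge_zero profile_eq_ray profile_radial schwartz_o_def)

lemma schwartz_o_measurable:
  fixes f :: "'a::euclidean_space \<Rightarrow> complex"
  assumes f: "f \<in> schwartz_o"
  shows "f \<in> borel_measurable lebesgue"
proof -
  note rapid_measurable[OF ray_rapid[OF f], measurable]
  have "(\<lambda>x. ray f (norm (x::'a))) \<in> borel_measurable borel" by measurable
  moreover have "(\<lambda>x. ray f (norm x)) = f" by (simp add: fun_eq_iff schwartz_o_eq_ray[OF f])
  ultimately have "f \<in> borel_measurable borel" by (simp only:)
  then show ?thesis by (intro measurable_completion) simp
qed

text \<open>\<open>hankel_const\<close> compares half-line integrals with weight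
  \<open>s ^ (n - 1)\<close>; dividing by the area of the unit sphere refers it to the L2 norm on
  the whole space.\<close>

definition plancherel_const :: "'a::euclidean_space itself \<Rightarrow> real" where
  "plancherel_const _ = hankel_const DIM('a) / sphere_const TYPE('a)"

text \<open>Squared distances with values in \<open>[0, \<infinity>]\<close>, so that no
  integrability has to be carried along. They satisfy the triangle inequality up to a factor 2,
  which is enough for limits and uniqueness.\<close>

definition L2_sqdist :: "('a::euclidean_space \<Rightarrow> complex) \<Rightarrow> ('a \<Rightarrow> complex) \<Rightarrow> ennreal" where
  "L2_sqdist f g = (\<integral>\<^sup>+x. ennreal ((norm (f x - g x))\<^sup>2) \<partial>lebesgue)"

definition spectral_sqdist :: "nat \<Rightarrow> (real \<Rightarrow> complex) \<Rightarrow> (real \<Rightarrow> complex) \<Rightarrow> ennreal" where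
  "spectral_sqdist n f g = (\<integral>\<^sup>+\<xi>. ennreal ((norm (f \<xi> - g \<xi>))\<^sup>2 * \<xi> ^ (n - 1)) \<partial>half_line)"

lemma L2_sqdist_commute: "L2_sqdist f g = L2_sqdist g f" by (simp add: L2_sqdist_def norm_minus_commute)
lemma spectral_sqdist_commute: "spectral_sqdist n f g = spectral_sqdist n g f" by (simp add: spectral_sqdist_def norm_minus_commute)

lemma L2_sqdist_triangle:
  assumes "f \<in> borel_measurable lebesgue" "g \<in> borel_measurable lebesgue" "h \<in> borel_measurable lebesgue"
  shows "L2_sqdist f h \<le> 2 * L2_sqdist f g + 2 * L2_sqdist g h"
  unfolding L2_sqdist_def by (rule nn_integral_sq_triangle1[OF assms])

lemma spectral_sqdist_triangle:
  assumes "f \<in> borel_measurable half_line" "g \<in> borel_measurable half_line" "h \<in> borel_measurable half_line"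
  shows "spectral_sqdist n f h \<le> 2 * spectral_sqdist n f g + 2 * spectral_sqdist n g h"
  unfolding spectral_sqdist_def
  by (rule nn_integral_sq_triangle[OF assms]) (auto intro!: borel_measurable_half_line simp: space_restrict_space)

context
  fixes dim_type :: "'a::euclidean_space itself"
  assumes dim: "DIM('a) \<ge> 2"
begin

lemma plancherel_const_pos: "plancherel_const TYPE('a) > 0"
  using hankel_const_pos[OF dim] sphere_const_pos[where 'a = 'a] by (simp add: plancherel_const_def)

lemma sft_measurable:
  fixes F :: "'a \<Rightarrow> complex"
  assumes "F \<in> schwartz_o"
  shows "sft F \<in> borel_measurable half_line"
proof -
  have "hankel DIM('a) (ray F) \<in> borel_measurable half_line"
    by (rule borel_measurable_half_line[OF rapid_measurable[OF sft_rapid[OF dim assms]]])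
  then show ?thesis
    by (rule measurable_cong[THEN iffD2, rotated]) (simp add: space_restrict_space sft_eq_hankel[OF dim assms])
qed

lemma sft_diff:
  fixes F G :: "'a \<Rightarrow> complex"
  assumes F: "F \<in> schwartz_o" and G: "G \<in> schwartz_o" and xi: "\<xi> \<ge> 0"
  shows "sft (\<lambda>x. F x - G x) \<xi> = sft F \<xi> - sft G \<xi>"
proof -
  have "ray (\<lambda>x. F x - G x) = (\<lambda>s. ray F s - ray G s)" by (simp add: ray_def fun_eq_iff)
  then show ?thesis
    by (simp add: sft_eq_hankel[OF dim F xi] sft_eq_hankel[OF dim G xi] sft_eq_hankel[OF dim schwartz_o_diff[OF F G] xi]
          hankel_diff[OF dim ray_rapid[OF F] ray_rapid[OF G]])
qed

lemma schwartz_L2_ray: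
  fixes F :: "'a \<Rightarrow> complex"
  assumes F: "F \<in> schwartz_o"
  shows "(\<integral>\<^sup>+x. ennreal ((norm (F x))\<^sup>2) \<partial>lebesgue)
     = ennreal (sphere_const TYPE('a)) * (\<integral>\<^sup>+s. ennreal ((norm (ray F s))\<^sup>2 * s ^ (DIM('a) - 1)) \<partial>half_line)"
proof -
  note rapid_measurable[OF ray_rapid[OF F], measurable]
  have "(\<integral>\<^sup>+x. ennreal ((norm (F x))\<^sup>2) \<partial>lebesgue)
      = (\<integral>\<^sup>+x. ennreal ((norm (ray F (norm (x::'a))))\<^sup>2) \<partial>lborel)"
    by (simp add: nn_integral_completion schwartz_o_eq_ray[OF F, symmetric])
  also have "\<dots> = ennreal (sphere_const TYPE('a)) * (\<integral>\<^sup>+s\<in>{0..}. ennreal ((norm (ray F s))\<^sup>2) * ennreal (s ^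
      (DIM('a) - 1)) \<partial>lborel)"
    by (rule nn_integral_radial) measurable
  also have "(\<integral>\<^sup>+s\<in>{0..}. ennreal ((norm (ray F s))\<^sup>2) * ennreal (s ^ (DIM('a) - 1)) \<partial>lborel)
      = (\<integral>\<^sup>+s. ennreal ((norm (ray F s))\<^sup>2 * s ^ (DIM('a) - 1)) \<partial>half_line)"
    unfolding nn_integral_half_line by (rule nn_integral_cong) (auto simp: indicator_def ennreal_mult)
  finally show ?thesis .
qed

lemma plancherel:
  fixes F G :: "'a \<Rightarrow> complex"
  assumes F: "F \<in> schwartz_o" and G: "G \<in> schwartz_o"
  shows "spectral_sqdist DIM('a) (sft F) (sft G) = ennreal (plancherel_const TYPE('a)) * L2_sqdist F G"
proof -
  let ?H = "\<lambda>x. F x - G x"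
  have H: "?H \<in> schwartz_o" by (rule schwartz_o_diff[OF F G])
  note sp = sphere_const_pos[where 'a = 'a] and kp = hankel_const_pos[OF dim]
  have "spectral_sqdist DIM('a) (sft F) (sft G) = (\<integral>\<^sup>+\<xi>. ennreal ((norm (hankel DIM('a) (ray ?H) \<xi>))\<^sup>2 * \<xi> ^
      (DIM('a) - 1)) \<partial>half_line)"
    unfolding spectral_sqdist_def by (rule nn_integral_half_line_cong) (simp add: sft_diff[OF F G, symmetric] sft_eq_hankel[OF dim H])
  also have "\<dots> = ennreal (hankel_const DIM('a)) * (\<integral>\<^sup>+s. ennreal ((norm (ray ?H s))\<^sup>2 * s ^ (DIM('a) - 1)) \<partial>half_line)"
    by (rule hankel_plancherel_nn[OF dim ray_rapid[OF H] sft_rapid[OF dim H]])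
  also have "ennreal (hankel_const DIM('a)) = ennreal (plancherel_const TYPE('a)) * ennreal (sphere_const TYPE('a))"
    using sp plancherel_const_pos by (simp add: plancherel_const_def flip: ennreal_mult)
  also have "ennreal (plancherel_const TYPE('a)) * ennreal (sphere_const TYPE('a))
      * (\<integral>\<^sup>+s. ennreal ((norm (ray ?H s))\<^sup>2 * s ^ (DIM('a) - 1)) \<partial>half_line) = ennreal (plancherel_const TYPE('a)) * L2_sqdist F G"
    unfolding mult.assoc L2_sqdist_def by (simp only: schwartz_L2_ray[OF H])
  finally show ?thesis .
qed

lemma is_sft_L2_iff:
  "is_sft_L2 (f :: 'a \<Rightarrow> complex) g \<longleftrightarrow> g \<in> borel_measurable half_line \<and>
     (\<exists>F. (\<forall>j. F j \<in> schwartz_o) \<and> (\<lambda>j. L2_sqdist (F j) f) \<longlonglongrightarrow> 0 \<and>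
         (\<lambda>j. spectral_sqdist DIM('a) (sft (F j)) g) \<longlonglongrightarrow> 0)"
  unfolding is_sft_L2_def L2_sqdist_def spectral_sqdist_def ..

text \<open>A sequence \<open>H\<close> from the definition of the extension is inserted: Plancherel
  is exact between Schwartz functions, and the terms with \<open>H j\<close> tend to 0. Two triangle
  inequalities produce the factor 4. The two directions transfer approximation from functions to
  transforms and back.\<close>

lemma sft_L2_estimate:
  fixes f :: "'a \<Rightarrow> complex"
  assumes f: "f \<in> borel_measurable lebesgue" and g: "is_sft_L2 f g" and F: "F \<in> schwartz_o"
  shows "spectral_sqdist DIM('a) (sft F) g \<le> ennreal (4 * plancherel_const TYPE('a)) * L2_sqdist F f" "ennreal
      (plancherel_const TYPE('a)) * L2_sqdist F f \<le> 4 * spectral_sqdist DIM('a) (sft F) g"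
proof -
  obtain H where H: "\<And>j. H j \<in> schwartz_o" "(\<lambda>j. L2_sqdist
      (H j) f) \<longlonglongrightarrow> 0" "(\<lambda>j. spectral_sqdist DIM('a) (sft (H j)) g) \<longlonglongrightarrow> 0"
    and gm: "g \<in> borel_measurable half_line" using g unfolding is_sft_L2_iff by blast
  note m = schwartz_o_measurable[OF F] schwartz_o_measurable[OF H(1)] f sft_measurable[OF F] sft_measurable[OF H(1)] gm
  have r4: "2 * (ennreal (plancherel_const TYPE('a)) * (2 * x)) = ennreal (4 * plancherel_const TYPE('a)) * x" for x
    using plancherel_const_pos by (simp add: ennreal_mult mult_ac)
  have "spectral_sqdist DIM('a) (sft F) g \<le> ennreal (4 * plancherel_const TYPE('a)) * L2_sqdist F f
      + (ennreal (4 * plancherel_const TYPE('a)) * L2_sqdist (H j) f + 2 * spectral_sqdist DIM('a) (sft (H j)) g)" for j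
  proof -
    have "spectral_sqdist DIM('a) (sft F) g \<le> 2 * spectral_sqdist DIM('a) (sft F) (sft (H j)) + 2 * spectral_sqdist DIM('a) (sft (H j)) g"
        by (rule spectral_sqdist_triangle[OF m(4,5,6)])
    also have "\<dots> \<le> 2 * (ennreal (plancherel_const TYPE('a)) * (2 * L2_sqdist F f + 2 * L2_sqdist f (H j))) + 2 * spectral_sqdist DIM('a) (sft (H j)) g"
      unfolding plancherel[OF F H(1)] by (intro add_mono mult_left_mono L2_sqdist_triangle m) auto
    also have "\<dots> = ennreal (4 * plancherel_const TYPE('a)) * L2_sqdist F f + (ennreal (4 * plancherel_const TYPE('a)) * L2_sqdist (H j) f
        + 2 * spectral_sqdist DIM('a) (sft (H j)) g)"
      by (simp only: distrib_left r4 L2_sqdist_commute[of f] add.assoc)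
    finally show ?thesis .
  qed
  moreover have "(\<lambda>j. ennreal (4 * plancherel_const TYPE('a)) * L2_sqdist F f + (ennreal (4 * plancherel_const TYPE('a)) * L2_sqdist (H j) f
      + 2 * spectral_sqdist DIM('a) (sft (H j)) g)) \<longlonglongrightarrow> ennreal (4 * plancherel_const TYPE('a)) * L2_sqdist F f
      + (ennreal (4 * plancherel_const TYPE('a)) * 0 + 2 * 0)"
    by (intro tendsto_add tendsto_const ennreal_tendsto_cmult H) auto
  ultimately show "spectral_sqdist DIM('a) (sft F) g \<le> ennreal (4 * plancherel_const TYPE('a)) * L2_sqdist F f" by (intro LIMSEQ_le_const) auto
  have "ennreal (plancherel_const TYPE('a)) * L2_sqdist F f \<le> 4 * spectral_sqdist DIM('a) (sft F) g + (4 * spectral_sqdist DIM('a) (sft (H j)) g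
      + ennreal (2 * plancherel_const TYPE('a)) * L2_sqdist (H j) f)" for j
  proof -
    have "ennreal (plancherel_const TYPE('a)) * L2_sqdist F f
        \<le> ennreal (plancherel_const TYPE('a)) * (2 * L2_sqdist F (H j) + 2 * L2_sqdist (H j) f)" by (intro mult_left_mono L2_sqdist_triangle m) auto
    also have "\<dots> = 2 * spectral_sqdist DIM('a) (sft F) (sft (H j)) + ennreal (2 * plancherel_const TYPE('a)) * L2_sqdist (H j) f"
      unfolding plancherel[OF F H(1)] using plancherel_const_pos by (simp add: distrib_left ennreal_mult mult_ac)
    also have "\<dots> \<le> 2 * (2 * spectral_sqdist DIM('a) (sft F) g + 2 * spectral_sqdist DIM('a) g (sft (H j)))
        + ennreal (2 * plancherel_const TYPE('a)) * L2_sqdist (H j) f"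
      by (intro add_mono mult_left_mono spectral_sqdist_triangle m) auto
    also have "\<dots> = 4 * spectral_sqdist DIM('a) (sft F) g + (4 * spectral_sqdist DIM('a) (sft (H j)) g
        + ennreal (2 * plancherel_const TYPE('a)) * L2_sqdist (H j) f)"
      by (simp add: distrib_left spectral_sqdist_commute[of _ g] add.assoc mult.assoc[symmetric])
    finally show ?thesis .
  qed
  moreover have "(\<lambda>j. 4 * spectral_sqdist DIM('a) (sft F) g + (4 * spectral_sqdist DIM('a) (sft (H j)) g
      + ennreal (2 * plancherel_const TYPE('a)) * L2_sqdist (H j) f)) \<longlonglongrightarrow> 4 * spectral_sqdist DIM('a) (sft F) g + (4 * 0
      + ennreal (2 * plancherel_const TYPE('a)) * 0)"
    by (intro tendsto_add tendsto_const ennreal_tendsto_cmult H) auto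
  ultimately show "ennreal (plancherel_const TYPE('a)) * L2_sqdist F f \<le> 4 * spectral_sqdist DIM('a) (sft F) g" by (intro LIMSEQ_le_const) auto
qed

text \<open>The distance of two candidates is bounded by quantities that tend to 0 along an
  approximating sequence. On the half line the weight vanishes only at frequency 0, a null
  set.\<close>

lemma sft_L2_unique:
  fixes f :: "'a \<Rightarrow> complex"
  assumes f: "f \<in> borel_measurable lebesgue" and g: "is_sft_L2 f g" and g': "is_sft_L2 f g'"
  shows "AE \<xi> in half_line. g \<xi> = g' \<xi>"
proof -
  obtain H where H: "\<And>j. H j \<in> schwartz_o" "(\<lambda>j. L2_sqdist
      (H j) f) \<longlonglongrightarrow> 0" "(\<lambda>j. spectral_sqdist DIM('a) (sft (H j)) g) \<longlonglongrightarrow> 0"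
    and gm: "g \<in> borel_measurable half_line" using g unfolding is_sft_L2_iff by blast
  have gm': "g' \<in> borel_measurable half_line" using g' unfolding is_sft_L2_iff by blast
  note [measurable] = gm gm'
  have "spectral_sqdist DIM('a) g g' \<le> 2 * spectral_sqdist DIM('a) (sft (H j)) g + 2 * (ennreal (4 * plancherel_const TYPE('a)) * L2_sqdist (H j) f)" for j
  proof -
    have "spectral_sqdist DIM('a) g g' \<le> 2 * spectral_sqdist DIM('a) g (sft (H j)) + 2 * spectral_sqdist DIM('a) (sft (H j)) g'"
      by (intro spectral_sqdist_triangle gm gm' sft_measurable H)
    also have "\<dots> \<le> 2 * spectral_sqdist DIM('a) (sft (H j)) g + 2 * (ennreal (4 * plancherel_const TYPE('a)) * L2_sqdist (H j) f)"
      unfolding spectral_sqdist_commute[of _ g] by (intro add_mono mult_left_mono sft_L2_estimate(1)[OF f g'] H) auto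
    finally show ?thesis .
  qed
  moreover have "(\<lambda>j. 2 * spectral_sqdist DIM('a) (sft (H j)) g
      + 2 * (ennreal (4 * plancherel_const TYPE('a)) * L2_sqdist (H j) f)) \<longlonglongrightarrow> 2 * 0 + 2 * (ennreal (4 * plancherel_const TYPE('a)) * 0)"
    by (intro tendsto_add ennreal_tendsto_cmult H) auto
  ultimately have "spectral_sqdist DIM('a) g g' \<le> 2 * 0 + 2 * (ennreal (4 * plancherel_const TYPE('a)) * 0)" by (intro LIMSEQ_le_const) auto
  then have "spectral_sqdist DIM('a) g g' = 0" by simp
  moreover have "(\<lambda>\<xi>. ennreal ((norm (g \<xi> - g' \<xi>))\<^sup>2 * \<xi> ^ (DIM('a) - 1))) \<in> borel_measurable half_line"
  proof -
    have [measurable]: "(\<lambda>\<xi>::real. \<xi> ^ (DIM('a) - 1)) \<in> borel_measurable half_line" by (rule borel_measurable_half_line) measurable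
    show ?thesis by measurable
  qed
  ultimately have "AE \<xi> in half_line. ennreal ((norm (g \<xi> - g' \<xi>))\<^sup>2 * \<xi> ^ (DIM('a) - 1)) = 0"
    unfolding spectral_sqdist_def by (simp only: nn_integral_0_iff_AE)
  moreover have "AE \<xi> in half_line. \<xi> > 0"
    unfolding AE_lebesgue_on_half_line using AE_lborel_singleton[of "0::real"] by eventually_elim auto
  ultimately show ?thesis
  proof eventually_elim
    case (elim \<xi>)
    then have "(norm (g \<xi> - g' \<xi>))\<^sup>2 * \<xi> ^ (DIM('a) - 1) \<le> 0" by (simp add: ennreal_eq_0_iff)
    then have "(norm (g \<xi> - g' \<xi>))\<^sup>2 \<le> 0" using elim(2) by (simp add: mult_le_0_iff) (metis not_less zero_less_power)
    then show ?case by simp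
  qed
qed

text \<open>Subtracting the members of an approximating sequence from \<open>F\<close> stays within
  radial Schwartz functions and leaves the distances unchanged. This is the form of linearity that
  the differences in \<open>approximates\<close> call for.\<close>

lemma sft_L2_schwartz_diff:
  fixes f :: "'a \<Rightarrow> complex"
  assumes g: "is_sft_L2 f g" and F: "F \<in> schwartz_o"
  shows "is_sft_L2 (\<lambda>x. F x - f x) (\<lambda>\<xi>. sft F \<xi> - g \<xi>)"
proof -
  obtain H where H: "\<And>j. H j \<in> schwartz_o" "(\<lambda>j. L2_sqdist
      (H j) f) \<longlonglongrightarrow> 0" "(\<lambda>j. spectral_sqdist DIM('a) (sft (H j)) g) \<longlonglongrightarrow> 0"
    and gm: "g \<in> borel_measurable half_line" using g unfolding is_sft_L2_iff by blast
  have 1: "L2_sqdist (\<lambda>x. F x - H j x) (\<lambda>x. F x - f x) = L2_sqdist (H j) f" for j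
    by (simp add: L2_sqdist_def norm_minus_commute)
  have 2: "spectral_sqdist DIM('a) (sft (\<lambda>x. F x - H j x)) (\<lambda>\<xi>. sft F \<xi> - g \<xi>) = spectral_sqdist DIM('a) (sft (H j)) g" for j
    unfolding spectral_sqdist_def by (rule nn_integral_half_line_cong) (simp add: sft_diff[OF F H(1)] norm_minus_commute)
  show ?thesis unfolding is_sft_L2_iff
    using H sft_measurable[OF F] gm by (intro conjI exI[of _ "\<lambda>j x. F x - H j x"]) (auto simp: 1 2 intro: schwartz_o_diff[OF F])
qed

text \<open>The Borel profile is approximated by Gaussian sums with geometrically decreasing squared
  error; by Plancherel the transforms form a Cauchy sequence, whose limit is a transform of
  \<open>f\<close>. The choice in \<open>sft_L2\<close> is therefore made from a nonempty
  set.\<close>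

lemma sft_L2_exists:
  fixes f :: "'a \<Rightarrow> complex"
  assumes "f \<in> L2_o"
  shows "is_sft_L2 f (sft_L2 f)"
proof -
  have r: "radial f" and fm: "f \<in> borel_measurable lebesgue" and fi: "integrable lebesgue (\<lambda>x. (norm (f x))\<^sup>2)"
    using assms by (auto simp: L2_o_def)
  obtain f0 where f0 [measurable]: "f0 \<in> borel_measurable borel" and ae: "AE x in lebesgue. f x = f0 (norm x)"
    by (rule radial_borel_profile[OF r fm]) blast
  note sp = sphere_const_pos[where 'a = 'a]
  have conv: "(\<integral>\<^sup>+x. ennreal ((norm (f x - h (norm x)))\<^sup>2) \<partial>lebesgue)
      = ennreal (sphere_const TYPE('a)) * (\<integral>\<^sup>+s\<in>{0..}. ennreal ((norm (f0 s - h s))\<^sup>2 * s ^ (DIM('a) - 1)) \<partial>lborel)"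
    if [measurable]: "h \<in> borel_measurable borel" for h
  proof -
    have "(\<integral>\<^sup>+x. ennreal ((norm (f x - h (norm x)))\<^sup>2) \<partial>lebesgue)
        = (\<integral>\<^sup>+x. ennreal ((norm (f0 (norm (x::'a)) - h (norm x)))\<^sup>2) \<partial>lebesgue)"
      using ae by (intro nn_integral_cong_AE) (auto elim: eventually_mono)
    also have "\<dots> = ennreal (sphere_const TYPE('a)) * (\<integral>\<^sup>+s\<in>{0..}. ennreal ((norm (f0 s - h s))\<^sup>2) * ennreal (s ^
        (DIM('a) - 1)) \<partial>lborel)"
      unfolding nn_integral_completion by (rule nn_integral_radial) measurable
    also have "(\<integral>\<^sup>+s\<in>{0..}. ennreal ((norm (f0 s - h s))\<^sup>2) * ennreal (s ^ (DIM('a) - 1)) \<partial>lborel)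
        = (\<integral>\<^sup>+s\<in>{0..}. ennreal ((norm (f0 s - h s))\<^sup>2 * s ^ (DIM('a) - 1)) \<partial>lborel)"
      by (rule nn_integral_cong) (auto simp: indicator_def ennreal_mult)
    finally show ?thesis .
  qed
  have fin: "(\<integral>\<^sup>+s\<in>{0..}. ennreal ((norm (f0 s))\<^sup>2 * s ^ (DIM('a) - 1)) \<partial>lborel) < \<infinity>"
  proof -
    have "(\<integral>\<^sup>+x. ennreal ((norm (f x))\<^sup>2) \<partial>lebesgue) < \<infinity>" using fi by (simp add: integrable_iff_bounded)
    then show ?thesis using conv[of "\<lambda>_. 0"] sp by (auto simp: ennreal_mult_less_top)
  qed
  have "\<exists>c m. (\<integral>\<^sup>+s\<in>{0..}. ennreal ((norm (f0 s - gauss_sum c m s))\<^sup>2 * s ^ (DIM('a) - 1)) \<partial>lborel)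
      \<le> ennreal (1 / 2 ^ j)" for j :: nat
  proof (rule gauss_sum_dense[of "\<lambda>s. s ^ (DIM('a) - 1)" 1 "DIM('a) - 1" f0 "1 / 2 ^ j"])
    show "\<bar>s ^ (DIM('a) - 1)\<bar> \<le> 1 * (1 + \<bar>s\<bar>) ^ (DIM('a) - 1)" for s :: real
      unfolding power_abs mult_1 by (rule power_mono) auto
    show "continuous_on UNIV (\<lambda>s::real. s ^ (DIM('a) - 1))" by (intro continuous_intros)
    show "f0 \<in> borel_measurable borel" by (rule f0)
    show "(\<integral>\<^sup>+s\<in>{0..}. ennreal ((norm (f0 s))\<^sup>2 * s ^ (DIM('a) - 1)) \<partial>lborel) < \<infinity>" by (rule fin)
  qed (assumption | simp | blast)+
  then obtain c where "\<forall>j. \<exists>m. (\<integral>\<^sup>+s\<in>{0..}. ennreal ((norm (f0 s - gauss_sum (c j) m s))\<^sup>2 * s ^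
      (DIM('a) - 1)) \<partial>lborel) \<le> ennreal (1 / 2 ^ j)"
    by (rule exE[OF choice[OF allI]])
  then obtain m where "\<forall>j. (\<integral>\<^sup>+s\<in>{0..}. ennreal ((norm (f0 s - gauss_sum (c j) (m j) s))\<^sup>2 * s ^
      (DIM('a) - 1)) \<partial>lborel) \<le> ennreal (1 / 2 ^ j)"
    by (rule exE[OF choice])
  then have cm: "(\<integral>\<^sup>+s\<in>{0..}. ennreal ((norm (f0 s - gauss_sum (c j) (m j) s))\<^sup>2 * s ^ (DIM('a) - 1)) \<partial>lborel)
      \<le> ennreal (1 / 2 ^ j)" for j
    by (rule spec)
  define F :: "nat \<Rightarrow> 'a \<Rightarrow> complex" where "F j x = gauss_sum (c j) (m j) (norm x)" for j x
  have F: "F j \<in> schwartz_o" for j unfolding F_def by (rule gauss_sum_schwartz)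
  have dxF: "L2_sqdist (F j) f \<le> ennreal (sphere_const TYPE('a)) * ennreal (1 / 2 ^ j)" for j
    unfolding L2_sqdist_commute[of "F j"] unfolding L2_sqdist_def F_def
    unfolding conv[OF rapid_measurable[OF rapid_gauss_sum]] by (rule mult_left_mono[OF cm]) simp
  have avg: "x / 2 + y / 2 \<le> e" if "x < e" "y < e" for x y e :: real
    using that by linarith
  have lim2: "(\<lambda>j. ennreal (c * (1 / 2 ^ j))) \<longlonglongrightarrow> 0" for c :: real
  proof -
    have "(\<lambda>j. c * (1 / 2) ^ j) \<longlonglongrightarrow> c * 0" by (intro tendsto_intros LIMSEQ_realpow_zero) auto
    then show ?thesis using tendsto_ennrealI[of "\<lambda>j. c * (1 / 2 ^ j)" 0 sequentially] by (simp add: power_one_over)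
  qed
  have limF: "(\<lambda>j. L2_sqdist (F j) f) \<longlonglongrightarrow> 0"
    by (rule tendsto_sandwich[OF _ _ tendsto_const lim2[of "sphere_const TYPE('a)"]])
       (use dxF sp in \<open>auto simp flip: ennreal_mult\<close>)
  \<comment> \<open>The weight and the restriction to the half line are absorbed into a measure, so
    that completeness applies in its unweighted form.\<close>
  define D where "D = density lborel (\<lambda>\<xi>. ennreal (\<xi> ^ (DIM('a) - 1)) * indicator {0..} \<xi>)"
  have Dint: "(\<integral>\<^sup>+\<xi>. ennreal ((norm (h \<xi>))\<^sup>2) \<partial>D)
      = (\<integral>\<^sup>+\<xi>. ennreal ((norm (h \<xi>))\<^sup>2 * \<xi> ^ (DIM('a) - 1)) \<partial>half_line)"
    if [measurable]: "h \<in> borel_measurable borel" for h :: "real \<Rightarrow> complex"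
    unfolding D_def nn_integral_half_line by (subst nn_integral_density) (auto intro!: nn_integral_cong simp: indicator_def ennreal_mult mult_ac)
  let ?h = "\<lambda>j. hankel DIM('a) (ray (F j))"
  have hm [measurable]: "?h j \<in> borel_measurable borel" for j by (rule rapid_measurable[OF sft_rapid[OF dim F]])
  have hs: "spectral_sqdist DIM('a) (sft (F j)) u = (\<integral>\<^sup>+\<xi>. ennreal ((norm (?h j \<xi> - u \<xi>))\<^sup>2 * \<xi> ^
      (DIM('a) - 1)) \<partial>half_line)" for j u
    unfolding spectral_sqdist_def by (rule nn_integral_half_line_cong) (simp add: sft_eq_hankel[OF dim F])
  obtain g where g: "g \<in> borel_measurable D" "(\<lambda>j. \<integral>\<^sup>+\<xi>. ennreal ((norm
      (?h j \<xi> - g \<xi>))\<^sup>2) \<partial>D) \<longlonglongrightarrow> 0"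
  proof (rule L2_complete[of ?h D])
    show "?h j \<in> borel_measurable D" for j unfolding D_def using hm[of j] by simp
    fix e :: real assume e: "e > 0"
    define S where "S = sphere_const TYPE('a)"
    have "(\<lambda>j. ennreal (4 * plancherel_const TYPE('a) * S * (1 / 2 ^ j))) \<longlonglongrightarrow> 0" by (rule lim2)
    then have "\<forall>\<^sub>F j in sequentially. ennreal (4 * plancherel_const TYPE('a) * S * (1 / 2 ^ j)) < ennreal e" using e by (intro order_tendstoD(2)) auto
    then obtain N where N: "\<And>j. j \<ge> N \<Longrightarrow> ennreal (4 * plancherel_const TYPE('a) * S * (1 / 2 ^ j)) < ennreal e"
        by (auto simp: eventually_sequentially)
    have N': "4 * plancherel_const TYPE('a) * S * (1 / 2 ^ j) < e" if "j \<ge> N" for j using N[OF that] e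
        by (simp add: ennreal_less_iff plancherel_const_pos less_imp_le sp S_def)
    have "(\<integral>\<^sup>+\<xi>. ennreal ((norm (?h i \<xi> - ?h j \<xi>))\<^sup>2) \<partial>D) \<le> ennreal e" if ij: "i \<ge> N" "j \<ge> N" for i j
    proof -
      have "(\<integral>\<^sup>+\<xi>. ennreal ((norm (?h i \<xi> - ?h j \<xi>))\<^sup>2) \<partial>D) = spectral_sqdist DIM('a) (sft (F i)) (?h j)"
        unfolding hs by (rule Dint) measurable
      also have "\<dots> = spectral_sqdist DIM('a) (sft (F i)) (sft (F j))"
        unfolding spectral_sqdist_def by (rule nn_integral_half_line_cong) (simp add: sft_eq_hankel[OF dim F])
      also have "\<dots> = ennreal (plancherel_const TYPE('a)) * L2_sqdist (F i) (F j)" by (rule plancherel[OF F F])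
      also have "\<dots> \<le> ennreal (plancherel_const TYPE('a)) * (2 * L2_sqdist (F i) f + 2 * L2_sqdist f (F j))"
        by (intro mult_left_mono L2_sqdist_triangle schwartz_o_measurable F fm) auto
      also have "\<dots> \<le> ennreal (plancherel_const TYPE('a)) * (2 * (ennreal S * ennreal (1 / 2 ^ i)) + 2 * (ennreal S * ennreal (1 / 2 ^ j)))"
        unfolding L2_sqdist_commute[of f] S_def by (intro mult_left_mono add_mono dxF) auto
      also have "\<dots> = ennreal ((4 * plancherel_const TYPE('a) * S * (1 / 2 ^ i)) / 2 + (4 * plancherel_const TYPE('a) * S * (1 / 2 ^ j)) / 2)"
      proof -
        have two: "2 * (ennreal S * ennreal x) = ennreal (2 * (S * x))" if "x \<ge> 0" for x
          using that sp unfolding S_def by (simp add: ennreal_mult)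
        have S0: "S \<ge> 0" using sp by (simp add: S_def)
        have "ennreal (plancherel_const TYPE('a)) * (ennreal (2 * (S * (1 / 2 ^ i))) + ennreal (2 * (S * (1 / 2 ^ j))))
            = ennreal (plancherel_const TYPE('a) * (2 * (S * (1 / 2 ^ i)) + 2 * (S * (1 / 2 ^ j))))"
          using plancherel_const_pos S0 by (subst ennreal_plus[symmetric], simp, simp) (simp add: ennreal_mult del: ennreal_plus)
        moreover have "plancherel_const TYPE('a) * (2 * (S * (1 / 2 ^ i)) + 2 * (S * (1 / 2 ^ j)))
            = (4 * plancherel_const TYPE('a) * S * (1 / 2 ^ i)) / 2 + (4 * plancherel_const TYPE('a) * S * (1 / 2 ^ j)) / 2"
          by (simp add: algebra_simps)
        ultimately show ?thesis by (simp only: two zero_le_divide_1_iff zero_le_power zero_le_numeral)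
      qed
      also have "\<dots> \<le> ennreal e" by (intro ennreal_leI avg N' ij)
      finally show ?thesis .
    qed
    then show "\<exists>N. \<forall>i\<ge>N. \<forall>j\<ge>N. (\<integral>\<^sup>+\<xi>. ennreal ((norm
        (?h i \<xi> - ?h j \<xi>))\<^sup>2) \<partial>D) \<le> ennreal e" by blast
  qed
  have gb [measurable]: "g \<in> borel_measurable borel" using g(1) unfolding D_def by simp
  have "(\<integral>\<^sup>+\<xi>. ennreal ((norm (?h j \<xi> - g \<xi>))\<^sup>2) \<partial>D) = spectral_sqdist DIM('a) (sft (F j)) g" for j
    unfolding hs by (rule Dint) measurable
  then have "is_sft_L2 f g" unfolding is_sft_L2_iff using g(2) limF F borel_measurable_half_line[OF gb] by auto
  then show ?thesis unfolding sft_L2_def by (rule someI[of "is_sft_L2 f"])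
qed

end

text \<open>A divergent Bochner integral has the value 0, so a bound on the root alone would say
  nothing; finiteness of the extended integral gives it content.\<close>

lemma nn_integral_le_of_sqrt_integral:
  fixes u :: "'b \<Rightarrow> real"
  assumes "u \<in> borel_measurable M" and u0: "\<And>x. x \<in> space M \<Longrightarrow> u x \<ge> 0"
    and "(\<integral>\<^sup>+x. ennreal (u x) \<partial>M) < \<infinity>" and le: "sqrt (integral\<^sup>L M u) \<le> e"
  shows "(\<integral>\<^sup>+x. ennreal (u x) \<partial>M) \<le> ennreal (e\<^sup>2)"
proof -
  have ae: "AE x in M. 0 \<le> u x" using u0 by (intro AE_I2) auto
  have "integrable M u" using assms ae by (intro integrableI_nonneg) auto
  then have "(\<integral>\<^sup>+x. ennreal (u x) \<partial>M) = ennreal (integral\<^sup>L M u)" using ae by (intro nn_integral_eq_integral)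
  moreover have "integral\<^sup>L M u \<ge> 0" using ae by (rule integral_nonneg_AE)
  then have "integral\<^sup>L M u = (sqrt (integral\<^sup>L M u))\<^sup>2" by simp
  then have "integral\<^sup>L M u \<le> e\<^sup>2" using le \<open>integral\<^sup>L M u \<ge> 0\<close> by (metis power_mono real_sqrt_ge_zero)
  ultimately show ?thesis by (simp add: ennreal_leI)
qed

lemma sqrt_integral_le_of_nn_integral:
  fixes u :: "'b \<Rightarrow> real"
  assumes "u \<in> borel_measurable M" and u0: "\<And>x. x \<in> space M \<Longrightarrow> u x \<ge> 0"
    and le: "(\<integral>\<^sup>+x. ennreal (u x) \<partial>M) \<le> ennreal (e\<^sup>2)" and "e \<ge> 0"
  shows "sqrt (integral\<^sup>L M u) \<le> e"
proof -
  have ae: "AE x in M. 0 \<le> u x" using u0 by (intro AE_I2) auto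
  have "(\<integral>\<^sup>+x. ennreal (u x) \<partial>M) < \<infinity>" using le by (simp add: le_less_trans)
  then have "integrable M u" using assms(1) ae by (intro integrableI_nonneg) auto
  then have "(\<integral>\<^sup>+x. ennreal (u x) \<partial>M) = ennreal (integral\<^sup>L M u)" using ae by (intro nn_integral_eq_integral)
  with le have "ennreal (integral\<^sup>L M u) \<le> ennreal (e\<^sup>2)" by simp
  then have "integral\<^sup>L M u \<le> e\<^sup>2" by (simp add: ennreal_le_iff)
  then have "sqrt (integral\<^sup>L M u) \<le> sqrt (e\<^sup>2)" by (rule real_sqrt_le_mono)
  then show ?thesis using \<open>e \<ge> 0\<close> by simp
qed

lemma integral_half_line: "(LINT \<xi>:{0..}|lebesgue. u \<xi>) = integral\<^sup>L half_line u" for u :: "real \<Rightarrow> real"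
  by (simp add: set_lebesgue_integral_def integral_restrict_space)

lemma set_integrable_half_line: "set_integrable lebesgue {0..} u \<longleftrightarrow> integrable half_line u" for u :: "real \<Rightarrow> real"
  by (simp add: set_integrable_def integrable_restrict_space)

text \<open>\<open>sqrt \<xi>\<close> is \<open>\<xi> powr (2 * \<beta>)\<close> for
  \<open>\<beta> = 1/4\<close>: this is the squared distance of the homogeneous space of order 1/4,
  read on the spectral side.\<close>

definition spectral_sqdist_sqrt :: "nat \<Rightarrow> (real \<Rightarrow> complex) \<Rightarrow> (real \<Rightarrow> complex) \<Rightarrow> ennreal" where
  "spectral_sqdist_sqrt n f g = (\<integral>\<^sup>+\<xi>. ennreal ((norm (f \<xi> - g \<xi>))\<^sup>2 * (sqrt \<xi> * \<xi> ^ (n - 1))) \<partial>half_line)"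

lemma spectral_sqdist_sqrt_triangle:
  assumes "f \<in> borel_measurable half_line" "g \<in> borel_measurable half_line" "h \<in> borel_measurable half_line"
  shows "spectral_sqdist_sqrt n f h \<le> 2 * spectral_sqdist_sqrt n f g + 2 * spectral_sqdist_sqrt n g h"
  unfolding spectral_sqdist_sqrt_def
  by (rule nn_integral_sq_triangle[OF assms]) (auto intro!: borel_measurable_half_line simp: space_restrict_space)

lemma rapid_spectral_sqdist_sqrt_finite:
  assumes g: "rapid g"
  shows "spectral_sqdist_sqrt n g (\<lambda>_. 0) < \<infinity>"
proof -
  note rapid_measurable[OF g, measurable]
  have m: "(\<lambda>\<xi>. ennreal ((norm (g \<xi>))\<^sup>2 * \<xi> ^ k)) \<in> borel_measurable half_line" for k :: nat
    by (rule borel_measurable_half_line) measurable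
  have "spectral_sqdist_sqrt n g (\<lambda>_. 0) \<le> (\<integral>\<^sup>+\<xi>. ennreal ((norm (g \<xi>))\<^sup>2 * \<xi> ^ (n - 1))
      + ennreal ((norm (g \<xi>))\<^sup>2 * \<xi> ^ Suc (n - 1)) \<partial>half_line)"
    unfolding spectral_sqdist_sqrt_def
  proof (rule nn_integral_mono)
    fix \<xi> assume "\<xi> \<in> space half_line"
    then have x: "\<xi> \<ge> 0" by (simp add: space_restrict_space)
    have "sqrt \<xi> \<le> sqrt ((1 + \<xi>)\<^sup>2)" using x by (intro real_sqrt_le_mono) (simp add: power2_eq_square algebra_simps)
    then have s: "sqrt \<xi> \<le> 1 + \<xi>" using x by simp
    have "(norm (g \<xi>))\<^sup>2 * (sqrt \<xi> * \<xi> ^ (n - 1)) \<le> (norm (g \<xi>))\<^sup>2 * ((1 + \<xi>) * \<xi> ^ (n - 1))"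
      using x s by (intro mult_left_mono mult_right_mono) auto
    also have "\<dots> = (norm (g \<xi>))\<^sup>2 * \<xi> ^ (n - 1) + (norm (g \<xi>))\<^sup>2 * \<xi> ^ Suc (n - 1)" by (simp add: algebra_simps)
    finally show "ennreal ((norm (g \<xi> - 0))\<^sup>2 * (sqrt \<xi> * \<xi> ^ (n - 1)))
        \<le> ennreal ((norm (g \<xi>))\<^sup>2 * \<xi> ^ (n - 1)) + ennreal ((norm (g \<xi>))\<^sup>2 * \<xi> ^ Suc (n - 1))"
      using x by (simp flip: ennreal_plus add: ennreal_leI)
  qed
  also have "\<dots> = (\<integral>\<^sup>+\<xi>. ennreal ((norm (g \<xi>))\<^sup>2 * \<xi> ^ (n - 1)) \<partial>half_line)
      + (\<integral>\<^sup>+\<xi>. ennreal ((norm (g \<xi>))\<^sup>2 * \<xi> ^ Suc (n - 1)) \<partial>half_line)"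
    by (rule nn_integral_add) (rule m)+
  also have "\<dots> < \<infinity>" using rapid_nn_integral_finite[OF g, of "n - 1"] rapid_nn_integral_finite[OF g, of "Suc (n - 1)"] by (simp del: power_Suc)
  finally show ?thesis .
qed

lemma sqrt_eq_powr: "\<xi> \<ge> 0 \<Longrightarrow> \<xi> powr (2 * (1 / 4)) = sqrt \<xi>" for \<xi> :: real
  by (simp add: powr_half_sqrt)

text \<open>The transform of a Gaussian sum has exponents \<open>1 / (4 * (i + 1))\<close> and is
  thus in general no \<open>gauss_sum\<close>; the class \<open>poly_gauss\<close> still contains
  it.\<close>

lemma hankel_gauss_sum_poly_gauss:
  assumes n: "n \<ge> 2"
  shows "poly_gauss (\<lambda>x::'a::euclidean_space. hankel n (gauss_sum c m) (norm x))"
proof -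
  have g: "poly_gauss (\<lambda>x::'a. b * gauss (1 / (4 * (real i + 1))) (norm x))" for b i
    unfolding gauss_def power2_norm_eq_inner by (intro poly_gauss.scale poly_gauss.base) simp
  have one: "hankel n (\<lambda>s. c i * gauss (real i + 1) s) \<xi>
    = (c i * of_real (sj_coeff ((real n - 2) / 2) 0 * gauss_moment (real i + 1) (n - 1))) * gauss (1 / (4 * (real i + 1))) \<xi>" for i \<xi>
    by (simp add: hankel_scale hankel_gauss[OF n])
  show ?thesis
  proof (induction m)
    case 0
    have "gauss_sum c 0 = (\<lambda>s. c 0 * gauss (real 0 + 1) s)" by (simp add: gauss_sum_def fun_eq_iff)
    then show ?case by (simp only: one g)
  next
    case (Suc m)
    have "gauss_sum c (Suc m) = (\<lambda>s. gauss_sum c m s + c (Suc m) * gauss (real (Suc m) + 1) s)"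
      by (simp add: gauss_sum_def fun_eq_iff)
    moreover have "hankel n (\<lambda>s. gauss_sum c m s + c (Suc m) * gauss (real (Suc m) + 1) s) \<xi>
       = hankel n (gauss_sum c m) \<xi> + (c (Suc m) * of_real (sj_coeff ((real n - 2) / 2) 0 * gauss_moment (real (Suc m)
           + 1) (n - 1))) * gauss (1 / (4 * (real (Suc m) + 1))) \<xi>" for \<xi>
      unfolding one[symmetric] by (intro hankel_add n rapid_gauss_sum rapid_scale gauss_rapid) simp
    ultimately show ?case by (simp only:) (intro poly_gauss.add Suc g)
  qed
qed

section \<open>Schwartz approximation in the homogeneous space of order 1/4\<close>

context
  fixes dim_type :: "'a::euclidean_space itself"
  assumes dim: "DIM('a) \<ge> 2"
begin

text \<open>By inversion, the Schwartz function is the normalised transform of the Gaussian sum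
  itself. Approximation on the spectral side, where the weight of order 1/4 lives, thereby yields
  Schwartz functions.\<close>

lemma schwartz_with_transform:
  obtains F :: "'a \<Rightarrow> complex" where "F \<in> schwartz_o" "\<And>\<xi>. \<xi> \<ge> 0 \<Longrightarrow> sft F \<xi> = gauss_sum c m \<xi>"
proof -
  let ?h = "hankel DIM('a) (gauss_sum c m)" and ?k = "of_real (1 / hankel_const DIM('a)) :: complex"
  define F :: "'a \<Rightarrow> complex" where "F x = ?k * ?h (norm x)" for x
  have "F \<in> schwartz" unfolding F_def by (intro poly_gauss_schwartz poly_gauss.scale hankel_gauss_sum_poly_gauss dim)
  then have F: "F \<in> schwartz_o" by (simp add: schwartz_o_def radial_def F_def)
  have "sft F \<xi> = gauss_sum c m \<xi>" if xi: "\<xi> \<ge> 0" for \<xi>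
  proof -
    have "sft F \<xi> = hankel DIM('a) (ray F) \<xi>" by (rule sft_eq_hankel[OF dim F xi])
    also have "\<dots> = hankel DIM('a) (\<lambda>s. ?k * ?h s) \<xi>"
      unfolding hankel_def[of _ "ray F"] hankel_def[of _ "\<lambda>s. ?k * ?h s"]
      by (rule set_lebesgue_integral_cong) (simp_all add: ray_def F_def)
    also have "\<dots> = ?k * hankel DIM('a) ?h \<xi>" by (rule hankel_scale)
    also have "\<dots> = gauss_sum c m \<xi>"
      using hankel_inversion[OF dim rapid_gauss_sum hankel_gauss_sum_rapid[OF dim] xi] hankel_const_pos[OF dim] by simp
    finally show ?thesis .
  qed
  with F show ?thesis by (rule that)
qed

lemma schwartz_L2_sqdist_finite:
  fixes F :: "'a \<Rightarrow> complex"
  assumes F: "F \<in> schwartz_o"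
  shows "L2_sqdist F (\<lambda>_. 0) < \<infinity>"
  unfolding L2_sqdist_def using schwartz_L2_ray[OF dim F] rapid_nn_integral_finite[OF ray_rapid[OF F]]
  by (simp add: ennreal_mult_less_top)

lemma schwartz_spectral_sqdist_sqrt_finite:
  fixes F :: "'a \<Rightarrow> complex"
  assumes F: "F \<in> schwartz_o"
  shows "spectral_sqdist_sqrt DIM('a) (sft F) (\<lambda>_. 0) < \<infinity>"
proof -
  have "spectral_sqdist_sqrt DIM('a) (sft F) (\<lambda>_. 0) = spectral_sqdist_sqrt DIM('a) (hankel DIM('a) (ray F)) (\<lambda>_. 0)"
    unfolding spectral_sqdist_sqrt_def by (rule nn_integral_half_line_cong) (simp add: sft_eq_hankel[OF dim F])
  then show ?thesis using rapid_spectral_sqdist_sqrt_finite[OF sft_rapid[OF dim F]] by simp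
qed

lemma Hdot_spectral_sqdist_sqrt_finite:
  fixes f :: "'a \<Rightarrow> complex"
  assumes "f \<in> Hdot_o (1/4)"
  shows "spectral_sqdist_sqrt DIM('a) (sft_L2 f) (\<lambda>_. 0) < \<infinity>"
proof -
  have "integrable half_line (\<lambda>\<xi>. \<xi> powr (2 * (1/4)) * (norm (sft_L2 f \<xi>))\<^sup>2 * \<xi> ^ (DIM('a) - 1))"
    using assms by (simp add: Hdot_o_def set_integrable_half_line)
  then have "(\<integral>\<^sup>+\<xi>. ennreal (norm (\<xi> powr (2 * (1/4))
      * (norm (sft_L2 f \<xi>))\<^sup>2 * \<xi> ^ (DIM('a) - 1))) \<partial>half_line) < \<infinity>"
    by (simp only: integrable_iff_bounded)
  also have "(\<integral>\<^sup>+\<xi>. ennreal (norm (\<xi> powr (2 * (1/4))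
      * (norm (sft_L2 f \<xi>))\<^sup>2 * \<xi> ^ (DIM('a) - 1))) \<partial>half_line) = spectral_sqdist_sqrt DIM('a) (sft_L2 f) (\<lambda>_. 0)"
    unfolding spectral_sqdist_sqrt_def by (rule nn_integral_half_line_cong) (simp add: sqrt_eq_powr[simplified] mult_ac)
  finally show ?thesis .
qed

lemma sft_L2_of_diff:
  fixes f F :: "'a \<Rightarrow> complex"
  assumes f: "f \<in> L2_o" and F: "F \<in> schwartz_o"
  shows "(\<lambda>x. F x - f x) \<in> L2_o" "L2_sqdist F f < \<infinity>"
    "AE \<xi> in half_line. sft_L2 (\<lambda>x. F x - f x) \<xi> = sft F \<xi> - sft_L2 f \<xi>"
    "sft_L2 (\<lambda>x. F x - f x) \<in> borel_measurable half_line"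
proof -
  have r: "radial f" and fm: "f \<in> borel_measurable lebesgue" and fi: "integrable lebesgue (\<lambda>x. (norm (f x))\<^sup>2)"
    using f by (auto simp: L2_o_def)
  have Fm: "F \<in> borel_measurable lebesgue" by (rule schwartz_o_measurable[OF F])
  have "L2_sqdist (\<lambda>_. 0) f < \<infinity>" using fi by (simp add: L2_sqdist_def integrable_iff_bounded)
  then have "2 * L2_sqdist F (\<lambda>_. 0) + 2 * L2_sqdist (\<lambda>_. 0) f < \<infinity>"
    using schwartz_L2_sqdist_finite[OF F] by (simp add: ennreal_mult_less_top)
  moreover have "L2_sqdist F f \<le> 2 * L2_sqdist F (\<lambda>_. 0) + 2 * L2_sqdist (\<lambda>_. 0) f"
    by (rule L2_sqdist_triangle[OF Fm _ fm]) simp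
  ultimately show fin: "L2_sqdist F f < \<infinity>" by (rule le_less_trans[rotated])
  show L: "(\<lambda>x. F x - f x) \<in> L2_o"
    unfolding L2_o_def mem_Collect_eq
  proof (intro conjI)
    show "radial (\<lambda>x. F x - f x)" using r F unfolding radial_def schwartz_o_def mem_Collect_eq by metis
    show m: "(\<lambda>x. F x - f x) \<in> borel_measurable lebesgue" by (intro borel_measurable_diff Fm fm)
    show "integrable lebesgue (\<lambda>x. (norm (F x - f x))\<^sup>2)"
      using fin m by (simp add: integrable_iff_bounded L2_sqdist_def)
  qed
  have 1: "is_sft_L2 (\<lambda>x. F x - f x) (sft_L2 (\<lambda>x. F x - f x))" by (rule sft_L2_exists[OF dim L])
  have 2: "is_sft_L2 (\<lambda>x. F x - f x) (\<lambda>\<xi>. sft F \<xi> - sft_L2 f \<xi>)"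
    by (rule sft_L2_schwartz_diff[OF dim sft_L2_exists[OF dim f] F])
  show "AE \<xi> in half_line. sft_L2 (\<lambda>x. F x - f x) \<xi> = sft F \<xi> - sft_L2 f \<xi>"
    by (rule sft_L2_unique[OF dim _ 1 2]) (intro borel_measurable_diff Fm fm)
  show "sft_L2 (\<lambda>x. F x - f x) \<in> borel_measurable half_line" using 1 by (simp add: is_sft_L2_def)
qed

lemma Hdot_norm_schwartz_diff:
  fixes f F :: "'a \<Rightarrow> complex"
  assumes f: "f \<in> L2_o" and F: "F \<in> schwartz_o"
  defines "u \<equiv> \<lambda>\<xi>. \<xi> powr (2 * (1/4)) * (norm (sft_L2 (\<lambda>x. F x - f x) \<xi>))\<^sup>2 * \<xi> ^ (DIM('a) - 1)"
  shows "Hdot_norm (1/4) (\<lambda>x. F x - f x) = sqrt (integral\<^sup>L half_line u)"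
    "u \<in> borel_measurable half_line" "\<And>\<xi>. \<xi> \<in> space half_line \<Longrightarrow> 0 \<le> u \<xi>"
    "(\<integral>\<^sup>+\<xi>. ennreal (u \<xi>) \<partial>half_line) = spectral_sqdist_sqrt DIM('a) (sft F) (sft_L2 f)"
proof -
  show "Hdot_norm (1/4) (\<lambda>x. F x - f x) = sqrt (integral\<^sup>L half_line u)"
    unfolding Hdot_norm_def u_def by (simp only: integral_half_line)
  note d = sft_L2_of_diff[OF f F]
  show "u \<in> borel_measurable half_line"
  proof -
    have [measurable]: "(\<lambda>\<xi>::real. \<xi> powr (2
        * (1/4))) \<in> borel_measurable half_line" "(\<lambda>\<xi>::real. \<xi> ^ (DIM('a) - 1)) \<in> borel_measurable half_line"
      by (rule borel_measurable_half_line, measurable)+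
    note d(4)[measurable]
    show ?thesis unfolding u_def by measurable
  qed
  show "\<And>\<xi>. \<xi> \<in> space half_line \<Longrightarrow> 0 \<le> u \<xi>" by (simp add: u_def space_restrict_space)
  have "AE \<xi> in half_line. \<xi> \<in> space half_line" by (rule AE_space)
  with d(3) show "(\<integral>\<^sup>+\<xi>. ennreal (u \<xi>) \<partial>half_line) = spectral_sqdist_sqrt DIM('a) (sft F) (sft_L2 f)"
    unfolding spectral_sqdist_sqrt_def u_def
    by (intro nn_integral_cong_AE, eventually_elim) (simp add: space_restrict_space sqrt_eq_powr[simplified] mult_ac)
qed

text \<open>The norms in \<open>approximates\<close> are roots of Bochner integrals, which become 0
  on divergence. Finiteness comes from \<open>f\<close> lying in the homogeneous space and from the
  rapid decay of transforms of Schwartz functions; with it the norms bound the extended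
  integrals.\<close>

lemma approximates_bounds:
  fixes f :: "'a \<Rightarrow> complex"
  assumes f: "f \<in> Hdot_o (1/4)" and F: "approximates F f"
  shows "F j \<in> schwartz_o" "L2_sqdist (F j) f \<le> ennreal ((1 / 2 ^ j)\<^sup>2)"
    "spectral_sqdist_sqrt DIM('a) (sft (F j)) (sft_L2 f) \<le> ennreal ((1 / 2 ^ j)\<^sup>2)"
proof -
  show Fj: "F j \<in> schwartz_o" using F by (simp add: approximates_def)
  have sum: "L2_norm (\<lambda>x. F j x - f x) + Hdot_norm (1/4) (\<lambda>x. F j x - f x) \<le> 1 / 2 ^ j"
    using F by (simp add: approximates_def)
  have L: "f \<in> L2_o" using f by (simp add: Hdot_o_def)
  note d = sft_L2_of_diff[OF L Fj] and h = Hdot_norm_schwartz_diff[OF L Fj]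
  have nn: "L2_norm (\<lambda>x. F j x - f x) \<ge> 0" "Hdot_norm (1/4) (\<lambda>x. F j x - f x) \<ge> 0"
    unfolding h(1) L2_norm_def by (auto intro!: integral_nonneg_AE AE_I2 h(3))
  have "L2_norm (\<lambda>x. F j x - f x) \<le> 1 / 2 ^ j" using sum nn(2) by linarith
  then show "L2_sqdist (F j) f \<le> ennreal ((1 / 2 ^ j)\<^sup>2)"
    unfolding L2_sqdist_def L2_norm_def using d(1,2)
    by (intro nn_integral_le_of_sqrt_integral) (auto simp: L2_o_def L2_sqdist_def)
  have fm: "sft_L2 f \<in> borel_measurable half_line" using sft_L2_exists[OF dim L] by (simp add: is_sft_L2_def)
  have c: "spectral_sqdist_sqrt DIM('a) (\<lambda>_. 0) (sft_L2 f) = spectral_sqdist_sqrt DIM('a) (sft_L2 f) (\<lambda>_. 0)" by (simp add: spectral_sqdist_sqrt_def)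
  have "spectral_sqdist_sqrt DIM('a) (sft (F j)) (sft_L2 f) \<le> 2 * spectral_sqdist_sqrt DIM('a) (sft (F j)) (\<lambda>_. 0)
      + 2 * spectral_sqdist_sqrt DIM('a) (\<lambda>_. 0) (sft_L2 f)"
    by (rule spectral_sqdist_sqrt_triangle[OF sft_measurable[OF dim Fj] _ fm]) simp
  also have "\<dots> < \<infinity>"
    unfolding c using schwartz_spectral_sqdist_sqrt_finite[OF Fj] Hdot_spectral_sqdist_sqrt_finite[OF f] by (simp add: ennreal_mult_less_top)
  finally have fin: "spectral_sqdist_sqrt DIM('a) (sft (F j)) (sft_L2 f) < \<infinity>" .
  have "Hdot_norm (1/4) (\<lambda>x. F j x - f x) \<le> 1 / 2 ^ j" using sum nn(1) by linarith
  then show "spectral_sqdist_sqrt DIM('a) (sft (F j)) (sft_L2 f) \<le> ennreal ((1 / 2 ^ j)\<^sup>2)"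
    unfolding h(4)[symmetric] h(1) by (intro nn_integral_le_of_sqrt_integral h) (use fin h(4) in simp_all)
qed

text \<open>Closeness in L2 and in the homogeneous norm is achieved by one density statement on the
  spectral side, with weight \<open>(1 + sqrt \<xi>) * \<xi> ^ (n - 1)\<close>, applied to a Borel
  version \<open>g0\<close> of the transform. \<open>schwartz_with_transform\<close> turns the
  Gaussian sum into the transform of a Schwartz function, and \<open>sft_L2_estimate\<close> returns
  to the L2 distance.\<close>

lemma approximates_exists:
  fixes f :: "'a \<Rightarrow> complex"
  assumes f: "f \<in> Hdot_o (1/4)"
  shows "\<exists>F. approximates F f"
proof -
  have L: "f \<in> L2_o" using f by (simp add: Hdot_o_def)
  have r: "radial f" and fm: "f \<in> borel_measurable lebesgue" using L by (auto simp: L2_o_def)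
  have g: "is_sft_L2 f (sft_L2 f)" by (rule sft_L2_exists[OF dim L])
  then have gm: "sft_L2 f \<in> borel_measurable half_line" by (simp add: is_sft_L2_def)
  let ?W = "\<lambda>\<xi>::real. (1 + sqrt \<xi>) * \<xi> ^ (DIM('a) - 1)"
  obtain g0 where g0 [measurable]: "g0 \<in> borel_measurable borel" and ae: "AE \<xi> in half_line. sft_L2 f \<xi> = g0 \<xi>"
  proof -
    have "(\<lambda>\<xi>. indicator {0..} \<xi> *\<^sub>R sft_L2 f \<xi>) \<in> borel_measurable lebesgue"
      using gm by (subst (asm) borel_measurable_restrict_space_iff) auto
    then obtain h where h: "h \<in> borel_measurable lborel" "AE \<xi> in lborel. indicator {0..} \<xi> *\<^sub>R sft_L2 f \<xi> = h \<xi>"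
      by (rule completion_ex_borel_measurable_complex)
    have "AE \<xi> in half_line. sft_L2 f \<xi> = h \<xi>"
      unfolding AE_lebesgue_on_half_line using h(2) by eventually_elim (auto simp: indicator_def)
    then show ?thesis using h(1) by (intro that[of h]) auto
  qed
  have split: "(\<integral>\<^sup>+\<xi>\<in>{0..}. ennreal ((norm (g0 \<xi> - h \<xi>))\<^sup>2 * ?W \<xi>) \<partial>lborel)
      = spectral_sqdist DIM('a) h (sft_L2 f) + spectral_sqdist_sqrt DIM('a) h (sft_L2 f)"
    if [measurable]: "h \<in> borel_measurable borel" for h
  proof -
    have "(\<integral>\<^sup>+\<xi>\<in>{0..}. ennreal ((norm (g0 \<xi> - h \<xi>))\<^sup>2 * ?W \<xi>) \<partial>lborel)
      = (\<integral>\<^sup>+\<xi>. ennreal ((norm (g0 \<xi> - h \<xi>))\<^sup>2 * \<xi> ^ (DIM('a) - 1))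
          + ennreal ((norm (g0 \<xi> - h \<xi>))\<^sup>2 * (sqrt \<xi> * \<xi> ^ (DIM('a) - 1))) \<partial>half_line)"
      unfolding nn_integral_half_line[symmetric] by (rule nn_integral_half_line_cong) (simp flip: ennreal_plus add: algebra_simps)
    also have "\<dots> = (\<integral>\<^sup>+\<xi>. ennreal ((norm (g0 \<xi> - h \<xi>))\<^sup>2 * \<xi> ^ (DIM('a) - 1)) \<partial>half_line)
        + (\<integral>\<^sup>+\<xi>. ennreal ((norm (g0 \<xi> - h \<xi>))\<^sup>2 * (sqrt \<xi> * \<xi> ^ (DIM('a) - 1))) \<partial>half_line)"
      by (rule nn_integral_add) (rule borel_measurable_half_line, measurable)+
    also have "(\<integral>\<^sup>+\<xi>. ennreal ((norm (g0 \<xi> - h \<xi>))\<^sup>2 * \<xi> ^ (DIM('a) - 1)) \<partial>half_line)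
        = spectral_sqdist DIM('a) h (sft_L2 f)"
      unfolding spectral_sqdist_def using ae by (intro nn_integral_cong_AE) (auto simp: norm_minus_commute elim: eventually_mono)
    also have "(\<integral>\<^sup>+\<xi>. ennreal ((norm (g0 \<xi> - h \<xi>))\<^sup>2 * (sqrt \<xi> * \<xi> ^ (DIM('a) - 1))) \<partial>half_line)
        = spectral_sqdist_sqrt DIM('a) h (sft_L2 f)"
      unfolding spectral_sqdist_sqrt_def using ae by (intro nn_integral_cong_AE) (auto simp: norm_minus_commute elim: eventually_mono)
    finally show ?thesis .
  qed
  \<comment> \<open>A Schwartz function whose transform is 0 on the half line: the estimate between
    \<open>Z\<close> and \<open>f\<close> shows that \<open>sft_L2 f\<close> is square integrable
    with weight \<open>\<xi> ^ (DIM('a) - 1)\<close>.\<close>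
  obtain Z :: "'a \<Rightarrow> complex" where Z: "Z \<in> schwartz_o" "\<And>\<xi>. \<xi> \<ge> 0 \<Longrightarrow> sft Z \<xi> = gauss_sum (\<lambda>_. 0) 0 \<xi>"
    by (rule schwartz_with_transform[of "\<lambda>_. 0" 0]) blast
  have "spectral_sqdist DIM('a) (\<lambda>_. 0) (sft_L2 f) = spectral_sqdist DIM('a) (sft Z) (sft_L2 f)"
    unfolding spectral_sqdist_def by (rule nn_integral_half_line_cong) (simp add: Z gauss_sum_def)
  also have "\<dots> \<le> ennreal (4 * plancherel_const TYPE('a)) * L2_sqdist Z f" by (rule sft_L2_estimate(1)[OF dim fm g Z(1)])
  also have "\<dots> < \<infinity>" using sft_L2_of_diff(2)[OF L Z(1)] by (simp add: ennreal_mult_less_top)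
  finally have fin1: "spectral_sqdist DIM('a) (\<lambda>_. 0) (sft_L2 f) < \<infinity>" .
  have "spectral_sqdist_sqrt DIM('a) (\<lambda>_. 0) (sft_L2 f) < \<infinity>" using Hdot_spectral_sqdist_sqrt_finite[OF f] by (simp add: spectral_sqdist_sqrt_def)
  with fin1 have fin: "(\<integral>\<^sup>+\<xi>\<in>{0..}. ennreal ((norm (g0 \<xi>))\<^sup>2 * ?W \<xi>) \<partial>lborel) < \<infinity>"
    using split[of "\<lambda>_. 0"] by simp
  have appr: "\<exists>F :: 'a \<Rightarrow> complex. F \<in> schwartz_o \<and> spectral_sqdist DIM('a) (sft F) (sft_L2 f)
      \<le> ennreal e \<and> spectral_sqdist_sqrt DIM('a) (sft F) (sft_L2 f) \<le> ennreal e"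
    if e: "e > 0" for e
  proof (rule gauss_sum_dense[of ?W 2 "DIM('a)" g0 e])
    show "continuous_on UNIV ?W" by (intro continuous_intros)
    show "?W s \<ge> 0" if "s \<ge> 0" for s using that by simp
    show "\<bar>?W s\<bar> \<le> 2 * (1 + \<bar>s\<bar>) ^ DIM('a)" for s
    proof -
      have "\<bar>sqrt s\<bar> = sqrt \<bar>s\<bar>" by (simp add: abs_if real_sqrt_minus)
      moreover have "sqrt \<bar>s\<bar> \<le> sqrt ((1 + \<bar>s\<bar>)\<^sup>2)" by (intro real_sqrt_le_mono) (simp add: power2_eq_square algebra_simps)
      ultimately have "\<bar>sqrt s\<bar> \<le> 1 + \<bar>s\<bar>" by simp
      then have "\<bar>1 + sqrt s\<bar> \<le> 2 * (1 + \<bar>s\<bar>)" using abs_triangle_ineq[of 1 "sqrt s"] by simp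
      moreover have "\<bar>s\<bar> ^ (DIM('a) - 1) \<le> (1 + \<bar>s\<bar>) ^ (DIM('a) - 1)" by (intro power_mono) auto
      ultimately have "\<bar>?W s\<bar> \<le> (2 * (1 + \<bar>s\<bar>)) * (1 + \<bar>s\<bar>) ^ (DIM('a) - 1)"
        unfolding abs_mult power_abs by (intro mult_mono) auto
      also have "\<dots> = 2 * (1 + \<bar>s\<bar>) ^ DIM('a)" by (simp add: power_eq_if)
      finally show ?thesis .
    qed
    fix c m assume cm: "(\<integral>\<^sup>+s\<in>{0..}. ennreal ((norm (g0 s - gauss_sum c m s))\<^sup>2 * ?W s) \<partial>lborel) \<le> ennreal e"
    obtain F :: "'a \<Rightarrow> complex" where F: "F \<in> schwartz_o" "\<And>\<xi>. \<xi> \<ge> 0 \<Longrightarrow> sft F \<xi> = gauss_sum c m \<xi>"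
      by (rule schwartz_with_transform[of c m]) blast
    have 1: "spectral_sqdist DIM('a) (sft F) (sft_L2 f) = spectral_sqdist DIM('a) (gauss_sum c m) (sft_L2 f)"
      "spectral_sqdist_sqrt DIM('a) (sft F) (sft_L2 f) = spectral_sqdist_sqrt DIM('a) (gauss_sum c m) (sft_L2 f)"
      unfolding spectral_sqdist_def spectral_sqdist_sqrt_def by (rule nn_integral_half_line_cong, simp add: F)+
    have "spectral_sqdist DIM('a) (sft F) (sft_L2 f) + spectral_sqdist_sqrt DIM('a) (sft F) (sft_L2 f) \<le> ennreal e"
      using cm unfolding 1 split[OF rapid_measurable[OF rapid_gauss_sum]] .
    then have "spectral_sqdist DIM('a) (sft F) (sft_L2 f) \<le> ennreal e" "spectral_sqdist_sqrt DIM('a) (sft F) (sft_L2 f) \<le> ennreal e"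
      by (metis add_increasing2 dual_order.trans order_refl zero_le add_increasing)+
    with F(1) show ?thesis by blast
  qed (fact fin e g0)+
  \<comment> \<open>1 stands for the homogeneous norm, the root for the L2 norm; with
    \<open>e = 1 / 2 ^ j / b\<close> the two norms together stay within
    \<open>1 / 2 ^ j\<close>.\<close>
  define b where "b = 1 + sqrt (4 / plancherel_const TYPE('a))"
  have rp: "plancherel_const TYPE('a) > 0" by (rule plancherel_const_pos[OF dim])
  have b: "b \<ge> 1" using rp by (simp add: b_def)
  have "\<exists>F :: 'a \<Rightarrow> complex. F \<in> schwartz_o \<and> L2_norm (\<lambda>x. F x - f x) + Hdot_norm (1/4) (\<lambda>x. F x - f x)
      \<le> 1 / 2 ^ j" for j :: nat
  proof -
    define e where "e = 1 / 2 ^ j / b"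
    have e: "e > 0" using b by (simp add: e_def)
    obtain F :: "'a \<Rightarrow> complex" where F: "F \<in> schwartz_o" "spectral_sqdist DIM('a) (sft F) (sft_L2 f)
        \<le> ennreal (e\<^sup>2)" "spectral_sqdist_sqrt DIM('a) (sft F) (sft_L2 f) \<le> ennreal (e\<^sup>2)"
      using appr[of "e\<^sup>2"] e by auto
    note h = Hdot_norm_schwartz_diff[OF L F(1)]
    have H: "Hdot_norm (1/4) (\<lambda>x. F x - f x) \<le> e"
      unfolding h(1) by (rule sqrt_integral_le_of_nn_integral[OF h(2,3)]) (use F(3) e h(4) in simp_all)
    have "ennreal (plancherel_const TYPE('a)) * L2_sqdist F f \<le> 4 * ennreal (e\<^sup>2)"
      using sft_L2_estimate(2)[OF dim fm g F(1)] F(2) by (meson mult_left_mono order_trans zero_le)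
    then have "ennreal (1 / plancherel_const TYPE('a)) * (ennreal (plancherel_const TYPE('a)) * L2_sqdist F f)
        \<le> ennreal (1 / plancherel_const TYPE('a)) * (4 * ennreal (e\<^sup>2))"
      by (rule mult_left_mono) simp
    moreover have "ennreal (1 / plancherel_const TYPE('a)) * (ennreal (plancherel_const TYPE('a)) * L2_sqdist F f) = L2_sqdist F f"
      unfolding mult.assoc[symmetric] using rp by (simp flip: ennreal_mult)
    moreover have "ennreal (1 / plancherel_const TYPE('a)) * (4 * ennreal (e\<^sup>2)) = ennreal ((sqrt (4 / plancherel_const TYPE('a)) * e)\<^sup>2)"
    proof -
      have "4 * ennreal (e\<^sup>2) = ennreal (4 * e\<^sup>2)" by (simp add: ennreal_mult)
      then show ?thesis using rp by (simp flip: ennreal_mult add: power_mult_distrib)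
    qed
    ultimately have "L2_sqdist F f \<le> ennreal ((sqrt (4 / plancherel_const TYPE('a)) * e)\<^sup>2)" by simp
    then have "L2_norm (\<lambda>x. F x - f x) \<le> sqrt (4 / plancherel_const TYPE('a)) * e"
      unfolding L2_norm_def L2_sqdist_def using sft_L2_of_diff(1)[OF L F(1)] rp e
      by (intro sqrt_integral_le_of_nn_integral) (auto simp: L2_o_def)
    with H have "L2_norm (\<lambda>x. F x - f x) + Hdot_norm (1/4) (\<lambda>x. F x - f x) \<le> b * e" by (simp add: b_def algebra_simps)
    also have "b * e = 1 / 2 ^ j" using b by (simp add: e_def)
    finally show ?thesis using F(1) by blast
  qed
  then have "\<exists>F :: nat \<Rightarrow> 'a \<Rightarrow> complex. \<forall>j. F j \<in> schwartz_o \<and> L2_norm (\<lambda>x. F j x - f x)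
      + Hdot_norm (1/4) (\<lambda>x. F j x - f x) \<le> 1 / 2 ^ j"
    by (intro choice allI)
  then show ?thesis unfolding approximates_def .
qed

text \<open>\<open>sqrt \<xi>\<close> is \<open>(\<xi>\<^sup>2) powr (1/4)\<close>, which lies below
  \<open>(1 + \<xi>\<^sup>2) powr \<beta>\<close> because the last base is at least 1.\<close>

lemma H_o_subset_Hdot_o:
  assumes "\<beta> \<ge> 1/4"
  shows "(H_o \<beta> :: ('a \<Rightarrow> complex) set) \<subseteq> Hdot_o (1/4)"
proof
  fix f :: "'a \<Rightarrow> complex" assume "f \<in> H_o \<beta>"
  then have L: "f \<in> L2_o" and i: "integrable half_line (\<lambda>\<xi>. (1 + \<xi>\<^sup>2) powr \<beta> * (norm (sft_L2 f \<xi>))\<^sup>2 * \<xi> ^ (DIM('a) - 1))"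
    by (auto simp: H_o_def set_integrable_half_line)
  have fm: "sft_L2 f \<in> borel_measurable half_line" using sft_L2_exists[OF dim L] by (simp add: is_sft_L2_def)
  have "integrable half_line (\<lambda>\<xi>. \<xi> powr (2 * (1/4)) * (norm (sft_L2 f \<xi>))\<^sup>2 * \<xi> ^ (DIM('a) - 1))"
  proof (rule Bochner_Integration.integrable_bound[OF i])
    show "(\<lambda>\<xi>. \<xi> powr (2 * (1/4)) * (norm (sft_L2 f \<xi>))\<^sup>2 * \<xi> ^ (DIM('a) - 1)) \<in> borel_measurable half_line"
    proof -
      have [measurable]: "(\<lambda>\<xi>::real. \<xi> powr (2
          * (1/4))) \<in> borel_measurable half_line" "(\<lambda>\<xi>::real. \<xi> ^ (DIM('a) - 1)) \<in> borel_measurable half_line"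
        by (rule borel_measurable_half_line, measurable)+
      note fm[measurable]
      show ?thesis by measurable
    qed
    show "AE \<xi> in half_line. norm (\<xi> powr (2 * (1/4)) * (norm (sft_L2 f \<xi>))\<^sup>2 * \<xi> ^ (DIM('a) - 1))
       \<le> norm ((1 + \<xi>\<^sup>2) powr \<beta> * (norm (sft_L2 f \<xi>))\<^sup>2 * \<xi> ^ (DIM('a) - 1))"
    proof (rule AE_I2)
      fix \<xi> :: real assume "\<xi> \<in> space half_line"
      then have x: "\<xi> \<ge> 0" by (simp add: space_restrict_space)
      have "\<xi> powr (2 * (1/4)) = (\<xi>\<^sup>2) powr (1/4)"
        using x by (cases "\<xi> = 0") (simp_all add: powr_powr flip: powr_numeral)
      also have "\<dots> \<le> (1 + \<xi>\<^sup>2) powr (1/4)" by (rule powr_mono2) auto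
      also have "\<dots> \<le> (1 + \<xi>\<^sup>2) powr \<beta>" using assms by (intro powr_mono) auto
      finally have "\<xi> powr (2 * (1/4)) \<le> (1 + \<xi>\<^sup>2) powr \<beta>" .
      then show "norm (\<xi> powr (2 * (1/4)) * (norm (sft_L2 f \<xi>))\<^sup>2 * \<xi> ^ (DIM('a) - 1))
       \<le> norm ((1 + \<xi>\<^sup>2) powr \<beta> * (norm (sft_L2 f \<xi>))\<^sup>2 * \<xi> ^ (DIM('a) - 1))"
        using x unfolding norm_mult by (intro mult_right_mono) auto
    qed
  qed
  then show "f \<in> Hdot_o (1/4)" using L by (simp add: Hdot_o_def set_integrable_half_line)
qed

end

subsection \<open>Convergence along the curves\<close>

lemma spec_prop_diff:
  assumes n: "n \<ge> 2" and g: "rapid g" and h: "rapid h"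
  shows "spec_prop n (\<lambda>\<xi>. g \<xi> - h \<xi>) t r = spec_prop n g t r - spec_prop n h t r"
proof -
  let ?\<nu> = "(real n - 2) / 2"
  let ?p = "\<lambda>\<xi>. of_real (sj ?\<nu> (\<xi> * r)) * cexp (t * \<xi>\<^sup>2) * of_real (\<xi> ^ (n - 1))"
  have nu: "?\<nu> \<ge> 0" using n by simp
  note sj_measurable[OF nu, measurable]
  obtain D where D: "D > 0" "\<And>z. \<bar>sj ?\<nu> z\<bar> \<le> D" by (rule sj_bounded_all[OF nu]) blast
  have pb: "norm (?p x) \<le> D * (1 + \<bar>x\<bar>) ^ (n - 1)" for x
    using D power_mono[of "\<bar>x\<bar>" "1 + \<bar>x\<bar>" "n - 1"]
    by (simp add: norm_mult cexp_def norm_power power_abs mult_mono)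
  have i: "set_integrable lborel {0..} (\<lambda>\<xi>. ?p \<xi> * u \<xi>)" if "rapid u" for u
    by (rule rapid_set_integrable[OF that _ pb]) measurable
  have e: "spec_prop n u t r = (LINT \<xi>:{0..}|lborel. ?p \<xi> * u \<xi>)" for u
    unfolding spec_prop_def by (simp only: mult_ac)
  show ?thesis unfolding e right_diff_distrib by (rule set_integral_diff(2)[OF i[OF g] i[OF h]])
qed

text \<open>The maximal constant depends on the interval, so the open half line is exhausted by the
  intervals \<open>{1 / (k + 1) .. k + 2}\<close>. On each, squared maximal functions with integrals
  of order \<open>1 / 4 ^ j\<close> are almost everywhere of order \<open>1 / 2 ^ j\<close>; the
  constant \<open>K\<close> depends on \<open>s\<close> but neither on \<open>j\<close> nor on
  \<open>t\<close>.\<close>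

lemma fast_maximal_AE:
  assumes n: "n \<ge> 2" and C: "C \<ge> 0" and d: "\<And>j. rapid (d j)" and B: "B \<ge> 0"
    and le: "\<And>j. (\<integral>\<^sup>+\<xi>\<in>{0..}. ennreal ((1 + sqrt \<xi>) * (norm (d j \<xi>))\<^sup>2 * \<xi> ^ (n - 1)) \<partial>lborel)
        \<le> ennreal (B / 4 ^ j)"
  shows "AE s in lborel. s > 0 \<longrightarrow>
    (\<exists>K\<ge>0. \<forall>j t. norm (spec_prop n (d j) t (s + C * sqrt \<bar>t\<bar>)) \<le> sqrt (K / 2 ^ j))"
proof -
  have "AE s in lborel. s \<in> {1 / real (Suc k) .. real (k + 2)} \<longrightarrow>
    (\<exists>K\<ge>0. \<forall>j t. norm (spec_prop n (d j) t (s + C * sqrt \<bar>t\<bar>))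
        \<le> sqrt (K / 2 ^ j))" (is "AE s in _. s \<in> ?I k \<longrightarrow> _") for k
  proof -
    have ab: "0 < 1 / real (Suc k)" "1 / real (Suc k) < real (k + 2)"
      by (simp, rule le_less_trans[of _ 1]) simp_all
    obtain K where K: "K \<ge> 0" "\<And>g. rapid g \<Longrightarrow> \<exists>M. M \<in> borel_measurable borel \<and>
       (\<forall>s t. ennreal ((norm (spec_prop n g t (s + C * sqrt \<bar>t\<bar>)))\<^sup>2) \<le> M s) \<and>
       (\<integral>\<^sup>+s\<in>?I k. M s \<partial>lborel)
           \<le> ennreal K * (\<integral>\<^sup>+\<xi>\<in>{0..}. ennreal ((1 + sqrt \<xi>) * (norm (g \<xi>))\<^sup>2 * \<xi> ^ (n - 1)) \<partial>lborel)"
      by (rule maximal_curve_bound[OF n C ab]) blast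
    have "\<forall>j. \<exists>M. M \<in> borel_measurable borel \<and>
       (\<forall>s t. ennreal ((norm (spec_prop n (d j) t (s + C * sqrt \<bar>t\<bar>)))\<^sup>2) \<le> M s) \<and>
       (\<integral>\<^sup>+s\<in>?I k. M s \<partial>lborel)
           \<le> ennreal K * (\<integral>\<^sup>+\<xi>\<in>{0..}. ennreal ((1 + sqrt \<xi>) * (norm (d j \<xi>))\<^sup>2 * \<xi> ^ (n - 1)) \<partial>lborel)"
      by (intro allI K(2) d)
    from choice[OF this] obtain M where M: "\<And>j. M j \<in> borel_measurable borel"
       "\<And>j s t. ennreal ((norm (spec_prop n (d j) t (s + C * sqrt \<bar>t\<bar>)))\<^sup>2) \<le> M j s"
       "\<And>j. (\<integral>\<^sup>+s\<in>?I k. M j s \<partial>lborel)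
           \<le> ennreal K * (\<integral>\<^sup>+\<xi>\<in>{0..}. ennreal ((1 + sqrt \<xi>) * (norm (d j \<xi>))\<^sup>2 * \<xi> ^ (n - 1)) \<partial>lborel)"
      by auto
    note M(1)[measurable]
    have "AE s in lborel. \<exists>L\<ge>0. \<forall>j. M j s * indicator (?I k) s \<le> ennreal (L / 2 ^ j)"
    proof (rule fast_decay_AE[where C = "K * B"])
      show "(\<lambda>s. M j s * indicator (?I k) s) \<in> borel_measurable lborel" for j by measurable
      show "K * B \<ge> 0" using K B by simp
      fix j
      have "(\<integral>\<^sup>+s\<in>?I k. M j s \<partial>lborel) \<le> ennreal K * ennreal (B / 4 ^ j)"
        by (rule order_trans[OF M(3)]) (intro mult_left_mono le, simp)
      also have "\<dots> = ennreal (K * B / 4 ^ j)" using K(1) B by (simp flip: ennreal_mult)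
      finally show "(\<integral>\<^sup>+s\<in>?I k. M j s \<partial>lborel) \<le> ennreal (K * B / 4 ^ j)" .
    qed
    then show ?thesis
    proof eventually_elim
      case (elim s)
      then obtain L where L: "L \<ge> 0" "\<And>j. M j s * indicator (?I k) s \<le> ennreal (L / 2 ^ j)" by blast
      show ?case
      proof (intro impI exI[of _ L] conjI allI L(1) norm_le_sqrtI)
        fix j t assume "s \<in> ?I k"
        then show "ennreal ((norm (spec_prop n (d j) t (s + C * sqrt \<bar>t\<bar>)))\<^sup>2) \<le> ennreal (L / 2 ^ j)"
          using L(2)[of j] M(2)[of j t s] by simp
        show "0 \<le> L / 2 ^ j" using L(1) by simp
      qed
    qed
  qed
  then have "AE s in lborel. \<forall>k. s \<in> ?I k \<longrightarrow>
    (\<exists>K\<ge>0. \<forall>j t. norm (spec_prop n (d j) t (s + C * sqrt \<bar>t\<bar>)) \<le> sqrt (K / 2 ^ j))"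
    by (simp only: AE_all_countable) blast
  then show ?thesis
  proof eventually_elim
    case (elim s)
    show ?case
    proof
      assume s: "s > 0"
      obtain k :: nat where k: "max s (1 / s) \<le> real k" using real_arch_simple by blast
      have "1 / real (Suc k) \<le> s" using k s by (simp add: field_simps)
      then have "s \<in> ?I k" using k by simp
      then show "\<exists>K\<ge>0. \<forall>j t. norm (spec_prop n (d j) t (s + C * sqrt \<bar>t\<bar>)) \<le> sqrt (K / 2 ^ j)"
        using elim by blast
    qed
  qed
qed

lemma uniform_limit_sqrt_geometric: "uniform_limit X (\<lambda>j t. sqrt (K / 2 ^ j)) (\<lambda>_. 0) sequentially"
  using summable_LIMSEQ_zero[OF summable_sqrt_geometric[of K]]
  by (simp add: uniform_limit_iff tendsto_iff)

text \<open>The Weierstrass test on the telescoping series. Naming the limit by \<open>lim\<close>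
  fixes it independently of \<open>K\<close>, which will vary with \<open>s\<close>.\<close>

lemma uniform_limit_fast_Cauchy:
  fixes a :: "nat \<Rightarrow> 'b \<Rightarrow> complex"
  assumes le: "\<And>j t. norm (a (Suc j) t - a j t) \<le> sqrt (K / 2 ^ j)"
  shows "uniform_limit UNIV a (\<lambda>t. lim (\<lambda>j. a j t)) sequentially"
proof -
  let ?f = "\<lambda>j t. a (Suc j) t - a j t"
  have tele: "(\<Sum>j<m. ?f j t) = a m t - a 0 t" for m t
    using sum_lessThan_telescope[of "\<lambda>j. a j t" m] .
  have "uniform_limit UNIV (\<lambda>m t. \<Sum>j<m. ?f j t) (\<lambda>t. suminf (\<lambda>j. ?f j t)) sequentially"
    by (rule Weierstrass_m_test[OF _ summable_sqrt_geometric]) (rule le)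
  then have "uniform_limit UNIV (\<lambda>m t. a m t - a 0 t) (\<lambda>t. suminf (\<lambda>j. ?f j t)) sequentially"
    unfolding tele .
  then have "uniform_limit UNIV (\<lambda>m t. (a m t - a 0 t) + a 0 t) (\<lambda>t. suminf (\<lambda>j. ?f j t) + a 0 t) sequentially"
    by (intro uniform_limit_add uniform_limit_const)
  then have u: "uniform_limit UNIV a (\<lambda>t. suminf (\<lambda>j. ?f j t) + a 0 t) sequentially" by simp
  have "(\<lambda>t. suminf (\<lambda>j. ?f j t) + a 0 t) = (\<lambda>t. lim (\<lambda>j. a j t))"
    using limI[OF tendsto_uniform_limitI[OF u UNIV_I]] by (simp add: fun_eq_iff)
  with u show ?thesis by simp
qed

context
  fixes dim_type :: "'a::euclidean_space itself"
  assumes dim: "DIM('a) \<ge> 2"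
begin

text \<open>Two sequences are compared so that one bound serves for successive members of one
  sequence and for uniqueness of the limit. The 16 is 2 + 2 from the triangle inequality times 4
  from \<open>sft_L2_estimate\<close>; the 4 is 2 + 2 for the part of order 1/4. The error at the
  index \<open>i\<close> is bounded by the one at \<open>j\<close>.\<close>

lemma approximates_diff_bound:
  fixes f :: "'a \<Rightarrow> complex"
  assumes f: "f \<in> Hdot_o (1/4)" and F: "approximates F f" and G: "approximates G f" and ij: "j \<le> i"
  shows "(\<integral>\<^sup>+\<xi>\<in>{0..}. ennreal ((1 + sqrt \<xi>)
      * (norm (hankel DIM('a) (ray (F j)) \<xi> - hankel DIM('a) (ray (G i)) \<xi>))\<^sup>2 * \<xi> ^ (DIM('a) - 1)) \<partial>lborel)
    \<le> ennreal ((16 * plancherel_const TYPE('a) + 4) / 4 ^ j)"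
proof -
  have L: "f \<in> L2_o" using f by (simp add: Hdot_o_def)
  have fm: "f \<in> borel_measurable lebesgue" using L by (simp add: L2_o_def)
  have g: "is_sft_L2 f (sft_L2 f)" by (rule sft_L2_exists[OF dim L])
  then have gm: "sft_L2 f \<in> borel_measurable half_line" by (simp add: is_sft_L2_def)
  note Fb = approximates_bounds[OF dim f F, of j] and Gb = approximates_bounds[OF dim f G, of i]
  have rp: "plancherel_const TYPE('a) > 0" by (rule plancherel_const_pos[OF dim])
  define q :: real where "q = 1 / 4 ^ j"
  have q: "q \<ge> 0" by (simp add: q_def)
  have qj: "(1 / 2 ^ j)\<^sup>2 = q" by (simp add: q_def power_divide power2_eq_square flip: power_mult_distrib)
  have "(1 / 2 ^ i :: real) \<le> 1 / 2 ^ j" using ij by (simp add: frac_le)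
  then have qi: "(1 / 2 ^ i)\<^sup>2 \<le> q" unfolding qj[symmetric] by (intro power_mono) auto
  let ?u = "hankel DIM('a) (ray (F j))" and ?v = "hankel DIM('a) (ray (G i))"
  note rapid_measurable[OF sft_rapid[OF dim Fb(1)], measurable] rapid_measurable[OF sft_rapid[OF dim Gb(1)], measurable]
  note m = sft_measurable[OF dim Fb(1)] sft_measurable[OF dim Gb(1)] gm
  have "spectral_sqdist DIM('a) (sft (F j)) (sft (G i)) \<le> 2 * spectral_sqdist DIM('a) (sft (F j)) (sft_L2 f) + 2 * spectral_sqdist DIM('a) (sft_L2 f) (sft (G i))"
    by (rule spectral_sqdist_triangle[OF m(1,3,2)])
  also have "\<dots> \<le> 2 * (ennreal (4 * plancherel_const TYPE('a)) * ennreal q) + 2 * (ennreal (4 * plancherel_const TYPE('a)) * ennreal q)"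
  proof (intro add_mono mult_left_mono)
    show "spectral_sqdist DIM('a) (sft (F j)) (sft_L2 f) \<le> ennreal (4 * plancherel_const TYPE('a)) * ennreal q"
      using Fb(2) unfolding qj by (intro order_trans[OF sft_L2_estimate(1)[OF dim fm g Fb(1)]] mult_left_mono) auto
    have "L2_sqdist (G i) f \<le> ennreal q" using Gb(2) qi by (meson ennreal_leI order_trans)
    then show "spectral_sqdist DIM('a) (sft_L2 f) (sft (G i)) \<le> ennreal (4 * plancherel_const TYPE('a)) * ennreal q"
      unfolding spectral_sqdist_commute[of _ "sft_L2 f"]
      by (intro order_trans[OF sft_L2_estimate(1)[OF dim fm g Gb(1)]] mult_left_mono) auto
  qed auto
  also have "\<dots> = ennreal (16 * plancherel_const TYPE('a) * q)"
  proof -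
    have "2 * ennreal x + 2 * ennreal x = ennreal (4 * x)" if "x \<ge> 0" for x
      using that by (simp add: ennreal_mult flip: distrib_right)
    from this[of "4 * plancherel_const TYPE('a) * q"] show ?thesis using rp q by (simp add: ennreal_mult mult.assoc)
  qed
  finally have 1: "spectral_sqdist DIM('a) (sft (F j)) (sft (G i)) \<le> ennreal (16 * plancherel_const TYPE('a) * q)" .
  have "spectral_sqdist_sqrt DIM('a) (sft (F j)) (sft (G i))
      \<le> 2 * spectral_sqdist_sqrt DIM('a) (sft (F j)) (sft_L2 f) + 2 * spectral_sqdist_sqrt DIM('a) (sft_L2 f) (sft (G i))"
    by (rule spectral_sqdist_sqrt_triangle[OF m(1,3,2)])
  also have "\<dots> \<le> 2 * ennreal q + 2 * ennreal q"
  proof (intro add_mono mult_left_mono)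
    show "spectral_sqdist_sqrt DIM('a) (sft (F j)) (sft_L2 f) \<le> ennreal q" using Fb(3) unfolding qj .
    have "spectral_sqdist_sqrt DIM('a) (sft (G i)) (sft_L2 f) \<le> ennreal q" using Gb(3) qi by (meson ennreal_leI order_trans)
    then show "spectral_sqdist_sqrt DIM('a) (sft_L2 f) (sft (G i)) \<le> ennreal q" by (simp add: spectral_sqdist_sqrt_def norm_minus_commute)
  qed auto
  also have "\<dots> = ennreal (4 * q)" using q by (simp add: ennreal_mult flip: distrib_right)
  finally have 2: "spectral_sqdist_sqrt DIM('a) (sft (F j)) (sft (G i)) \<le> ennreal (4 * q)" .
  have "(\<integral>\<^sup>+\<xi>\<in>{0..}. ennreal ((1 + sqrt \<xi>) * (norm (?u \<xi> - ?v \<xi>))\<^sup>2 * \<xi> ^ (DIM('a) - 1)) \<partial>lborel)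
    = (\<integral>\<^sup>+\<xi>. ennreal ((norm (?u \<xi> - ?v \<xi>))\<^sup>2 * \<xi> ^ (DIM('a) - 1))
        + ennreal ((norm (?u \<xi> - ?v \<xi>))\<^sup>2 * (sqrt \<xi> * \<xi> ^ (DIM('a) - 1))) \<partial>half_line)"
    unfolding nn_integral_half_line[symmetric] by (rule nn_integral_half_line_cong) (simp flip: ennreal_plus add: algebra_simps)
  also have "\<dots> = (\<integral>\<^sup>+\<xi>. ennreal ((norm (?u \<xi> - ?v \<xi>))\<^sup>2 * \<xi> ^ (DIM('a) - 1)) \<partial>half_line)
      + (\<integral>\<^sup>+\<xi>. ennreal ((norm (?u \<xi> - ?v \<xi>))\<^sup>2 * (sqrt \<xi> * \<xi> ^ (DIM('a) - 1))) \<partial>half_line)"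
    by (rule nn_integral_add) (rule borel_measurable_half_line, measurable)+
  also have "(\<integral>\<^sup>+\<xi>. ennreal ((norm (?u \<xi> - ?v \<xi>))\<^sup>2 * \<xi> ^ (DIM('a) - 1)) \<partial>half_line)
      = spectral_sqdist DIM('a) (sft (F j)) (sft (G i))"
    unfolding spectral_sqdist_def by (rule nn_integral_half_line_cong) (simp add: sft_eq_hankel[OF dim Fb(1)] sft_eq_hankel[OF dim Gb(1)])
  also have "(\<integral>\<^sup>+\<xi>. ennreal ((norm (?u \<xi> - ?v \<xi>))\<^sup>2 * (sqrt \<xi> * \<xi> ^ (DIM('a) - 1))) \<partial>half_line)
      = spectral_sqdist_sqrt DIM('a) (sft (F j)) (sft (G i))"
    unfolding spectral_sqdist_sqrt_def by (rule nn_integral_half_line_cong) (simp add: sft_eq_hankel[OF dim Fb(1)] sft_eq_hankel[OF dim Gb(1)])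
  also have "spectral_sqdist DIM('a) (sft (F j)) (sft (G i)) + spectral_sqdist_sqrt DIM('a) (sft (F j)) (sft (G i))
      \<le> ennreal (16 * plancherel_const TYPE('a) * q) + ennreal (4 * q)"
    by (rule add_mono[OF 1 2])
  also have "\<dots> = ennreal ((16 * plancherel_const TYPE('a) + 4) / 4 ^ j)"
    using rp q by (simp flip: ennreal_plus add: q_def add_divide_distrib)
  finally show ?thesis .
qed

text \<open>The index map \<open>i\<close> will be \<open>Suc\<close> for convergence along one
  sequence and the identity for comparing two. The bound is for the explicit radius
  \<open>s + C * sqrt \<bar>t\<bar>\<close> at all times; the given curves are known to follow it
  for small \<open>t\<close>.\<close>

lemma schroedinger_diff_AE:
  fixes f :: "'a \<Rightarrow> complex"
  assumes C: "C \<ge> 0" and f: "f \<in> Hdot_o (1/4)" and F: "approximates F f" and G: "approximates G f"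
    and i: "\<And>j. j \<le> i j"
  shows "AE s in half_line. \<exists>K. \<forall>j t.
    norm (schroedinger (F j) t (s + C * sqrt \<bar>t\<bar>) - schroedinger (G (i j)) t (s + C * sqrt \<bar>t\<bar>)) \<le> sqrt (K / 2 ^ j)"
proof -
  let ?n = "DIM('a)"
  note F1 = approximates_bounds(1)[OF dim f F] and G1 = approximates_bounds(1)[OF dim f G]
  let ?d = "\<lambda>j \<xi>. hankel ?n (ray (F j)) \<xi> - hankel ?n (ray (G (i j))) \<xi>"
  have kp: "hankel_const ?n > 0" by (rule hankel_const_pos[OF dim])
  have "AE s in lborel. s > 0 \<longrightarrow> (\<exists>K\<ge>0. \<forall>j t. norm (spec_prop ?n (?d j) t (s + C * sqrt \<bar>t\<bar>)) \<le> sqrt (K / 2 ^ j))"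
  proof (rule fast_maximal_AE[OF dim C])
    show "rapid (?d j)" for j by (intro rapid_diff sft_rapid dim F1 G1)
    show "16 * plancherel_const TYPE('a) + 4 \<ge> 0" using plancherel_const_pos[OF dim] by simp
  qed (rule approximates_diff_bound[OF f F G i])
  then show ?thesis
    unfolding AE_lebesgue_on_half_line using AE_lborel_singleton[of "0::real"]
  proof eventually_elim
    case (elim s)
    show ?case
    proof
      assume "0 \<le> s"
      then have s: "s > 0" using elim(2) by simp
      then obtain K where K: "K \<ge> 0" "\<And>j t. norm (spec_prop ?n (?d j) t (s + C * sqrt \<bar>t\<bar>)) \<le> sqrt (K / 2 ^ j)"
        using elim(1) by blast
      show "\<exists>K. \<forall>j t. norm (schroedinger (F j) t (s + C * sqrt \<bar>t\<bar>) - schroedinger (G (i j)) t (s + C * sqrt \<bar>t\<bar>))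
          \<le> sqrt (K / 2 ^ j)"
      proof (intro exI[of _ "(1 / hankel_const ?n)\<^sup>2 * K"] allI)
        fix j t
        have r: "s + C * sqrt \<bar>t\<bar> \<ge> 0" using s C by simp
        have "schroedinger (F j) t (s + C * sqrt \<bar>t\<bar>) - schroedinger (G (i j)) t (s + C * sqrt \<bar>t\<bar>)
          = of_real (1 / hankel_const ?n) * spec_prop ?n (?d j) t (s + C * sqrt \<bar>t\<bar>)"
          unfolding schroedinger_eq[OF dim F1 r] schroedinger_eq[OF dim G1 r]
            spec_prop_diff[OF dim sft_rapid[OF dim F1] sft_rapid[OF dim G1]] right_diff_distrib ..
        then have "norm (schroedinger (F j) t (s + C * sqrt \<bar>t\<bar>) - schroedinger (G (i j)) t (s + C * sqrt \<bar>t\<bar>))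
          = (1 / hankel_const ?n) * norm (spec_prop ?n (?d j) t (s + C * sqrt \<bar>t\<bar>))"
          using kp by (simp add: norm_mult norm_divide)
        also have "\<dots> \<le> (1 / hankel_const ?n) * sqrt (K / 2 ^ j)" using kp K(2) by (intro mult_left_mono) auto
        also have "\<dots> = sqrt ((1 / hankel_const ?n)\<^sup>2 * K / 2 ^ j)"
          using kp by (simp add: real_sqrt_mult real_sqrt_divide)
        finally show "norm (schroedinger (F j) t (s + C * sqrt \<bar>t\<bar>) - schroedinger (G (i j)) t (s + C * sqrt \<bar>t\<bar>))
          \<le> sqrt ((1 / hankel_const ?n)\<^sup>2 * K / 2 ^ j)" .
      qed
    qed
  qed
qed

text \<open>The prescribed rate makes the sequence itself converge almost everywhere, so that the
  values at time 0 tend to \<open>f\<close>. Convergence at almost every point is carried to almost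
  every radius by \<open>AE_profile\<close>.\<close>

lemma profile_tendsto_AE:
  fixes f :: "'a \<Rightarrow> complex"
  assumes f: "f \<in> Hdot_o (1/4)" and F: "approximates F f"
  shows "AE s in half_line. (\<lambda>j. profile (F j) s) \<longlonglongrightarrow> profile f s"
proof -
  note Fb = approximates_bounds[OF dim f F]
  have fm: "f \<in> borel_measurable lebesgue" and r: "radial f" using f by (auto simp: Hdot_o_def L2_o_def)
  have Fr: "radial (F j)" for j using Fb(1) by (simp add: schwartz_o_def)
  have q: "(1 / 2 ^ j)\<^sup>2 = (1 / 4 ^ j :: real)" for j
    by (simp add: power_divide power2_eq_square flip: power_mult_distrib)
  have "AE x in lebesgue. \<exists>K\<ge>0. \<forall>j. ennreal ((norm (F j x - f x))\<^sup>2) \<le> ennreal (K / 2 ^ j)"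
  proof (rule fast_decay_AE)
    show "(\<lambda>x. ennreal ((norm (F j x - f x))\<^sup>2)) \<in> borel_measurable lebesgue" for j
      using schwartz_o_measurable[OF Fb(1)] fm by measurable
    show "(\<integral>\<^sup>+x. ennreal ((norm (F j x - f x))\<^sup>2) \<partial>lebesgue) \<le> ennreal (1 / 4 ^ j)" for j
      using Fb(2)[of j] unfolding L2_sqdist_def q .
  qed simp
  then have "AE x in lebesgue. (\<lambda>j. profile (F j) (norm (x::'a))) \<longlonglongrightarrow> profile f (norm x)"
  proof eventually_elim
    case (elim x)
    then obtain K where K: "K \<ge> 0" "\<And>j. ennreal ((norm (F j x - f x))\<^sup>2) \<le> ennreal (K / 2 ^ j)" by blast
    have "norm (F j x - f x) \<le> sqrt (K / 2 ^ j)" for j using K by (intro norm_le_sqrtI) auto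
    then have "(\<lambda>j. F j x - f x) \<longlonglongrightarrow> 0"
      by (intro Lim_null_comparison[OF always_eventually summable_LIMSEQ_zero[OF summable_sqrt_geometric]]) blast
    then show ?case by (simp add: profile_radial[OF Fr] profile_radial[OF r] LIM_zero_iff)
  qed
  then show ?thesis by (rule AE_profile)
qed

text \<open>The slice of the relative neighbourhood at fixed \<open>s\<close> contains an interval
  of times around 0, whose length may depend on \<open>s\<close>.\<close>

lemma curve_norm_near_0:
  fixes \<gamma> :: "'a \<Rightarrow> real \<Rightarrow> 'a"
  assumes V: "\<And>s\<^sub>0. s\<^sub>0 \<ge> 0 \<Longrightarrow>
           \<exists>V. openin (top_of_set ({0..} \<times> UNIV)) V \<and> (s\<^sub>0, 0) \<in> V \<and>
             (\<forall>(s, t) \<in> V. curve_norm \<gamma> s t = s + C * sqrt \<bar>t\<bar>)"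
    and s: "s \<ge> 0"
  obtains \<delta> where "\<delta> > 0" "\<And>t. t \<in> {-\<delta><..<\<delta>} \<Longrightarrow> curve_norm \<gamma> s t = s + C * sqrt \<bar>t\<bar>"
proof -
  obtain V where V: "openin (top_of_set ({0..} \<times> UNIV)) V" "(s, 0) \<in> V"
    "\<forall>(s, t) \<in> V. curve_norm \<gamma> s t = s + C * sqrt \<bar>t\<bar>" using V[OF s] by blast
  obtain T where T: "open T" "V = ({0..} \<times> UNIV) \<inter> T" using V(1) by (auto simp: openin_open)
  obtain e where e: "e > 0" "ball (s, 0) e \<subseteq> T" using T V(2) by (metis IntD2 open_contains_ball)
  show ?thesis
  proof (rule that[OF e(1)])
    fix t assume "t \<in> {-e<..<e}"
    then have "(s, t) \<in> ball (s, 0) e" by (simp add: dist_Pair_Pair dist_real_def abs_less_iff)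
    then have "(s, t) \<in> V" using e(2) T(2) s by auto
    then show "curve_norm \<gamma> s t = s + C * sqrt \<bar>t\<bar>" using V(3) by auto
  qed
qed

text \<open>For existence, one sequence \<open>F0\<close> defines \<open>U\<close>, and any other
  approximating sequence differs from it by a term that tends to 0 uniformly in time. For
  convergence, let \<open>U\<close> be any admissible version: uniform convergence near time 0
  allows the limits in the index and in time to be exchanged. Each approximant is continuous in time
  with value \<open>profile (F j) s\<close> at time 0 by inversion, and these values tend to
  \<open>profile f s\<close>.\<close>

lemma converges_along_Hdot:
  fixes \<gamma> :: "'a \<Rightarrow> real \<Rightarrow> 'a"
  assumes C: "C \<ge> 0"
    and V: "\<And>s\<^sub>0. s\<^sub>0 \<ge> 0 \<Longrightarrow>
           \<exists>V. openin (top_of_set ({0..} \<times> UNIV)) V \<and> (s\<^sub>0, 0) \<in> V \<and>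
             (\<forall>(s, t) \<in> V. curve_norm \<gamma> s t = s + C * sqrt \<bar>t\<bar>)"
    and f: "f \<in> Hdot_o (1/4)"
  shows "converges_along \<gamma> f"
  unfolding converges_along_def
proof (intro conjI allI impI)
  obtain F0 where F0: "approximates F0 f" using approximates_exists[OF dim f] by blast
  define U where "U s t = lim (\<lambda>j. schroedinger (F0 j) t (s + C * sqrt \<bar>t\<bar>))" for s t
  have "AE s in half_line. \<exists>\<delta>>0. uniform_limit {-\<delta><..<\<delta>} (\<lambda>j t. schroedinger (F j) t (curve_norm \<gamma> s t)) (U s) sequentially"
    if F: "approximates F f" for F
    using schroedinger_diff_AE[OF C f F0 F0, of Suc, OF le_SucI[OF order_refl]] schroedinger_diff_AE[OF C f F F0, of "\<lambda>j. j", OF order_refl]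
        AE_space[of half_line]
  proof eventually_elim
    case (elim s)
    let ?a = "\<lambda>j t. schroedinger (F0 j) t (s + C * sqrt \<bar>t\<bar>)" and ?b = "\<lambda>j t. schroedinger (F j) t (s + C * sqrt \<bar>t\<bar>)"
    have s: "s \<ge> 0" using elim by (simp add: space_restrict_space)
    obtain K where K: "\<And>j t. norm (?a j t - ?a (Suc j) t) \<le> sqrt (K / 2 ^ j)" using elim by auto
    obtain K' where K': "\<And>j t. norm (?b j t - ?a j t) \<le> sqrt (K' / 2 ^ j)" using elim by auto
    have "uniform_limit UNIV ?a (U s) sequentially"
      unfolding U_def by (rule uniform_limit_fast_Cauchy) (subst norm_minus_commute, rule K)
    moreover have "uniform_limit UNIV (\<lambda>j t. ?b j t - ?a j t) (\<lambda>_. 0) sequentially"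
      by (rule uniform_limit_null_comparison[OF always_eventually uniform_limit_sqrt_geometric[of K']]) (intro allI ballI K')
    ultimately have "uniform_limit UNIV (\<lambda>j t. ?a j t + (?b j t - ?a j t)) (\<lambda>t. U s t + 0) sequentially"
      by (rule uniform_limit_add)
    then have u: "uniform_limit UNIV ?b (U s) sequentially" by simp
    obtain \<delta> where d: "\<delta> > 0" "\<And>t. t \<in> {-\<delta><..<\<delta>} \<Longrightarrow> curve_norm \<gamma> s t = s + C * sqrt \<bar>t\<bar>"
      by (rule curve_norm_near_0[OF V s]) blast+
    have "uniform_limit {-\<delta><..<\<delta>} (\<lambda>j t. schroedinger (F j) t (curve_norm \<gamma> s t)) (U s) sequentially
       \<longleftrightarrow> uniform_limit {-\<delta><..<\<delta>} ?b (U s) sequentially"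
      by (rule uniform_limit_cong') (simp_all only: d(2))
    then show ?case using d(1) uniform_limit_on_subset[OF u subset_UNIV] by blast
  qed
  then have "is_propagation_along \<gamma> f U" unfolding is_propagation_along_def using F0 by blast
  then show "\<exists>U. is_propagation_along \<gamma> f U" by blast
next
  fix U assume U: "is_propagation_along \<gamma> f U"
  have r: "radial f" using f by (auto simp: Hdot_o_def L2_o_def)
  obtain F where F: "approximates F f" using U by (auto simp: is_propagation_along_def)
  note F1 = approximates_bounds(1)[OF dim f F]
  have "AE s in half_line. \<exists>\<delta>>0. uniform_limit {-\<delta><..<\<delta>} (\<lambda>j t. schroedinger (F j) t (curve_norm \<gamma> s t)) (U s) sequentially"
    using U F by (simp add: is_propagation_along_def)
  then show ae: "AE s in half_line. (U s \<longlongrightarrow> profile f s) (at 0)"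
    using profile_tendsto_AE[OF f F] AE_space[of half_line]
  proof eventually_elim
    case (elim s)
    have s: "s \<ge> 0" using elim by (simp add: space_restrict_space)
    obtain \<delta> where d: "\<delta> > 0" "uniform_limit {-\<delta><..<\<delta>} (\<lambda>j t. schroedinger (F j) t (curve_norm \<gamma> s t)) (U s) sequentially"
      using elim by blast
    obtain \<delta>' where d': "\<delta>' > 0" "\<And>t. t \<in> {-\<delta>'<..<\<delta>'} \<Longrightarrow> curve_norm \<gamma> s t = s + C * sqrt \<bar>t\<bar>"
      by (rule curve_norm_near_0[OF V s]) blast+
    let ?b = "\<lambda>j t. schroedinger (F j) t (s + C * sqrt \<bar>t\<bar>)"
    have cont: "(?b j \<longlongrightarrow> profile (F j) s) (at 0)" for j
    proof -
      have e: "?b j = (\<lambda>t. of_real (1 / hankel_const DIM('a)) * spec_prop DIM('a) (hankel DIM('a) (ray (F j))) t (s + C * sqrt \<bar>t\<bar>))"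
        using s C by (intro ext schroedinger_eq[OF dim F1]) simp
      have "continuous_on UNIV (?b j)"
        unfolding e by (intro continuous_on_mult continuous_on_const spec_prop_curve_continuous[OF dim sft_rapid[OF dim F1]])
      then have "(?b j \<longlongrightarrow> ?b j 0) (at 0)" unfolding continuous_on_def by (rule bspec) simp
      then show ?thesis using schroedinger_0[OF dim F1 s] by simp
    qed
    have lim: "((\<lambda>t. schroedinger (F j) t (curve_norm \<gamma> s t)) \<longlongrightarrow> profile (F j) s) (at 0)" for j
    proof (rule Lim_transform_eventually[OF cont])
      have "\<forall>\<^sub>F t in at 0. t \<in> {-\<delta>'<..<\<delta>'}"
        using d'(1) by (intro eventually_at_in_open') auto
      then show "\<forall>\<^sub>F t in at 0. ?b j t = schroedinger (F j) t (curve_norm \<gamma> s t)"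
        by eventually_elim (simp only: d'(2))
    qed
    have w: "at 0 within {-\<delta><..<\<delta>} = at (0::real)" using d(1) by (intro at_within_open) auto
    have "(U s \<longlongrightarrow> profile f s) (at 0 within {-\<delta><..<\<delta>})"
      by (rule swap_uniform_limit[OF always_eventually _ d(2) sequentially_bot])
        (use lim elim(2) in \<open>simp_all only: w simp_thms\<close>)
    then show ?case unfolding w .
  qed
  then have "AE x in lebesgue. (U (norm (x::'a)) \<longlongrightarrow> profile f (norm x)) (at 0)" by (rule AE_radial)
  then show "AE x in lebesgue. (U (norm x) \<longlongrightarrow> f x) (at 0)" by (simp add: profile_radial[OF r])
qed

end

theorem theorem1p7:
  fixes \<gamma> :: "'a::euclidean_space \<Rightarrow> real \<Rightarrow> 'a" and C\<^sub>7 :: real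
  assumes "DIM('a) \<ge> 2"
    and "C\<^sub>7 \<ge> 0"
    and "\<And>x. \<gamma> x 0 = x"
    and "\<And>t. radial (\<lambda>x. norm (\<gamma> x t))"
    and "\<And>s\<^sub>0. s\<^sub>0 \<ge> 0 \<Longrightarrow>
           \<exists>V. openin (top_of_set ({0..} \<times> UNIV)) V \<and> (s\<^sub>0, 0) \<in> V \<and>
             (\<forall>(s, t) \<in> V. curve_norm \<gamma> s t = s + C\<^sub>7 * sqrt \<bar>t\<bar>)"
  shows "(\<forall>f \<in> Hdot_o (1/4). converges_along \<gamma> f) \<and>
         (\<forall>\<beta> \<ge> 1/4. \<forall>f \<in> H_o \<beta>. converges_along \<gamma> f)"
proof -
  have "converges_along \<gamma> f" if "f \<in> Hdot_o (1/4)" for f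
    by (rule converges_along_Hdot[OF assms(1,2,5) that])
  then show ?thesis using H_o_subset_Hdot_o[OF assms(1)] by blast
qed

end
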